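(* Let $R$ be a right artinian ring. The following are equivalent. (a) $\phi\dim(R)=0$. (b) $\psi\dim(R)=0$. (c) $R$ is right self-injective.
   Context: $R$ is a right artinian ring (associative with unit), and $\mathrm{mod}\,R$ is the category of finitely generated right $R$-modules. $\mathrm{pd}\,X$ denotes the projective dimension of a module $X$ (with $\mathrm{pd}\,0=0$). $\Omega M$ denotes the syzygy of $M\in\mathrm{mod}\,R$, i.e. the kernel of a projective cover $P\to M$, and $\Omega^n$ denotes its $n$-th iterate, with $\Omega^0M=M$. Let $K$ be the free abelian group generated by all symbols $[M]$ with $M\in\mathrm{mod}\,R$, modulo the subgroup generated by: $[A]-[B]-[C]$ whenever $A\cong B\oplus C$; and $[P]$ whenever $P$ is projective. Then $K$ is the free abelian group on the isomorphism classes of finitely generated indecomposable non-projective right $R$-modules. The syzygy induces a group homomorphism $\Omega:K\to K$, $\Omega([M])=[\Omega M]$. For $M\in\mathrm{mod}\,R$, let $\langle M\rangle$ be the subgroup of $K$ generated by the classes of all indecomposable non-projective direct summands of $M$; it has finite rank. The Igusa–Todorov functions $\phi,\psi:\mathrm{mod}\,R\to\mathbb{N}$ (with $0\in\mathbb N$) are defined as follows. $\phi(M)$ is the least non-negative integer $n$ such that the rank of $\Omega^n(\langle M\rangle)$ equals the rank of $\Omega^i(\langle M\rangle)$ for all $i\geq n$. And $$\psi(M)=\phi(M)+\max\{\mathrm{pd}\,X \mid X \text{ is a direct summand of } \Omega^{\phi(M)}M \text{ and } \mathrm{pd}\,X<\infty\}.$$ Define $\phi\dim(R)=\sup\{\phi(M)\mid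 M\in\mathrm{mod}\,R\}$ and $\psi\dim(R)=\sup\{\psi(M)\mid M\in\mathrm{mod}\,R\}$ (possibly $\infty$). $R$ is right self-injective if the right module $R_R$ is injective. *)

theory Defs
  imports "HOL-Algebra.Module" "HOL-Algebra.AbelCoset" "HOL-Algebra.Generated_Groups"
    "HOL-Algebra.Free_Abelian_Groups" "HOL-Library.Extended_Nat"
begin

section \<open>Right modules\<close>

text \<open>
  The library's module locale requires a commutative ring, so right modules over an arbitrary
  ring are introduced here, on the library's module records. The term \<open>a \<odot>\<^bsub>M\<^esub> x\<close> stands for
  the right action \<open>x\<cdot>a\<close>; only \<open>smult_assoc\<close> below distinguishes right from left modules.
  The fields \<open>mult\<close> and \<open>one\<close> of a module record carry no meaning.
\<close>

locale right_module = R?: ring R + M?: abelian_group M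
  for R :: "('a, 'b) ring_scheme" (structure) and M :: "('a, 'm) module" (structure) +
  assumes smult_closed [simp, intro]:
      "\<lbrakk>a \<in> carrier R; x \<in> carrier M\<rbrakk> \<Longrightarrow> a \<odot>\<^bsub>M\<^esub> x \<in> carrier M"
    and smult_l_distr:
      "\<lbrakk>a \<in> carrier R; b \<in> carrier R; x \<in> carrier M\<rbrakk> \<Longrightarrow>
        (a \<oplus> b) \<odot>\<^bsub>M\<^esub> x = a \<odot>\<^bsub>M\<^esub> x \<oplus>\<^bsub>M\<^esub> b \<odot>\<^bsub>M\<^esub> x"
    and smult_r_distr:
      "\<lbrakk>a \<in> carrier R; x \<in> carrier M; y \<in> carrier M\<rbrakk> \<Longrightarrow>
        a \<odot>\<^bsub>M\<^esub> (x \<oplus>\<^bsub>M\<^esub> y) = a \<odot>\<^bsub>M\<^esub> x \<oplus>\<^bsub>M\<^esub> a \<odot>\<^bsub>M\<^esub> y"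
    and smult_assoc:
      "\<lbrakk>a \<in> carrier R; b \<in> carrier R; x \<in> carrier M\<rbrakk> \<Longrightarrow>
        (a \<otimes> b) \<odot>\<^bsub>M\<^esub> x = b \<odot>\<^bsub>M\<^esub> (a \<odot>\<^bsub>M\<^esub> x)"
    and smult_one [simp]:
      "x \<in> carrier M \<Longrightarrow> \<one> \<odot>\<^bsub>M\<^esub> x = x"

text \<open>The right module \<open>R\<^sub>R\<close>; its submodules are the right ideals of \<open>R\<close>.\<close>

definition regular_module :: "('a, 'b) ring_scheme \<Rightarrow> ('a, 'a) module" where
  "regular_module R =
    \<lparr>carrier = carrier R, monoid.mult = undefined, one = undefined,
     ring.zero = \<zero>\<^bsub>R\<^esub>, ring.add = (\<lambda>x y. x \<oplus>\<^bsub>R\<^esub> y), smult = (\<lambda>a x. x \<otimes>\<^bsub>R\<^esub> a)\<rparr>"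

definition right_artinian :: "('a, 'b) ring_scheme \<Rightarrow> bool" where
  "right_artinian R \<longleftrightarrow> ring R \<and>
    (\<forall>I :: nat \<Rightarrow> 'a set.
      (\<forall>n. submodule (I n) R (regular_module R)) \<and> (\<forall>n. I (Suc n) \<subseteq> I n) \<longrightarrow>
      (\<exists>n. \<forall>m\<ge>n. I m = I n))"

definition direct_sum :: "('a, 'm) module \<Rightarrow> ('a, 'n) module \<Rightarrow> ('a, 'm \<times> 'n) module" where
  "direct_sum M N =
    \<lparr>carrier = carrier M \<times> carrier N, monoid.mult = undefined, one = undefined,
     ring.zero = (\<zero>\<^bsub>M\<^esub>, \<zero>\<^bsub>N\<^esub>),
     ring.add = (\<lambda>(x, y) (x', y'). (x \<oplus>\<^bsub>M\<^esub> x', y \<oplus>\<^bsub>N\<^esub> y')),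
     smult = (\<lambda>a (x, y). (a \<odot>\<^bsub>M\<^esub> x, a \<odot>\<^bsub>N\<^esub> y))\<rparr>"

definition right_module_hom ::
    "('a, 'b) ring_scheme \<Rightarrow> ('a, 'm) module \<Rightarrow> ('a, 'n) module \<Rightarrow> ('m \<Rightarrow> 'n) set" where
  "right_module_hom R M N = {f \<in> carrier M \<rightarrow> carrier N.
     (\<forall>x\<in>carrier M. \<forall>y\<in>carrier M. f (x \<oplus>\<^bsub>M\<^esub> y) = f x \<oplus>\<^bsub>N\<^esub> f y) \<and>
     (\<forall>a\<in>carrier R. \<forall>x\<in>carrier M. f (a \<odot>\<^bsub>M\<^esub> x) = a \<odot>\<^bsub>N\<^esub> f x)}"

definition module_isomorphic ::
    "('a, 'b) ring_scheme \<Rightarrow> ('a, 'm) module \<Rightarrow> ('a, 'n) module \<Rightarrow> bool" where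
  "module_isomorphic R M N \<longleftrightarrow>
    (\<exists>f\<in>right_module_hom R M N. bij_betw f (carrier M) (carrier N))"

definition finitely_generated :: "('a, 'b) ring_scheme \<Rightarrow> ('a, 'm) module \<Rightarrow> bool" where
  "finitely_generated R M \<longleftrightarrow>
    (\<exists>S. finite S \<and> S \<subseteq> carrier M \<and>
      (\<forall>H. submodule H R M \<and> S \<subseteq> H \<longrightarrow> H = carrier M))"

text \<open>
  \<open>mod_cat R\<close> is mod-\<open>R\<close>, with all modules carried by the type of lists over \<open>R\<close>. Every finitely
  generated right module, on whatever type, is isomorphic to one of these: see
  \<open>finitely_generated_ex_mod_cat\<close> below.
\<close>

definition mod_cat :: "('a, 'b) ring_scheme \<Rightarrow> ('a, 'a list) module set" where
  "mod_cat R = {M. right_module R M \<and> finitely_generated R M}"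

text \<open>
  Projectivity and injectivity are the usual lifting and extension properties. The test modules
  \<open>M\<close> and \<open>N\<close> range over all right modules carried by the type of lists over \<open>R\<close>; that this
  implies the same property for test modules on arbitrary types is shown in
  \<open>projective_lift\<close> (for finitely generated \<open>P\<close>, the only ones considered) and
  \<open>injective_extend\<close>.
\<close>

definition projective_module :: "('a, 'b) ring_scheme \<Rightarrow> ('a, 'm) module \<Rightarrow> bool" where
  "projective_module R P \<longleftrightarrow> right_module R P \<and>
    (\<forall>(M :: ('a, 'a list) module) (N :: ('a, 'a list) module).
      right_module R M \<and> right_module R N \<longrightarrow>
      (\<forall>g\<in>right_module_hom R M N. \<forall>f\<in>right_module_hom R P N. g ` carrier M = carrier N \<longrightarrow>
        (\<exists>h\<in>right_module_hom R P M. \<forall>x\<in>carrier P. g (h x) = f x)))"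

definition injective_module :: "('a, 'b) ring_scheme \<Rightarrow> ('a, 'm) module \<Rightarrow> bool" where
  "injective_module R E \<longleftrightarrow> right_module R E \<and>
    (\<forall>(M :: ('a, 'a list) module) (N :: ('a, 'a list) module).
      right_module R M \<and> right_module R N \<longrightarrow>
      (\<forall>i\<in>right_module_hom R M N. \<forall>f\<in>right_module_hom R M E. inj_on i (carrier M) \<longrightarrow>
        (\<exists>h\<in>right_module_hom R N E. \<forall>x\<in>carrier M. h (i x) = f x)))"

definition right_self_injective :: "('a, 'b) ring_scheme \<Rightarrow> bool" where
  "right_self_injective R \<longleftrightarrow> injective_module R (regular_module R)"

definition zero_module :: "('a, 'm) module \<Rightarrow> bool" where
  "zero_module M \<longleftrightarrow> carrier M = {\<zero>\<^bsub>M\<^esub>}"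

definition direct_summand ::
    "('a, 'b) ring_scheme \<Rightarrow> ('a, 'a list) module \<Rightarrow> ('a, 'a list) module \<Rightarrow> bool" where
  "direct_summand R X M \<longleftrightarrow> X \<in> mod_cat R \<and>
    (\<exists>Y\<in>mod_cat R. module_isomorphic R M (direct_sum X Y))"

definition indecomposable :: "('a, 'b) ring_scheme \<Rightarrow> ('a, 'a list) module \<Rightarrow> bool" where
  "indecomposable R X \<longleftrightarrow> \<not> zero_module X \<and>
    (\<forall>A\<in>mod_cat R. \<forall>B\<in>mod_cat R.
      module_isomorphic R X (direct_sum A B) \<longrightarrow> zero_module A \<or> zero_module B)"


section \<open>Syzygies and projective dimension\<close>

definition superfluous :: "('a, 'b) ring_scheme \<Rightarrow> ('a, 'm) module \<Rightarrow> 'm set \<Rightarrow> bool" where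
  "superfluous R P N \<longleftrightarrow> submodule N R P \<and>
    (\<forall>H. submodule H R P \<and> H <+>\<^bsub>P\<^esub> N = carrier P \<longrightarrow> H = carrier P)"

definition projective_cover ::
    "('a, 'b) ring_scheme \<Rightarrow> ('a, 'a list) module \<Rightarrow> ('a, 'a list) module \<Rightarrow>
     ('a list \<Rightarrow> 'a list) \<Rightarrow> bool" where
  "projective_cover R M P f \<longleftrightarrow> P \<in> mod_cat R \<and> projective_module R P \<and>
    f \<in> right_module_hom R P M \<and> f ` carrier P = carrier M \<and> superfluous R P (a_kernel P M f)"

text \<open>
  Over a right artinian ring every finitely generated module has a projective cover, unique up to
  isomorphism; \<open>syzygy R M\<close> is the kernel of a chosen one.
\<close>

definition syzygy ::
    "('a, 'b) ring_scheme \<Rightarrow> ('a, 'a list) module \<Rightarrow> ('a, 'a list) module" where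
  "syzygy R M =
    (let (P, f) = (SOME (P, f). projective_cover R M P f) in P\<lparr>carrier := a_kernel P M f\<rparr>)"

definition projective_resolution ::
    "('a, 'b) ring_scheme \<Rightarrow> ('a, 'a list) module \<Rightarrow> (nat \<Rightarrow> ('a, 'a list) module) \<Rightarrow>
     (nat \<Rightarrow> 'a list \<Rightarrow> 'a list) \<Rightarrow> bool" where
  "projective_resolution R X P d \<longleftrightarrow>
    (\<forall>i. P i \<in> mod_cat R \<and> projective_module R (P i)) \<and>
    d 0 \<in> right_module_hom R (P 0) X \<and> d 0 ` carrier (P 0) = carrier X \<and>
    (\<forall>i. d (Suc i) \<in> right_module_hom R (P (Suc i)) (P i)) \<and>
    d 1 ` carrier (P 1) = a_kernel (P 0) X (d 0) \<and>
    (\<forall>i. d (Suc (Suc i)) ` carrier (P (Suc (Suc i))) = a_kernel (P (Suc i)) (P i) (d (Suc i)))"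

text \<open>The infimum of the empty set of extended naturals is \<open>\<infinity>\<close>.\<close>

definition proj_dim :: "('a, 'b) ring_scheme \<Rightarrow> ('a, 'a list) module \<Rightarrow> enat" where
  "proj_dim R X =
    (INF n\<in>{n. \<exists>P d. projective_resolution R X P d \<and> (\<forall>i>n. zero_module (P i))}. enat n)"


section \<open>The Igusa-Todorov functions\<close>

text \<open>
  \<open>free_Abelian_group\<close> is a monoid record whose product is addition of finitely supported
  functions, so the quotient \<open>K\<close> and everything below is written multiplicatively.
\<close>

definition IT_relations :: "('a, 'b) ring_scheme \<Rightarrow> (('a, 'a list) module \<Rightarrow>\<^sub>0 int) set" where
  "IT_relations R =
    {frag_of A - frag_of B - frag_of C | A B C.
       A \<in> mod_cat R \<and> B \<in> mod_cat R \<and> C \<in> mod_cat R \<and>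
       module_isomorphic R A (direct_sum B C)} \<union>
    {frag_of P | P. P \<in> mod_cat R \<and> projective_module R P}"

definition IT_subgroup :: "('a, 'b) ring_scheme \<Rightarrow> (('a, 'a list) module \<Rightarrow>\<^sub>0 int) set" where
  "IT_subgroup R = generate (free_Abelian_group (mod_cat R)) (IT_relations R)"

definition IT_group :: "('a, 'b) ring_scheme \<Rightarrow> (('a, 'a list) module \<Rightarrow>\<^sub>0 int) set monoid" where
  "IT_group R = free_Abelian_group (mod_cat R) Mod IT_subgroup R"

definition IT_class ::
    "('a, 'b) ring_scheme \<Rightarrow> ('a, 'a list) module \<Rightarrow> (('a, 'a list) module \<Rightarrow>\<^sub>0 int) set" where
  "IT_class R M = IT_subgroup R #>\<^bsub>free_Abelian_group (mod_cat R)\<^esub> frag_of M"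

text \<open>The defining property determines \<open>IT_syzygy R\<close> on the carrier of \<open>IT_group R\<close>.\<close>

definition IT_syzygy ::
    "('a, 'b) ring_scheme \<Rightarrow>
     (('a, 'a list) module \<Rightarrow>\<^sub>0 int) set \<Rightarrow> (('a, 'a list) module \<Rightarrow>\<^sub>0 int) set" where
  "IT_syzygy R = (SOME h. h \<in> hom (IT_group R) (IT_group R) \<and>
    (\<forall>M\<in>mod_cat R. h (IT_class R M) = IT_class R (syzygy R M)))"

definition IT_span ::
    "('a, 'b) ring_scheme \<Rightarrow> ('a, 'a list) module \<Rightarrow> (('a, 'a list) module \<Rightarrow>\<^sub>0 int) set set" where
  "IT_span R M = generate (IT_group R)
    {IT_class R X | X. direct_summand R X M \<and> indecomposable R X \<and> \<not> projective_module R X}"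

text \<open>
  The rank of a subgroup \<open>H\<close> of an abelian group \<open>G\<close>: the supremum of the cardinalities of its
  finite subsets that are linearly independent over the integers.
\<close>

definition Z_independent :: "('g, 'e) monoid_scheme \<Rightarrow> 'g set \<Rightarrow> bool" where
  "Z_independent G B \<longleftrightarrow> finite B \<and> B \<subseteq> carrier G \<and>
    (\<forall>c :: 'g \<Rightarrow> int. finprod G (\<lambda>b. b [^]\<^bsub>G\<^esub> c b) B = \<one>\<^bsub>G\<^esub> \<longrightarrow> (\<forall>b\<in>B. c b = 0))"

definition abelian_rank :: "('g, 'e) monoid_scheme \<Rightarrow> 'g set \<Rightarrow> enat" where
  "abelian_rank G H = (SUP B\<in>{B. B \<subseteq> H \<and> Z_independent G B}. enat (card B))"

definition IT_phi :: "('a, 'b) ring_scheme \<Rightarrow> ('a, 'a list) module \<Rightarrow> nat" where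
  "IT_phi R M = (LEAST n. \<forall>i\<ge>n.
     abelian_rank (IT_group R) ((IT_syzygy R ^^ n) ` IT_span R M) =
     abelian_rank (IT_group R) ((IT_syzygy R ^^ i) ` IT_span R M))"

definition IT_psi :: "('a, 'b) ring_scheme \<Rightarrow> ('a, 'a list) module \<Rightarrow> nat" where
  "IT_psi R M = IT_phi R M +
    Max {n. \<exists>X. direct_summand R X ((syzygy R ^^ IT_phi R M) M) \<and> proj_dim R X = enat n}"

definition phi_dim :: "('a, 'b) ring_scheme \<Rightarrow> enat" where
  "phi_dim R = (SUP M\<in>mod_cat R. enat (IT_phi R M))"

definition psi_dim :: "('a, 'b) ring_scheme \<Rightarrow> enat" where
  "psi_dim R = (SUP M\<in>mod_cat R. enat (IT_psi R M))"

section \<open>Independence of the carrier type\<close>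

lemma right_module_homI:
  assumes "f \<in> carrier M \<rightarrow> carrier N"
    and "\<And>x y. \<lbrakk>x \<in> carrier M; y \<in> carrier M\<rbrakk> \<Longrightarrow> f (x \<oplus>\<^bsub>M\<^esub> y) = f x \<oplus>\<^bsub>N\<^esub> f y"
    and "\<And>a x. \<lbrakk>a \<in> carrier R; x \<in> carrier M\<rbrakk> \<Longrightarrow> f (a \<odot>\<^bsub>M\<^esub> x) = a \<odot>\<^bsub>N\<^esub> f x"
  shows "f \<in> right_module_hom R M N"
  using assms unfolding right_module_hom_def by blast

lemma right_module_homD:
  assumes "f \<in> right_module_hom R M N"
  shows "x \<in> carrier M \<Longrightarrow> f x \<in> carrier N"
    and "\<lbrakk>x \<in> carrier M; y \<in> carrier M\<rbrakk> \<Longrightarrow> f (x \<oplus>\<^bsub>M\<^esub> y) = f x \<oplus>\<^bsub>N\<^esub> f y"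
    and "\<lbrakk>a \<in> carrier R; x \<in> carrier M\<rbrakk> \<Longrightarrow> f (a \<odot>\<^bsub>M\<^esub> x) = a \<odot>\<^bsub>N\<^esub> f x"
  using assms unfolding right_module_hom_def by blast+

lemma right_module_hom_comp:
  assumes "f \<in> right_module_hom R L M" "g \<in> right_module_hom R M N"
  shows "(\<lambda>x. g (f x)) \<in> right_module_hom R L N"
  using right_module_homD[OF assms(1)] right_module_homD[OF assms(2)] by (intro right_module_homI) auto

lemma right_module_hom_inv:
  assumes f: "f \<in> right_module_hom R M N" and M: "right_module R M"
    and bij: "bij_betw f (carrier M) (carrier N)"
  shows "inv_into (carrier M) f \<in> right_module_hom R N M"
proof -
  interpret M: right_module R M by fact
  let ?g = "inv_into (carrier M) f"
  have g: "?g y \<in> carrier M" "f (?g y) = y" if "y \<in> carrier N" for y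
    using bij that by (auto simp: bij_betw_def inv_into_into f_inv_into_f)
  have gf: "?g (f x) = x" if "x \<in> carrier M" for x
    using bij that by (simp add: bij_betw_def)
  show ?thesis
  proof (rule right_module_homI)
    show "?g \<in> carrier N \<rightarrow> carrier M" using g by auto
  next
    fix x y assume xy: "x \<in> carrier N" "y \<in> carrier N"
    have "x \<oplus>\<^bsub>N\<^esub> y = f (?g x \<oplus>\<^bsub>M\<^esub> ?g y)"
      using right_module_homD(2)[OF f] g xy by simp
    then show "?g (x \<oplus>\<^bsub>N\<^esub> y) = ?g x \<oplus>\<^bsub>M\<^esub> ?g y" using gf g xy by simp
  next
    fix a x assume ax: "a \<in> carrier R" "x \<in> carrier N"
    have "a \<odot>\<^bsub>N\<^esub> x = f (a \<odot>\<^bsub>M\<^esub> ?g x)"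
      using right_module_homD(3)[OF f] g ax by simp
    then show "?g (a \<odot>\<^bsub>N\<^esub> x) = a \<odot>\<^bsub>M\<^esub> ?g x" using gf g ax by simp
  qed
qed

context right_module
begin

lemma smult_zero [simp]: "a \<in> carrier R \<Longrightarrow> a \<odot>\<^bsub>M\<^esub> \<zero>\<^bsub>M\<^esub> = \<zero>\<^bsub>M\<^esub>"
  by (metis M.add.l_cancel_one' M.zero_closed smult_closed smult_r_distr M.r_zero)

lemma zero_smult [simp]: "x \<in> carrier M \<Longrightarrow> \<zero> \<odot>\<^bsub>M\<^esub> x = \<zero>\<^bsub>M\<^esub>"
  by (metis M.add.l_cancel_one' R.zero_closed smult_closed smult_l_distr R.r_zero)

lemma minus_smult:
  assumes "a \<in> carrier R" "x \<in> carrier M"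
  shows "(\<ominus> a) \<odot>\<^bsub>M\<^esub> x = \<ominus>\<^bsub>M\<^esub> (a \<odot>\<^bsub>M\<^esub> x)"
proof -
  have "(\<ominus> a) \<odot>\<^bsub>M\<^esub> x \<oplus>\<^bsub>M\<^esub> a \<odot>\<^bsub>M\<^esub> x = \<zero>\<^bsub>M\<^esub>"
    using assms smult_l_distr[of "\<ominus> a" a x] by (simp add: R.l_neg)
  then show ?thesis using assms by (simp add: M.minus_equality)
qed

lemma right_submoduleI:
  assumes "H \<subseteq> carrier M" "\<zero>\<^bsub>M\<^esub> \<in> H"
    and "\<And>x y. \<lbrakk>x \<in> H; y \<in> H\<rbrakk> \<Longrightarrow> x \<oplus>\<^bsub>M\<^esub> y \<in> H"
    and sm: "\<And>a x. \<lbrakk>a \<in> carrier R; x \<in> H\<rbrakk> \<Longrightarrow> a \<odot>\<^bsub>M\<^esub> x \<in> H"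
  shows "submodule H R M"
proof -
  have "\<ominus>\<^bsub>M\<^esub> x \<in> H" if "x \<in> H" for x
    using sm[of "\<ominus> \<one>" x] that assms(1) minus_smult[of \<one> x] by auto
  then show ?thesis
    using assms unfolding submodule_def submodule_axioms_def
    by (auto intro!: subgroup.intro simp: a_inv_def)
qed

lemma right_submoduleE:
  assumes "submodule H R M"
  shows "H \<subseteq> carrier M" "\<zero>\<^bsub>M\<^esub> \<in> H"
    and "\<And>x y. \<lbrakk>x \<in> H; y \<in> H\<rbrakk> \<Longrightarrow> x \<oplus>\<^bsub>M\<^esub> y \<in> H"
    and "\<And>a x. \<lbrakk>a \<in> carrier R; x \<in> H\<rbrakk> \<Longrightarrow> a \<odot>\<^bsub>M\<^esub> x \<in> H"
    and "\<And>x. x \<in> H \<Longrightarrow> \<ominus>\<^bsub>M\<^esub> x \<in> H"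
  using assms unfolding submodule_def submodule_axioms_def subgroup_def
  by (auto simp: a_inv_def)

lemma right_module_submodule:
  assumes "submodule H R M"
  shows "right_module R (M\<lparr>carrier := H\<rparr>)"
proof -
  note H = right_submoduleE[OF assms]
  have HM: "x \<in> carrier M" if "x \<in> H" for x using that H(1) by auto
  have "abelian_group (M\<lparr>carrier := H\<rparr>)"
    by (rule abelian_groupI) (auto simp: H HM M.a_ac M.r_neg M.l_neg intro!: bexI[of _ "\<ominus>\<^bsub>M\<^esub> _"] H(5))
  then show ?thesis
    unfolding right_module_def right_module_axioms_def
    by (auto simp: H HM smult_l_distr smult_r_distr smult_assoc R.ring_axioms)
qed

lemma transport:
  fixes t :: "'m \<Rightarrow> 'd"
  assumes inj: "inj_on t (carrier M)"
  obtains M' :: "('a, 'd) module" where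
    "right_module R M'" "t \<in> right_module_hom R M M'" "bij_betw t (carrier M) (carrier M')"
proof -
  let ?s = "inv_into (carrier M) t"
  let ?M = "\<lparr>carrier = t ` carrier M, monoid.mult = undefined, one = undefined,
    ring.zero = t \<zero>\<^bsub>M\<^esub>, ring.add = (\<lambda>x y. t (?s x \<oplus>\<^bsub>M\<^esub> ?s y)),
    smult = (\<lambda>a x. t (a \<odot>\<^bsub>M\<^esub> ?s x))\<rparr> :: ('a, 'd) module"
  have s: "?s (t x) = x" if "x \<in> carrier M" for x
    using inj that by simp
  have "abelian_group ?M"
    by (rule abelian_groupI)
      (auto simp: s M.a_ac M.r_neg M.l_neg intro!: bexI[of _ "\<ominus>\<^bsub>M\<^esub> _"])
  then have 1: "right_module R ?M"
    unfolding right_module_def right_module_axioms_def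
    by (auto simp: s smult_l_distr smult_r_distr smult_assoc R.ring_axioms)
  have 2: "t \<in> right_module_hom R M ?M" by (rule right_module_homI) (auto simp: s)
  have 3: "bij_betw t (carrier M) (carrier ?M)" using inj by (simp add: bij_betw_def)
  show thesis by (rule that[OF 1 2 3])
qed

lemma finite_subset_list_cover:
  assumes "finite S" "S \<subseteq> carrier M"
  shows "\<exists>H (f :: 'a list \<Rightarrow> 'm). submodule H R M \<and> S \<subseteq> H \<and> H \<subseteq> range f"
  using assms
proof (induction S rule: finite_induct)
  case empty
  have "submodule {\<zero>\<^bsub>M\<^esub>} R M" by (rule right_submoduleI) auto
  moreover have "{\<zero>\<^bsub>M\<^esub>} \<subseteq> range (\<lambda>_ :: 'a list. \<zero>\<^bsub>M\<^esub>)" by simp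
  ultimately show ?case by blast
next
  case (insert x S)
  then have "S \<subseteq> carrier M" by blast
  then obtain H and f :: "'a list \<Rightarrow> 'm" where
    Hf: "submodule H R M" "S \<subseteq> H" "H \<subseteq> range f" using insert.IH by blast
  note H = right_submoduleE[OF Hf(1)]
  have x: "x \<in> carrier M" using insert by auto
  let ?H = "{a \<odot>\<^bsub>M\<^esub> x \<oplus>\<^bsub>M\<^esub> y | a y. a \<in> carrier R \<and> y \<in> H}"
  let ?f = "\<lambda>l. hd l \<odot>\<^bsub>M\<^esub> x \<oplus>\<^bsub>M\<^esub> f (tl l)"
  have HM: "y \<in> carrier M" if "y \<in> H" for y using that H(1) by auto
  have "submodule ?H R M"
  proof (rule right_submoduleI)
    show "?H \<subseteq> carrier M" using x HM by auto
    show "\<zero>\<^bsub>M\<^esub> \<in> ?H" using x H(2) by (auto intro!: exI[of _ \<zero>] exI[of _ "\<zero>\<^bsub>M\<^esub>"])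
  next
    fix u v assume "u \<in> ?H" "v \<in> ?H"
    then obtain a y b z where uv: "u = a \<odot>\<^bsub>M\<^esub> x \<oplus>\<^bsub>M\<^esub> y" "v = b \<odot>\<^bsub>M\<^esub> x \<oplus>\<^bsub>M\<^esub> z"
      "a \<in> carrier R" "b \<in> carrier R" "y \<in> H" "z \<in> H" by auto
    then have "u \<oplus>\<^bsub>M\<^esub> v = (a \<oplus> b) \<odot>\<^bsub>M\<^esub> x \<oplus>\<^bsub>M\<^esub> (y \<oplus>\<^bsub>M\<^esub> z)"
      using x HM by (simp add: smult_l_distr M.a_ac)
    then show "u \<oplus>\<^bsub>M\<^esub> v \<in> ?H" using uv H(3) by blast
  next
    fix c u assume "c \<in> carrier R" "u \<in> ?H"
    then obtain a y where u: "u = a \<odot>\<^bsub>M\<^esub> x \<oplus>\<^bsub>M\<^esub> y" "a \<in> carrier R" "y \<in> H" by auto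
    then have "c \<odot>\<^bsub>M\<^esub> u = (a \<otimes> c) \<odot>\<^bsub>M\<^esub> x \<oplus>\<^bsub>M\<^esub> c \<odot>\<^bsub>M\<^esub> y"
      using x HM \<open>c \<in> carrier R\<close> by (simp add: smult_r_distr smult_assoc)
    then show "c \<odot>\<^bsub>M\<^esub> u \<in> ?H" using u H(4) \<open>c \<in> carrier R\<close> R.m_closed by blast
  qed
  moreover have "insert x S \<subseteq> ?H"
  proof
    fix y assume "y \<in> insert x S"
    then consider "y = x" | "y \<in> H" using Hf(2) by auto
    then show "y \<in> ?H"
    proof cases
      case 1
      then have "y = \<one> \<odot>\<^bsub>M\<^esub> x \<oplus>\<^bsub>M\<^esub> \<zero>\<^bsub>M\<^esub>" using x by simp
      then show ?thesis using H(2) R.one_closed by blast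
    next
      case 2
      then have "y = \<zero> \<odot>\<^bsub>M\<^esub> x \<oplus>\<^bsub>M\<^esub> y" using x HM by simp
      then show ?thesis using 2 R.zero_closed by blast
    qed
  qed
  moreover have "?H \<subseteq> range ?f"
  proof
    fix u assume "u \<in> ?H"
    then obtain a y where u: "u = a \<odot>\<^bsub>M\<^esub> x \<oplus>\<^bsub>M\<^esub> y" "y \<in> H" by auto
    then obtain l where "y = f l" using Hf(3) by auto
    then have "u = ?f (a # l)" using u by simp
    then show "u \<in> range ?f" by blast
  qed
  ultimately show ?case by blast
qed

end

lemma finitely_generated_hom:
  assumes N: "right_module R N" and M: "right_module R M"
    and f: "f \<in> right_module_hom R M N" "f ` carrier M = carrier N" and fg: "finitely_generated R M"
  shows "finitely_generated R N"
proof -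
  interpret M: right_module R M by fact
  interpret N: right_module R N by fact
  obtain S where S: "finite S" "S \<subseteq> carrier M"
    "\<forall>H. submodule H R M \<and> S \<subseteq> H \<longrightarrow> H = carrier M"
    using fg unfolding finitely_generated_def by (elim exE conjE) (rule that)
  have f0: "f \<zero>\<^bsub>M\<^esub> = \<zero>\<^bsub>N\<^esub>"
    using right_module_homD(3)[OF f(1), of "\<zero>\<^bsub>R\<^esub>" "\<zero>\<^bsub>M\<^esub>"] right_module_homD(1)[OF f(1), of "\<zero>\<^bsub>M\<^esub>"] by simp
  have "H = carrier N" if H: "submodule H R N" "f ` S \<subseteq> H" for H
  proof -
    note HE = N.right_submoduleE[OF H(1)]
    have "submodule {x \<in> carrier M. f x \<in> H} R M"
      by (rule M.right_submoduleI) (auto simp: f0 HE right_module_homD[OF f(1)])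
    moreover have "S \<subseteq> {x \<in> carrier M. f x \<in> H}" using S(2) H(2) by auto
    ultimately have "{x \<in> carrier M. f x \<in> H} = carrier M" using S(3) by blast
    then have "f ` carrier M \<subseteq> H" by blast
    then have "carrier N \<subseteq> H" unfolding f(2) .
    then show ?thesis using HE(1) by auto
  qed
  then show ?thesis
    unfolding finitely_generated_def
    using S(1,2) f(2) by (intro exI[of _ "f ` S"]) auto
qed

lemma finitely_generated_ex_mod_cat:
  fixes M :: "('a, 'm) module"
  assumes M: "right_module R M" and fg: "finitely_generated R M"
  shows "\<exists>M'\<in>mod_cat R. module_isomorphic R M M'"
proof -
  interpret M: right_module R M by fact
  obtain S where S: "finite S" "S \<subseteq> carrier M"
    "\<forall>H. submodule H R M \<and> S \<subseteq> H \<longrightarrow> H = carrier M"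
    using fg unfolding finitely_generated_def by (elim exE conjE) (rule that)
  obtain H and f :: "'a list \<Rightarrow> 'm" where "submodule H R M" "S \<subseteq> H" "H \<subseteq> range f"
    using M.finite_subset_list_cover[OF S(1,2)] by (elim exE conjE) (rule that)
  with S(3) have "carrier M \<subseteq> range f" by blast
  then have "inj_on (inv_into UNIV f) (carrier M)" by (rule inj_on_inv_into)
  then obtain M' :: "('a, 'a list) module" where M': "right_module R M'"
    "inv_into UNIV f \<in> right_module_hom R M M'" "bij_betw (inv_into UNIV f) (carrier M) (carrier M')"
    using M.transport by blast
  moreover have "finitely_generated R M'"
    using finitely_generated_hom[OF M'(1) M M'(2) _ fg] M'(3) by (simp add: bij_betw_def)
  ultimately show ?thesis unfolding mod_cat_def module_isomorphic_def by blast
qed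

lemma right_module_hom_sub:
  assumes "f \<in> right_module_hom R M N" "H \<subseteq> carrier M" "f ` H \<subseteq> L"
  shows "f \<in> right_module_hom R (M\<lparr>carrier := H\<rparr>) (N\<lparr>carrier := L\<rparr>)"
  using right_module_homD[OF assms(1)] subsetD[OF assms(2)] assms(3) by (intro right_module_homI) auto

lemma right_module_hom_incl:
  assumes "f \<in> right_module_hom R M (N\<lparr>carrier := L\<rparr>)" "L \<subseteq> carrier N"
  shows "f \<in> right_module_hom R M N"
  using right_module_homD[OF assms(1)] assms(2) by (intro right_module_homI) auto

lemma projective_lift:
  fixes P :: "('a, 'p) module" and M :: "('a, 'm) module" and N :: "('a, 'n) module"
  assumes proj: "projective_module R P" and fg: "finitely_generated R P"
    and M: "right_module R M" and N: "right_module R N"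
    and g: "g \<in> right_module_hom R M N" "g ` carrier M = carrier N" and f: "f \<in> right_module_hom R P N"
  shows "\<exists>h\<in>right_module_hom R P M. \<forall>x\<in>carrier P. g (h x) = f x"
proof -
  have P: "right_module R P" using proj unfolding projective_module_def by blast
  interpret P: right_module R P by fact
  interpret M: right_module R M by fact
  interpret N: right_module R N by fact
  obtain S where S: "finite S" "S \<subseteq> carrier P"
    "\<forall>H. submodule H R P \<and> S \<subseteq> H \<longrightarrow> H = carrier P"
    using fg unfolding finitely_generated_def by (elim exE conjE) (rule that)
  define m where "m p = inv_into (carrier M) g (f p)" for p
  have m: "m p \<in> carrier M \<and> g (m p) = f p" if "p \<in> S" for p
  proof -
    have "f p \<in> g ` carrier M" unfolding g(2) using right_module_homD(1)[OF f] S(2) that by blast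
    then show ?thesis unfolding m_def by (simp add: inv_into_into f_inv_into_f)
  qed
  have mS: "finite (m ` S)" "m ` S \<subseteq> carrier M" using S(1) m by auto
  obtain H and l :: "'a list \<Rightarrow> 'm" where Hl: "submodule H R M" "m ` S \<subseteq> H" "H \<subseteq> range l"
    using M.finite_subset_list_cover[OF mS] by (elim exE conjE) (rule that)
  note H = M.right_submoduleE[OF Hl(1)]
  have HM: "x \<in> carrier M" if "x \<in> H" for x using that H(1) by auto
  have g0: "g \<zero>\<^bsub>M\<^esub> = \<zero>\<^bsub>N\<^esub>"
    using right_module_homD(3)[OF g(1), of "\<zero>\<^bsub>R\<^esub>" "\<zero>\<^bsub>M\<^esub>"] right_module_homD(1)[OF g(1), of "\<zero>\<^bsub>M\<^esub>"] by simp
  have f0: "f \<zero>\<^bsub>P\<^esub> = \<zero>\<^bsub>N\<^esub>"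
    using right_module_homD(3)[OF f, of "\<zero>\<^bsub>R\<^esub>" "\<zero>\<^bsub>P\<^esub>"] right_module_homD(1)[OF f, of "\<zero>\<^bsub>P\<^esub>"] by simp
  have L: "submodule (g ` H) R N"
  proof (rule N.right_submoduleI)
    show "g ` H \<subseteq> carrier N" using HM right_module_homD(1)[OF g(1)] by auto
    show "\<zero>\<^bsub>N\<^esub> \<in> g ` H" using H(2) g0 by (metis imageI)
  next
    fix x y assume "x \<in> g ` H" "y \<in> g ` H"
    then show "x \<oplus>\<^bsub>N\<^esub> y \<in> g ` H"
      using right_module_homD(2)[OF g(1)] HM H(3) by (auto simp flip: right_module_homD(2)[OF g(1)])
  next
    fix a x assume "a \<in> carrier R" "x \<in> g ` H"
    then show "a \<odot>\<^bsub>N\<^esub> x \<in> g ` H"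
      using HM H(4) by (auto simp flip: right_module_homD(3)[OF g(1)])
  qed
  note LE = N.right_submoduleE[OF L]
  have "submodule {p \<in> carrier P. f p \<in> g ` H} R P"
    by (rule P.right_submoduleI) (auto simp: f0 LE right_module_homD[OF f] simp del: image_iff)
  moreover have "S \<subseteq> {p \<in> carrier P. f p \<in> g ` H}"
  proof
    fix p assume "p \<in> S"
    then have "m p \<in> H" "f p = g (m p)" "p \<in> carrier P" using Hl(2) m S(2) by auto
    then show "p \<in> {p \<in> carrier P. f p \<in> g ` H}" by blast
  qed
  ultimately have fL: "f ` carrier P \<subseteq> g ` H" using S(3) by blast
  let ?M = "M\<lparr>carrier := H\<rparr>" and ?N = "N\<lparr>carrier := g ` H\<rparr>"
  have M0: "right_module R ?M" by (rule M.right_module_submodule[OF Hl(1)])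
  have N0: "right_module R ?N" by (rule N.right_module_submodule[OF L])
  have g': "g \<in> right_module_hom R ?M ?N" by (rule right_module_hom_sub[OF g(1) H(1)]) simp
  have f': "f \<in> right_module_hom R P ?N"
    using right_module_hom_sub[OF f order_refl fL] by simp
  have "inj_on (inv_into UNIV l) (carrier ?M)" using Hl(3) by (simp add: inj_on_inv_into)
  then obtain M1 :: "('a, 'a list) module" where M1: "right_module R M1"
    "inv_into UNIV l \<in> right_module_hom R ?M M1" "bij_betw (inv_into UNIV l) (carrier ?M) (carrier M1)"
    using right_module.transport[OF M0] by blast
  have "g ` H \<subseteq> range (g \<circ> l)" using Hl(3) by auto
  then have "inj_on (inv_into UNIV (g \<circ> l)) (carrier ?N)" by (simp add: inj_on_inv_into)
  then obtain N1 :: "('a, 'a list) module" where N1: "right_module R N1"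
    "inv_into UNIV (g \<circ> l) \<in> right_module_hom R ?N N1" "bij_betw (inv_into UNIV (g \<circ> l)) (carrier ?N) (carrier N1)"
    using right_module.transport[OF N0] by blast
  define t where "t = inv_into (carrier ?M) (inv_into UNIV l)"
  define u where "u = inv_into UNIV (g \<circ> l)"
  have t: "t \<in> right_module_hom R M1 ?M" unfolding t_def by (rule right_module_hom_inv[OF M1(2) M0 M1(3)])
  have timg: "t ` carrier M1 = H"
    using bij_betw_inv_into[OF M1(3)] unfolding t_def by (simp add: bij_betw_def)
  have uimg: "u ` (g ` H) = carrier N1" and uinj: "inj_on u (g ` H)"
    using N1(3) unfolding u_def by (simp_all add: bij_betw_def)
  have g1: "(\<lambda>x. u (g (t x))) \<in> right_module_hom R M1 N1"
    using right_module_hom_comp[OF right_module_hom_comp[OF t g'] N1(2)] unfolding u_def .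
  have f1: "(\<lambda>x. u (f x)) \<in> right_module_hom R P N1"
    using right_module_hom_comp[OF f' N1(2)] unfolding u_def .
  have "(\<lambda>x. u (g (t x))) ` carrier M1 = u ` g ` t ` carrier M1" by auto
  then have "(\<lambda>x. u (g (t x))) ` carrier M1 = carrier N1" using timg uimg by simp
  from proj[unfolded projective_module_def, THEN conjunct2, rule_format,
      OF conjI[OF M1(1) N1(1)] g1 f1 this]
  obtain h where h: "h \<in> right_module_hom R P M1"
    "\<And>x. x \<in> carrier P \<Longrightarrow> u (g (t (h x))) = u (f x)" by blast
  have hh: "(\<lambda>x. t (h x)) \<in> right_module_hom R P M"
    by (rule right_module_hom_incl[OF right_module_hom_comp[OF h(1) t] H(1)])
  have gh: "g (t (h x)) = f x" if x: "x \<in> carrier P" for x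
  proof -
    have "t (h x) \<in> H" using timg right_module_homD(1)[OF h(1) x] by auto
    moreover have "f x \<in> g ` H" using fL x by auto
    ultimately show ?thesis using inj_onD[OF uinj h(2)[OF x]] by auto
  qed
  show ?thesis by (rule bexI[OF _ hh]) (simp add: gh)
qed

lemma right_module_regular:
  assumes "ring R"
  shows "right_module R (regular_module R)"
proof -
  interpret ring R by fact
  have "abelian_group (regular_module R)"
    by (rule abelian_groupI)
      (auto simp: regular_module_def a_ac l_neg r_neg intro!: bexI[of _ "\<ominus>\<^bsub>R\<^esub> _"])
  then show ?thesis
    unfolding right_module_def right_module_axioms_def
    by (auto simp: regular_module_def r_distr l_distr m_assoc ring_axioms)
qed

lemma right_module_direct_sum:
  assumes "right_module R M" "right_module R N"
  shows "right_module R (direct_sum M N)"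
proof -
  interpret M: right_module R M by fact
  interpret N: right_module R N by fact
  have "abelian_group (direct_sum M N)"
  proof (rule abelian_groupI)
    fix x assume "x \<in> carrier (direct_sum M N)"
    then show "\<exists>y\<in>carrier (direct_sum M N). y \<oplus>\<^bsub>direct_sum M N\<^esub> x = \<zero>\<^bsub>direct_sum M N\<^esub>"
      by (intro bexI[of _ "(\<ominus>\<^bsub>M\<^esub> fst x, \<ominus>\<^bsub>N\<^esub> snd x)"])
        (auto simp: direct_sum_def M.M.l_neg N.M.l_neg)
  qed (auto simp: direct_sum_def M.M.a_ac N.M.a_ac)
  then show ?thesis
    unfolding right_module_def right_module_axioms_def
    by (auto simp: direct_sum_def M.smult_l_distr M.smult_r_distr M.smult_assoc
        N.smult_l_distr N.smult_r_distr N.smult_assoc M.R.ring_axioms)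
qed

lemma injective_right_ideal:
  assumes inj: "injective_module R E" and I: "submodule I R (regular_module R)"
    and p: "p \<in> right_module_hom R ((regular_module R)\<lparr>carrier := I\<rparr>) E"
  shows "\<exists>e\<in>carrier E. \<forall>r\<in>I. p r = r \<odot>\<^bsub>E\<^esub> e"
proof -
  have E: "right_module R E" using inj unfolding injective_module_def by blast
  interpret E: right_module R E by fact
  let ?A = "regular_module R" and ?t = "\<lambda>a :: 'a. [a]"
  let ?I = "?A\<lparr>carrier := I\<rparr>"
  have A: "right_module R ?A" by (rule right_module_regular) (rule E.R.ring_axioms)
  have I0: "right_module R ?I" by (rule right_module.right_module_submodule[OF A I])
  note IE = right_module.right_submoduleE[OF A I]
  have cA: "carrier ?A = carrier R" by (simp add: regular_module_def)
  obtain A' :: "('a, 'a list) module" where A': "right_module R A'"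
    "?t \<in> right_module_hom R ?A A'" "bij_betw ?t (carrier ?A) (carrier A')"
    by (rule right_module.transport[OF A, of ?t]) (simp add: inj_on_def)
  obtain I' :: "('a, 'a list) module" where I': "right_module R I'"
    "?t \<in> right_module_hom R ?I I'" "bij_betw ?t (carrier ?I) (carrier I')"
    by (rule right_module.transport[OF I0, of ?t]) (simp add: inj_on_def)
  define s where "s = inv_into (carrier ?I) ?t"
  have s: "s \<in> right_module_hom R I' ?I"
    unfolding s_def by (rule right_module_hom_inv[OF I'(2) I0 I'(3)])
  have st: "s [r] = r" if "r \<in> I" for r
    using bij_betw_inv_into_left[OF I'(3), of r] that unfolding s_def by simp
  have s_inj: "inj_on s (carrier I')"
    using bij_betw_inv_into[OF I'(3)] unfolding s_def by (simp add: bij_betw_def)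
  have s': "s \<in> right_module_hom R I' ?A" by (rule right_module_hom_incl[OF s IE(1)])
  have j: "(\<lambda>x. ?t (s x)) \<in> right_module_hom R I' A'" by (rule right_module_hom_comp[OF s' A'(2)])
  have q: "(\<lambda>x. p (s x)) \<in> right_module_hom R I' E" by (rule right_module_hom_comp[OF s p])
  have "inj_on (\<lambda>x. ?t (s x)) (carrier I')" using s_inj by (simp add: inj_on_def)
  from inj[unfolded injective_module_def, THEN conjunct2, rule_format,
      OF conjI[OF I'(1) A'(1)] j q this]
  obtain h where h: "h \<in> right_module_hom R A' E"
    "\<And>x. x \<in> carrier I' \<Longrightarrow> h (?t (s x)) = p (s x)" by blast
  have ht: "(\<lambda>x. h (?t x)) \<in> right_module_hom R ?A E" by (rule right_module_hom_comp[OF A'(2) h(1)])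
  show ?thesis
  proof (intro bexI ballI)
    show "h [\<one>\<^bsub>R\<^esub>] \<in> carrier E" using right_module_homD(1)[OF ht] cA by simp
  next
    fix r assume r: "r \<in> I"
    then have rR: "r \<in> carrier R" using IE(1) cA by auto
    have "[r] \<in> carrier I'" using right_module_homD(1)[OF I'(2)] r by simp
    then have "p r = h [r]" using h(2)[of "[r]"] st[OF r] by simp
    also have "r = r \<odot>\<^bsub>?A\<^esub> \<one>\<^bsub>R\<^esub>" using rR by (simp add: regular_module_def)
    then have "h [r] = h [r \<odot>\<^bsub>?A\<^esub> \<one>\<^bsub>R\<^esub>]" by simp
    also have "\<dots> = r \<odot>\<^bsub>E\<^esub> h [\<one>\<^bsub>R\<^esub>]" using right_module_homD(3)[OF ht] rR cA by simp
    finally show "p r = r \<odot>\<^bsub>E\<^esub> h [\<one>\<^bsub>R\<^esub>]" .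
  qed
qed

text \<open>Baer's criterion.\<close>

lemma injective_extend:
  fixes E :: "('a, 'e) module" and M :: "('a, 'm) module" and N :: "('a, 'n) module"
  assumes inj: "injective_module R E" and M: "right_module R M" and N: "right_module R N"
    and i: "i \<in> right_module_hom R M N" "inj_on i (carrier M)" and f: "f \<in> right_module_hom R M E"
  shows "\<exists>h\<in>right_module_hom R N E. \<forall>x\<in>carrier M. h (i x) = f x"
proof -
  have E: "right_module R E" using inj unfolding injective_module_def by blast
  interpret E: right_module R E by fact
  interpret M: right_module R M by fact
  interpret N: right_module R N by fact
  interpret A: right_module R "regular_module R" by (rule right_module_regular) (rule E.R.ring_axioms)
  define D where "D = direct_sum N E"
  interpret D: right_module R D unfolding D_def by (rule right_module_direct_sum[OF N E])
  have D: "carrier D = carrier N \<times> carrier E" "\<zero>\<^bsub>D\<^esub> = (\<zero>\<^bsub>N\<^esub>, \<zero>\<^bsub>E\<^esub>)"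
    "\<And>x y x' y'. (x, y) \<oplus>\<^bsub>D\<^esub> (x', y') = (x \<oplus>\<^bsub>N\<^esub> x', y \<oplus>\<^bsub>E\<^esub> y')"
    "\<And>a x y. a \<odot>\<^bsub>D\<^esub> (x, y) = (a \<odot>\<^bsub>N\<^esub> x, a \<odot>\<^bsub>E\<^esub> y)"
    unfolding D_def direct_sum_def by simp_all
  have i0: "i \<zero>\<^bsub>M\<^esub> = \<zero>\<^bsub>N\<^esub>"
    using right_module_homD(3)[OF i(1), of "\<zero>\<^bsub>R\<^esub>" "\<zero>\<^bsub>M\<^esub>"] right_module_homD(1)[OF i(1), of "\<zero>\<^bsub>M\<^esub>"] by simp
  have f0: "f \<zero>\<^bsub>M\<^esub> = \<zero>\<^bsub>E\<^esub>"
    using right_module_homD(3)[OF f, of "\<zero>\<^bsub>R\<^esub>" "\<zero>\<^bsub>M\<^esub>"] right_module_homD(1)[OF f, of "\<zero>\<^bsub>M\<^esub>"] by simp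
  let ?G0 = "(\<lambda>x. (i x, f x)) ` carrier M"
  define \<G> where "\<G> = {G. ?G0 \<subseteq> G \<and> submodule G R D \<and> (\<forall>y. (\<zero>\<^bsub>N\<^esub>, y) \<in> G \<longrightarrow> y = \<zero>\<^bsub>E\<^esub>)}"
  have "?G0 \<in> \<G>"
  proof -
    have "submodule ?G0 R D"
    proof (rule D.right_submoduleI)
      show "?G0 \<subseteq> carrier D" using right_module_homD(1)[OF i(1)] right_module_homD(1)[OF f] D(1) by auto
      have "\<zero>\<^bsub>D\<^esub> = (i \<zero>\<^bsub>M\<^esub>, f \<zero>\<^bsub>M\<^esub>)" using D(2) i0 f0 by simp
      then show "\<zero>\<^bsub>D\<^esub> \<in> ?G0" by blast
    next
      fix u v assume "u \<in> ?G0" "v \<in> ?G0"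
      then obtain x y where xy: "x \<in> carrier M" "y \<in> carrier M" "u = (i x, f x)" "v = (i y, f y)" by auto
      then have "u \<oplus>\<^bsub>D\<^esub> v = (i (x \<oplus>\<^bsub>M\<^esub> y), f (x \<oplus>\<^bsub>M\<^esub> y))"
        by (simp add: D right_module_homD(2)[OF i(1)] right_module_homD(2)[OF f])
      then show "u \<oplus>\<^bsub>D\<^esub> v \<in> ?G0" using xy M.M.add.m_closed by blast
    next
      fix a u assume "a \<in> carrier R" "u \<in> ?G0"
      then obtain x where x: "a \<in> carrier R" "x \<in> carrier M" "u = (i x, f x)" by auto
      then have "a \<odot>\<^bsub>D\<^esub> u = (i (a \<odot>\<^bsub>M\<^esub> x), f (a \<odot>\<^bsub>M\<^esub> x))"
        by (simp add: D right_module_homD(3)[OF i(1)] right_module_homD(3)[OF f])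
      then show "a \<odot>\<^bsub>D\<^esub> u \<in> ?G0" using x M.smult_closed by blast
    qed
    moreover have "y = \<zero>\<^bsub>E\<^esub>" if y: "(\<zero>\<^bsub>N\<^esub>, y) \<in> ?G0" for y
    proof -
      obtain x where x: "x \<in> carrier M" "i x = \<zero>\<^bsub>N\<^esub>" "y = f x" using y by auto
      then have "x = \<zero>\<^bsub>M\<^esub>" using inj_onD[OF i(2), of x "\<zero>\<^bsub>M\<^esub>"] i0 by simp
      then show ?thesis using x f0 by simp
    qed
    ultimately show ?thesis unfolding \<G>_def by blast
  qed
  moreover have "\<Union>C \<in> \<G>" if C: "C \<noteq> {}" "subset.chain \<G> C" for C
  proof -
    have sub: "G \<in> \<G>" if "G \<in> C" for G using C(2) that unfolding subset_chain_def by blast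
    have mod: "submodule G R D" if "G \<in> C" for G using sub[OF that] unfolding \<G>_def by blast
    obtain G1 where G1: "G1 \<in> C" using C(1) by blast
    have "submodule (\<Union>C) R D"
    proof (rule D.right_submoduleI)
      show "\<Union>C \<subseteq> carrier D" using D.right_submoduleE(1)[OF mod] by blast
      show "\<zero>\<^bsub>D\<^esub> \<in> \<Union>C" using D.right_submoduleE(2)[OF mod[OF G1]] G1 by blast
    next
      fix u v assume "u \<in> \<Union>C" "v \<in> \<Union>C"
      then obtain G H where GH: "G \<in> C" "H \<in> C" "u \<in> G" "v \<in> H" by blast
      then have "G \<subseteq> H \<or> H \<subseteq> G" using C(2) unfolding subset_chain_def by blast
      then obtain K where K: "K \<in> C" "u \<in> K" "v \<in> K" using GH by blast
      show "u \<oplus>\<^bsub>D\<^esub> v \<in> \<Union>C" using D.right_submoduleE(3)[OF mod[OF K(1)] K(2,3)] K(1) by blast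
    next
      fix a u assume a: "a \<in> carrier R" and "u \<in> \<Union>C"
      then obtain G where G: "G \<in> C" "u \<in> G" by blast
      show "a \<odot>\<^bsub>D\<^esub> u \<in> \<Union>C" using D.right_submoduleE(4)[OF mod[OF G(1)] a G(2)] G(1) by blast
    qed
    moreover have "?G0 \<subseteq> \<Union>C" using sub[OF G1] G1 unfolding \<G>_def by blast
    moreover have "\<forall>y. (\<zero>\<^bsub>N\<^esub>, y) \<in> \<Union>C \<longrightarrow> y = \<zero>\<^bsub>E\<^esub>" using sub unfolding \<G>_def by blast
    ultimately show ?thesis unfolding \<G>_def by blast
  qed
  ultimately obtain G where G: "G \<in> \<G>" and max: "\<forall>X\<in>\<G>. G \<subseteq> X \<longrightarrow> X = G"
    using subset_Zorn_nonempty[of \<G>] by blast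
  have Gsub: "submodule G R D" and G0: "?G0 \<subseteq> G"
    and Gz: "\<And>y. (\<zero>\<^bsub>N\<^esub>, y) \<in> G \<Longrightarrow> y = \<zero>\<^bsub>E\<^esub>"
    using G unfolding \<G>_def by blast+
  note GE = D.right_submoduleE[OF Gsub]
  have Gc: "x \<in> carrier N" "y \<in> carrier E" if "(x, y) \<in> G" for x y
    using GE(1) D(1) that by auto
  have Gadd: "(x \<oplus>\<^bsub>N\<^esub> x', y \<oplus>\<^bsub>E\<^esub> y') \<in> G" if "(x, y) \<in> G" "(x', y') \<in> G" for x y x' y'
    using GE(3)[OF that] D(3) by simp
  have Gsm: "(a \<odot>\<^bsub>N\<^esub> x, a \<odot>\<^bsub>E\<^esub> y) \<in> G" if "a \<in> carrier R" "(x, y) \<in> G" for a x y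
    using GE(4)[OF that] D(4) by simp
  have Gneg: "(\<ominus>\<^bsub>N\<^esub> x, \<ominus>\<^bsub>E\<^esub> y) \<in> G" if "(x, y) \<in> G" for x y
    using Gsm[of "\<ominus>\<^bsub>R\<^esub> \<one>\<^bsub>R\<^esub>", OF _ that] Gc[OF that] by (simp add: N.minus_smult E.minus_smult)
  have uniq: "y = y'" if "(x, y) \<in> G" "(x, y') \<in> G" for x y y'
  proof -
    have "(\<zero>\<^bsub>N\<^esub>, y \<oplus>\<^bsub>E\<^esub> (\<ominus>\<^bsub>E\<^esub> y')) \<in> G"
      using Gadd[OF that(1) Gneg[OF that(2)]] Gc(1)[OF that(1)] by (simp add: N.M.r_neg)
    from Gz[OF this] show ?thesis
      using Gc(2)[OF that(1)] Gc(2)[OF that(2)]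
      by (metis E.M.a_inv_closed E.M.minus_equality E.M.minus_minus)
  qed
  have total: "\<exists>y. (n, y) \<in> G" if n: "n \<in> carrier N" for n
  proof -
    define I where "I = {r \<in> carrier R. \<exists>y. (r \<odot>\<^bsub>N\<^esub> n, y) \<in> G}"
    define p where "p r = (SOME y. (r \<odot>\<^bsub>N\<^esub> n, y) \<in> G)" for r
    have p: "(r \<odot>\<^bsub>N\<^esub> n, p r) \<in> G" if "r \<in> I" for r
      using that unfolding I_def p_def by (auto intro: someI)
    have IR: "r \<in> carrier R" if "r \<in> I" for r using that unfolding I_def by simp
    have II: "r \<in> I" if "r \<in> carrier R" "(r \<odot>\<^bsub>N\<^esub> n, y) \<in> G" for r y
      using that unfolding I_def by blast
    have Iadd: "((r \<oplus>\<^bsub>R\<^esub> s) \<odot>\<^bsub>N\<^esub> n, p r \<oplus>\<^bsub>E\<^esub> p s) \<in> G" if "r \<in> I" "s \<in> I" for r s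
      using Gadd[OF p[OF that(1)] p[OF that(2)]] IR that n by (simp add: N.smult_l_distr)
    have Ism: "((r \<otimes>\<^bsub>R\<^esub> a) \<odot>\<^bsub>N\<^esub> n, a \<odot>\<^bsub>E\<^esub> p r) \<in> G" if "r \<in> I" "a \<in> carrier R" for r a
      using Gsm[OF that(2) p[OF that(1)]] IR that n by (simp add: N.smult_assoc)
    have Iz: "\<zero>\<^bsub>R\<^esub> \<in> I" using II[of "\<zero>\<^bsub>R\<^esub>" "\<zero>\<^bsub>E\<^esub>"] GE(2) D(2) n by simp
    have I1: "r \<oplus>\<^bsub>R\<^esub> s \<in> I" if "r \<in> I" "s \<in> I" for r s
      using II[OF _ Iadd[OF that]] IR that by simp
    have I2: "r \<otimes>\<^bsub>R\<^esub> a \<in> I" if "r \<in> I" "a \<in> carrier R" for r a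
      using II[OF _ Ism[OF that]] IR that by simp
    have I: "submodule I R (regular_module R)"
    proof (rule A.right_submoduleI)
      show "I \<subseteq> carrier (regular_module R)" using IR by (auto simp: regular_module_def)
      show "\<zero>\<^bsub>regular_module R\<^esub> \<in> I" using Iz by (simp add: regular_module_def)
    next
      fix r s assume "r \<in> I" "s \<in> I"
      then show "r \<oplus>\<^bsub>regular_module R\<^esub> s \<in> I" using I1 by (simp add: regular_module_def)
    next
      fix a r assume "a \<in> carrier R" "r \<in> I"
      then show "a \<odot>\<^bsub>regular_module R\<^esub> r \<in> I" using I2 by (simp add: regular_module_def)
    qed
    have "p \<in> right_module_hom R ((regular_module R)\<lparr>carrier := I\<rparr>) E"
    proof (rule right_module_homI)
      show "p \<in> carrier ((regular_module R)\<lparr>carrier := I\<rparr>) \<rightarrow> carrier E"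
        using Gc(2)[OF p] by auto
    next
      fix r s assume "r \<in> carrier ((regular_module R)\<lparr>carrier := I\<rparr>)"
        "s \<in> carrier ((regular_module R)\<lparr>carrier := I\<rparr>)"
      then have rs: "r \<in> I" "s \<in> I" by simp_all
      show "p (r \<oplus>\<^bsub>(regular_module R)\<lparr>carrier := I\<rparr>\<^esub> s) = p r \<oplus>\<^bsub>E\<^esub> p s"
        using uniq[OF p[OF I1[OF rs]] Iadd[OF rs]] by (simp add: regular_module_def)
    next
      fix a r assume a: "a \<in> carrier R" and "r \<in> carrier ((regular_module R)\<lparr>carrier := I\<rparr>)"
      then have r: "r \<in> I" by simp
      show "p (a \<odot>\<^bsub>(regular_module R)\<lparr>carrier := I\<rparr>\<^esub> r) = a \<odot>\<^bsub>E\<^esub> p r"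
        using uniq[OF p[OF I2[OF r a]] Ism[OF r a]] by (simp add: regular_module_def)
    qed
    then obtain e where e: "e \<in> carrier E" "\<And>r. r \<in> I \<Longrightarrow> p r = r \<odot>\<^bsub>E\<^esub> e"
      using injective_right_ideal[OF inj I] by blast
    let ?G = "{(x \<oplus>\<^bsub>N\<^esub> r \<odot>\<^bsub>N\<^esub> n, y \<oplus>\<^bsub>E\<^esub> r \<odot>\<^bsub>E\<^esub> e) | x y r. (x, y) \<in> G \<and> r \<in> carrier R}"
    have G'I: "(x \<oplus>\<^bsub>N\<^esub> r \<odot>\<^bsub>N\<^esub> n, y \<oplus>\<^bsub>E\<^esub> r \<odot>\<^bsub>E\<^esub> e) \<in> ?G" if "(x, y) \<in> G" "r \<in> carrier R" for x y r
      using that by blast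
    have sub: "G \<subseteq> ?G"
    proof
      fix u assume "u \<in> G"
      then show "u \<in> ?G"
        using G'I[of "fst u" "snd u" "\<zero>\<^bsub>R\<^esub>"] Gc[of "fst u" "snd u"] n e(1) by simp
    qed
    have "submodule ?G R D"
    proof (rule D.right_submoduleI)
      show "?G \<subseteq> carrier D" using Gc n e(1) D(1) by auto
      show "\<zero>\<^bsub>D\<^esub> \<in> ?G" using sub GE(2) by blast
    next
      fix u v assume "u \<in> ?G" "v \<in> ?G"
      then obtain x y r x' y' r' where uv: "(x, y) \<in> G" "r \<in> carrier R" "(x', y') \<in> G" "r' \<in> carrier R"
        "u = (x \<oplus>\<^bsub>N\<^esub> r \<odot>\<^bsub>N\<^esub> n, y \<oplus>\<^bsub>E\<^esub> r \<odot>\<^bsub>E\<^esub> e)"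
        "v = (x' \<oplus>\<^bsub>N\<^esub> r' \<odot>\<^bsub>N\<^esub> n, y' \<oplus>\<^bsub>E\<^esub> r' \<odot>\<^bsub>E\<^esub> e)" by blast
      then have "u \<oplus>\<^bsub>D\<^esub> v = ((x \<oplus>\<^bsub>N\<^esub> x') \<oplus>\<^bsub>N\<^esub> (r \<oplus>\<^bsub>R\<^esub> r') \<odot>\<^bsub>N\<^esub> n,
          (y \<oplus>\<^bsub>E\<^esub> y') \<oplus>\<^bsub>E\<^esub> (r \<oplus>\<^bsub>R\<^esub> r') \<odot>\<^bsub>E\<^esub> e)"
        using Gc[OF uv(1)] Gc[OF uv(3)] n e(1)
        by (simp add: D(3) N.smult_l_distr E.smult_l_distr N.M.a_ac E.M.a_ac)
      then show "u \<oplus>\<^bsub>D\<^esub> v \<in> ?G" using G'I[OF Gadd[OF uv(1) uv(3)], of "r \<oplus>\<^bsub>R\<^esub> r'"] uv by simp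
    next
      fix a u assume a: "a \<in> carrier R" and "u \<in> ?G"
      then obtain x y r where u: "(x, y) \<in> G" "r \<in> carrier R"
        "u = (x \<oplus>\<^bsub>N\<^esub> r \<odot>\<^bsub>N\<^esub> n, y \<oplus>\<^bsub>E\<^esub> r \<odot>\<^bsub>E\<^esub> e)" by blast
      then have "a \<odot>\<^bsub>D\<^esub> u = (a \<odot>\<^bsub>N\<^esub> x \<oplus>\<^bsub>N\<^esub> (r \<otimes>\<^bsub>R\<^esub> a) \<odot>\<^bsub>N\<^esub> n, a \<odot>\<^bsub>E\<^esub> y \<oplus>\<^bsub>E\<^esub> (r \<otimes>\<^bsub>R\<^esub> a) \<odot>\<^bsub>E\<^esub> e)"
        using Gc[OF u(1)] n e(1) a
        by (simp add: D(4) N.smult_r_distr E.smult_r_distr N.smult_assoc E.smult_assoc)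
      then show "a \<odot>\<^bsub>D\<^esub> u \<in> ?G" using G'I[OF Gsm[OF a u(1)], of "r \<otimes>\<^bsub>R\<^esub> a"] u(2) a by simp
    qed
    moreover have "z = \<zero>\<^bsub>E\<^esub>" if z: "(\<zero>\<^bsub>N\<^esub>, z) \<in> ?G" for z
    proof -
      obtain x y r where xyr: "(x, y) \<in> G" "r \<in> carrier R" "x \<oplus>\<^bsub>N\<^esub> r \<odot>\<^bsub>N\<^esub> n = \<zero>\<^bsub>N\<^esub>"
        "z = y \<oplus>\<^bsub>E\<^esub> r \<odot>\<^bsub>E\<^esub> e" using z by auto
      note c = Gc[OF xyr(1)]
      have "x = \<ominus>\<^bsub>N\<^esub> (r \<odot>\<^bsub>N\<^esub> n)"
        using N.M.minus_equality[OF xyr(3)] c(1) xyr(2) n by simp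
      then have x: "x = (\<ominus>\<^bsub>R\<^esub> r) \<odot>\<^bsub>N\<^esub> n" using xyr(2) n by (simp add: N.minus_smult)
      have rI: "\<ominus>\<^bsub>R\<^esub> r \<in> I" using II[of "\<ominus>\<^bsub>R\<^esub> r" y] xyr(1,2) x by simp
      have "y = p (\<ominus>\<^bsub>R\<^esub> r)" using uniq[OF _ p[OF rI]] xyr(1) x by simp
      also have "\<dots> = \<ominus>\<^bsub>E\<^esub> (r \<odot>\<^bsub>E\<^esub> e)" using e(2)[OF rI] xyr(2) e(1) by (simp add: E.minus_smult)
      finally show ?thesis using xyr(2,4) e(1) by (simp add: E.M.l_neg)
    qed
    ultimately have "?G \<in> \<G>" using sub G0 unfolding \<G>_def by blast
    from max[rule_format, OF this sub] have "?G = G" .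
    moreover have "(n, e) \<in> ?G"
      using G'I[of "\<zero>\<^bsub>N\<^esub>" "\<zero>\<^bsub>E\<^esub>" "\<one>\<^bsub>R\<^esub>"] GE(2) D(2) n e(1) by simp
    ultimately have "(n, e) \<in> G" by (rule subst)
    then show ?thesis by (rule exI)
  qed
  define h where "h x = (SOME y. (x, y) \<in> G)" for x
  have h: "(x, h x) \<in> G" if "x \<in> carrier N" for x
    using total[OF that] unfolding h_def by (rule someI_ex)
  have hh: "h \<in> right_module_hom R N E"
  proof (rule right_module_homI)
    show "h \<in> carrier N \<rightarrow> carrier E" using Gc(2)[OF h] by auto
  next
    fix x y assume "x \<in> carrier N" "y \<in> carrier N"
    then show "h (x \<oplus>\<^bsub>N\<^esub> y) = h x \<oplus>\<^bsub>E\<^esub> h y" using uniq[OF h Gadd[OF h h]] by simp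
  next
    fix a x assume "a \<in> carrier R" "x \<in> carrier N"
    then show "h (a \<odot>\<^bsub>N\<^esub> x) = a \<odot>\<^bsub>E\<^esub> h x" using uniq[OF h Gsm[OF _ h]] by simp
  qed
  have hi: "h (i x) = f x" if "x \<in> carrier M" for x
  proof -
    have "i x \<in> carrier N" by (rule right_module_homD(1)[OF i(1) that])
    moreover have "(i x, f x) \<in> G" using G0 that by blast
    ultimately show ?thesis using uniq[OF h] by blast
  qed
  show ?thesis by (rule bexI[OF _ hh]) (simp add: hi)
qed

end

theory Submission
  imports Defs
begin

text \<open>
  As \<open>IT_psi R M\<close> is at least \<open>IT_phi R M\<close>, vanishing of \<open>psi_dim\<close> implies vanishing of \<open>phi_dim\<close>.
  The two substantial implications are the following.

  Suppose that \<open>R\<close> is right self-injective. Then finitely generated projective modules are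
  injective (\<open>injective_of_projective\<close>). Consequently the cokernel of a map from \<open>M\<close> to a projective
  module, with kernel as small as possible, has a class in \<open>IT_group R\<close> that depends only on \<open>M\<close>,
  and since \<open>M\<close> is such a cokernel for its syzygy, this operation is a left inverse of the syzygy
  homomorphism. So the latter is injective (\<open>IT_syzygy_inj\<close>), it preserves ranks, and \<open>IT_phi\<close>
  vanishes. Moreover the kernels in a finite projective resolution split off one after the
  other, so modules of finite projective dimension are projective
  (\<open>projective_of_finite_resolution\<close>), and \<open>IT_psi\<close> vanishes too.

  Conversely suppose that \<open>IT_phi\<close> vanishes. Since \<open>IT_span R N\<close> is finitely generated, equality of
  ranks means that the syzygy homomorphism has only torsion elements in its kernel on
  \<open>IT_span R N\<close> (\<open>torsion_kernel_if_rank_eq\<close>). To prove that \<open>R\<close> is injective as a right module it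
  suffices to extend homomorphisms \<open>p : L \<rightarrow> R\<close> from maximal right ideals to \<open>R\<close>
  (\<open>injective_if_extends_from_maximal\<close>). Such a \<open>p\<close> gives an exact sequence
  \<open>0 \<rightarrow> R \<rightarrow> M \<rightarrow> S \<rightarrow> 0\<close>, where \<open>M\<close> is the quotient of \<open>R \<oplus> R\<close> by the graph of \<open>- p\<close> and \<open>S = R/L\<close>
  is simple; \<open>p\<close> extends precisely if the sequence splits. Both \<open>M\<close> and \<open>S\<close> are quotients of
  projective modules with kernel \<open>L\<close>, so \<open>[M] - [S]\<close> is torsion. Let \<open>t(X)\<close> be the length of the
  sum of the images of all homomorphisms \<open>S \<rightarrow> X\<close>. For a presentation \<open>0 \<rightarrow> K \<rightarrow> P \<rightarrow> X \<rightarrow> 0\<close> the number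
  \<open>t(X) + t(K) - t(P)\<close> depends only on \<open>X\<close> by Schanuel's lemma, is additive on direct sums, and
  is zero if \<open>X\<close> is projective. Hence it defines a homomorphism from \<open>IT_group R\<close> to the integers
  (\<open>trace_defect_hom\<close>), and it takes the same value on \<open>M\<close> and \<open>S\<close>:
  \<open>t(M) + t(L) - 2 t(R) = t(S) + t(L) - t(R)\<close>. So \<open>t(M) = t(S) + t(R) > t(R)\<close>, some homomorphism
  \<open>S \<rightarrow> M\<close> does not land in \<open>R\<close>, its composite with \<open>M \<rightarrow> S\<close> is nonzero and therefore invertible, and
  the sequence splits.

  Both directions use that \<open>R\<close> has finite length (\<open>right_artinian_finite_length\<close>), which yields
  projective covers and makes syzygies finitely generated. The syzygy homomorphism is computed
  from arbitrary projective presentations by Schanuel's lemma. Fitting's lemma enters through the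
  finiteness of the set of classes of indecomposable summands of a module.
\<close>

section \<open>Submodules and quotients\<close>

lemma right_module_hom_zero:
  assumes "right_module R M" "right_module R N" "f \<in> right_module_hom R M N"
  shows "f \<zero>\<^bsub>M\<^esub> = \<zero>\<^bsub>N\<^esub>"
proof -
  interpret M: right_module R M by fact
  interpret N: right_module R N by fact
  show ?thesis
    using right_module_homD(3)[OF assms(3), of "\<zero>\<^bsub>R\<^esub>" "\<zero>\<^bsub>M\<^esub>"] right_module_homD(1)[OF assms(3), of "\<zero>\<^bsub>M\<^esub>"]
    by simp
qed

lemma right_module_hom_neg:
  assumes "right_module R M" "right_module R N" "f \<in> right_module_hom R M N" "x \<in> carrier M"
  shows "f (\<ominus>\<^bsub>M\<^esub> x) = \<ominus>\<^bsub>N\<^esub> f x"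
proof -
  interpret M: right_module R M by fact
  interpret N: right_module R N by fact
  have "f (\<ominus>\<^bsub>M\<^esub> x) \<oplus>\<^bsub>N\<^esub> f x = \<zero>\<^bsub>N\<^esub>"
    using assms(4) by (simp flip: right_module_homD(2)[OF assms(3)]
        add: M.M.l_neg right_module_hom_zero[OF assms(1-3)])
  then show ?thesis using right_module_homD(1)[OF assms(3)] assms(4) by (simp add: N.M.minus_equality)
qed

lemma right_module_hom_id: "(\<lambda>x. x) \<in> right_module_hom R M M"
  by (rule right_module_homI) auto

lemma right_module_hom_const_zero:
  assumes "right_module R N"
  shows "(\<lambda>_. \<zero>\<^bsub>N\<^esub>) \<in> right_module_hom R M N"
proof -
  interpret N: right_module R N by fact
  show ?thesis by (rule right_module_homI) auto
qed

lemma right_module_hom_add: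
  assumes "right_module R M" "right_module R N"
    and "f \<in> right_module_hom R M N" "g \<in> right_module_hom R M N"
  shows "(\<lambda>x. f x \<oplus>\<^bsub>N\<^esub> g x) \<in> right_module_hom R M N"
proof -
  interpret N: right_module R N by fact
  show ?thesis
    using right_module_homD[OF assms(3)] right_module_homD[OF assms(4)]
    by (intro right_module_homI) (auto simp: N.smult_r_distr N.M.a_ac)
qed

lemma right_module_hom_uminus:
  assumes "right_module R M" "right_module R N" and "f \<in> right_module_hom R M N"
  shows "(\<lambda>x. \<ominus>\<^bsub>N\<^esub> f x) \<in> right_module_hom R M N"
proof -
  interpret M: right_module R M by fact
  interpret N: right_module R N by fact
  have "(\<lambda>x. f (\<ominus>\<^bsub>M\<^esub> x)) \<in> right_module_hom R M N"
  proof (rule right_module_homI)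
    fix a x assume ax: "a \<in> carrier R" "x \<in> carrier M"
    then have "a \<odot>\<^bsub>M\<^esub> x \<oplus>\<^bsub>M\<^esub> a \<odot>\<^bsub>M\<^esub> (\<ominus>\<^bsub>M\<^esub> x) = \<zero>\<^bsub>M\<^esub>"
      by (simp flip: M.smult_r_distr add: M.M.r_neg)
    then have "\<ominus>\<^bsub>M\<^esub> (a \<odot>\<^bsub>M\<^esub> x) = a \<odot>\<^bsub>M\<^esub> (\<ominus>\<^bsub>M\<^esub> x)"
      using ax by (metis M.M.a_inv_closed M.M.minus_equality M.M.a_comm M.smult_closed)
    then show "f (\<ominus>\<^bsub>M\<^esub> (a \<odot>\<^bsub>M\<^esub> x)) = a \<odot>\<^bsub>N\<^esub> f (\<ominus>\<^bsub>M\<^esub> x)"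
      using right_module_homD(3)[OF assms(3)] ax by simp
  qed (use right_module_homD[OF assms(3)] in \<open>auto simp: M.M.minus_add\<close>)
  then show ?thesis
    using right_module_hom_neg[OF assms] right_module_homD(1)[OF assms(3)]
    unfolding right_module_hom_def by (auto simp: Pi_iff)
qed

lemma a_kernel_iff: "x \<in> a_kernel M N f \<longleftrightarrow> x \<in> carrier M \<and> f x = \<zero>\<^bsub>N\<^esub>"
  by (simp add: a_kernel_def')

lemma submodule_vimage:
  assumes M: "right_module R M" and N: "right_module R N"
    and f: "f \<in> right_module_hom R M N" and K: "submodule K R N"
  shows "submodule {x \<in> carrier M. f x \<in> K} R M"
proof -
  interpret M: right_module R M by fact
  interpret N: right_module R N by fact
  note KE = N.right_submoduleE[OF K]
  show ?thesis
    by (rule M.right_submoduleI)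
      (auto simp: right_module_hom_zero[OF M N f] KE right_module_homD[OF f])
qed

lemma submodule_image:
  assumes M: "right_module R M" and N: "right_module R N"
    and f: "f \<in> right_module_hom R M N" and H: "submodule H R M"
  shows "submodule (f ` H) R N"
proof -
  interpret M: right_module R M by fact
  interpret N: right_module R N by fact
  note HE = M.right_submoduleE[OF H]
  have c: "x \<in> carrier M" if "x \<in> H" for x using HE(1) that by blast
  show ?thesis
  proof (rule N.right_submoduleI)
    show "f ` H \<subseteq> carrier N" using c right_module_homD(1)[OF f] by blast
    show "\<zero>\<^bsub>N\<^esub> \<in> f ` H" using HE(2) right_module_hom_zero[OF M N f] by (metis imageI)
  next
    fix x y assume "x \<in> f ` H" "y \<in> f ` H"
    then show "x \<oplus>\<^bsub>N\<^esub> y \<in> f ` H"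
      using HE(3) c by (auto simp flip: right_module_homD(2)[OF f])
  next
    fix a x assume "a \<in> carrier R" "x \<in> f ` H"
    then show "a \<odot>\<^bsub>N\<^esub> x \<in> f ` H"
      using HE(4) c by (auto simp flip: right_module_homD(3)[OF f])
  qed
qed

lemma submodule_carrier:
  assumes "right_module R M"
  shows "submodule (carrier M) R M"
proof -
  interpret M: right_module R M by fact
  show ?thesis by (rule M.right_submoduleI) auto
qed

lemma submodule_zero:
  assumes "right_module R M"
  shows "submodule {\<zero>\<^bsub>M\<^esub>} R M"
proof -
  interpret M: right_module R M by fact
  show ?thesis by (rule M.right_submoduleI) auto
qed

lemma submodule_a_kernel:
  assumes M: "right_module R M" and N: "right_module R N" and f: "f \<in> right_module_hom R M N"
  shows "submodule (a_kernel M N f) R M"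
  using submodule_vimage[OF M N f submodule_zero[OF N]] by (simp add: a_kernel_def')

lemma submodule_Inter:
  assumes "right_module R M" "F \<noteq> {}" "\<And>H. H \<in> F \<Longrightarrow> submodule H R M"
  shows "submodule (\<Inter>F) R M"
proof -
  interpret M: right_module R M by fact
  note E = M.right_submoduleE[OF assms(3)]
  show ?thesis
  proof (rule M.right_submoduleI)
    obtain H where "H \<in> F" using assms(2) by blast
    then show "\<Inter>F \<subseteq> carrier M" using E(1)[of H] by blast
  qed (simp_all add: E)
qed

lemma submodule_submodule_iff:
  assumes M: "right_module R M" and H: "submodule H R M"
  shows "submodule K R (M\<lparr>carrier := H\<rparr>) \<longleftrightarrow> submodule K R M \<and> K \<subseteq> H"
proof -
  interpret M: right_module R M by fact
  interpret H: right_module R "M\<lparr>carrier := H\<rparr>" by (rule M.right_module_submodule[OF H])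
  note HE = M.right_submoduleE[OF H]
  show ?thesis
  proof
    assume K: "submodule K R (M\<lparr>carrier := H\<rparr>)"
    note KE = H.right_submoduleE[OF K, simplified]
    have "submodule K R M" by (rule M.right_submoduleI) (use KE(1-4) HE(1) in blast)+
    then show "submodule K R M \<and> K \<subseteq> H" using KE(1) by simp
  next
    assume "submodule K R M \<and> K \<subseteq> H"
    then have K: "submodule K R M" "K \<subseteq> H" by simp_all
    note KE = M.right_submoduleE[OF K(1)]
    show "submodule K R (M\<lparr>carrier := H\<rparr>)"
      by (rule H.right_submoduleI) (simp_all add: K(2) KE(2-4))
  qed
qed

lemma right_module_zero_submodule:
  assumes "right_module R M"
  shows "right_module R (M\<lparr>carrier := {\<zero>\<^bsub>M\<^esub>}\<rparr>)"
  by (rule right_module.right_module_submodule[OF assms submodule_zero[OF assms]])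

definition generated_submodule :: "('a, 'b) ring_scheme \<Rightarrow> ('a, 'm) module \<Rightarrow> 'm set \<Rightarrow> 'm set" where
  "generated_submodule R M S = \<Inter>{H. submodule H R M \<and> S \<subseteq> H}"

lemma submodule_generated:
  assumes "right_module R M" "S \<subseteq> carrier M"
  shows "submodule (generated_submodule R M S) R M"
  unfolding generated_submodule_def
  by (rule submodule_Inter[OF assms(1)]) (use submodule_carrier[OF assms(1)] assms(2) in auto)

lemma generated_submodule_superset: "S \<subseteq> generated_submodule R M S"
  unfolding generated_submodule_def by blast

lemma generated_submodule_minimal:
  "submodule H R M \<Longrightarrow> S \<subseteq> H \<Longrightarrow> generated_submodule R M S \<subseteq> H"
  unfolding generated_submodule_def by blast

lemma generated_submodule_mono: "S \<subseteq> T \<Longrightarrow> generated_submodule R M S \<subseteq> generated_submodule R M T"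
  unfolding generated_submodule_def by blast

lemma generated_submodule_eq:
  assumes "right_module R M" "submodule H R M" "S \<subseteq> H"
    and "\<And>K. submodule K R M \<Longrightarrow> S \<subseteq> K \<Longrightarrow> H \<subseteq> K"
  shows "generated_submodule R M S = H"
  unfolding generated_submodule_def using assms by blast

lemma generated_submodule_image:
  assumes M: "right_module R M" and N: "right_module R N" and f: "f \<in> right_module_hom R M N"
    and S: "S \<subseteq> carrier M"
  shows "generated_submodule R N (f ` S) = f ` generated_submodule R M S"
proof (rule generated_submodule_eq[OF N])
  note G = submodule_generated[OF M S]
  show "submodule (f ` generated_submodule R M S) R N" by (rule submodule_image[OF M N f G])
  show "f ` S \<subseteq> f ` generated_submodule R M S"
    by (rule image_mono[OF generated_submodule_superset])
  fix K assume K: "submodule K R N" "f ` S \<subseteq> K"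
  have "generated_submodule R M S \<subseteq> {x \<in> carrier M. f x \<in> K}"
    by (rule generated_submodule_minimal[OF submodule_vimage[OF M N f K(1)]]) (use S K(2) in auto)
  then show "f ` generated_submodule R M S \<subseteq> K" by blast
qed

lemma finitely_generated_iff:
  assumes "right_module R M"
  shows "finitely_generated R M \<longleftrightarrow>
    (\<exists>S. finite S \<and> S \<subseteq> carrier M \<and> generated_submodule R M S = carrier M)"
proof -
  interpret M: right_module R M by fact
  have "(\<forall>H. submodule H R M \<and> S \<subseteq> H \<longrightarrow> H = carrier M) \<longleftrightarrow> generated_submodule R M S = carrier M"
    if S: "S \<subseteq> carrier M" for S
  proof
    assume "\<forall>H. submodule H R M \<and> S \<subseteq> H \<longrightarrow> H = carrier M"
    then show "generated_submodule R M S = carrier M"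
      using submodule_generated[OF assms S] generated_submodule_superset[of S R M] by blast
  next
    assume *: "generated_submodule R M S = carrier M"
    show "\<forall>H. submodule H R M \<and> S \<subseteq> H \<longrightarrow> H = carrier M"
    proof (intro allI impI)
      fix H assume H: "submodule H R M \<and> S \<subseteq> H"
      then have "carrier M \<subseteq> H" using generated_submodule_minimal[of H R M S] * by simp
      moreover have "H \<subseteq> carrier M" by (rule M.right_submoduleE(1)) (use H in simp)
      ultimately show "H = carrier M" by (rule subset_antisym[symmetric])
    qed
  qed
  then show ?thesis unfolding finitely_generated_def by (metis (no_types, lifting))
qed

lemma submodule_add_cyclic:
  assumes M: "right_module R M" and H: "submodule H R M" and x: "x \<in> carrier M"
    and I: "submodule I R (regular_module R)"
  shows "submodule {h \<oplus>\<^bsub>M\<^esub> r \<odot>\<^bsub>M\<^esub> x | h r. h \<in> H \<and> r \<in> I} R M" (is "submodule ?K R M")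
proof -
  interpret M: right_module R M by fact
  interpret A: right_module R "regular_module R" by (rule right_module_regular) (rule M.R.ring_axioms)
  note HE = M.right_submoduleE[OF H]
  have c: "y \<in> carrier M" if "y \<in> H" for y using HE(1) that by blast
  note IE = A.right_submoduleE[OF I, unfolded regular_module_def, simplified]
  have ic: "r \<in> carrier R" if "r \<in> I" for r using IE(1) that by blast
  show ?thesis
  proof (rule M.right_submoduleI)
    show "?K \<subseteq> carrier M" using c ic x by auto
    show "\<zero>\<^bsub>M\<^esub> \<in> ?K" using HE(2) IE(2) x by (auto intro!: exI[of _ "\<zero>\<^bsub>M\<^esub>"] exI[of _ "\<zero>\<^bsub>R\<^esub>"])
  next
    fix u v assume "u \<in> ?K" "v \<in> ?K"
    then obtain h r k s where *: "u = h \<oplus>\<^bsub>M\<^esub> r \<odot>\<^bsub>M\<^esub> x" "v = k \<oplus>\<^bsub>M\<^esub> s \<odot>\<^bsub>M\<^esub> x"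
      "h \<in> H" "k \<in> H" "r \<in> I" "s \<in> I" by blast
    then have "u \<oplus>\<^bsub>M\<^esub> v = (h \<oplus>\<^bsub>M\<^esub> k) \<oplus>\<^bsub>M\<^esub> (r \<oplus>\<^bsub>R\<^esub> s) \<odot>\<^bsub>M\<^esub> x"
      using x c ic by (simp add: M.smult_l_distr M.M.a_ac)
    then show "u \<oplus>\<^bsub>M\<^esub> v \<in> ?K" using * HE(3) IE(3) by blast
  next
    fix a u assume a: "a \<in> carrier R" and "u \<in> ?K"
    then obtain h r where *: "u = h \<oplus>\<^bsub>M\<^esub> r \<odot>\<^bsub>M\<^esub> x" "h \<in> H" "r \<in> I" by blast
    then have "a \<odot>\<^bsub>M\<^esub> u = a \<odot>\<^bsub>M\<^esub> h \<oplus>\<^bsub>M\<^esub> (r \<otimes>\<^bsub>R\<^esub> a) \<odot>\<^bsub>M\<^esub> x"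
      using x c ic a by (simp add: M.smult_r_distr M.smult_assoc)
    then show "a \<odot>\<^bsub>M\<^esub> u \<in> ?K" using * HE(4) IE(4) a by blast
  qed
qed

lemma submodule_regular_carrier: "ring R \<Longrightarrow> submodule (carrier R) R (regular_module R)"
  using submodule_carrier[OF right_module_regular, of R] by (simp add: regular_module_def)

lemma regular_simps [simp]:
  "carrier (regular_module R) = carrier R" "\<zero>\<^bsub>regular_module R\<^esub> = \<zero>\<^bsub>R\<^esub>"
  "x \<oplus>\<^bsub>regular_module R\<^esub> y = x \<oplus>\<^bsub>R\<^esub> y" "a \<odot>\<^bsub>regular_module R\<^esub> x = x \<otimes>\<^bsub>R\<^esub> a"
  by (simp_all add: regular_module_def)

lemma orbit_hom:
  assumes "right_module R M" "x \<in> carrier M"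
  shows "(\<lambda>r. r \<odot>\<^bsub>M\<^esub> x) \<in> right_module_hom R (regular_module R) M"
proof -
  interpret M: right_module R M by fact
  show ?thesis using assms(2) by (intro right_module_homI) (auto simp: M.smult_l_distr M.smult_assoc)
qed

lemma submodule_Union_chain:
  assumes M: "right_module R M" and C: "subset.chain UNIV C" "C \<noteq> {}" "\<And>H. H \<in> C \<Longrightarrow> submodule H R M"
  shows "submodule (\<Union>C) R M"
proof -
  interpret M: right_module R M by fact
  note E = M.right_submoduleE[OF C(3)]
  show ?thesis
  proof (rule M.right_submoduleI)
    fix x y assume "x \<in> \<Union>C" "y \<in> \<Union>C"
    then obtain H K where *: "H \<in> C" "x \<in> H" "K \<in> C" "y \<in> K" by blast
    then have "H \<subseteq> K \<or> K \<subseteq> H" using C(1) unfolding subset_chain_def by blast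
    then show "x \<oplus>\<^bsub>M\<^esub> y \<in> \<Union>C" using * E(3) by blast
  next
    obtain H where "H \<in> C" using C(2) by blast
    then show "\<zero>\<^bsub>M\<^esub> \<in> \<Union>C" using E(2)[of H] by blast
    show "\<Union>C \<subseteq> carrier M" using E(1) by (rule Union_least)
  next
    fix a x assume "a \<in> carrier R" "x \<in> \<Union>C"
    then show "a \<odot>\<^bsub>M\<^esub> x \<in> \<Union>C" using E(4) by (elim UnionE) (rule UnionI)
  qed
qed

text \<open>
  By Zorn's lemma. With \<open>Z\<close> a single element this yields maximal submodules; with \<open>Z\<close> the pairs
  \<open>(0, y)\<close>, \<open>y \<noteq> 0\<close>, in a direct sum it yields maximal graphs of partial homomorphisms.
\<close>

lemma ex_maximal_submodule_avoiding:
  assumes M: "right_module R M" and N: "submodule N R M" and NZ: "N \<inter> Z = {}"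
  obtains L where "submodule L R M" "N \<subseteq> L" "L \<inter> Z = {}"
    "\<And>K. submodule K R M \<Longrightarrow> L \<subset> K \<Longrightarrow> K \<inter> Z \<noteq> {}"
proof -
  let ?F = "{L. submodule L R M \<and> N \<subseteq> L \<and> L \<inter> Z = {}}"
  have "\<Union>C \<in> ?F" if C: "C \<noteq> {}" "subset.chain ?F C" for C
  proof -
    have C': "\<And>H. H \<in> C \<Longrightarrow> H \<in> ?F" "subset.chain UNIV C"
      using C(2) unfolding subset_chain_def by (simp_all add: subset_iff)
    have "submodule (\<Union>C) R M" by (rule submodule_Union_chain[OF M C'(2) C(1)]) (use C'(1) in simp)
    then show ?thesis using C'(1) C(1) by auto
  qed
  moreover have "?F \<noteq> {}" using N NZ by blast
  ultimately obtain L where "L \<in> ?F" "\<forall>X\<in>?F. L \<subseteq> X \<longrightarrow> X = L"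
    using subset_Zorn_nonempty[of ?F] by blast
  then show thesis by (intro that[of L]) auto
qed

text \<open>
  The quotient is carried by chosen coset representatives, so that it lives on the same type as
  the module itself and the quotients of a module in \<open>mod_cat\<close> are again in \<open>mod_cat\<close>.
\<close>

lemma ex_quotient:
  fixes M :: "('a, 'm) module"
  assumes M: "right_module R M" and H: "submodule H R M"
  obtains C :: "('a, 'm) module" and g where "right_module R C" "g \<in> right_module_hom R M C"
    "g ` carrier M = carrier C" "a_kernel M C g = H"
proof -
  interpret M: right_module R M by fact
  note HE = M.right_submoduleE[OF H]
  have Hc: "y \<in> carrier M" if "y \<in> H" for y using HE(1) that by blast
  define D where "D x = {y \<in> carrier M. y \<ominus>\<^bsub>M\<^esub> x \<in> H}" for x
  have diff: "(z \<ominus>\<^bsub>M\<^esub> y) \<oplus>\<^bsub>M\<^esub> (y \<ominus>\<^bsub>M\<^esub> x) = z \<ominus>\<^bsub>M\<^esub> x" and diff_neg: "\<ominus>\<^bsub>M\<^esub> (y \<ominus>\<^bsub>M\<^esub> x) = x \<ominus>\<^bsub>M\<^esub> y"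
    if "x \<in> carrier M" "y \<in> carrier M" "z \<in> carrier M" for x y z
    using that by (simp add: a_minus_def M.M.a_assoc M.M.r_neg1, simp add: a_minus_def M.M.minus_add M.M.a_comm)
  have D_add: "D x = D y" if "x \<in> carrier M" "y \<in> carrier M" "y \<ominus>\<^bsub>M\<^esub> x \<in> H" for x y
  proof -
    have "z \<ominus>\<^bsub>M\<^esub> x = (z \<ominus>\<^bsub>M\<^esub> y) \<oplus>\<^bsub>M\<^esub> (y \<ominus>\<^bsub>M\<^esub> x)"
      "z \<ominus>\<^bsub>M\<^esub> y = (z \<ominus>\<^bsub>M\<^esub> x) \<oplus>\<^bsub>M\<^esub> \<ominus>\<^bsub>M\<^esub> (y \<ominus>\<^bsub>M\<^esub> x)" if "z \<in> carrier M" for z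
      using that \<open>x \<in> carrier M\<close> \<open>y \<in> carrier M\<close> by (simp_all add: diff diff_neg)
    then show ?thesis unfolding D_def using that(3) HE(3,5) by auto metis+
  qed
  define rep where "rep x = (SOME y. y \<in> D x)" for x
  have self: "x \<in> D x" if "x \<in> carrier M" for x
    using that HE(2) unfolding D_def by (simp add: a_minus_def M.M.r_neg)
  have rep: "rep x \<in> carrier M" "rep x \<ominus>\<^bsub>M\<^esub> x \<in> H" if "x \<in> carrier M" for x
    using someI[of "\<lambda>y. y \<in> D x", OF self[OF that]] unfolding rep_def D_def by auto
  have rep_eq: "rep x = rep y" if "x \<in> carrier M" "y \<in> carrier M" "y \<ominus>\<^bsub>M\<^esub> x \<in> H" for x y
    using D_add[OF that] unfolding rep_def by simp
  have rep_eqD: "y \<ominus>\<^bsub>M\<^esub> x \<in> H" if "x \<in> carrier M" "y \<in> carrier M" "rep x = rep y" for x y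
  proof -
    have "y \<ominus>\<^bsub>M\<^esub> x = (rep x \<ominus>\<^bsub>M\<^esub> x) \<oplus>\<^bsub>M\<^esub> \<ominus>\<^bsub>M\<^esub> (rep y \<ominus>\<^bsub>M\<^esub> y)"
      using that(1,2) rep(1)[OF that(2)] unfolding that(3)
      by (simp add: diff_neg diff M.M.a_comm[of "rep y \<ominus>\<^bsub>M\<^esub> x"])
    then show ?thesis using rep(2)[OF that(1)] rep(2)[OF that(2)] HE(3,5) by simp
  qed
  have rr: "rep (rep x) = rep x" if "x \<in> carrier M" for x
    using rep_eq[OF that rep(1)[OF that] rep(2)[OF that]] by simp
  have ra: "rep (rep x \<oplus>\<^bsub>M\<^esub> y) = rep (x \<oplus>\<^bsub>M\<^esub> y)" if "x \<in> carrier M" "y \<in> carrier M" for x y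
  proof (rule rep_eq[symmetric])
    have "rep x \<oplus>\<^bsub>M\<^esub> y \<ominus>\<^bsub>M\<^esub> (x \<oplus>\<^bsub>M\<^esub> y) = (rep x \<ominus>\<^bsub>M\<^esub> x) \<oplus>\<^bsub>M\<^esub> (y \<ominus>\<^bsub>M\<^esub> y)"
      using that rep(1) by (simp add: a_minus_def M.M.minus_add M.M.a_ac)
    then have "rep x \<oplus>\<^bsub>M\<^esub> y \<ominus>\<^bsub>M\<^esub> (x \<oplus>\<^bsub>M\<^esub> y) = rep x \<ominus>\<^bsub>M\<^esub> x"
      using that rep(1) by (simp add: a_minus_def M.M.r_neg)
    then show "rep x \<oplus>\<^bsub>M\<^esub> y \<ominus>\<^bsub>M\<^esub> (x \<oplus>\<^bsub>M\<^esub> y) \<in> H" using rep(2)[OF that(1)] by simp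
  qed (use that rep(1) in auto)
  have rb: "rep (y \<oplus>\<^bsub>M\<^esub> rep x) = rep (y \<oplus>\<^bsub>M\<^esub> x)" if "x \<in> carrier M" "y \<in> carrier M" for x y
    using ra[OF that] that rep(1) by (simp add: M.M.a_comm)
  have rs: "rep (a \<odot>\<^bsub>M\<^esub> rep x) = rep (a \<odot>\<^bsub>M\<^esub> x)" if "a \<in> carrier R" "x \<in> carrier M" for a x
  proof (rule rep_eq[symmetric])
    have "a \<odot>\<^bsub>M\<^esub> (\<ominus>\<^bsub>M\<^esub> x) = \<ominus>\<^bsub>M\<^esub> (a \<odot>\<^bsub>M\<^esub> x)"
    proof (rule M.M.minus_equality[symmetric])
      show "a \<odot>\<^bsub>M\<^esub> (\<ominus>\<^bsub>M\<^esub> x) \<oplus>\<^bsub>M\<^esub> a \<odot>\<^bsub>M\<^esub> x = \<zero>\<^bsub>M\<^esub>"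
        using that by (simp flip: M.smult_r_distr add: M.M.l_neg)
    qed (use that in auto)
    then have "a \<odot>\<^bsub>M\<^esub> rep x \<ominus>\<^bsub>M\<^esub> a \<odot>\<^bsub>M\<^esub> x = a \<odot>\<^bsub>M\<^esub> (rep x \<ominus>\<^bsub>M\<^esub> x)"
      using that rep(1) by (simp add: a_minus_def M.smult_r_distr)
    then show "a \<odot>\<^bsub>M\<^esub> rep x \<ominus>\<^bsub>M\<^esub> a \<odot>\<^bsub>M\<^esub> x \<in> H" using rep(2)[OF that(2)] HE(4) that(1) by simp
  qed (use that rep(1) in auto)
  have rsa: "rep (a \<odot>\<^bsub>M\<^esub> rep x \<oplus>\<^bsub>M\<^esub> b \<odot>\<^bsub>M\<^esub> rep x) = rep (a \<odot>\<^bsub>M\<^esub> x \<oplus>\<^bsub>M\<^esub> b \<odot>\<^bsub>M\<^esub> x)"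
    "rep (b \<odot>\<^bsub>M\<^esub> (a \<odot>\<^bsub>M\<^esub> rep x)) = rep (b \<odot>\<^bsub>M\<^esub> (a \<odot>\<^bsub>M\<^esub> x))"
    if "a \<in> carrier R" "b \<in> carrier R" "x \<in> carrier M" for a b x
    using that ra[of "a \<odot>\<^bsub>M\<^esub> rep x" "rep (b \<odot>\<^bsub>M\<^esub> rep x)"] rb[of "b \<odot>\<^bsub>M\<^esub> rep x" "a \<odot>\<^bsub>M\<^esub> rep x"]
      ra[of "a \<odot>\<^bsub>M\<^esub> x" "rep (b \<odot>\<^bsub>M\<^esub> x)"] rb[of "b \<odot>\<^bsub>M\<^esub> x" "a \<odot>\<^bsub>M\<^esub> x"]
      rs[of b "a \<odot>\<^bsub>M\<^esub> rep x"] rs[of b "a \<odot>\<^bsub>M\<^esub> x"] rs[of a x] rs[of b x] rep(1)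
    by simp_all
  let ?C = "\<lparr>carrier = rep ` carrier M, monoid.mult = undefined, one = undefined,
    ring.zero = rep \<zero>\<^bsub>M\<^esub>, ring.add = (\<lambda>x y. rep (x \<oplus>\<^bsub>M\<^esub> y)),
    smult = (\<lambda>a x. rep (a \<odot>\<^bsub>M\<^esub> x))\<rparr> :: ('a, 'm) module"
  have "abelian_group ?C"
  proof (rule abelian_groupI)
    fix x y assume "x \<in> carrier ?C" "y \<in> carrier ?C"
    then show "x \<oplus>\<^bsub>?C\<^esub> y = y \<oplus>\<^bsub>?C\<^esub> x" by (auto simp: rep(1) M.M.a_comm)
  next
    fix x assume "x \<in> carrier ?C"
    then obtain u where u: "u \<in> carrier M" "x = rep u" by auto
    then show "\<exists>y\<in>carrier ?C. y \<oplus>\<^bsub>?C\<^esub> x = \<zero>\<^bsub>?C\<^esub>"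
      by (intro bexI[of _ "rep (\<ominus>\<^bsub>M\<^esub> u)"]) (auto simp: rep(1) ra rb M.M.l_neg)
  qed (auto simp: rep(1) ra rb rr M.M.a_assoc)
  then have 1: "right_module R ?C"
    unfolding right_module_def right_module_axioms_def
    by (auto simp: rep(1) ra rb rs rsa rr M.smult_l_distr M.smult_r_distr M.smult_assoc M.R.ring_axioms)
  have 2: "rep \<in> right_module_hom R M ?C"
    by (rule right_module_homI) (auto simp: ra rb rs rep(1))
  have 3: "rep ` carrier M = carrier ?C" by simp
  have 4: "a_kernel M ?C rep = H"
  proof -
    have "rep x = rep \<zero>\<^bsub>M\<^esub> \<longleftrightarrow> x \<in> H" if "x \<in> carrier M" for x
    proof -
      have "x \<ominus>\<^bsub>M\<^esub> \<zero>\<^bsub>M\<^esub> = x" using that by (simp add: a_minus_def)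
      then show ?thesis using rep_eqD[of "\<zero>\<^bsub>M\<^esub>" x] rep_eq[of "\<zero>\<^bsub>M\<^esub>" x] that by auto
    qed
    then show ?thesis using Hc by (auto simp: a_kernel_def')
  qed
  show thesis by (rule that[OF 1 2 3 4])
qed

section \<open>Isomorphisms, direct sums and splittings\<close>

lemma module_isomorphicI:
  assumes "f \<in> right_module_hom R M N" "inj_on f (carrier M)" "f ` carrier M = carrier N"
  shows "module_isomorphic R M N"
  using assms unfolding module_isomorphic_def bij_betw_def by blast

lemma module_isomorphicE:
  assumes "module_isomorphic R M N"
  obtains f where "f \<in> right_module_hom R M N" "inj_on f (carrier M)" "f ` carrier M = carrier N"
  using assms unfolding module_isomorphic_def bij_betw_def by blast

lemma module_isomorphic_refl: "module_isomorphic R M M"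
  by (rule module_isomorphicI[OF right_module_hom_id]) auto

lemma module_isomorphic_sym:
  assumes "right_module R M" "module_isomorphic R M N"
  shows "module_isomorphic R N M"
proof -
  obtain f where f: "f \<in> right_module_hom R M N" "bij_betw f (carrier M) (carrier N)"
    using assms(2) unfolding module_isomorphic_def by blast
  show ?thesis unfolding module_isomorphic_def
    using bij_betw_inv_into[OF f(2)] right_module_hom_inv[OF f(1) assms(1) f(2)] by blast
qed

lemma module_isomorphic_trans:
  assumes "module_isomorphic R L M" "module_isomorphic R M N"
  shows "module_isomorphic R L N"
proof -
  obtain f where f: "f \<in> right_module_hom R L M" "bij_betw f (carrier L) (carrier M)"
    using assms(1) unfolding module_isomorphic_def by blast
  obtain g where g: "g \<in> right_module_hom R M N" "bij_betw g (carrier M) (carrier N)"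
    using assms(2) unfolding module_isomorphic_def by blast
  show ?thesis unfolding module_isomorphic_def
    using bij_betw_trans[OF f(2) g(2)] by (intro bexI[OF _ right_module_hom_comp[OF f(1) g(1)]]) (simp add: comp_def)
qed

lemma inj_on_hom_iff:
  assumes M: "right_module R M" and N: "right_module R N" and f: "f \<in> right_module_hom R M N"
  shows "inj_on f (carrier M) \<longleftrightarrow> (\<forall>x\<in>carrier M. f x = \<zero>\<^bsub>N\<^esub> \<longrightarrow> x = \<zero>\<^bsub>M\<^esub>)"
proof -
  interpret M: right_module R M by fact
  interpret N: right_module R N by fact
  have f0: "f \<zero>\<^bsub>M\<^esub> = \<zero>\<^bsub>N\<^esub>" by (rule right_module_hom_zero[OF M N f])
  show ?thesis
  proof
    assume "inj_on f (carrier M)"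
    then show "\<forall>x\<in>carrier M. f x = \<zero>\<^bsub>N\<^esub> \<longrightarrow> x = \<zero>\<^bsub>M\<^esub>" using f0 by (auto simp: inj_on_def)
  next
    assume *: "\<forall>x\<in>carrier M. f x = \<zero>\<^bsub>N\<^esub> \<longrightarrow> x = \<zero>\<^bsub>M\<^esub>"
    show "inj_on f (carrier M)"
    proof (rule inj_onI)
      fix x y assume xy: "x \<in> carrier M" "y \<in> carrier M" "f x = f y"
      have "f (x \<oplus>\<^bsub>M\<^esub> (\<ominus>\<^bsub>M\<^esub> y)) = \<zero>\<^bsub>N\<^esub>"
        using xy right_module_homD(1)[OF f]
        by (simp add: right_module_homD(2)[OF f] right_module_hom_neg[OF M N f] N.M.r_neg)
      then have "x \<oplus>\<^bsub>M\<^esub> (\<ominus>\<^bsub>M\<^esub> y) = \<zero>\<^bsub>M\<^esub>" using * xy by simp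
      then show "x = y" using xy by (metis M.M.a_inv_closed M.M.minus_equality M.M.minus_minus)
    qed
  qed
qed

lemma zero_module_iso_iff:
  assumes M: "right_module R M" and N: "right_module R N" and "module_isomorphic R M N"
  shows "zero_module M \<longleftrightarrow> zero_module N"
proof -
  obtain f where f: "f \<in> right_module_hom R M N" "inj_on f (carrier M)" "f ` carrier M = carrier N"
    using assms(3) by (rule module_isomorphicE)
  have f0: "f \<zero>\<^bsub>M\<^esub> = \<zero>\<^bsub>N\<^esub>" by (rule right_module_hom_zero[OF M N f(1)])
  interpret M: right_module R M by fact
  have m0: "\<zero>\<^bsub>M\<^esub> \<in> carrier M" by simp
  show ?thesis
  proof
    assume "zero_module M"
    then show "zero_module N" using f(3) f0 unfolding zero_module_def by simp
  next
    assume "zero_module N"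
    then have "f x = f \<zero>\<^bsub>M\<^esub>" if "x \<in> carrier M" for x
      using f(3) f0 that unfolding zero_module_def by (metis imageI singletonD)
    then show "zero_module M" using f(2) m0 unfolding zero_module_def inj_on_def by blast
  qed
qed

lemma direct_sum_simps [simp]:
  "carrier (direct_sum M N) = carrier M \<times> carrier N"
  "\<zero>\<^bsub>direct_sum M N\<^esub> = (\<zero>\<^bsub>M\<^esub>, \<zero>\<^bsub>N\<^esub>)"
  "z \<oplus>\<^bsub>direct_sum M N\<^esub> w = (fst z \<oplus>\<^bsub>M\<^esub> fst w, snd z \<oplus>\<^bsub>N\<^esub> snd w)"
  "a \<odot>\<^bsub>direct_sum M N\<^esub> z = (a \<odot>\<^bsub>M\<^esub> fst z, a \<odot>\<^bsub>N\<^esub> snd z)"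
  by (simp_all add: direct_sum_def case_prod_beta)

lemma direct_sum_carrier_update:
  "(direct_sum M N)\<lparr>carrier := H \<times> K\<rparr> = direct_sum (M\<lparr>carrier := H\<rparr>) (N\<lparr>carrier := K\<rparr>)"
  by (simp add: direct_sum_def)

lemma hom_fst: "fst \<in> right_module_hom R (direct_sum M N) M"
  by (rule right_module_homI) auto

lemma hom_snd: "snd \<in> right_module_hom R (direct_sum M N) N"
  by (rule right_module_homI) auto

lemma hom_pair:
  assumes "f \<in> right_module_hom R L M" "g \<in> right_module_hom R L N"
  shows "(\<lambda>x. (f x, g x)) \<in> right_module_hom R L (direct_sum M N)"
  using right_module_homD[OF assms(1)] right_module_homD[OF assms(2)] by (intro right_module_homI) auto

lemma hom_inl:
  assumes "right_module R N" shows "(\<lambda>x. (x, \<zero>\<^bsub>N\<^esub>)) \<in> right_module_hom R M (direct_sum M N)"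
  by (rule hom_pair[OF right_module_hom_id right_module_hom_const_zero[OF assms]])

lemma hom_inr:
  assumes "right_module R M" shows "(\<lambda>x. (\<zero>\<^bsub>M\<^esub>, x)) \<in> right_module_hom R N (direct_sum M N)"
  by (rule hom_pair[OF right_module_hom_const_zero[OF assms] right_module_hom_id])

lemma hom_copair:
  assumes "right_module R M" "right_module R N" "right_module R L"
    and "f \<in> right_module_hom R M L" "g \<in> right_module_hom R N L"
  shows "(\<lambda>z. f (fst z) \<oplus>\<^bsub>L\<^esub> g (snd z)) \<in> right_module_hom R (direct_sum M N) L"
  by (rule right_module_hom_add[OF right_module_direct_sum[OF assms(1,2)] assms(3)
      right_module_hom_comp[OF hom_fst assms(4)] right_module_hom_comp[OF hom_snd assms(5)]])

lemma hom_map_prod: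
  assumes "f \<in> right_module_hom R M M'" "g \<in> right_module_hom R N N'"
  shows "map_prod f g \<in> right_module_hom R (direct_sum M N) (direct_sum M' N')"
  using hom_pair[OF right_module_hom_comp[OF hom_fst assms(1)] right_module_hom_comp[OF hom_snd assms(2)]]
  by (simp add: map_prod_def case_prod_beta')

lemma module_isomorphic_direct_sum_cong:
  assumes "module_isomorphic R M M'" "module_isomorphic R N N'"
  shows "module_isomorphic R (direct_sum M N) (direct_sum M' N')"
proof -
  obtain f where f: "f \<in> right_module_hom R M M'" "inj_on f (carrier M)" "f ` carrier M = carrier M'"
    using assms(1) by (rule module_isomorphicE)
  obtain g where g: "g \<in> right_module_hom R N N'" "inj_on g (carrier N)" "g ` carrier N = carrier N'"
    using assms(2) by (rule module_isomorphicE)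
  show ?thesis
    using f(2,3) g(2,3)
    by (intro module_isomorphicI[OF hom_map_prod[OF f(1) g(1)]]) (simp_all add: map_prod_inj_on map_prod_surj_on)
qed

lemma module_isomorphic_direct_sum_comm:
  "module_isomorphic R (direct_sum M N) (direct_sum N M)"
  by (rule module_isomorphicI[OF hom_pair[OF hom_snd hom_fst]]) (auto simp: inj_on_def image_iff)

lemma module_isomorphic_direct_sum_zero:
  assumes "zero_module Z"
  shows "module_isomorphic R (direct_sum M Z) M"
  by (rule module_isomorphicI[OF hom_fst]) (use assms in \<open>auto simp: inj_on_def zero_module_def\<close>)

text \<open>An element \<open>b\<close> is the sum of \<open>b - s (g b)\<close>, which lies in the kernel, and \<open>s (g b)\<close>.\<close>

lemma split_epi:
  assumes B: "right_module R B" and C: "right_module R C" and g: "g \<in> right_module_hom R B C"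
    and s: "s \<in> right_module_hom R C B" and gs: "\<And>c. c \<in> carrier C \<Longrightarrow> g (s c) = c"
  shows "module_isomorphic R B (direct_sum (B\<lparr>carrier := a_kernel B C g\<rparr>) C)"
proof -
  interpret B: right_module R B by fact
  interpret C: right_module R C by fact
  note sub = submodule_a_kernel[OF B C g]
  let ?K = "B\<lparr>carrier := a_kernel B C g\<rparr>"
  have K: "right_module R ?K" by (rule B.right_module_submodule[OF sub])
  have incl: "(\<lambda>x. x) \<in> right_module_hom R ?K B"
    by (rule right_module_homI) (auto simp: a_kernel_iff)
  note hom = hom_copair[OF K C B incl s]
  note sC = right_module_homD(1)[OF s] and gC = right_module_homD(1)[OF g]
  have iso: "module_isomorphic R (direct_sum ?K C) B"
  proof (rule module_isomorphicI[OF hom])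
    have "snd z = \<zero>\<^bsub>C\<^esub> \<and> fst z = \<zero>\<^bsub>B\<^esub>"
      if z: "z \<in> carrier (direct_sum ?K C)" "fst z \<oplus>\<^bsub>B\<^esub> s (snd z) = \<zero>\<^bsub>B\<^esub>" for z
    proof -
      have zc: "fst z \<in> carrier B" "g (fst z) = \<zero>\<^bsub>C\<^esub>" "snd z \<in> carrier C"
        using z(1) by (auto simp: a_kernel_iff)
      have "g (fst z \<oplus>\<^bsub>B\<^esub> s (snd z)) = snd z"
        using zc by (simp add: right_module_homD(2)[OF g] sC gs)
      then have "snd z = \<zero>\<^bsub>C\<^esub>" using z(2) right_module_hom_zero[OF B C g] by simp
      then show ?thesis using z(2) right_module_hom_zero[OF C B s] zc by simp
    qed
    then show "inj_on (\<lambda>z. fst z \<oplus>\<^bsub>B\<^esub> s (snd z)) (carrier (direct_sum ?K C))"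
      by (subst inj_on_hom_iff[OF right_module_direct_sum[OF K C] B hom]) (auto simp: prod_eq_iff)
  next
    show "(\<lambda>z. fst z \<oplus>\<^bsub>B\<^esub> s (snd z)) ` carrier (direct_sum ?K C) = carrier B"
    proof
      show "(\<lambda>z. fst z \<oplus>\<^bsub>B\<^esub> s (snd z)) ` carrier (direct_sum ?K C) \<subseteq> carrier B"
        using sC by (auto simp: a_kernel_iff)
    next
      show "carrier B \<subseteq> (\<lambda>z. fst z \<oplus>\<^bsub>B\<^esub> s (snd z)) ` carrier (direct_sum ?K C)"
      proof
        fix b assume b: "b \<in> carrier B"
        let ?k = "b \<oplus>\<^bsub>B\<^esub> \<ominus>\<^bsub>B\<^esub> s (g b)"
        have "g ?k = \<zero>\<^bsub>C\<^esub>"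
          using b by (simp add: right_module_homD(2)[OF g] right_module_hom_neg[OF B C g] sC gC gs C.M.r_neg)
        then have "(?k, g b) \<in> carrier (direct_sum ?K C)" using b by (simp add: a_kernel_iff sC gC)
        moreover have "b = ?k \<oplus>\<^bsub>B\<^esub> s (g b)" using b by (simp add: B.M.a_assoc sC gC B.M.l_neg)
        ultimately show "b \<in> (\<lambda>z. fst z \<oplus>\<^bsub>B\<^esub> s (snd z)) ` carrier (direct_sum ?K C)"
          by (intro image_eqI[of _ _ "(?k, g b)"]) simp_all
      qed
    qed
  qed
  show ?thesis by (rule module_isomorphic_sym[OF right_module_direct_sum[OF K C] iso])
qed

text \<open>The isomorphism sends \<open>b\<close> to \<open>(g b, r b)\<close>.\<close>

lemma split_mono:
  assumes A: "right_module R A" and B: "right_module R B" and C: "right_module R C"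
    and i: "i \<in> right_module_hom R A B" and g: "g \<in> right_module_hom R B C"
    and surj: "g ` carrier B = carrier C" and ker: "a_kernel B C g = i ` carrier A"
    and r: "r \<in> right_module_hom R B A" and ri: "\<And>a. a \<in> carrier A \<Longrightarrow> r (i a) = a"
  shows "module_isomorphic R B (direct_sum C A)"
proof (rule module_isomorphicI[OF hom_pair[OF g r]])
  interpret A: right_module R A by fact
  interpret B: right_module R B by fact
  interpret C: right_module R C by fact
  note hom = hom_pair[OF g r]
  note iB = right_module_homD(1)[OF i] and rA = right_module_homD(1)[OF r]
  have gi: "g (i a) = \<zero>\<^bsub>C\<^esub>" if "a \<in> carrier A" for a
    using that ker by (metis a_kernel_iff imageI)
  have "x = \<zero>\<^bsub>B\<^esub>" if x: "x \<in> carrier B" "g x = \<zero>\<^bsub>C\<^esub>" "r x = \<zero>\<^bsub>A\<^esub>" for x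
  proof -
    have "x \<in> i ` carrier A" using x ker by (metis a_kernel_iff)
    then obtain a where "a \<in> carrier A" "x = i a" by blast
    then show ?thesis using ri x(3) right_module_hom_zero[OF A B i] by simp
  qed
  then show "inj_on (\<lambda>x. (g x, r x)) (carrier B)"
    by (subst inj_on_hom_iff[OF B right_module_direct_sum[OF C A] hom]) auto
  show "(\<lambda>x. (g x, r x)) ` carrier B = carrier (direct_sum C A)"
  proof
    show "(\<lambda>x. (g x, r x)) ` carrier B \<subseteq> carrier (direct_sum C A)"
      using right_module_homD(1)[OF hom] by blast
    show "carrier (direct_sum C A) \<subseteq> (\<lambda>x. (g x, r x)) ` carrier B"
    proof
      fix z assume z: "z \<in> carrier (direct_sum C A)"
      then obtain b where b: "b \<in> carrier B" "g b = fst z" 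
      proof -
        have "fst z \<in> g ` carrier B" using z surj by auto
        then show thesis using that by (metis imageE)
      qed
      let ?a = "snd z \<oplus>\<^bsub>A\<^esub> \<ominus>\<^bsub>A\<^esub> r b"
      let ?x = "b \<oplus>\<^bsub>B\<^esub> i ?a"
      have a: "?a \<in> carrier A" using z b rA by auto
      have zc: "snd z \<in> carrier A" "fst z \<in> carrier C" using z by auto
      have "g ?x = fst z" using a b zc by (simp add: right_module_homD(2)[OF g] iB gi)
      moreover have "r ?x = r b \<oplus>\<^bsub>A\<^esub> ?a" using a b by (simp add: right_module_homD(2)[OF r] iB ri)
      then have "r ?x = snd z" using zc rA[OF b(1)] by (simp add: A.M.a_lcomm A.M.r_neg)
      ultimately have "z = (g ?x, r ?x)" by (simp add: prod_eq_iff)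
      then show "z \<in> (\<lambda>x. (g x, r x)) ` carrier B" using b(1) iB[OF a] by blast
    qed
  qed
qed

section \<open>Projective and injective modules\<close>

lemma projective_moduleD: "projective_module R P \<Longrightarrow> right_module R P"
  unfolding projective_module_def by blast

lemma injective_moduleD: "injective_module R E \<Longrightarrow> right_module R E"
  unfolding injective_module_def by blast

text \<open>
  The lift of a map on \<open>P\<close> is the lift of its composite with the retraction, restricted to \<open>P\<close>;
  dually for injective modules.
\<close>

lemma projective_retract:
  assumes Q: "projective_module R Q" and P: "right_module R P"
    and i: "i \<in> right_module_hom R P Q" and r: "r \<in> right_module_hom R Q P"
    and ri: "\<And>x. x \<in> carrier P \<Longrightarrow> r (i x) = x"
  shows "projective_module R P"
  unfolding projective_module_def
proof (intro conjI P allI impI ballI)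
  fix M N :: "('a, 'a list) module" and g f
  assume MN: "right_module R M \<and> right_module R N" and g: "g \<in> right_module_hom R M N"
    and f: "f \<in> right_module_hom R P N" and surj: "g ` carrier M = carrier N"
  obtain h where h: "h \<in> right_module_hom R Q M" "\<And>x. x \<in> carrier Q \<Longrightarrow> g (h x) = f (r x)"
    using Q[unfolded projective_module_def, THEN conjunct2, rule_format, OF MN g right_module_hom_comp[OF r f] surj]
    by blast
  show "\<exists>h\<in>right_module_hom R P M. \<forall>x\<in>carrier P. g (h x) = f x"
    by (rule bexI[OF _ right_module_hom_comp[OF i h(1)]]) (simp add: h(2) ri right_module_homD(1)[OF i])
qed

lemma injective_retract:
  assumes Q: "injective_module R Q" and P: "right_module R P"
    and i: "i \<in> right_module_hom R P Q" and r: "r \<in> right_module_hom R Q P"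
    and ri: "\<And>x. x \<in> carrier P \<Longrightarrow> r (i x) = x"
  shows "injective_module R P"
  unfolding injective_module_def
proof (intro conjI P allI impI ballI)
  fix M N :: "('a, 'a list) module" and j f
  assume MN: "right_module R M \<and> right_module R N" and j: "j \<in> right_module_hom R M N"
    and f: "f \<in> right_module_hom R M P" and inj: "inj_on j (carrier M)"
  obtain h where h: "h \<in> right_module_hom R N Q" "\<And>x. x \<in> carrier M \<Longrightarrow> h (j x) = i (f x)"
    using Q[unfolded injective_module_def, THEN conjunct2, rule_format, OF MN j right_module_hom_comp[OF f i] inj]
    by blast
  show "\<exists>h\<in>right_module_hom R N P. \<forall>x\<in>carrier M. h (j x) = f x"
    by (rule bexI[OF _ right_module_hom_comp[OF h(1) r]]) (simp add: h(2) ri right_module_homD(1)[OF f])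
qed

lemma projective_module_iso:
  assumes P: "projective_module R P" and Q: "right_module R Q" and iso: "module_isomorphic R P Q"
  shows "projective_module R Q"
proof -
  obtain f where f: "f \<in> right_module_hom R P Q" "bij_betw f (carrier P) (carrier Q)"
    using iso unfolding module_isomorphic_def by blast
  show ?thesis
    by (rule projective_retract[OF P Q right_module_hom_inv[OF f(1) projective_moduleD[OF P] f(2)] f(1)])
      (use f(2) in \<open>simp add: bij_betw_inv_into_right\<close>)
qed

lemma injective_module_iso:
  assumes P: "injective_module R P" and Q: "right_module R Q" and iso: "module_isomorphic R P Q"
  shows "injective_module R Q"
proof -
  obtain f where f: "f \<in> right_module_hom R P Q" "bij_betw f (carrier P) (carrier Q)"
    using iso unfolding module_isomorphic_def by blast
  show ?thesis
    by (rule injective_retract[OF P Q right_module_hom_inv[OF f(1) injective_moduleD[OF P] f(2)] f(1)])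
      (use f(2) in \<open>simp add: bij_betw_inv_into_right\<close>)
qed

lemma projective_direct_sum:
  assumes P: "projective_module R P" and Q: "projective_module R Q"
  shows "projective_module R (direct_sum P Q)"
  unfolding projective_module_def
proof (intro conjI allI impI ballI)
  note P' = projective_moduleD[OF P] and Q' = projective_moduleD[OF Q]
  interpret P: right_module R P by (rule P')
  interpret Q: right_module R Q by (rule Q')
  show "right_module R (direct_sum P Q)" by (rule right_module_direct_sum[OF P' Q'])
  fix M N :: "('a, 'a list) module" and g f
  assume MN: "right_module R M \<and> right_module R N" and g: "g \<in> right_module_hom R M N"
    and f: "f \<in> right_module_hom R (direct_sum P Q) N" and surj: "g ` carrier M = carrier N"
  obtain h where h: "h \<in> right_module_hom R P M" "\<And>x. x \<in> carrier P \<Longrightarrow> g (h x) = f (x, \<zero>\<^bsub>Q\<^esub>)"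
    using P[unfolded projective_module_def, THEN conjunct2, rule_format, OF MN g
        right_module_hom_comp[OF hom_inl[OF Q'] f] surj] by blast
  obtain k where k: "k \<in> right_module_hom R Q M" "\<And>x. x \<in> carrier Q \<Longrightarrow> g (k x) = f (\<zero>\<^bsub>P\<^esub>, x)"
    using Q[unfolded projective_module_def, THEN conjunct2, rule_format, OF MN g
        right_module_hom_comp[OF hom_inr[OF P'] f] surj] by blast
  show "\<exists>h\<in>right_module_hom R (direct_sum P Q) M. \<forall>x\<in>carrier (direct_sum P Q). g (h x) = f x"
  proof (rule bexI[OF _ hom_copair[OF P' Q' conjunct1[OF MN] h(1) k(1)]], rule ballI)
    fix z assume z: "z \<in> carrier (direct_sum P Q)"
    then have "g (h (fst z) \<oplus>\<^bsub>M\<^esub> k (snd z)) = f (fst z, \<zero>\<^bsub>Q\<^esub>) \<oplus>\<^bsub>N\<^esub> f (\<zero>\<^bsub>P\<^esub>, snd z)"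
      by (auto simp: right_module_homD(2)[OF g] h k right_module_homD(1)[OF h(1)] right_module_homD(1)[OF k(1)])
    also have "\<dots> = f ((fst z, \<zero>\<^bsub>Q\<^esub>) \<oplus>\<^bsub>direct_sum P Q\<^esub> (\<zero>\<^bsub>P\<^esub>, snd z))"
      by (rule right_module_homD(2)[OF f, symmetric]) (use z in auto)
    also have "\<dots> = f z" using z by auto
    finally show "g (h (fst z) \<oplus>\<^bsub>M\<^esub> k (snd z)) = f z" .
  qed
qed

lemma injective_direct_sum:
  assumes P: "injective_module R P" and Q: "injective_module R Q"
  shows "injective_module R (direct_sum P Q)"
  unfolding injective_module_def
proof (intro conjI allI impI ballI)
  show "right_module R (direct_sum P Q)"
    by (rule right_module_direct_sum[OF injective_moduleD[OF P] injective_moduleD[OF Q]])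
  fix M N :: "('a, 'a list) module" and j f
  assume MN: "right_module R M \<and> right_module R N" and j: "j \<in> right_module_hom R M N"
    and f: "f \<in> right_module_hom R M (direct_sum P Q)" and inj: "inj_on j (carrier M)"
  obtain h where h: "h \<in> right_module_hom R N P" "\<And>x. x \<in> carrier M \<Longrightarrow> h (j x) = fst (f x)"
    using P[unfolded injective_module_def, THEN conjunct2, rule_format, OF MN j
        right_module_hom_comp[OF f hom_fst] inj] by blast
  obtain k where k: "k \<in> right_module_hom R N Q" "\<And>x. x \<in> carrier M \<Longrightarrow> k (j x) = snd (f x)"
    using Q[unfolded injective_module_def, THEN conjunct2, rule_format, OF MN j
        right_module_hom_comp[OF f hom_snd] inj] by blast
  show "\<exists>h\<in>right_module_hom R N (direct_sum P Q). \<forall>x\<in>carrier M. h (j x) = f x"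
    by (rule bexI[OF _ hom_pair[OF h(1) k(1)]]) (simp add: h k)
qed

lemma projective_regular:
  assumes "ring R"
  shows "projective_module R (regular_module R)"
  unfolding projective_module_def
proof (intro conjI allI impI ballI)
  interpret R: ring R by fact
  show "right_module R (regular_module R)" by (rule right_module_regular[OF assms])
  fix M N :: "('a, 'a list) module" and g f
  assume MN: "right_module R M \<and> right_module R N" and g: "g \<in> right_module_hom R M N"
    and f: "f \<in> right_module_hom R (regular_module R) N" and surj: "g ` carrier M = carrier N"
  have "f \<one>\<^bsub>R\<^esub> \<in> g ` carrier M" using right_module_homD(1)[OF f] surj by simp
  then obtain m where m: "m \<in> carrier M" "g m = f \<one>\<^bsub>R\<^esub>" by auto
  have "g (r \<odot>\<^bsub>M\<^esub> m) = f r" if "r \<in> carrier R" for r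
    using right_module_homD(3)[OF g that m(1)] right_module_homD(3)[OF f that, of "\<one>\<^bsub>R\<^esub>"] m(2) that by simp
  then show "\<exists>h\<in>right_module_hom R (regular_module R) M. \<forall>x\<in>carrier (regular_module R). g (h x) = f x"
    by (intro bexI[OF _ orbit_hom[OF conjunct1[OF MN] m(1)]]) simp
qed

lemma projective_zero_module:
  assumes Z: "right_module R Z" and z: "zero_module Z"
  shows "projective_module R Z"
  unfolding projective_module_def
proof (intro conjI Z allI impI ballI)
  fix M N :: "('a, 'a list) module" and g f
  assume MN: "right_module R M \<and> right_module R N" and g: "g \<in> right_module_hom R M N"
    and f: "f \<in> right_module_hom R Z N"
  show "\<exists>h\<in>right_module_hom R Z M. \<forall>x\<in>carrier Z. g (h x) = f x"
  proof (rule bexI[OF _ right_module_hom_const_zero[OF conjunct1[OF MN]]], rule ballI)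
    fix x assume "x \<in> carrier Z"
    then have "x = \<zero>\<^bsub>Z\<^esub>" using z unfolding zero_module_def by simp
    then show "g \<zero>\<^bsub>M\<^esub> = f x"
      using right_module_hom_zero[OF Z conjunct2[OF MN] f] right_module_hom_zero[OF _ _ g] MN by simp
  qed
qed

section \<open>Schanuel's lemma\<close>

definition pullback :: "('a, 'm) module \<Rightarrow> ('a, 'n) module \<Rightarrow> ('m \<Rightarrow> 'k) \<Rightarrow> ('n \<Rightarrow> 'k) \<Rightarrow> ('a, 'm \<times> 'n) module" where
  "pullback P Q p q = (direct_sum P Q)\<lparr>carrier := {z \<in> carrier P \<times> carrier Q. p (fst z) = q (snd z)}\<rparr>"

lemma right_module_pullback:
  assumes P: "right_module R P" and Q: "right_module R Q" and M: "right_module R M"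
    and p: "p \<in> right_module_hom R P M" and q: "q \<in> right_module_hom R Q M"
  shows "right_module R (pullback P Q p q)"
proof -
  interpret P: right_module R P by fact
  interpret Q: right_module R Q by fact
  interpret D: right_module R "direct_sum P Q" by (rule right_module_direct_sum[OF P Q])
  have "submodule {z \<in> carrier P \<times> carrier Q. p (fst z) = q (snd z)} R (direct_sum P Q)"
    by (rule D.right_submoduleI)
      (auto simp: right_module_hom_zero[OF P M p] right_module_hom_zero[OF Q M q]
        right_module_homD[OF p] right_module_homD[OF q])
  then show ?thesis unfolding pullback_def by (rule D.right_module_submodule)
qed

text \<open>
  The projection of the pullback to the projective module \<open>Q\<close> is surjective and so splits; its
  kernel consists of the pairs \<open>(x, 0)\<close> with \<open>p x = 0\<close>.
\<close>

lemma pullback_split: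
  assumes P: "right_module R P" and Q: "projective_module R Q" "finitely_generated R Q"
    and M: "right_module R M"
    and p: "p \<in> right_module_hom R P M" "p ` carrier P = carrier M" and q: "q \<in> right_module_hom R Q M"
  shows "module_isomorphic R (pullback P Q p q) (direct_sum (P\<lparr>carrier := a_kernel P M p\<rparr>) Q)"
proof -
  note Q' = projective_moduleD[OF Q(1)]
  interpret Q: right_module R Q by fact
  let ?E = "pullback P Q p q"
  have E: "right_module R ?E" by (rule right_module_pullback[OF P Q' M p(1) q])
  have g: "snd \<in> right_module_hom R ?E Q" by (rule right_module_homI) (auto simp: pullback_def)
  have surj: "snd ` carrier ?E = carrier Q"
  proof
    show "carrier Q \<subseteq> snd ` carrier ?E"
    proof
      fix y assume y: "y \<in> carrier Q"
      then have "q y \<in> p ` carrier P" using right_module_homD(1)[OF q] p(2) by simp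
      then obtain x where "x \<in> carrier P" "p x = q y" by auto
      then show "y \<in> snd ` carrier ?E" using y by (intro image_eqI[of _ _ "(x, y)"]) (auto simp: pullback_def)
    qed
  qed (auto simp: pullback_def)
  obtain s where s: "s \<in> right_module_hom R Q ?E" "\<And>y. y \<in> carrier Q \<Longrightarrow> snd (s y) = y"
    using projective_lift[OF Q E Q' g surj right_module_hom_id] by blast
  have 1: "module_isomorphic R ?E (direct_sum (?E\<lparr>carrier := a_kernel ?E Q snd\<rparr>) Q)"
    by (rule split_epi[OF E Q' g s])
  have 2: "module_isomorphic R (?E\<lparr>carrier := a_kernel ?E Q snd\<rparr>) (P\<lparr>carrier := a_kernel P M p\<rparr>)"
  proof (rule module_isomorphicI)
    have q0: "q \<zero>\<^bsub>Q\<^esub> = \<zero>\<^bsub>M\<^esub>" by (rule right_module_hom_zero[OF Q' M q])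
    show "fst \<in> right_module_hom R (?E\<lparr>carrier := a_kernel ?E Q snd\<rparr>) (P\<lparr>carrier := a_kernel P M p\<rparr>)"
      by (rule right_module_homI) (auto simp: pullback_def a_kernel_iff q0)
    show "inj_on fst (carrier (?E\<lparr>carrier := a_kernel ?E Q snd\<rparr>))"
      by (auto simp: inj_on_def a_kernel_iff)
    show "fst ` carrier (?E\<lparr>carrier := a_kernel ?E Q snd\<rparr>) = carrier (P\<lparr>carrier := a_kernel P M p\<rparr>)"
    proof
      show "carrier (P\<lparr>carrier := a_kernel P M p\<rparr>) \<subseteq> fst ` carrier (?E\<lparr>carrier := a_kernel ?E Q snd\<rparr>)"
      proof
        fix x assume "x \<in> carrier (P\<lparr>carrier := a_kernel P M p\<rparr>)"
        then show "x \<in> fst ` carrier (?E\<lparr>carrier := a_kernel ?E Q snd\<rparr>)"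
          by (intro image_eqI[of _ _ "(x, \<zero>\<^bsub>Q\<^esub>)"]) (auto simp: pullback_def a_kernel_iff q0)
      qed
    qed (auto simp: pullback_def a_kernel_iff q0)
  qed
  show ?thesis
    by (rule module_isomorphic_trans[OF 1 module_isomorphic_direct_sum_cong[OF 2 module_isomorphic_refl]])
qed

text \<open>
  The pullback of the two presentations splits in both ways.
\<close>

lemma schanuel:
  assumes P: "projective_module R P" "finitely_generated R P"
    and Q: "projective_module R Q" "finitely_generated R Q"
    and M: "right_module R M"
    and p: "p \<in> right_module_hom R P M" "p ` carrier P = carrier M"
    and q: "q \<in> right_module_hom R Q M" "q ` carrier Q = carrier M"
  shows "module_isomorphic R (direct_sum (P\<lparr>carrier := a_kernel P M p\<rparr>) Q)
    (direct_sum (Q\<lparr>carrier := a_kernel Q M q\<rparr>) P)"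
proof -
  note P' = projective_moduleD[OF P(1)] and Q' = projective_moduleD[OF Q(1)]
  note 1 = pullback_split[OF P' Q M p q(1)] and 2 = pullback_split[OF Q' P M q p(1)]
  have 3: "module_isomorphic R (pullback P Q p q) (pullback Q P q p)"
  proof (rule module_isomorphicI[where f = "\<lambda>z. (snd z, fst z)"])
    show "(\<lambda>z. (snd z, fst z)) \<in> right_module_hom R (pullback P Q p q) (pullback Q P q p)"
      by (rule right_module_homI) (auto simp: pullback_def)
  qed (auto simp: inj_on_def pullback_def image_iff prod_eq_iff)
  show ?thesis
    by (rule module_isomorphic_trans[OF module_isomorphic_sym[OF right_module_pullback[OF P' Q' M p(1) q(1)] 1]
          module_isomorphic_trans[OF 3 2]])
qed

section \<open>Length\<close>

text \<open>
  Chains of submodules of a given length that end in a given submodule: chains grow at the top,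
  and their last term can be followed along homomorphisms.
\<close>

inductive has_chain :: "('a, 'b) ring_scheme \<Rightarrow> ('a, 'm) module \<Rightarrow> nat \<Rightarrow> 'm set \<Rightarrow> bool"
  for R M where
  has_chain_0: "submodule H R M \<Longrightarrow> has_chain R M 0 H"
| has_chain_Suc: "\<lbrakk>has_chain R M n H; H \<subset> K; submodule K R M\<rbrakk> \<Longrightarrow> has_chain R M (Suc n) K"

definition finite_length :: "('a, 'b) ring_scheme \<Rightarrow> ('a, 'm) module \<Rightarrow> bool" where
  "finite_length R M \<longleftrightarrow> (\<exists>n. \<forall>m. has_chain R M m (carrier M) \<longrightarrow> m \<le> n)"

definition mod_length :: "('a, 'b) ring_scheme \<Rightarrow> ('a, 'm) module \<Rightarrow> nat" where
  "mod_length R M = Max {n. has_chain R M n (carrier M)}"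

lemma has_chain_submodule: "has_chain R M n H \<Longrightarrow> submodule H R M"
  by (induction rule: has_chain.induct) auto

lemma has_chain_mono:
  assumes "has_chain R M n H" "H \<subseteq> K" "submodule K R M"
  shows "has_chain R M n K"
  using assms(1)
proof cases
  case has_chain_0
  then show ?thesis using assms(3) by (auto intro: has_chain.has_chain_0)
next
  case (has_chain_Suc m L)
  then have "L \<subset> K" using assms(2) by blast
  then show ?thesis using has_chain.has_chain_Suc[OF has_chain_Suc(2) _ assms(3)] has_chain_Suc(1) by simp
qed

lemma has_chain_top:
  assumes "right_module R M" "has_chain R M n H"
  shows "has_chain R M n (carrier M)"
  by (rule has_chain_mono[OF assms(2) _ submodule_carrier[OF assms(1)]])
    (rule right_module.right_submoduleE(1)[OF assms(1) has_chain_submodule[OF assms(2)]])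

lemma mod_length_eqI:
  assumes "has_chain R M n (carrier M)" "\<And>m. has_chain R M m (carrier M) \<Longrightarrow> m \<le> n"
  shows "finite_length R M" "mod_length R M = n"
proof -
  have "finite {n. has_chain R M n (carrier M)}"
    by (rule finite_subset[of _ "{..n}"]) (use assms(2) in auto)
  then show "mod_length R M = n" unfolding mod_length_def
    by (intro Max_eqI) (use assms in auto)
  show "finite_length R M" unfolding finite_length_def using assms(2) by blast
qed

lemma has_chain_mod_length:
  assumes "right_module R M" "finite_length R M"
  shows "has_chain R M (mod_length R M) (carrier M)"
    and "has_chain R M m H \<Longrightarrow> m \<le> mod_length R M"
proof -
  obtain n where n: "\<And>m. has_chain R M m (carrier M) \<Longrightarrow> m \<le> n"
    using assms(2) unfolding finite_length_def by blast
  let ?S = "{n. has_chain R M n (carrier M)}"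
  have fin: "finite ?S" by (rule finite_subset[of _ "{..n}"]) (use n in auto)
  have "0 \<in> ?S" using has_chain_0[OF submodule_carrier[OF assms(1)]] by simp
  then have "Max ?S \<in> ?S" using fin by (intro Max_in) auto
  then show "has_chain R M (mod_length R M) (carrier M)" unfolding mod_length_def by simp
  show "m \<le> mod_length R M" if "has_chain R M m H"
    unfolding mod_length_def using has_chain_top[OF assms(1) that] fin by (intro Max_ge) auto
qed

lemma has_chain_image:
  assumes M: "right_module R M" and N: "right_module R N"
    and f: "f \<in> right_module_hom R M N" "inj_on f (carrier M)" and c: "has_chain R M n H"
  shows "has_chain R N n (f ` H)"
  using c
proof (induction rule: has_chain.induct)
  case (has_chain_0 H)
  show ?case by (rule has_chain.has_chain_0[OF submodule_image[OF M N f(1) has_chain_0]])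
next
  case (has_chain_Suc n H K)
  have "K \<subseteq> carrier M" by (rule right_module.right_submoduleE(1)[OF M has_chain_Suc(3)])
  then have "f ` H \<subset> f ` K" using f(2) has_chain_Suc(2) by (auto simp: inj_on_def) blast
  then show ?case by (rule has_chain.has_chain_Suc[OF has_chain_Suc.IH _ submodule_image[OF M N f(1) has_chain_Suc(3)]])
qed

lemma length_inj_hom:
  assumes M: "right_module R M" and N: "right_module R N"
    and f: "f \<in> right_module_hom R M N" "inj_on f (carrier M)" and fin: "finite_length R N"
  shows "finite_length R M" "mod_length R M \<le> mod_length R N"
proof -
  have le: "m \<le> mod_length R N" if "has_chain R M m (carrier M)" for m
    by (rule has_chain_mod_length(2)[OF N fin has_chain_image[OF M N f that]])
  then show fM: "finite_length R M" unfolding finite_length_def by blast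
  show "mod_length R M \<le> mod_length R N" by (rule le[OF has_chain_mod_length(1)[OF M fM]])
qed

lemma length_iso:
  assumes M: "right_module R M" and N: "right_module R N" and iso: "module_isomorphic R M N"
  shows "finite_length R M \<longleftrightarrow> finite_length R N" "finite_length R M \<Longrightarrow> mod_length R M = mod_length R N"
proof -
  obtain f where f: "f \<in> right_module_hom R M N" "inj_on f (carrier M)" using iso by (rule module_isomorphicE)
  obtain g where g: "g \<in> right_module_hom R N M" "inj_on g (carrier N)"
    using module_isomorphic_sym[OF M iso] by (rule module_isomorphicE)
  show 1: "finite_length R M \<longleftrightarrow> finite_length R N"
    using length_inj_hom(1)[OF M N f] length_inj_hom(1)[OF N M g] by blast
  show "mod_length R M = mod_length R N" if "finite_length R M"
    using length_inj_hom(2)[OF M N f] length_inj_hom(2)[OF N M g] that 1 by simp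
qed

lemma length_submodule:
  assumes M: "right_module R M" and H: "submodule H R M" and fin: "finite_length R M"
  shows "finite_length R (M\<lparr>carrier := H\<rparr>)" "mod_length R (M\<lparr>carrier := H\<rparr>) \<le> mod_length R M"
    and "mod_length R (M\<lparr>carrier := H\<rparr>) = mod_length R M \<Longrightarrow> H = carrier M"
proof -
  let ?H = "M\<lparr>carrier := H\<rparr>"
  have HM: "H \<subseteq> carrier M" by (rule right_module.right_submoduleE(1)[OF M H])
  have H': "right_module R ?H" by (rule right_module.right_module_submodule[OF M H])
  have i: "(\<lambda>x. x) \<in> right_module_hom R ?H M" "inj_on (\<lambda>x. x) (carrier ?H)"
    using HM by (auto intro!: right_module_homI simp: inj_on_def)
  show fH: "finite_length R ?H" and "mod_length R ?H \<le> mod_length R M"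
    by (rule length_inj_hom[OF H' M i fin])+
  show "H = carrier M" if eq: "mod_length R ?H = mod_length R M"
  proof (rule ccontr)
    assume "H \<noteq> carrier M"
    then have "H \<subset> carrier M" using HM by blast
    moreover have "has_chain R M (mod_length R ?H) H"
      using has_chain_image[OF H' M i has_chain_mod_length(1)[OF H' fH]] by simp
    ultimately have "has_chain R M (Suc (mod_length R ?H)) (carrier M)"
      by (intro has_chain_Suc submodule_carrier[OF M])
    from has_chain_mod_length(2)[OF M fin this] show False using eq by simp
  qed
qed

lemma length_submodule_mono:
  assumes M: "right_module R M" and H: "submodule H R M" and K: "submodule K R M" and "H \<subset> K"
    and fin: "finite_length R M"
  shows "mod_length R (M\<lparr>carrier := H\<rparr>) < mod_length R (M\<lparr>carrier := K\<rparr>)"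
proof -
  have K': "right_module R (M\<lparr>carrier := K\<rparr>)" by (rule right_module.right_module_submodule[OF M K])
  have H': "submodule H R (M\<lparr>carrier := K\<rparr>)" using assms by (simp add: submodule_submodule_iff[OF M K] H)
  show ?thesis
    using length_submodule(2,3)[OF K' H' length_submodule(1)[OF M K fin]] \<open>H \<subset> K\<close> by force
qed

text \<open>
  Subtract from an element of \<open>K\<close> an element of \<open>H\<close> with the same image: the difference lies in
  the kernel. This is what makes length additive.
\<close>

lemma submodule_eqI_quotient:
  assumes B: "right_module R B" and C: "right_module R C" and g: "g \<in> right_module_hom R B C"
    and H: "submodule H R B" and K: "submodule K R B" and HK: "H \<subseteq> K"
    and ker: "K \<inter> a_kernel B C g \<subseteq> H" and img: "g ` K \<subseteq> g ` H"
  shows "H = K"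
proof
  interpret B: right_module R B by fact
  interpret C: right_module R C by fact
  note HE = B.right_submoduleE[OF H] and KE = B.right_submoduleE[OF K]
  show "K \<subseteq> H"
  proof
    fix k assume k: "k \<in> K"
    then obtain h where h: "h \<in> H" "g k = g h" using img by blast
    have c: "k \<in> carrier B" "h \<in> carrier B" using k h(1) KE(1) HE(1) by auto
    have "k \<oplus>\<^bsub>B\<^esub> \<ominus>\<^bsub>B\<^esub> h \<in> K" using k h(1) HK KE(3,5) by blast
    moreover have "g (k \<oplus>\<^bsub>B\<^esub> \<ominus>\<^bsub>B\<^esub> h) = \<zero>\<^bsub>C\<^esub>"
      using c h(2) right_module_homD(1)[OF g]
      by (simp add: right_module_homD(2)[OF g] right_module_hom_neg[OF B C g] C.M.r_neg)
    ultimately have "k \<oplus>\<^bsub>B\<^esub> \<ominus>\<^bsub>B\<^esub> h \<in> H" using ker c by (auto simp: a_kernel_iff)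
    then have "(k \<oplus>\<^bsub>B\<^esub> \<ominus>\<^bsub>B\<^esub> h) \<oplus>\<^bsub>B\<^esub> h \<in> H" using HE(3) h(1) by simp
    then show "k \<in> H" using c by (simp add: B.M.a_assoc B.M.l_neg)
  qed
qed (rule HK)

text \<open>
  A strict step in \<open>B\<close> is strict after intersecting with the kernel or after mapping to \<open>C\<close>.
\<close>

lemma has_chain_extension_le:
  assumes B: "right_module R B" and C: "right_module R C" and g: "g \<in> right_module_hom R B C"
    and c: "has_chain R B n H"
  shows "\<exists>p q. n \<le> p + q \<and> has_chain R (B\<lparr>carrier := a_kernel B C g\<rparr>) p (H \<inter> a_kernel B C g) \<and>
    has_chain R C q (g ` H)"
  using c
proof (induction rule: has_chain.induct)
  case (has_chain_0 H)
  interpret B: right_module R B by fact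
  note sub = submodule_a_kernel[OF B C g]
  have "submodule (H \<inter> a_kernel B C g) R B"
    using submodule_Inter[OF B, of "{H, a_kernel B C g}"] has_chain_0 sub by auto
  then have "submodule (H \<inter> a_kernel B C g) R (B\<lparr>carrier := a_kernel B C g\<rparr>)"
    by (simp add: submodule_submodule_iff[OF B sub])
  then show ?case
    using has_chain.has_chain_0[OF submodule_image[OF B C g has_chain_0]] has_chain.has_chain_0
    by (intro exI[of _ 0] exI[of _ 0]) auto
next
  case (has_chain_Suc n H K)
  let ?N = "a_kernel B C g"
  note sub = submodule_a_kernel[OF B C g]
  have "submodule (K \<inter> ?N) R B"
    using submodule_Inter[OF B, of "{K, ?N}"] has_chain_Suc(3) sub by auto
  then have s1: "submodule (K \<inter> ?N) R (B\<lparr>carrier := ?N\<rparr>)"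
    by (simp add: submodule_submodule_iff[OF B sub])
  note s2 = submodule_image[OF B C g has_chain_Suc(3)]
  have Hs: "submodule H R B" by (rule has_chain_submodule[OF has_chain_Suc(1)])
  obtain p q where pq: "n \<le> p + q" "has_chain R (B\<lparr>carrier := ?N\<rparr>) p (H \<inter> ?N)" "has_chain R C q (g ` H)"
    using has_chain_Suc.IH by blast
  have sub1: "H \<inter> ?N \<subseteq> K \<inter> ?N" and sub2: "g ` H \<subseteq> g ` K" using has_chain_Suc(2) by auto
  consider "H \<inter> ?N \<subset> K \<inter> ?N" | "g ` H \<subset> g ` K"
    using submodule_eqI_quotient[OF B C g Hs has_chain_Suc(3)] has_chain_Suc(2) sub1 sub2 by blast
  then show ?case
  proof cases
    case 1
    then show ?thesis
      using has_chain.has_chain_Suc[OF pq(2) 1 s1] has_chain_mono[OF pq(3) sub2 s2] pq(1)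
      by (intro exI[of _ "Suc p"] exI[of _ q]) simp
  next
    case 2
    then show ?thesis
      using has_chain.has_chain_Suc[OF pq(3) 2 s2] has_chain_mono[OF pq(2) sub1 s1] pq(1)
      by (intro exI[of _ p] exI[of _ "Suc q"]) simp
  qed
qed

text \<open>
  A chain in the kernel is continued by the preimages of a chain in \<open>C\<close>.
\<close>

lemma has_chain_extension_ge:
  assumes B: "right_module R B" and C: "right_module R C" and g: "g \<in> right_module_hom R B C"
    and surj: "g ` carrier B = carrier C"
    and p: "has_chain R (B\<lparr>carrier := a_kernel B C g\<rparr>) p (a_kernel B C g)" and q: "has_chain R C q G"
  shows "has_chain R B (p + q) {x \<in> carrier B. g x \<in> G}"
  using q
proof (induction rule: has_chain.induct)
  case (has_chain_0 G)
  note sub = submodule_a_kernel[OF B C g]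
  let ?K = "B\<lparr>carrier := a_kernel B C g\<rparr>"
  have K: "right_module R ?K" by (rule right_module.right_module_submodule[OF B sub])
  have i: "(\<lambda>x. x) \<in> right_module_hom R ?K B" "inj_on (\<lambda>x. x) (carrier ?K)"
    by (auto intro!: right_module_homI simp: inj_on_def a_kernel_iff)
  have "\<zero>\<^bsub>C\<^esub> \<in> G" by (rule right_module.right_submoduleE(2)[OF C has_chain_0])
  then have "a_kernel B C g \<subseteq> {x \<in> carrier B. g x \<in> G}" by (auto simp: a_kernel_iff)
  then show ?case
    using has_chain_mono[OF has_chain_image[OF K B i p]] submodule_vimage[OF B C g has_chain_0] by simp
next
  case (has_chain_Suc n G G')
  have "G' \<subseteq> g ` carrier B" unfolding surj by (rule right_module.right_submoduleE(1)[OF C has_chain_Suc(3)])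
  then have "{x \<in> carrier B. g x \<in> G} \<subset> {x \<in> carrier B. g x \<in> G'}"
    using has_chain_Suc(2) by blast
  then show ?case
    using has_chain.has_chain_Suc[OF has_chain_Suc.IH _ submodule_vimage[OF B C g has_chain_Suc(3)]] by simp
qed

lemma length_extension:
  assumes B: "right_module R B" and C: "right_module R C" and g: "g \<in> right_module_hom R B C"
    and surj: "g ` carrier B = carrier C"
    and fK: "finite_length R (B\<lparr>carrier := a_kernel B C g\<rparr>)" and fC: "finite_length R C"
  shows "finite_length R B"
    and "mod_length R B = mod_length R (B\<lparr>carrier := a_kernel B C g\<rparr>) + mod_length R C"
proof -
  let ?K = "B\<lparr>carrier := a_kernel B C g\<rparr>"
  have K: "right_module R ?K" by (rule right_module.right_module_submodule[OF B submodule_a_kernel[OF B C g]])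
  have "has_chain R ?K (mod_length R ?K) (a_kernel B C g)"
    using has_chain_mod_length(1)[OF K fK] by simp
  from has_chain_extension_ge[OF B C g surj this has_chain_mod_length(1)[OF C fC]]
  have 1: "has_chain R B (mod_length R ?K + mod_length R C) (carrier B)"
    by (rule has_chain_top[OF B])
  have 2: "m \<le> mod_length R ?K + mod_length R C" if "has_chain R B m (carrier B)" for m
  proof -
    obtain p q where pq: "m \<le> p + q" "has_chain R ?K p (carrier B \<inter> a_kernel B C g)" "has_chain R C q (g ` carrier B)"
      using has_chain_extension_le[OF B C g \<open>has_chain R B m (carrier B)\<close>] by blast
    show ?thesis
      using has_chain_mod_length(2)[OF K fK pq(2)] has_chain_mod_length(2)[OF C fC pq(3)] pq(1) by simp
  qed
  show "finite_length R B" "mod_length R B = mod_length R ?K + mod_length R C"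
    by (rule mod_length_eqI[OF 1 2]; assumption)+
qed

lemma length_quotient:
  assumes B: "right_module R B" and C: "right_module R C" and g: "g \<in> right_module_hom R B C"
    and surj: "g ` carrier B = carrier C" and fin: "finite_length R B"
  shows "finite_length R C"
    and "mod_length R B = mod_length R (B\<lparr>carrier := a_kernel B C g\<rparr>) + mod_length R C"
proof -
  let ?K = "B\<lparr>carrier := a_kernel B C g\<rparr>"
  note sub = submodule_a_kernel[OF B C g]
  have K: "right_module R ?K" by (rule right_module.right_module_submodule[OF B sub])
  have fK: "finite_length R ?K" by (rule length_submodule(1)[OF B sub fin])
  have "has_chain R ?K (mod_length R ?K) (a_kernel B C g)"
    using has_chain_mod_length(1)[OF K fK] by simp
  from has_chain_mod_length(2)[OF B fin has_chain_extension_ge[OF B C g surj this]]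
  have "q \<le> mod_length R B" if "has_chain R C q (carrier C)" for q
    using that by fastforce
  then show fC: "finite_length R C" unfolding finite_length_def by blast
  show "mod_length R B = mod_length R ?K + mod_length R C"
    by (rule length_extension(2)[OF B C g surj fK fC])
qed

lemma length_direct_sum:
  assumes M: "right_module R M" and N: "right_module R N" and fM: "finite_length R M" and fN: "finite_length R N"
  shows "finite_length R (direct_sum M N)" "mod_length R (direct_sum M N) = mod_length R M + mod_length R N"
proof -
  note D = right_module_direct_sum[OF M N]
  interpret M: right_module R M by fact
  interpret N: right_module R N by fact
  let ?K = "(direct_sum M N)\<lparr>carrier := a_kernel (direct_sum M N) M fst\<rparr>"
  have K: "right_module R ?K" by (rule right_module.right_module_submodule[OF D submodule_a_kernel[OF D M hom_fst]])
  have surj: "fst ` carrier (direct_sum M N) = carrier M"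
    using N.M.zero_closed by force
  have iso: "module_isomorphic R N ?K"
  proof (rule module_isomorphicI)
    show "(\<lambda>x. (\<zero>\<^bsub>M\<^esub>, x)) \<in> right_module_hom R N ?K"
      by (rule right_module_homI) (auto simp: a_kernel_iff)
    show "(\<lambda>x. (\<zero>\<^bsub>M\<^esub>, x)) ` carrier N = carrier ?K" by (auto simp: a_kernel_iff image_iff)
  qed (auto simp: inj_on_def)
  have fK: "finite_length R ?K" "mod_length R ?K = mod_length R N" using length_iso[OF N K iso] fN by auto
  show "finite_length R (direct_sum M N)" "mod_length R (direct_sum M N) = mod_length R M + mod_length R N"
    using length_extension[OF D M hom_fst surj fK(1) fM] fK(2) by simp_all
qed

lemma mod_length_zero_iff:
  assumes M: "right_module R M" and fin: "finite_length R M"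
  shows "mod_length R M = 0 \<longleftrightarrow> zero_module M"
proof
  interpret M: right_module R M by fact
  assume *: "mod_length R M = 0"
  show "zero_module M"
  proof (rule ccontr)
    assume "\<not> zero_module M"
    then have "{\<zero>\<^bsub>M\<^esub>} \<subset> carrier M" unfolding zero_module_def using M.M.zero_closed by blast
    then have "has_chain R M (Suc 0) (carrier M)"
      by (rule has_chain_Suc[OF has_chain_0[OF submodule_zero[OF M]] _ submodule_carrier[OF M]])
    then show False using has_chain_mod_length(2)[OF M fin] * by fastforce
  qed
next
  assume z: "zero_module M"
  show "mod_length R M = 0"
  proof (rule ccontr)
    assume "mod_length R M \<noteq> 0"
    then obtain n where "has_chain R M (Suc n) (carrier M)"
      using has_chain_mod_length(1)[OF M fin] by (metis not0_implies_Suc)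
    then obtain H where "has_chain R M n H" "H \<subset> carrier M" by (cases rule: has_chain.cases) auto
    then have "\<zero>\<^bsub>M\<^esub> \<in> H" by (intro right_module.right_submoduleE(2)[OF M has_chain_submodule])
    then have "carrier M \<subseteq> H" using z unfolding zero_module_def by simp
    then show False using \<open>H \<subset> carrier M\<close> by simp
  qed
qed

lemma finite_length_zero:
  assumes M: "right_module R M" and z: "zero_module M"
  shows "finite_length R M"
proof -
  have "m \<le> 0" if "has_chain R M m (carrier M)" for m
    using that
  proof cases
    case (has_chain_Suc n H)
    then have "\<zero>\<^bsub>M\<^esub> \<in> H" by (intro right_module.right_submoduleE(2)[OF M has_chain_submodule])
    then have "carrier M \<subseteq> H" using z unfolding zero_module_def by simp
    then show ?thesis using has_chain_Suc(3) by simp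
  qed simp
  then show ?thesis unfolding finite_length_def by blast
qed

lemma inj_endo_surj:
  assumes M: "right_module R M" and fin: "finite_length R M"
    and f: "f \<in> right_module_hom R M M" "inj_on f (carrier M)"
  shows "f ` carrier M = carrier M"
proof -
  let ?I = "M\<lparr>carrier := f ` carrier M\<rparr>"
  note sub = submodule_image[OF M M f(1) submodule_carrier[OF M]]
  have I: "right_module R ?I" by (rule right_module.right_module_submodule[OF M sub])
  have "module_isomorphic R M ?I"
    using right_module_hom_sub[OF f(1) order_refl order_refl] f(2) by (intro module_isomorphicI[of f]) auto
  then have "mod_length R ?I = mod_length R M" using length_iso(2)[OF M I] fin by simp
  then show ?thesis by (rule length_submodule(3)[OF M sub fin])
qed

lemma surj_endo_inj:
  assumes M: "right_module R M" and fin: "finite_length R M"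
    and f: "f \<in> right_module_hom R M M" "f ` carrier M = carrier M"
  shows "inj_on f (carrier M)"
proof -
  note sub = submodule_a_kernel[OF M M f(1)]
  let ?K = "M\<lparr>carrier := a_kernel M M f\<rparr>"
  have K: "right_module R ?K" by (rule right_module.right_module_submodule[OF M sub])
  have "mod_length R ?K = 0" using length_quotient(2)[OF M M f fin] by simp
  then have "zero_module ?K" using mod_length_zero_iff[OF K length_submodule(1)[OF M sub fin]] by simp
  then have "a_kernel M M f = {\<zero>\<^bsub>M\<^esub>}" by (simp add: zero_module_def)
  then show ?thesis by (subst inj_on_hom_iff[OF M M f(1)]) (auto simp: a_kernel_iff set_eq_iff)
qed

text \<open>
  A finitely generated submodule of greatest length cannot be enlarged by a further generator.
\<close>

lemma finite_length_imp_fg: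
  assumes M: "right_module R M" and fin: "finite_length R M"
  shows "finitely_generated R M"
proof -
  let ?P = "\<lambda>S. finite S \<and> S \<subseteq> carrier M"
  let ?l = "\<lambda>S. mod_length R (M\<lparr>carrier := generated_submodule R M S\<rparr>)"
  have sub: "submodule (generated_submodule R M S) R M" if "?P S" for S
    by (rule submodule_generated[OF M]) (use that in simp)
  have "?P {}" by simp
  moreover have "\<forall>S. ?P S \<longrightarrow> ?l S < Suc (mod_length R M)"
    using length_submodule(2)[OF M sub fin] by (simp add: less_Suc_eq_le)
  ultimately obtain S where S: "?P S" and max: "\<And>T. ?P T \<Longrightarrow> ?l T \<le> ?l S"
    using ex_has_greatest_nat[of ?P "{}" ?l "Suc (mod_length R M)"] by blast
  have "carrier M \<subseteq> generated_submodule R M S"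
  proof
    fix x assume x: "x \<in> carrier M"
    show "x \<in> generated_submodule R M S"
    proof (rule ccontr)
      assume nx: "x \<notin> generated_submodule R M S"
      have T: "?P (insert x S)" using S x by simp
      have "generated_submodule R M S \<subseteq> generated_submodule R M (insert x S)"
        by (rule generated_submodule_mono) blast
      moreover have "x \<in> generated_submodule R M (insert x S)"
        using generated_submodule_superset[of "insert x S" R M] by blast
      ultimately have "generated_submodule R M S \<subset> generated_submodule R M (insert x S)" using nx by blast
      from length_submodule_mono[OF M sub[OF S] sub[OF T] this fin] show False using max[OF T] by simp
    qed
  qed
  then have "generated_submodule R M S = carrier M"
    using right_module.right_submoduleE(1)[OF M sub[OF S]] by blast
  then show ?thesis using S finitely_generated_iff[OF M] by blast
qed

section \<open>Right artinian rings have finite length\<close>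

lemma artinian_minimal_right_ideal:
  assumes "right_artinian R" and "F \<noteq> {}" and sub: "\<And>I. I \<in> F \<Longrightarrow> submodule I R (regular_module R)"
  obtains I where "I \<in> F" "\<And>J. J \<in> F \<Longrightarrow> \<not> J \<subset> I"
proof -
  have "\<exists>I\<in>F. \<forall>J\<in>F. \<not> J \<subset> I"
  proof (rule ccontr)
    assume "\<not> ?thesis"
    then have step: "\<exists>J. J \<in> F \<and> J \<subset> I" if "I \<in> F" for I using that by blast
    obtain I0 where "I0 \<in> F" using assms(2) by blast
    define f where "f = rec_nat I0 (\<lambda>_ I. SOME J. J \<in> F \<and> J \<subset> I)"
    have fS: "f (Suc n) = (SOME J. J \<in> F \<and> J \<subset> f n)" for n unfolding f_def by simp
    have fF: "f n \<in> F" for n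
    proof (induction n)
      case 0
      show ?case using \<open>I0 \<in> F\<close> by (simp add: f_def)
    next
      case (Suc n)
      then show ?case unfolding fS using someI_ex[OF step[OF Suc]] by blast
    qed
    have fs: "f (Suc n) \<subset> f n" for n
      unfolding fS using someI_ex[OF step[OF fF[of n]]] by blast
    have "(\<forall>n. submodule (f n) R (regular_module R)) \<and> (\<forall>n. f (Suc n) \<subseteq> f n)"
      using fs sub[OF fF] by blast
    then obtain n where "\<forall>m\<ge>n. f m = f n" using assms(1) unfolding right_artinian_def by blast
    then have "f (Suc n) = f n" by (rule allE[of _ "Suc n"]) (erule mp, rule le_SucI, rule order_refl)
    then show False using fs[of n] by blast
  qed
  then show thesis using that by blast
qed

text \<open>
  \<open>K/H\<close> is simple.
\<close>

definition simple_step :: "('a, 'b) ring_scheme \<Rightarrow> ('a, 'm) module \<Rightarrow> 'm set \<Rightarrow> 'm set \<Rightarrow> bool" where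
  "simple_step R M H K \<longleftrightarrow> submodule H R M \<and> submodule K R M \<and> H \<subset> K \<and>
    (\<forall>L. submodule L R M \<and> H \<subseteq> L \<and> L \<subseteq> K \<longrightarrow> L = H \<or> L = K)"

lemma finite_length_simple_step:
  assumes M: "right_module R M" and st: "simple_step R M H K" and fH: "finite_length R (M\<lparr>carrier := H\<rparr>)"
  shows "finite_length R (M\<lparr>carrier := K\<rparr>)"
proof -
  have H: "submodule H R M" and K: "submodule K R M" and HK: "H \<subset> K"
    using st unfolding simple_step_def by blast+
  let ?K = "M\<lparr>carrier := K\<rparr>"
  have K': "right_module R ?K" by (rule right_module.right_module_submodule[OF M K])
  have HinK: "submodule H R ?K" using HK by (simp add: submodule_submodule_iff[OF M K] H)
  obtain C :: "('a, 'c) module" and g where C: "right_module R C" and g: "g \<in> right_module_hom R ?K C"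
    "g ` carrier ?K = carrier C" "a_kernel ?K C g = H"
    by (rule ex_quotient[OF K' HinK])
  have all: "J = carrier C \<or> J = {\<zero>\<^bsub>C\<^esub>}" if J: "submodule J R C" for J
  proof -
    let ?L = "{x \<in> carrier ?K. g x \<in> J}"
    have z: "\<zero>\<^bsub>C\<^esub> \<in> J" by (rule right_module.right_submoduleE(2)[OF C J])
    have "submodule ?L R ?K" by (rule submodule_vimage[OF K' C g(1) J])
    then have "submodule ?L R M" "?L \<subseteq> K" by (simp_all add: submodule_submodule_iff[OF M K])
    moreover have "x \<in> K \<and> g x = \<zero>\<^bsub>C\<^esub>" if "x \<in> H" for x
      using that g(3) a_kernel_iff[of x ?K C g] by simp
    then have "H \<subseteq> ?L" using z by auto
    ultimately have "?L = H \<or> ?L = K" using st unfolding simple_step_def by blast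
    moreover have "J \<subseteq> g ` K" using right_module.right_submoduleE(1)[OF C J] g(2) by simp
    then have "J = g ` ?L" by auto
    ultimately show ?thesis
    proof (elim disjE)
      assume "?L = H"
      then have "J \<subseteq> {\<zero>\<^bsub>C\<^esub>}" using \<open>J = g ` ?L\<close> g(3) by (auto simp: a_kernel_iff set_eq_iff)
      then show ?thesis using z by auto
    next
      assume "?L = K"
      then show ?thesis using \<open>J = g ` ?L\<close> g(2) by simp
    qed
  qed
  have "m \<le> 1" if m: "has_chain R C m (carrier C)" for m
  proof (rule ccontr)
    assume "\<not> m \<le> 1"
    then obtain n where n: "m = Suc (Suc n)" by (metis One_nat_def le_Suc_eq le_zero_eq not0_implies_Suc)
    from m[unfolded n] obtain J where J: "has_chain R C (Suc n) J" "J \<subset> carrier C" by cases auto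
    from J(1) obtain L where L: "has_chain R C n L" "L \<subset> J" by cases auto
    have "J = {\<zero>\<^bsub>C\<^esub>}" using all[OF has_chain_submodule[OF J(1)]] J(2) by blast
    then show False using L right_module.right_submoduleE(2)[OF C has_chain_submodule[OF L(1)]] by blast
  qed
  then have fC: "finite_length R C" unfolding finite_length_def by blast
  show ?thesis by (rule length_extension(1)[OF K' C g(1,2) _ fC]) (simp add: g(3) fH)
qed

lemma ex_maximal_submodule_finite_length:
  assumes M: "right_module R M" and K: "submodule K R M" and fin: "finite_length R (M\<lparr>carrier := K\<rparr>)"
    and nz: "K \<noteq> {\<zero>\<^bsub>M\<^esub>}"
  obtains H where "simple_step R M H K"
proof -
  let ?K = "M\<lparr>carrier := K\<rparr>"
  have K': "right_module R ?K" by (rule right_module.right_module_submodule[OF M K])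
  have sub: "submodule H R ?K \<longleftrightarrow> submodule H R M \<and> H \<subseteq> K" for H by (rule submodule_submodule_iff[OF M K])
  let ?P = "\<lambda>H. submodule H R ?K \<and> H \<noteq> K"
  let ?l = "\<lambda>H. mod_length R (?K\<lparr>carrier := H\<rparr>)"
  have "?P {\<zero>\<^bsub>M\<^esub>}" using submodule_zero[OF K'] nz by simp
  moreover have "\<forall>H. ?P H \<longrightarrow> ?l H < Suc (mod_length R ?K)"
    using length_submodule(2)[OF K' _ fin] by (simp add: less_Suc_eq_le)
  ultimately obtain H where H: "?P H" and max: "\<And>L. ?P L \<Longrightarrow> ?l L \<le> ?l H"
    using ex_has_greatest_nat[of ?P "{\<zero>\<^bsub>M\<^esub>}" ?l "Suc (mod_length R ?K)"] by blast
  have "L = H \<or> L = K" if L: "submodule L R M" "H \<subseteq> L" "L \<subseteq> K" for L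
  proof (rule ccontr)
    assume *: "\<not> (L = H \<or> L = K)"
    then have "?P L" "H \<subset> L" using L sub by auto
    then show False using max[of L] length_submodule_mono[OF K' _ _ \<open>H \<subset> L\<close> fin] H by force
  qed
  then have "simple_step R M H K" unfolding simple_step_def using H sub K by auto
  then show thesis by (rule that)
qed

text \<open>
  Let \<open>I\<close> be a minimal right ideal of infinite length. It has no maximal submodule \<open>V\<close>, since \<open>V\<close>
  would have finite length and \<open>I/V\<close> length one. In particular \<open>xR \<noteq> I\<close> for every \<open>x \<in> I\<close>, because
  a nonzero cyclic module has a maximal submodule; so every \<open>xR\<close> has finite length.

  Let \<open>B\<close> be a minimal right ideal with \<open>IB = I\<close>, and choose \<open>x \<in> I\<close> with \<open>xB \<noteq> 0\<close>. As \<open>xB\<close> has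
  finite length it has a maximal submodule \<open>V\<close>, and \<open>C = {b \<in> B. xb \<in> V}\<close> is maximal in \<open>B\<close>. By
  the choice of \<open>B\<close> the submodule \<open>N = IC\<close> is proper. Now \<open>I/N\<close> is a sum of images \<open>yB\<close> of the
  simple module \<open>B/C\<close>. A submodule \<open>L \<supseteq> N\<close> maximal among those avoiding a chosen element
  \<open>z \<in> I - N\<close> is then a maximal submodule of \<open>I\<close>, a contradiction: if \<open>K\<close> is strictly larger than
  \<open>L\<close> but misses some \<open>yB\<close>, then \<open>K\<close> and \<open>L + yB\<close> both contain \<open>z\<close>, while the elements of \<open>yB\<close>
  in \<open>K\<close> lie in \<open>N\<close>.
\<close>

theorem right_artinian_finite_length:
  assumes art: "right_artinian R"
  shows "finite_length R (regular_module R)"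
proof (rule ccontr)
  assume inf: "\<not> finite_length R (regular_module R)"
  have ring: "ring R" using art unfolding right_artinian_def by blast
  interpret R: ring R by fact
  let ?A = "regular_module R"
  have A: "right_module R ?A" by (rule right_module_regular[OF ring])
  interpret A: right_module R ?A by fact
  let ?fl = "\<lambda>H. finite_length R (?A\<lparr>carrier := H\<rparr>)"
  have "carrier R \<in> {I. submodule I R ?A \<and> \<not> ?fl I}"
    using inf submodule_regular_carrier[OF ring] by (simp add: regular_module_def)
  then have "{I. submodule I R ?A \<and> \<not> ?fl I} \<noteq> {}" by (rule ex_in_conv[THEN iffD1, OF exI])
  then obtain I where "I \<in> {I. submodule I R ?A \<and> \<not> ?fl I}"
    and "\<And>J. J \<in> {I. submodule I R ?A \<and> \<not> ?fl I} \<Longrightarrow> \<not> J \<subset> I"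
    by (rule artinian_minimal_right_ideal[OF art]) simp_all
  then have I: "submodule I R ?A" "\<not> ?fl I"
    and Imin: "\<And>J. submodule J R ?A \<Longrightarrow> \<not> ?fl J \<Longrightarrow> \<not> J \<subset> I" by simp_all
  have prp: "?fl J" if "submodule J R ?A" "J \<subset> I" for J by (rule ccontr) (use Imin[OF that(1)] that(2) in simp)
  \<comment> \<open>A maximal submodule would have finite length, and then so would \<open>I\<close>.\<close>
  have nomax: "\<not> simple_step R ?A H I" for H
    using finite_length_simple_step[OF A _ prp] I(2) unfolding simple_step_def by blast
  note IE = A.right_submoduleE[OF I(1), simplified]
  have Ic: "x \<in> carrier R" if "x \<in> I" for x using IE(1) that by blast
  have avoid: "\<exists>L. submodule L R ?A \<and> N \<subseteq> L \<and> L \<subset> I \<and> z \<notin> L \<and>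
      (\<forall>K. submodule K R ?A \<and> L \<subset> K \<and> K \<subseteq> I \<longrightarrow> z \<in> K)"
    if N: "submodule N R ?A" "N \<subseteq> I" "z \<in> I" "z \<notin> N" for N z
  proof -
    let ?I = "?A\<lparr>carrier := I\<rparr>"
    have I': "right_module R ?I" by (rule A.right_module_submodule[OF I(1)])
    have "submodule N R ?I" using N by (simp add: submodule_submodule_iff[OF A I(1)])
    moreover have "N \<inter> {z} = {}" using N by simp
    ultimately obtain L where L: "submodule L R ?I" "N \<subseteq> L" "L \<inter> {z} = {}"
      "\<And>K. submodule K R ?I \<Longrightarrow> L \<subset> K \<Longrightarrow> K \<inter> {z} \<noteq> {}"
      by (rule ex_maximal_submodule_avoiding[OF I']) blast
    then show ?thesis using N by (intro exI[of _ L]) (auto simp: submodule_submodule_iff[OF A I(1)])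
  qed
  have cyc: "submodule ((\<lambda>b. x \<otimes>\<^bsub>R\<^esub> b) ` B) R ?A" if "x \<in> carrier R" "submodule B R ?A" for x B
    using submodule_image[OF A A orbit_hom[OF A, of x] that(2)] that(1) by simp
  have cyc_sub: "(\<lambda>b. x \<otimes>\<^bsub>R\<^esub> b) ` B \<subseteq> I" if "x \<in> I" "submodule B R ?A" for x B
    using IE(4)[OF _ that(1)] A.right_submoduleE(1)[OF that(2)] by auto
  have cyc_ne: "(\<lambda>b. x \<otimes>\<^bsub>R\<^esub> b) ` carrier R \<noteq> I" if x: "x \<in> I" for x
  proof
    assume eq: "(\<lambda>b. x \<otimes>\<^bsub>R\<^esub> b) ` carrier R = I"
    have "x \<noteq> \<zero>\<^bsub>R\<^esub>"
    proof
      assume "x = \<zero>\<^bsub>R\<^esub>"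
      then have "I = {\<zero>\<^bsub>R\<^esub>}" using eq x by auto
      then have "finite_length R (?A\<lparr>carrier := I\<rparr>)"
        using finite_length_zero[OF A.right_module_submodule[OF I(1)]] by (simp add: zero_module_def)
      then show False using I(2) by blast
    qed
    then have x0: "x \<notin> {\<zero>\<^bsub>?A\<^esub>}" "{\<zero>\<^bsub>?A\<^esub>} \<subseteq> I" using IE(2) by simp_all
    obtain L where L0: "submodule L R ?A" "{\<zero>\<^bsub>?A\<^esub>} \<subseteq> L" "L \<subset> I" "x \<notin> L"
      and L': "\<forall>K. submodule K R ?A \<and> L \<subset> K \<and> K \<subseteq> I \<longrightarrow> x \<in> K"
      using avoid[OF submodule_zero[OF A] x0(2) x x0(1)] by (elim exE conjE) (rule that)
    note L = L0(1,3,4) L'[rule_format, OF conjI[OF _ conjI]]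
    have "K = I" if K: "submodule K R ?A" "L \<subset> K" "K \<subseteq> I" for K
    proof -
      have "x \<in> K" by (rule L(4)[OF K])
      then have "I \<subseteq> K" using A.right_submoduleE(4)[OF K(1)] unfolding eq[symmetric] by auto
      then show ?thesis using K(3) by blast
    qed
    then have "simple_step R ?A L I" unfolding simple_step_def using L(1,2) I(1) by blast
    then show False using nomax by blast
  qed
  \<comment> \<open>The submodule \<open>IB\<close>.\<close>
  define mul where "mul B = generated_submodule R ?A {x \<otimes>\<^bsub>R\<^esub> b | x b. x \<in> I \<and> b \<in> B}" for B
  have mulS: "{x \<otimes>\<^bsub>R\<^esub> b | x b. x \<in> I \<and> b \<in> B} \<subseteq> I" if "submodule B R ?A" for B
    using IE(4) A.right_submoduleE(1)[OF that] by auto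
  have mul_sub: "submodule (mul B) R ?A" "mul B \<subseteq> I" if "submodule B R ?A" for B
  proof -
    have "{x \<otimes>\<^bsub>R\<^esub> b | x b. x \<in> I \<and> b \<in> B} \<subseteq> carrier ?A"
      using subset_trans[OF mulS[OF that] IE(1)] by simp
    then show "submodule (mul B) R ?A" unfolding mul_def by (rule submodule_generated[OF A])
    show "mul B \<subseteq> I" unfolding mul_def by (rule generated_submodule_minimal[OF I(1) mulS[OF that]])
  qed
  have mul_in: "x \<otimes>\<^bsub>R\<^esub> b \<in> mul B" if "x \<in> I" "b \<in> B" for x b B
    unfolding mul_def using generated_submodule_superset[of "{x \<otimes>\<^bsub>R\<^esub> b | x b. x \<in> I \<and> b \<in> B}" R ?A] that by blast
  have "mul (carrier R) = I"
  proof
    show "mul (carrier R) \<subseteq> I" by (rule mul_sub(2)[OF submodule_regular_carrier[OF ring]])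
    show "I \<subseteq> mul (carrier R)" using mul_in[of _ "\<one>\<^bsub>R\<^esub>" "carrier R"] Ic by auto
  qed
  then have "carrier R \<in> {B. submodule B R ?A \<and> mul B = I}"
    using submodule_regular_carrier[OF ring] by simp
  then have "{B. submodule B R ?A \<and> mul B = I} \<noteq> {}" by (rule ex_in_conv[THEN iffD1, OF exI])
  then obtain B where "B \<in> {B. submodule B R ?A \<and> mul B = I}"
    and "\<And>C. C \<in> {B. submodule B R ?A \<and> mul B = I} \<Longrightarrow> \<not> C \<subset> B"
    by (rule artinian_minimal_right_ideal[OF art]) simp_all
  then have B: "submodule B R ?A" "mul B = I"
    and Bmin: "\<And>C. submodule C R ?A \<Longrightarrow> mul C = I \<Longrightarrow> \<not> C \<subset> B" by simp_all
  note BE = A.right_submoduleE[OF B(1), simplified]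
  have Bc: "b \<in> carrier R" if "b \<in> B" for b using BE(1) that by blast
  have gen_ne: "\<exists>x\<in>I. \<exists>b\<in>B. x \<otimes>\<^bsub>R\<^esub> b \<notin> N" if N: "submodule N R ?A" "\<not> I \<subseteq> N" for N
  proof (rule ccontr)
    assume "\<not> ?thesis"
    then have "mul B \<subseteq> N" unfolding mul_def by (intro generated_submodule_minimal[OF N(1)]) auto
    then show False using B(2) N(2) by blast
  qed
  have "\<not> I \<subseteq> {\<zero>\<^bsub>R\<^esub>}"
  proof
    assume "I \<subseteq> {\<zero>\<^bsub>R\<^esub>}"
    then have "I = {\<zero>\<^bsub>R\<^esub>}" using IE(2) by auto
    then have "finite_length R (?A\<lparr>carrier := I\<rparr>)"
      using finite_length_zero[OF A.right_module_submodule[OF I(1)]] by (simp add: zero_module_def)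
    then show False using I(2) by blast
  qed
  then obtain x b where xb: "x \<in> I" "b \<in> B" "x \<otimes>\<^bsub>R\<^esub> b \<noteq> \<zero>\<^bsub>R\<^esub>"
    using gen_ne[of "{\<zero>\<^bsub>R\<^esub>}"] submodule_zero[OF A] by auto
  let ?xB = "(\<lambda>b. x \<otimes>\<^bsub>R\<^esub> b) ` B"
  have xB: "submodule ?xB R ?A" by (rule cyc[OF Ic[OF xb(1)] B(1)])
  have "?xB \<subset> I"
  proof -
    have "?xB \<subseteq> (\<lambda>b. x \<otimes>\<^bsub>R\<^esub> b) ` carrier R" using BE(1) by blast
    moreover have "(\<lambda>b. x \<otimes>\<^bsub>R\<^esub> b) ` carrier R \<subseteq> I"
      by (rule cyc_sub[OF xb(1) submodule_regular_carrier[OF ring]])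
    ultimately show ?thesis using cyc_ne[OF xb(1)] by blast
  qed
  then have "?fl ?xB" by (rule prp[OF xB])
  moreover have "?xB \<noteq> {\<zero>\<^bsub>?A\<^esub>}" using xb(2,3) by auto
  ultimately obtain V where V: "simple_step R ?A V ?xB"
    by (rule ex_maximal_submodule_finite_length[OF A xB])
  have Vsub: "submodule V R ?A" "V \<subset> ?xB" using V unfolding simple_step_def by blast+
  define C where "C = {b \<in> B. x \<otimes>\<^bsub>R\<^esub> b \<in> V}"
  have trace: "submodule {b \<in> B. y \<otimes>\<^bsub>R\<^esub> b \<in> K} R ?A" if "y \<in> carrier R" "submodule K R ?A" for y K
  proof -
    have "submodule {b \<in> carrier ?A. b \<odot>\<^bsub>?A\<^esub> y \<in> K} R ?A"
      by (rule submodule_vimage[OF A A orbit_hom[OF A] that(2)]) (use that(1) in simp)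
    from submodule_Inter[OF A, of "{B, {b \<in> carrier ?A. b \<odot>\<^bsub>?A\<^esub> y \<in> K}}"] this B(1)
    have "submodule (B \<inter> {b \<in> carrier ?A. b \<odot>\<^bsub>?A\<^esub> y \<in> K}) R ?A" by auto
    moreover have "B \<inter> {b \<in> carrier ?A. b \<odot>\<^bsub>?A\<^esub> y \<in> K} = {b \<in> B. y \<otimes>\<^bsub>R\<^esub> b \<in> K}" using BE(1) by auto
    ultimately show ?thesis by simp
  qed
  have C: "submodule C R ?A" unfolding C_def by (rule trace[OF Ic[OF xb(1)] Vsub(1)])
  have CB: "C \<subset> B" using Vsub(2) unfolding C_def by blast
  have Cmax: "D = C \<or> D = B" if D: "submodule D R ?A" "C \<subseteq> D" "D \<subseteq> B" for D
  proof -
    let ?xD = "(\<lambda>b. x \<otimes>\<^bsub>R\<^esub> b) ` D"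
    have "submodule ?xD R ?A" by (rule cyc[OF Ic[OF xb(1)] D(1)])
    moreover have "V \<subseteq> ?xD"
    proof
      fix v assume v: "v \<in> V"
      then obtain c where "c \<in> B" "v = x \<otimes>\<^bsub>R\<^esub> c" using Vsub(2) by blast
      then show "v \<in> ?xD" using v D(2) unfolding C_def by blast
    qed
    moreover have "?xD \<subseteq> ?xB" using D(3) by blast
    ultimately have "?xD = V \<or> ?xD = ?xB" using V unfolding simple_step_def by blast
    then show ?thesis
    proof
      assume "?xD = V"
      then have "D \<subseteq> C" using D(3) unfolding C_def by blast
      then show ?thesis using D(2) by blast
    next
      assume eq: "?xD = ?xB"
      have "B \<subseteq> D"
      proof
        fix c assume c: "c \<in> B"
        then have "x \<otimes>\<^bsub>R\<^esub> c \<in> ?xD" using eq by blast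
        then obtain d where d: "d \<in> D" "x \<otimes>\<^bsub>R\<^esub> c = x \<otimes>\<^bsub>R\<^esub> d" by blast
        have dB: "d \<in> B" using d(1) D(3) by blast
        have "\<ominus>\<^bsub>?A\<^esub> d = \<ominus>\<^bsub>R\<^esub> d"
          using A.M.minus_equality[of "\<ominus>\<^bsub>R\<^esub> d" d] Bc[OF dB] by (simp add: R.l_neg)
        then have neg: "\<ominus>\<^bsub>R\<^esub> d \<in> B" using A.right_submoduleE(5)[OF B(1) dB] by simp
        have "x \<otimes>\<^bsub>R\<^esub> (c \<oplus>\<^bsub>R\<^esub> \<ominus>\<^bsub>R\<^esub> d) = \<zero>\<^bsub>R\<^esub>"
          using d(2) Bc[OF c] Bc[OF dB] Ic[OF xb(1)] by (simp add: R.r_distr R.r_minus R.r_neg)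
        then have "c \<oplus>\<^bsub>R\<^esub> \<ominus>\<^bsub>R\<^esub> d \<in> C"
          using BE(3)[OF c neg] A.right_submoduleE(2)[OF Vsub(1)] unfolding C_def by simp
        then have "c \<oplus>\<^bsub>R\<^esub> \<ominus>\<^bsub>R\<^esub> d \<in> D" using D(2) by blast
        then have "(c \<oplus>\<^bsub>R\<^esub> \<ominus>\<^bsub>R\<^esub> d) \<oplus>\<^bsub>R\<^esub> d \<in> D" using A.right_submoduleE(3)[OF D(1) _ d(1)] by simp
        then show "c \<in> D" using Bc[OF c] Bc[OF dB] by (simp add: R.a_assoc R.l_neg)
      qed
      then show ?thesis using D(3) by blast
    qed
  qed
  define N where "N = mul C"
  have N: "submodule N R ?A" "N \<subset> I" using mul_sub[OF C] Bmin[OF C] CB unfolding N_def by blast+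
  \<comment> \<open>As \<open>B/C\<close> is simple, a submodule above \<open>N = IC\<close> contains \<open>yB\<close> or meets it only in \<open>yC\<close>.\<close>
  have dich: "(\<forall>b\<in>B. y \<otimes>\<^bsub>R\<^esub> b \<in> K) \<or> (\<forall>b\<in>B. y \<otimes>\<^bsub>R\<^esub> b \<in> K \<longrightarrow> y \<otimes>\<^bsub>R\<^esub> b \<in> N)"
    if y: "y \<in> I" and K: "submodule K R ?A" "N \<subseteq> K" for y K
  proof -
    have CN: "y \<otimes>\<^bsub>R\<^esub> c \<in> N" if "c \<in> C" for c using mul_in[OF y that] unfolding N_def .
    then have "C \<subseteq> {b \<in> B. y \<otimes>\<^bsub>R\<^esub> b \<in> K}" using K(2) CB by blast
    then have "{b \<in> B. y \<otimes>\<^bsub>R\<^esub> b \<in> K} = C \<or> {b \<in> B. y \<otimes>\<^bsub>R\<^esub> b \<in> K} = B"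
      by (intro Cmax[OF trace[OF Ic[OF y] K(1)]]) auto
    then show ?thesis using CN by blast
  qed
  obtain y0 b0 where yb: "y0 \<in> I" "b0 \<in> B" "y0 \<otimes>\<^bsub>R\<^esub> b0 \<notin> N" using gen_ne[OF N(1)] N(2) by blast
  let ?z = "y0 \<otimes>\<^bsub>R\<^esub> b0"
  have z: "?z \<in> I" using mul_in[OF yb(1,2)] B(2) by simp
  obtain L where L0: "submodule L R ?A" "N \<subseteq> L" "L \<subset> I" "?z \<notin> L"
    and L': "\<forall>K. submodule K R ?A \<and> L \<subset> K \<and> K \<subseteq> I \<longrightarrow> ?z \<in> K"
    using avoid[OF N(1) psubset_imp_subset[OF N(2)] z yb(3)] by (elim exE conjE) (rule that)
  note L = L0 L'[rule_format, OF conjI[OF _ conjI]]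
  note LE = A.right_submoduleE[OF L(1), simplified]
  have "K = I" if K: "submodule K R ?A" "L \<subset> K" "K \<subseteq> I" for K
  proof (rule ccontr)
    assume "K \<noteq> I"
    then have "\<not> I \<subseteq> K" using K(3) by blast
    then obtain y b1 where y: "y \<in> I" "b1 \<in> B" "y \<otimes>\<^bsub>R\<^esub> b1 \<notin> K" using gen_ne[OF K(1)] by blast
    have yK: "y \<otimes>\<^bsub>R\<^esub> b \<in> N" if "b \<in> B" "y \<otimes>\<^bsub>R\<^esub> b \<in> K" for b
    proof -
      have "N \<subseteq> K" using L(2) K(2) by simp
      from dich[OF y(1) K(1) this] show ?thesis using y(2,3) that by (elim disjE) simp_all
    qed
    let ?S = "{l \<oplus>\<^bsub>R\<^esub> y \<otimes>\<^bsub>R\<^esub> b | l b. l \<in> L \<and> b \<in> B}"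
    have S: "submodule ?S R ?A" using submodule_add_cyclic[OF A L(1) _ B(1), of y] Ic[OF y(1)] by simp
    have Lc: "l \<in> carrier R" if "l \<in> L" for l using LE(1) that by blast
    have "L \<subseteq> ?S"
    proof
      fix l assume "l \<in> L"
      then have "l = l \<oplus>\<^bsub>R\<^esub> y \<otimes>\<^bsub>R\<^esub> \<zero>\<^bsub>R\<^esub>" using Lc Ic[OF y(1)] by simp
      then show "l \<in> ?S" using \<open>l \<in> L\<close> BE(2) by blast
    qed
    moreover have "y \<otimes>\<^bsub>R\<^esub> b1 \<in> ?S"
    proof -
      have "y \<otimes>\<^bsub>R\<^esub> b1 = \<zero>\<^bsub>R\<^esub> \<oplus>\<^bsub>R\<^esub> y \<otimes>\<^bsub>R\<^esub> b1" using Ic[OF y(1)] Bc[OF y(2)] by simp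
      then show ?thesis using LE(2) y(2) by blast
    qed
    ultimately have "L \<subset> ?S" using y(3) K(2) by blast
    moreover have "?S \<subseteq> I"
    proof
      fix s assume "s \<in> ?S"
      then obtain l b where "l \<in> L" "b \<in> B" "s = l \<oplus>\<^bsub>R\<^esub> y \<otimes>\<^bsub>R\<^esub> b" by blast
      then show "s \<in> I" using L(3) IE(3)[of l "y \<otimes>\<^bsub>R\<^esub> b"] IE(4)[OF Bc y(1)] by blast
    qed
    ultimately have "?z \<in> ?S" by (rule L(5)[OF S])
    then obtain l b where lb: "l \<in> L" "b \<in> B" "?z = l \<oplus>\<^bsub>R\<^esub> y \<otimes>\<^bsub>R\<^esub> b" by blast
    have c: "l \<in> carrier R" "y \<otimes>\<^bsub>R\<^esub> b \<in> carrier R" using Lc[OF lb(1)] Ic[OF y(1)] Bc[OF lb(2)] by auto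
    have neg: "\<ominus>\<^bsub>?A\<^esub> l = \<ominus>\<^bsub>R\<^esub> l" using A.M.minus_equality[of "\<ominus>\<^bsub>R\<^esub> l" l] c(1) by (simp add: R.l_neg)
    have zK: "?z \<in> K" by (rule L(5)[OF K])
    have "\<ominus>\<^bsub>R\<^esub> l \<in> K" using A.right_submoduleE(5)[OF L(1) lb(1)] neg K(2) by auto
    then have "\<ominus>\<^bsub>R\<^esub> l \<oplus>\<^bsub>R\<^esub> ?z \<in> K" using A.right_submoduleE(3)[OF K(1) _ zK] by simp
    then have "y \<otimes>\<^bsub>R\<^esub> b \<in> K" unfolding lb(3) using c by (simp add: R.r_neg1)
    then have "y \<otimes>\<^bsub>R\<^esub> b \<in> L" using yK[OF lb(2)] L(2) by blast
    then have "?z \<in> L" using LE(3)[OF lb(1)] lb(3) by simp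
    then show False using L(4) by blast
  qed
  then have "simple_step R ?A L I" unfolding simple_step_def using L(1,3) I(1) by blast
  then show False using nomax by blast
qed

section \<open>Finitely generated modules, projective covers and syzygies\<close>

lemma mod_catD: "M \<in> mod_cat R \<Longrightarrow> right_module R M" "M \<in> mod_cat R \<Longrightarrow> finitely_generated R M"
  unfolding mod_cat_def by simp_all

lemma injective_zero_module:
  assumes E: "injective_module R E" and Z: "right_module R Z" "zero_module Z"
  shows "injective_module R Z"
  by (rule injective_retract[OF E Z(1) right_module_hom_const_zero[OF injective_moduleD[OF E]]
        right_module_hom_const_zero[OF Z(1)]]) (use Z(2) in \<open>simp add: zero_module_def\<close>)

locale artinian_ring =
  fixes R :: "('a, 'b) ring_scheme"
  assumes artinian: "right_artinian R"
begin

lemma ring_R: "ring R"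
  using artinian unfolding right_artinian_def by blast

lemma right_module_R: "right_module R (regular_module R)"
  by (rule right_module_regular[OF ring_R])

lemma ex_mod_cat_iso:
  assumes M: "right_module R M" and fin: "finite_length R M"
  obtains M' where "M' \<in> mod_cat R" "module_isomorphic R M M'" "finite_length R M'"
proof -
  obtain M' where M': "M' \<in> mod_cat R" "module_isomorphic R M M'"
    using finitely_generated_ex_mod_cat[OF M finite_length_imp_fg[OF M fin]] by blast
  have "finite_length R M'" using length_iso(1)[OF M mod_catD(1)[OF M'(1)] M'(2)] fin by simp
  with M' show thesis by (rule that)
qed

text \<open>
  The module \<open>P\<close> is built as a finite direct sum of copies of \<open>R\<close>, one for each generator of \<open>M\<close>.
  This construction also gives its finite length and, over a self-injective ring, its
  injectivity, from which both follow for all finitely generated (projective) modules.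
\<close>

lemma ex_projective_surjection:
  assumes M: "right_module R M" and fg: "finitely_generated R M"
  obtains P p where "P \<in> mod_cat R" "projective_module R P" "finite_length R P"
    "right_self_injective R \<Longrightarrow> injective_module R P"
    "p \<in> right_module_hom R P M" "p ` carrier P = carrier M"
proof -
  interpret M: right_module R M by fact
  define good where "good P \<longleftrightarrow> P \<in> mod_cat R \<and> projective_module R P \<and> finite_length R P \<and>
    (right_self_injective R \<longrightarrow> injective_module R P)" for P
  have R1: "projective_module R (regular_module R)" by (rule projective_regular[OF ring_R])
  have R2: "finite_length R (regular_module R)" by (rule right_artinian_finite_length[OF artinian])
  have main: "\<exists>P p. good P \<and> p \<in> right_module_hom R P M \<and> S \<subseteq> p ` carrier P"
    if "finite S" "S \<subseteq> carrier M" for S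
    using that
  proof (induction S rule: finite_induct)
    case empty
    let ?Z = "(regular_module R)\<lparr>carrier := {\<zero>\<^bsub>regular_module R\<^esub>}\<rparr>"
    have Z: "right_module R ?Z" by (rule right_module_zero_submodule[OF right_module_R])
    have zZ: "zero_module ?Z" by (simp add: zero_module_def)
    obtain P where P: "P \<in> mod_cat R" "module_isomorphic R ?Z P" "finite_length R P"
      by (rule ex_mod_cat_iso[OF Z finite_length_zero[OF Z zZ]])
    note P' = mod_catD(1)[OF P(1)]
    have zP: "zero_module P" using zero_module_iso_iff[OF Z P' P(2)] zZ by simp
    have "right_self_injective R \<longrightarrow> injective_module R P"
      using injective_zero_module[OF _ P' zP] unfolding right_self_injective_def by blast
    then have "good P" unfolding good_def using P projective_zero_module[OF P' zP] by simp
    then show ?case using right_module_hom_const_zero[OF M] by blast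
  next
    case (insert x S)
    then obtain P p where P: "good P" "p \<in> right_module_hom R P M" "S \<subseteq> p ` carrier P" by auto
    have x: "x \<in> carrier M" using insert.prems by simp
    have gP: "P \<in> mod_cat R" "projective_module R P" "finite_length R P"
      "right_self_injective R \<Longrightarrow> injective_module R P" using P(1) unfolding good_def by simp_all
    note P' = mod_catD(1)[OF gP(1)]
    interpret P: right_module R P by (rule P')
    let ?D = "direct_sum (regular_module R) P"
    have D: "right_module R ?D" by (rule right_module_direct_sum[OF right_module_R P'])
    have fD: "finite_length R ?D" by (rule length_direct_sum(1)[OF right_module_R P' R2 gP(3)])
    obtain Q where Q: "Q \<in> mod_cat R" "module_isomorphic R ?D Q" "finite_length R Q"
      by (rule ex_mod_cat_iso[OF D fD])
    note Q' = mod_catD(1)[OF Q(1)]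
    have "right_self_injective R \<longrightarrow> injective_module R Q"
      using injective_module_iso[OF injective_direct_sum[OF _ gP(4)] Q' Q(2)]
      unfolding right_self_injective_def by blast
    then have gQ: "good Q"
      unfolding good_def using Q projective_module_iso[OF projective_direct_sum[OF R1 gP(2)] Q' Q(2)] by simp
    let ?q = "\<lambda>z. fst z \<odot>\<^bsub>M\<^esub> x \<oplus>\<^bsub>M\<^esub> p (snd z)"
    have q: "?q \<in> right_module_hom R ?D M" by (rule hom_copair[OF right_module_R P' M orbit_hom[OF M x] P(2)])
    obtain t where t: "t \<in> right_module_hom R Q ?D" "t ` carrier Q = carrier ?D"
      using module_isomorphic_sym[OF D Q(2)] by (rule module_isomorphicE)
    have qt: "(\<lambda>y. ?q (t y)) ` carrier Q = ?q ` carrier ?D"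
      unfolding t(2)[symmetric] image_image ..
    have "x = ?q (\<one>\<^bsub>R\<^esub>, \<zero>\<^bsub>P\<^esub>)" using x right_module_hom_zero[OF P' M P(2)] by simp
    then have "x \<in> ?q ` carrier ?D" by (rule image_eqI) simp
    moreover have "S \<subseteq> ?q ` carrier ?D"
    proof
      fix y assume "y \<in> S"
      then obtain u where u: "u \<in> carrier P" "y = p u" using P(3) by blast
      then have "y = ?q (\<zero>\<^bsub>R\<^esub>, u)" using x right_module_homD(1)[OF P(2)] by simp
      then show "y \<in> ?q ` carrier ?D" by (rule image_eqI) (use u in simp)
    qed
    ultimately have "insert x S \<subseteq> (\<lambda>y. ?q (t y)) ` carrier Q" unfolding qt by blast
    then show ?case using gQ right_module_hom_comp[OF t(1) q] by blast
  qed
  obtain S where S: "finite S" "S \<subseteq> carrier M" "generated_submodule R M S = carrier M"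
    using fg finitely_generated_iff[OF M] by blast
  obtain P p where P: "good P" "p \<in> right_module_hom R P M" "S \<subseteq> p ` carrier P"
    using main[OF S(1,2)] by blast
  have P': "P \<in> mod_cat R" "projective_module R P" "finite_length R P"
    "right_self_injective R \<Longrightarrow> injective_module R P" using P(1) unfolding good_def by simp_all
  have sub: "submodule (p ` carrier P) R M"
    by (rule submodule_image[OF mod_catD(1)[OF P'(1)] M P(2) submodule_carrier[OF mod_catD(1)[OF P'(1)]]])
  have surj: "p ` carrier P = carrier M"
    using generated_submodule_minimal[OF sub P(3)] M.right_submoduleE(1)[OF sub] S(3) by simp
  show thesis by (rule that[OF P'(1-3) _ P(2) surj]) (rule P'(4))
qed

lemma fg_imp_finite_length:
  assumes M: "right_module R M" and fg: "finitely_generated R M"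
  shows "finite_length R M"
proof -
  obtain P p where P: "P \<in> mod_cat R" "finite_length R P" "p \<in> right_module_hom R P M" "p ` carrier P = carrier M"
    by (rule ex_projective_surjection[OF M fg])
  show ?thesis by (rule length_quotient(1)[OF mod_catD(1)[OF P(1)] M P(3,4,2)])
qed

lemma mod_cat_iff: "M \<in> mod_cat R \<longleftrightarrow> right_module R M \<and> finite_length R M"
  using fg_imp_finite_length[of M] finite_length_imp_fg[of R M] unfolding mod_cat_def by auto

lemma mod_cat_submodule:
  assumes "M \<in> mod_cat R" "submodule H R M"
  shows "M\<lparr>carrier := H\<rparr> \<in> mod_cat R"
  using assms length_submodule(1)[of R M H] right_module.right_module_submodule[of R M H]
  by (simp add: mod_cat_iff)

lemma injective_of_projective:
  assumes inj: "right_self_injective R" and P: "projective_module R P" "finitely_generated R P"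
  shows "injective_module R P"
proof -
  note P' = projective_moduleD[OF P(1)]
  obtain Q q where Q: "Q \<in> mod_cat R" "injective_module R Q" "q \<in> right_module_hom R Q P" "q ` carrier Q = carrier P"
    by (rule ex_projective_surjection[OF P' P(2)]) (use inj in blast)
  obtain s where s: "s \<in> right_module_hom R P Q" "\<And>x. x \<in> carrier P \<Longrightarrow> q (s x) = x"
    using projective_lift[OF P mod_catD(1)[OF Q(1)] P' Q(3,4) right_module_hom_id] by blast
  show ?thesis by (rule injective_retract[OF Q(2) P' s(1) Q(3) s(2)])
qed

text \<open>
  A submodule \<open>H\<close> of minimal length among those that a projective \<open>P\<close> maps onto \<open>M\<close> is a
  projective cover: \<open>P \<rightarrow> M\<close> lifts to \<open>P \<rightarrow> H\<close>, minimality makes the restriction to \<open>H\<close> surjective,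
  hence bijective, so \<open>H\<close> is a retract of \<open>P\<close>.
\<close>

lemma ex_projective_cover:
  assumes M: "M \<in> mod_cat R"
  shows "\<exists>P f. projective_cover R M P f"
proof -
  note M' = mod_catD(1)[OF M]
  obtain P p where P: "P \<in> mod_cat R" "projective_module R P" "finite_length R P"
    "p \<in> right_module_hom R P M" "p ` carrier P = carrier M"
    by (rule ex_projective_surjection[OF M' mod_catD(2)[OF M]])
  note P' = mod_catD(1)[OF P(1)]
  let ?Q = "\<lambda>H. submodule H R P \<and> p ` H = carrier M"
  let ?l = "\<lambda>H. mod_length R (P\<lparr>carrier := H\<rparr>)"
  have "?Q (carrier P)" using submodule_carrier[OF P'] P(5) by simp
  then obtain H where H: "?Q H" and min: "\<And>K. ?Q K \<Longrightarrow> ?l H \<le> ?l K"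
    using ex_has_least_nat[of ?Q "carrier P" ?l] by blast
  have Hs: "submodule H R P" using H by simp
  have HP: "H \<subseteq> carrier P" by (rule right_module.right_submoduleE(1)[OF P' Hs])
  let ?H = "P\<lparr>carrier := H\<rparr>"
  have Hmod: "?H \<in> mod_cat R" by (rule mod_cat_submodule[OF P(1) Hs])
  note H' = mod_catD(1)[OF Hmod]
  have fH: "finite_length R ?H" using Hmod by (simp add: mod_cat_iff)
  have least: "K = H" if K: "submodule K R P" "K \<subseteq> H" "p ` K = carrier M" for K
    using length_submodule_mono[OF P' K(1) Hs _ P(3)] min[of K] K by fastforce
  have pH: "p \<in> right_module_hom R ?H M" using right_module_hom_sub[OF P(4) HP, of "carrier M"] H by simp
  have incl: "(\<lambda>x. x) \<in> right_module_hom R ?H P"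
    by (rule right_module_homI) (use HP in auto)
  obtain g where g: "g \<in> right_module_hom R P ?H" "\<And>x. x \<in> carrier P \<Longrightarrow> p (g x) = p x"
    using projective_lift[OF P(2) mod_catD(2)[OF P(1)] H' M' pH _ P(4)] H by auto
  have gH: "g \<in> right_module_hom R ?H ?H" using right_module_hom_comp[OF incl g(1)] by simp
  have gP: "g \<in> right_module_hom R P P" by (rule right_module_hom_incl[OF g(1) HP])
  have "g ` H = H"
  proof (rule least)
    show "submodule (g ` H) R P" by (rule submodule_image[OF P' P' gP Hs])
    show "g ` H \<subseteq> H" using right_module_homD(1)[OF gH] by auto
    have "p ` g ` H = p ` H" unfolding image_image by (rule image_cong) (use g(2) HP in auto)
    then show "p ` g ` H = carrier M" using H by simp
  qed
  then have gs: "g ` carrier ?H = carrier ?H" by simp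
  have bij: "bij_betw g (carrier ?H) (carrier ?H)"
    using surj_endo_inj[OF H' fH gH gs] gs by (simp add: bij_betw_def)
  let ?r = "\<lambda>x. inv_into (carrier ?H) g (g x)"
  have r: "?r \<in> right_module_hom R P ?H"
    by (rule right_module_hom_comp[OF g(1) right_module_hom_inv[OF gH H' bij]])
  have "projective_module R ?H"
    by (rule projective_retract[OF P(2) H' incl r]) (use bij in \<open>simp add: bij_betw_inv_into_left\<close>)
  moreover have "superfluous R ?H (a_kernel ?H M p)"
    unfolding superfluous_def
  proof (intro conjI allI impI)
    show "submodule (a_kernel ?H M p) R ?H" by (rule submodule_a_kernel[OF H' M' pH])
    fix K assume K: "submodule K R ?H \<and> K <+>\<^bsub>?H\<^esub> a_kernel ?H M p = carrier ?H"
    interpret M: right_module R M by (rule M')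
    have K': "submodule K R P" "K \<subseteq> H" using K by (simp_all add: submodule_submodule_iff[OF P' Hs])
    have "p ` H \<subseteq> p ` K"
    proof
      fix y assume "y \<in> p ` H"
      then obtain h where h: "h \<in> H" "y = p h" by blast
      then have "h \<in> K <+>\<^bsub>?H\<^esub> a_kernel ?H M p" using K by simp
      then obtain k n where kn: "k \<in> K" "n \<in> a_kernel ?H M p" "h = k \<oplus>\<^bsub>P\<^esub> n"
        by (auto simp: set_add_def')
      then have "y = p k \<oplus>\<^bsub>M\<^esub> p n" using h(2) right_module_homD(2)[OF pH] K'(2) by (auto simp: a_kernel_iff)
      also have "\<dots> = p k" using kn K'(2) right_module_homD(1)[OF pH] by (auto simp: a_kernel_iff)
      finally show "y \<in> p ` K" using kn(1) by blast
    qed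
    then have "p ` K = carrier M" using K'(2) H by blast
    then show "K = carrier ?H" using least[OF K'] by simp
  qed
  ultimately show ?thesis using Hmod pH H unfolding projective_cover_def
    by (intro exI[of _ ?H] exI[of _ p]) simp
qed

lemma syzygy_cover:
  assumes M: "M \<in> mod_cat R"
  obtains P p where "P \<in> mod_cat R" "projective_module R P" "p \<in> right_module_hom R P M"
    "p ` carrier P = carrier M" "syzygy R M = P\<lparr>carrier := a_kernel P M p\<rparr>"
proof -
  obtain z where z: "z = (SOME (P, f). projective_cover R M P f)" by blast
  have "case z of (P, f) \<Rightarrow> projective_cover R M P f"
    unfolding z by (rule someI_ex) (use ex_projective_cover[OF M] in auto)
  moreover obtain P f where Pf: "z = (P, f)" by (cases z)
  ultimately have "projective_cover R M P f" by simp
  moreover have "syzygy R M = P\<lparr>carrier := a_kernel P M f\<rparr>"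
    unfolding syzygy_def Let_def z[symmetric] Pf by simp
  ultimately show thesis unfolding projective_cover_def using that by blast
qed

lemma syzygy_mod_cat:
  assumes M: "M \<in> mod_cat R"
  shows "syzygy R M \<in> mod_cat R"
proof -
  obtain P p where P: "P \<in> mod_cat R" "projective_module R P" "p \<in> right_module_hom R P M"
    "syzygy R M = P\<lparr>carrier := a_kernel P M p\<rparr>"
    by (rule syzygy_cover[OF M])
  show ?thesis
    unfolding P(4) by (rule mod_cat_submodule[OF P(1) submodule_a_kernel[OF mod_catD(1)[OF P(1)] mod_catD(1)[OF M] P(3)]])
qed

lemma ex_zero_module: obtains Z where "Z \<in> mod_cat R" "zero_module Z"
proof -
  let ?Z = "(regular_module R)\<lparr>carrier := {\<zero>\<^bsub>regular_module R\<^esub>}\<rparr>"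
  have Z: "right_module R ?Z" by (rule right_module_zero_submodule[OF right_module_R])
  have zZ: "zero_module ?Z" by (simp add: zero_module_def)
  obtain P where P: "P \<in> mod_cat R" "module_isomorphic R ?Z P"
    by (rule ex_mod_cat_iso[OF Z finite_length_zero[OF Z zZ]])
  show thesis
    using that[OF P(1)] zero_module_iso_iff[OF Z mod_catD(1)[OF P(1)] P(2)] zZ by simp
qed

lemma ex_direct_sum:
  assumes "M \<in> mod_cat R" "N \<in> mod_cat R"
  obtains S where "S \<in> mod_cat R" "module_isomorphic R (direct_sum M N) S"
  using ex_mod_cat_iso[OF right_module_direct_sum length_direct_sum(1), of M N] assms
  by (auto simp: mod_cat_iff)

section \<open>The Igusa-Todorov group\<close>

abbreviation "FG \<equiv> free_Abelian_group (mod_cat R)"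

lemma IT_relations_carrier: "IT_relations R \<subseteq> carrier FG"
  unfolding IT_relations_def
  by (auto dest!: subsetD[OF keys_diff])

lemma IT_subgroup: "subgroup (IT_subgroup R) FG" and normal_IT_subgroup: "IT_subgroup R \<lhd> FG"
  using group.generate_is_subgroup[OF group_free_Abelian_group IT_relations_carrier]
    comm_group.subgroup_imp_normal[OF abelian_free_Abelian_group]
  unfolding IT_subgroup_def by blast+

lemma comm_group_IT_group: "comm_group (IT_group R)"
  unfolding IT_group_def
  by (rule comm_group.abelian_FactGroup[OF abelian_free_Abelian_group IT_subgroup])

lemma group_IT_group: "group (IT_group R)"
  by (rule comm_group.axioms(2)[OF comm_group_IT_group])

lemma IT_class_closed: "M \<in> mod_cat R \<Longrightarrow> IT_class R M \<in> carrier (IT_group R)"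
  unfolding IT_class_def IT_group_def carrier_FactGroup by auto

lemma IT_coset_eq:
  assumes "x \<in> carrier FG" "y \<in> carrier FG" "x - y \<in> IT_subgroup R"
  shows "IT_subgroup R #>\<^bsub>FG\<^esub> x = IT_subgroup R #>\<^bsub>FG\<^esub> y"
proof (rule group.repr_independence[OF group_free_Abelian_group _ assms(2) IT_subgroup, symmetric])
  have "x = (x - y) \<otimes>\<^bsub>FG\<^esub> y" by simp
  then show "x \<in> IT_subgroup R #>\<^bsub>FG\<^esub> y" using assms(3) unfolding r_coset_def by blast
qed

lemma IT_coset_mult:
  assumes "x \<in> carrier FG" "y \<in> carrier FG"
  shows "(IT_subgroup R #>\<^bsub>FG\<^esub> x) \<otimes>\<^bsub>IT_group R\<^esub> (IT_subgroup R #>\<^bsub>FG\<^esub> y) = IT_subgroup R #>\<^bsub>FG\<^esub> (x + y)"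
  using normal.rcos_sum[OF normal_IT_subgroup assms] unfolding IT_group_def by simp

lemma IT_relation_mem: "x \<in> IT_relations R \<Longrightarrow> x \<in> IT_subgroup R"
  unfolding IT_subgroup_def by (rule generate.incl)

lemma IT_class_direct_sum:
  assumes "A \<in> mod_cat R" "B \<in> mod_cat R" "C \<in> mod_cat R" "module_isomorphic R A (direct_sum B C)"
  shows "IT_class R A = IT_class R B \<otimes>\<^bsub>IT_group R\<^esub> IT_class R C"
proof -
  have "frag_of A - frag_of B - frag_of C \<in> IT_subgroup R"
    by (rule IT_relation_mem) (use assms in \<open>auto simp: IT_relations_def\<close>)
  then have "frag_of A - (frag_of B + frag_of C) \<in> IT_subgroup R" by (simp add: algebra_simps)
  moreover have "frag_of B + frag_of C \<in> carrier FG"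
    using assms(2,3) by (auto dest!: subsetD[OF keys_add])
  ultimately show ?thesis
    using assms(1-3) IT_coset_eq[of "frag_of A" "frag_of B + frag_of C"] IT_coset_mult[of "frag_of B" "frag_of C"]
    unfolding IT_class_def by simp
qed

lemma IT_class_projective:
  assumes "P \<in> mod_cat R" "projective_module R P"
  shows "IT_class R P = \<one>\<^bsub>IT_group R\<^esub>"
proof -
  have "frag_of P \<in> IT_subgroup R"
    by (rule IT_relation_mem) (use assms in \<open>auto simp: IT_relations_def\<close>)
  then have "IT_class R P = IT_subgroup R"
    unfolding IT_class_def using assms(1)
    by (intro group.coset_join2[OF group_free_Abelian_group _ IT_subgroup]) auto
  then show ?thesis unfolding IT_group_def by simp
qed

lemma IT_class_iso:
  assumes A: "A \<in> mod_cat R" and B: "B \<in> mod_cat R" and iso: "module_isomorphic R A B"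
  shows "IT_class R A = IT_class R B"
proof -
  obtain Z where Z: "Z \<in> mod_cat R" "zero_module Z" by (rule ex_zero_module)
  note r = mod_catD(1)
  have "module_isomorphic R A (direct_sum B Z)"
    by (rule module_isomorphic_trans[OF iso module_isomorphic_sym[OF right_module_direct_sum[OF r[OF B] r[OF Z(1)]]
            module_isomorphic_direct_sum_zero[OF Z(2)]]])
  from IT_class_direct_sum[OF A B Z(1) this] show ?thesis
    using IT_class_projective[OF Z(1) projective_zero_module[OF r[OF Z(1)] Z(2)]] IT_class_closed[OF B]
      monoid.r_one[OF group.is_monoid[OF group_IT_group]] by simp
qed

text \<open>
  The universal property of \<open>IT_group R\<close>. It produces the syzygy homomorphism, a left inverse of
  it over self-injective rings, and an integer-valued invariant.
\<close>

lemma IT_group_hom_exists: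
  assumes G: "comm_group G" and cl: "\<And>M. M \<in> mod_cat R \<Longrightarrow> \<Phi> M \<in> carrier G"
    and add: "\<And>A B C. \<lbrakk>A \<in> mod_cat R; B \<in> mod_cat R; C \<in> mod_cat R; module_isomorphic R A (direct_sum B C)\<rbrakk>
      \<Longrightarrow> \<Phi> A = \<Phi> B \<otimes>\<^bsub>G\<^esub> \<Phi> C"
    and proj: "\<And>P. \<lbrakk>P \<in> mod_cat R; projective_module R P\<rbrakk> \<Longrightarrow> \<Phi> P = \<one>\<^bsub>G\<^esub>"
  obtains h where "h \<in> hom (IT_group R) G" "\<And>M. M \<in> mod_cat R \<Longrightarrow> h (IT_class R M) = \<Phi> M"
proof -
  interpret G: comm_group G by fact
  obtain k where k: "k \<in> hom FG G" "\<And>M. M \<in> mod_cat R \<Longrightarrow> k (frag_of M) = \<Phi> M"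
    using G.free_Abelian_group_universal[of \<Phi> "mod_cat R"] cl by blast
  interpret k: group_hom FG G k
    using k(1) by (simp add: group_hom_def group_hom_axioms_def G.is_group)
  have kdiff: "k (x - y) = k x \<otimes>\<^bsub>G\<^esub> inv\<^bsub>G\<^esub> k y" if "x \<in> carrier FG" "y \<in> carrier FG" for x y
  proof -
    have "x - y = x \<otimes>\<^bsub>FG\<^esub> inv\<^bsub>FG\<^esub> y" using that by simp
    then show ?thesis using that by (metis k.hom_inv k.hom_mult group.inv_closed group_free_Abelian_group)
  qed
  have "IT_relations R \<subseteq> kernel FG G k"
  proof
    fix x assume "x \<in> IT_relations R"
    then consider A B C where "A \<in> mod_cat R" "B \<in> mod_cat R" "C \<in> mod_cat R"
        "module_isomorphic R A (direct_sum B C)" "x = frag_of A - frag_of B - frag_of C"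
      | P where "P \<in> mod_cat R" "projective_module R P" "x = frag_of P"
      unfolding IT_relations_def by blast
    then show "x \<in> kernel FG G k"
    proof cases
      case 1
      have AB: "frag_of A - frag_of B \<in> carrier FG" using 1 by (auto dest!: subsetD[OF keys_diff])
      have "x \<in> carrier FG" using 1 by (auto dest!: subsetD[OF keys_diff])
      moreover have "k x = \<Phi> A \<otimes>\<^bsub>G\<^esub> inv\<^bsub>G\<^esub> \<Phi> B \<otimes>\<^bsub>G\<^esub> inv\<^bsub>G\<^esub> \<Phi> C"
        using 1(1-3,5) AB by (simp add: kdiff k(2))
      moreover have "\<dots> = (\<Phi> B \<otimes>\<^bsub>G\<^esub> \<Phi> C) \<otimes>\<^bsub>G\<^esub> inv\<^bsub>G\<^esub> (\<Phi> B \<otimes>\<^bsub>G\<^esub> \<Phi> C)"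
        using add[OF 1(1-4)] cl[OF 1(2)] cl[OF 1(3)] by (simp add: G.m_assoc G.inv_mult)
      moreover have "\<dots> = \<one>\<^bsub>G\<^esub>" using cl[OF 1(2)] cl[OF 1(3)] by (intro G.r_inv G.m_closed)
      ultimately show ?thesis unfolding kernel_def by simp
    next
      case 2
      then show ?thesis unfolding kernel_def using k(2) proj by simp
    qed
  qed
  then have "IT_subgroup R \<subseteq> kernel FG G k"
    unfolding IT_subgroup_def by (rule group.generate_subgroup_incl[OF group_free_Abelian_group _ k.subgroup_kernel])
  then obtain h where h: "h \<in> hom (FG Mod IT_subgroup R) G"
    "\<And>x. x \<in> carrier FG \<Longrightarrow> h (IT_subgroup R #>\<^bsub>FG\<^esub> x) = k x"
    using k.FactGroup_universal_kernel[OF normal_IT_subgroup] by blast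
  show thesis
    by (rule that[of h]) (use h k(2) in \<open>auto simp: IT_group_def IT_class_def\<close>)
qed

text \<open>
  The classes of modules generate \<open>IT_group R\<close>.
\<close>

lemma IT_group_hom_eq:
  assumes G: "group G" and h: "h \<in> hom (IT_group R) G" and k: "k \<in> hom (IT_group R) G"
    and eq: "\<And>M. M \<in> mod_cat R \<Longrightarrow> h (IT_class R M) = k (IT_class R M)" and x: "x \<in> carrier (IT_group R)"
  shows "h x = k x"
proof -
  interpret G: group G by fact
  interpret h: group_hom "IT_group R" G h using h by (simp add: group_hom_def group_hom_axioms_def G group_IT_group)
  interpret k: group_hom "IT_group R" G k using k by (simp add: group_hom_def group_hom_axioms_def G group_IT_group)
  let ?c = "\<lambda>x. IT_subgroup R #>\<^bsub>FG\<^esub> x"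
  have cc: "?c x \<in> carrier (IT_group R)" if "x \<in> carrier FG" for x
    using that unfolding IT_group_def carrier_FactGroup by blast
  obtain u where u: "u \<in> carrier FG" "x = ?c u" using x unfolding IT_group_def carrier_FactGroup by auto
  have "Poly_Mapping.keys u \<subseteq> mod_cat R" using u(1) by simp
  then have "h (?c u) = k (?c u)"
  proof (rule free_Abelian_group_induct[where S = "mod_cat R" and x = u])
    have "?c 0 = \<one>\<^bsub>IT_group R\<^esub>"
      using group.coset_join2[OF group_free_Abelian_group _ IT_subgroup, of 0] subgroup.one_closed[OF IT_subgroup]
      unfolding IT_group_def by simp
    then show "h (?c 0) = k (?c 0)" by simp
  next
    fix x y :: "('a, 'a list) module \<Rightarrow>\<^sub>0 int"
    assume xy: "Poly_Mapping.keys x \<subseteq> mod_cat R" "Poly_Mapping.keys y \<subseteq> mod_cat R"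
      and IH: "h (?c x) = k (?c x)" "h (?c y) = k (?c y)"
    have c: "x \<in> carrier FG" "y \<in> carrier FG" "x - y \<in> carrier FG"
      using xy by (auto dest!: subsetD[OF keys_diff])
    have e: "?c x = ?c (x - y) \<otimes>\<^bsub>IT_group R\<^esub> ?c y" using IT_coset_mult[OF c(3,2)] by simp
    have "h (?c (x - y)) \<otimes>\<^bsub>G\<^esub> h (?c y) = k (?c (x - y)) \<otimes>\<^bsub>G\<^esub> k (?c y)"
      using h.hom_mult[OF cc[OF c(3)] cc[OF c(2)]] k.hom_mult[OF cc[OF c(3)] cc[OF c(2)]] IH(1) e by simp
    then show "h (?c (x - y)) = k (?c (x - y))" using IH(2) cc c by simp
  next
    fix M assume "M \<in> mod_cat R"
    then show "h (?c (frag_of M)) = k (?c (frag_of M))" using eq unfolding IT_class_def by simp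
  qed
  then show ?thesis using u(2) by simp
qed

text \<open>The class of a module on an arbitrary type, through an isomorphic member of \<open>mod_cat\<close>.\<close>

definition mclass :: "('a, 'm) module \<Rightarrow> (('a, 'a list) module \<Rightarrow>\<^sub>0 int) set" where
  "mclass M = IT_class R (SOME M'. M' \<in> mod_cat R \<and> module_isomorphic R M M')"

lemma mclass_eq:
  assumes M: "right_module R M" and M': "M' \<in> mod_cat R" and iso: "module_isomorphic R M M'"
  shows "mclass M = IT_class R M'"
proof -
  let ?N = "SOME M'. M' \<in> mod_cat R \<and> module_isomorphic R M M'"
  have N: "?N \<in> mod_cat R \<and> module_isomorphic R M ?N"
    by (rule someI[of _ M']) (use M' iso in simp)
  show ?thesis unfolding mclass_def
    by (rule IT_class_iso[OF _ M' module_isomorphic_trans[OF module_isomorphic_sym[OF M] iso]])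
      (use N in simp_all)
qed

lemma mclass_mod_cat: "M \<in> mod_cat R \<Longrightarrow> mclass M = IT_class R M"
  by (rule mclass_eq[OF mod_catD(1) _ module_isomorphic_refl])

lemma mclass_closed:
  assumes "right_module R M" "finite_length R M"
  shows "mclass M \<in> carrier (IT_group R)"
proof -
  obtain M' where M': "M' \<in> mod_cat R" "module_isomorphic R M M'" by (rule ex_mod_cat_iso[OF assms])
  show ?thesis using mclass_eq[OF assms(1) M'] IT_class_closed[OF M'(1)] by simp
qed

lemma mclass_iso:
  assumes M: "right_module R M" "finite_length R M" and N: "right_module R N" and iso: "module_isomorphic R M N"
  shows "mclass M = mclass N"
proof -
  have fN: "finite_length R N" using length_iso(1)[OF M(1) N iso] M(2) by simp
  obtain N' where N': "N' \<in> mod_cat R" "module_isomorphic R N N'" by (rule ex_mod_cat_iso[OF N fN])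
  show ?thesis
    using mclass_eq[OF N N'] mclass_eq[OF M(1) N'(1) module_isomorphic_trans[OF iso N'(2)]] by simp
qed

lemma mclass_direct_sum:
  assumes M: "right_module R M" "finite_length R M" and N: "right_module R N" "finite_length R N"
  shows "mclass (direct_sum M N) = mclass M \<otimes>\<^bsub>IT_group R\<^esub> mclass N"
proof -
  obtain M' where M': "M' \<in> mod_cat R" "module_isomorphic R M M'" by (rule ex_mod_cat_iso[OF M])
  obtain N' where N': "N' \<in> mod_cat R" "module_isomorphic R N N'" by (rule ex_mod_cat_iso[OF N])
  obtain S where S: "S \<in> mod_cat R" "module_isomorphic R (direct_sum M' N') S"
    by (rule ex_direct_sum[OF M'(1) N'(1)])
  note r = mod_catD(1)
  have 1: "module_isomorphic R (direct_sum M N) S"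
    by (rule module_isomorphic_trans[OF module_isomorphic_direct_sum_cong[OF M'(2) N'(2)] S(2)])
  have 2: "module_isomorphic R S (direct_sum M' N')"
    by (rule module_isomorphic_sym[OF right_module_direct_sum[OF r[OF M'(1)] r[OF N'(1)]] S(2)])
  show ?thesis
    using mclass_eq[OF right_module_direct_sum[OF M(1) N(1)] S(1) 1] mclass_eq[OF M(1) M'] mclass_eq[OF N(1) N']
      IT_class_direct_sum[OF S(1) M'(1) N'(1) 2] by simp
qed

lemma mclass_projective:
  assumes P: "projective_module R P" "finite_length R P"
  shows "mclass P = \<one>\<^bsub>IT_group R\<^esub>"
proof -
  note P' = projective_moduleD[OF P(1)]
  obtain Q where Q: "Q \<in> mod_cat R" "module_isomorphic R P Q" by (rule ex_mod_cat_iso[OF P' P(2)])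
  show ?thesis
    using mclass_eq[OF P' Q] IT_class_projective[OF Q(1) projective_module_iso[OF P(1) mod_catD(1)[OF Q(1)] Q(2)]]
    by simp
qed

text \<open>By Schanuel's lemma, because projective modules have trivial class.\<close>

lemma mclass_kernel:
  assumes P: "projective_module R P" "finite_length R P" and Q: "projective_module R Q" "finite_length R Q"
    and M: "right_module R M" and p: "p \<in> right_module_hom R P M" "p ` carrier P = carrier M"
    and q: "q \<in> right_module_hom R Q M" "q ` carrier Q = carrier M"
  shows "mclass (P\<lparr>carrier := a_kernel P M p\<rparr>) = mclass (Q\<lparr>carrier := a_kernel Q M q\<rparr>)"
proof -
  interpret K: comm_group "IT_group R" by (rule comm_group_IT_group)
  note P' = projective_moduleD[OF P(1)] and Q' = projective_moduleD[OF Q(1)]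
  note sP = submodule_a_kernel[OF P' M p(1)] and sQ = submodule_a_kernel[OF Q' M q(1)]
  let ?KP = "P\<lparr>carrier := a_kernel P M p\<rparr>" and ?KQ = "Q\<lparr>carrier := a_kernel Q M q\<rparr>"
  have KP: "right_module R ?KP" "finite_length R ?KP"
    by (rule right_module.right_module_submodule[OF P' sP]) (rule length_submodule(1)[OF P' sP P(2)])
  have KQ: "right_module R ?KQ" "finite_length R ?KQ"
    by (rule right_module.right_module_submodule[OF Q' sQ]) (rule length_submodule(1)[OF Q' sQ Q(2)])
  have "module_isomorphic R (direct_sum ?KP Q) (direct_sum ?KQ P)"
    by (rule schanuel[OF P(1) finite_length_imp_fg[OF P' P(2)] Q(1) finite_length_imp_fg[OF Q' Q(2)] M p q])
  from mclass_iso[OF right_module_direct_sum[OF KP(1) Q'] length_direct_sum(1)[OF KP(1) Q' KP(2) Q(2)]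
      right_module_direct_sum[OF KQ(1) P'] this]
  show ?thesis
    using mclass_direct_sum[OF KP Q' Q(2)] mclass_direct_sum[OF KQ P' P(2)]
      mclass_projective[OF P] mclass_projective[OF Q] mclass_closed[OF KP] mclass_closed[OF KQ] by simp
qed

lemma mclass_kernel_iso:
  assumes P: "projective_module R P" "finite_length R P" and Q: "projective_module R Q" "finite_length R Q"
    and M: "right_module R M" and p: "p \<in> right_module_hom R P M" "p ` carrier P = carrier M"
    and N: "right_module R N" and q: "q \<in> right_module_hom R Q N" "q ` carrier Q = carrier N"
    and iso: "module_isomorphic R M N"
  shows "mclass (P\<lparr>carrier := a_kernel P M p\<rparr>) = mclass (Q\<lparr>carrier := a_kernel Q N q\<rparr>)"
proof -
  note P' = projective_moduleD[OF P(1)]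
  obtain f where f: "f \<in> right_module_hom R M N" "inj_on f (carrier M)" "f ` carrier M = carrier N"
    using iso by (rule module_isomorphicE)
  have fp: "(\<lambda>x. f (p x)) \<in> right_module_hom R P N" by (rule right_module_hom_comp[OF p(1) f(1)])
  have s: "(\<lambda>x. f (p x)) ` carrier P = carrier N" using p(2) f(3) by (simp flip: image_image)
  have "a_kernel P N (\<lambda>x. f (p x)) = a_kernel P M p"
    using f(2) inj_on_hom_iff[OF M N f(1)] right_module_hom_zero[OF M N f(1)] right_module_homD(1)[OF p(1)]
    by (auto simp: a_kernel_iff set_eq_iff)
  then show ?thesis using mclass_kernel[OF P Q N fp s q] by simp
qed

text \<open>
  The direct sum of covers of \<open>B\<close> and \<open>C\<close> presents \<open>B \<oplus> C\<close>, and the identity presents a projective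
  module with zero kernel. As the class of the kernel is independent of the presentation, the
  syzygy respects the defining relations.
\<close>

lemma IT_syzygy_exists:
  "\<exists>h. h \<in> hom (IT_group R) (IT_group R) \<and> (\<forall>M\<in>mod_cat R. h (IT_class R M) = IT_class R (syzygy R M))"
proof -
  have fl: "finite_length R M" if "M \<in> mod_cat R" for M using that by (simp add: mod_cat_iff)
  show ?thesis
  proof (rule IT_group_hom_exists[OF comm_group_IT_group, where \<Phi> = "\<lambda>M. IT_class R (syzygy R M)"])
    fix M assume "M \<in> mod_cat R"
    then show "IT_class R (syzygy R M) \<in> carrier (IT_group R)" by (intro IT_class_closed syzygy_mod_cat)
  next
    fix A B C assume ABC: "A \<in> mod_cat R" "B \<in> mod_cat R" "C \<in> mod_cat R"
      and iso: "module_isomorphic R A (direct_sum B C)"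
    obtain P p where P: "P \<in> mod_cat R" "projective_module R P" "p \<in> right_module_hom R P A"
      "p ` carrier P = carrier A" "syzygy R A = P\<lparr>carrier := a_kernel P A p\<rparr>"
      by (rule syzygy_cover[OF ABC(1)])
    obtain Q q where Q: "Q \<in> mod_cat R" "projective_module R Q" "q \<in> right_module_hom R Q B"
      "q ` carrier Q = carrier B" "syzygy R B = Q\<lparr>carrier := a_kernel Q B q\<rparr>"
      by (rule syzygy_cover[OF ABC(2)])
    obtain T t where T: "T \<in> mod_cat R" "projective_module R T" "t \<in> right_module_hom R T C"
      "t ` carrier T = carrier C" "syzygy R C = T\<lparr>carrier := a_kernel T C t\<rparr>"
      by (rule syzygy_cover[OF ABC(3)])
    note r = mod_catD(1)
    let ?D = "direct_sum Q T"
    have "a_kernel ?D (direct_sum B C) (map_prod q t) = a_kernel Q B q \<times> a_kernel T C t"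
      by (auto simp: a_kernel_iff)
    then have K: "?D\<lparr>carrier := a_kernel ?D (direct_sum B C) (map_prod q t)\<rparr> = direct_sum (syzygy R B) (syzygy R C)"
      unfolding Q(5) T(5) by (simp only: direct_sum_carrier_update)
    have "mclass (syzygy R A) = mclass (direct_sum (syzygy R B) (syzygy R C))"
      unfolding K[symmetric] P(5)
      by (rule mclass_kernel_iso[OF P(2) fl[OF P(1)] projective_direct_sum[OF Q(2) T(2)]
            length_direct_sum(1)[OF r[OF Q(1)] r[OF T(1)] fl[OF Q(1)] fl[OF T(1)]] r[OF ABC(1)] P(3,4)
            right_module_direct_sum[OF r[OF ABC(2)] r[OF ABC(3)]] hom_map_prod[OF Q(3) T(3)] _ iso])
        (use Q(4) T(4) in \<open>simp add: map_prod_surj_on\<close>)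
    also have "\<dots> = mclass (syzygy R B) \<otimes>\<^bsub>IT_group R\<^esub> mclass (syzygy R C)"
      using syzygy_mod_cat ABC by (intro mclass_direct_sum r fl)
    finally show "IT_class R (syzygy R A) = IT_class R (syzygy R B) \<otimes>\<^bsub>IT_group R\<^esub> IT_class R (syzygy R C)"
      using syzygy_mod_cat ABC by (simp add: mclass_mod_cat)
  next
    fix P assume P: "P \<in> mod_cat R" "projective_module R P"
    obtain Q q where Q: "Q \<in> mod_cat R" "projective_module R Q" "q \<in> right_module_hom R Q P"
      "q ` carrier Q = carrier P" "syzygy R P = Q\<lparr>carrier := a_kernel Q P q\<rparr>"
      by (rule syzygy_cover[OF P(1)])
    note r = mod_catD(1)
    let ?Z = "P\<lparr>carrier := a_kernel P P (\<lambda>x. x)\<rparr>"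
    have sub: "submodule (a_kernel P P (\<lambda>x. x)) R P"
      by (rule submodule_a_kernel[OF r[OF P(1)] r[OF P(1)] right_module_hom_id])
    note Z = mod_cat_submodule[OF P(1) sub]
    have zZ: "zero_module ?Z"
      using right_module.right_submoduleE(2)[OF r[OF P(1)] sub] by (auto simp: zero_module_def a_kernel_iff)
    have "mclass (syzygy R P) = mclass ?Z"
      unfolding Q(5) by (rule mclass_kernel[OF Q(2) fl[OF Q(1)] P(2) fl[OF P(1)] r[OF P(1)] Q(3,4) right_module_hom_id]) simp
    also have "\<dots> = \<one>\<^bsub>IT_group R\<^esub>"
      by (rule mclass_projective[OF projective_zero_module[OF r[OF Z] zZ] fl[OF Z]])
    finally show "IT_class R (syzygy R P) = \<one>\<^bsub>IT_group R\<^esub>"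
      using mclass_mod_cat[OF syzygy_mod_cat[OF P(1)]] by simp
  next
    fix h assume "h \<in> hom (IT_group R) (IT_group R)"
      "\<And>M. M \<in> mod_cat R \<Longrightarrow> h (IT_class R M) = IT_class R (syzygy R M)"
    then show ?thesis by blast
  qed
qed

lemma IT_syzygy_hom: "IT_syzygy R \<in> hom (IT_group R) (IT_group R)"
  and IT_syzygy_class: "M \<in> mod_cat R \<Longrightarrow> IT_syzygy R (IT_class R M) = IT_class R (syzygy R M)"
  using someI_ex[OF IT_syzygy_exists] unfolding IT_syzygy_def by blast+

lemma IT_syzygy_presentation:
  assumes M: "M \<in> mod_cat R" and P: "projective_module R P" "finite_length R P"
    and p: "p \<in> right_module_hom R P M" "p ` carrier P = carrier M"
  shows "IT_syzygy R (IT_class R M) = mclass (P\<lparr>carrier := a_kernel P M p\<rparr>)"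
proof -
  obtain Q q where Q: "Q \<in> mod_cat R" "projective_module R Q" "q \<in> right_module_hom R Q M"
    "q ` carrier Q = carrier M" "syzygy R M = Q\<lparr>carrier := a_kernel Q M q\<rparr>"
    by (rule syzygy_cover[OF M])
  have fQ: "finite_length R Q" using Q(1) by (simp add: mod_cat_iff)
  have "mclass (syzygy R M) = mclass (P\<lparr>carrier := a_kernel P M p\<rparr>)"
    unfolding Q(5) by (rule mclass_kernel[OF Q(2) fQ P mod_catD(1)[OF M] Q(3,4) p])
  then show ?thesis using IT_syzygy_class[OF M] mclass_mod_cat[OF syzygy_mod_cat[OF M]] by simp
qed

end

section \<open>Ranks of subgroups\<close>

lemma (in comm_group) hom_finprod:
  assumes H: "comm_group H" and h: "h \<in> hom G H" and f: "f \<in> A \<rightarrow> carrier G"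
  shows "h (finprod G f A) = finprod H (\<lambda>a. h (f a)) A"
proof -
  interpret H: comm_group H by fact
  interpret h: group_hom G H h using h by (simp add: group_hom_def group_hom_axioms_def H.is_group is_group)
  show ?thesis
    using f
  proof (induction A rule: infinite_finite_induct)
    case (insert a A)
    then have "f \<in> A \<rightarrow> carrier G" "f a \<in> carrier G" by auto
    then show ?case using insert by (simp add: Pi_iff)
  qed simp_all
qed

lemma (in comm_group) hom_finprod_pow:
  assumes h: "h \<in> hom G G" and B: "B \<subseteq> carrier G"
  shows "h (finprod G (\<lambda>b. b [^] (c b :: int)) B) = finprod G (\<lambda>b. h b [^] c b) B"
proof -
  interpret h: group_hom G G h using h by (simp add: group_hom_def group_hom_axioms_def is_group)
  have "h (finprod G (\<lambda>b. b [^] (c b :: int)) B) = finprod G (\<lambda>b. h (b [^] c b)) B"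
    by (rule hom_finprod[OF comm_group_axioms h]) (use B in auto)
  also have "\<dots> = finprod G (\<lambda>b. h b [^] c b) B"
    by (rule finprod_cong') (use B in \<open>auto simp: h.hom_int_pow\<close>)
  finally show ?thesis .
qed

lemma (in comm_group) Z_independent_image:
  assumes h: "h \<in> hom G G" "inj_on h (carrier G)" and B: "B \<subseteq> carrier G"
  shows "Z_independent G (h ` B) \<longleftrightarrow> Z_independent G B"
proof -
  interpret h: group_hom G G h using h by (simp add: group_hom_def group_hom_axioms_def is_group)
  have inj: "inj_on h B" using h(2) B by (rule inj_on_subset)
  have key: "finprod G (\<lambda>b. b [^] (c b :: int)) (h ` B) = \<one> \<longleftrightarrow> finprod G (\<lambda>b. b [^] c (h b)) B = \<one>" for c
  proof -
    have "finprod G (\<lambda>b. b [^] c b) (h ` B) = finprod G (\<lambda>b. h b [^] c (h b)) B"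
      by (rule finprod_reindex[OF _ inj]) (use B in auto)
    also have "\<dots> = h (finprod G (\<lambda>b. b [^] c (h b)) B)"
      by (rule hom_finprod_pow[OF h(1) B, symmetric])
    finally show ?thesis
      using inj_onD[OF h(2), of "finprod G (\<lambda>b. b [^] c (h b)) B" \<one>] B by (auto simp: subset_iff)
  qed
  have "(\<forall>c :: 'a \<Rightarrow> int. finprod G (\<lambda>b. b [^] c b) (h ` B) = \<one> \<longrightarrow> (\<forall>b\<in>h ` B. c b = 0)) \<longleftrightarrow>
    (\<forall>c :: 'a \<Rightarrow> int. finprod G (\<lambda>b. b [^] c b) B = \<one> \<longrightarrow> (\<forall>b\<in>B. c b = 0))" (is "?L \<longleftrightarrow> ?R")
  proof
    assume L: ?L
    show ?R
    proof (intro allI impI ballI)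
      fix c :: "'a \<Rightarrow> int" and b assume c: "finprod G (\<lambda>b. b [^] c b) B = \<one>" and b: "b \<in> B"
      have "finprod G (\<lambda>b. b [^] c (inv_into B h (h b))) B = finprod G (\<lambda>b. b [^] c b) B"
        by (rule finprod_cong') (use B inj in auto)
      then have "finprod G (\<lambda>b. b [^] c (inv_into B h b)) (h ` B) = \<one>"
        using key[of "\<lambda>b. c (inv_into B h b)"] c by simp
      then have "c (inv_into B h (h b)) = 0" using L[rule_format, of "\<lambda>b. c (inv_into B h b)"] b by blast
      then show "c b = 0" using b inj by simp
    qed
  next
    assume R: ?R
    then show ?L using key by fast
  qed
  then show ?thesis unfolding Z_independent_def using B inj by (auto simp: finite_image_iff)
qed

lemma (in comm_group) abelian_rank_inj_image:
  assumes h: "h \<in> hom G G" "inj_on h (carrier G)" and H: "H \<subseteq> carrier G"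
  shows "abelian_rank G (h ` H) = abelian_rank G H"
proof -
  have "{B. B \<subseteq> h ` H \<and> Z_independent G B} = (`) h ` {B. B \<subseteq> H \<and> Z_independent G B}"
  proof (intro equalityI subsetI)
    fix B assume "B \<in> {B. B \<subseteq> h ` H \<and> Z_independent G B}"
    then obtain A where A: "A \<subseteq> H" "B = h ` A" "Z_independent G B" by (auto simp: subset_image_iff)
    then have "Z_independent G A" using Z_independent_image[OF h] H by (metis subset_trans)
    then show "B \<in> (`) h ` {B. B \<subseteq> H \<and> Z_independent G B}" using A by blast
  next
    fix B assume "B \<in> (`) h ` {B. B \<subseteq> H \<and> Z_independent G B}"
    then obtain A where A: "A \<subseteq> H" "B = h ` A" "Z_independent G A" by blast
    then have "Z_independent G B" using Z_independent_image[OF h] H by (metis subset_trans)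
    then show "B \<in> {B. B \<subseteq> h ` H \<and> Z_independent G B}" using A by blast
  qed
  then have "abelian_rank G (h ` H) = (SUP B\<in>{B. B \<subseteq> H \<and> Z_independent G B}. enat (card (h ` B)))"
    unfolding abelian_rank_def by (simp only: image_image)
  also have "\<dots> = abelian_rank G H"
    unfolding abelian_rank_def
  proof (rule SUP_cong[OF refl])
    fix B assume "B \<in> {B. B \<subseteq> H \<and> Z_independent G B}"
    then have "inj_on h B" using H by (intro inj_on_subset[OF h(2)]) auto
    then show "enat (card (h ` B)) = enat (card B)" by (simp add: card_image)
  qed
  finally show ?thesis .
qed

text \<open>
  Independent elements of the image have independent preimages.
\<close>

lemma (in comm_group) abelian_rank_image_le:
  assumes h: "h \<in> hom G G" and H: "H \<subseteq> carrier G"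
  shows "abelian_rank G (h ` H) \<le> abelian_rank G H"
  unfolding abelian_rank_def
proof (rule SUP_mono)
  fix B assume "B \<in> {B. B \<subseteq> h ` H \<and> Z_independent G B}"
  then have B: "B \<subseteq> h ` H" "Z_independent G B" by simp_all
  obtain A where A: "A \<subseteq> H" "inj_on h A" "B = h ` A" using B(1) unfolding subset_image_inj by blast
  have Ac: "A \<subseteq> carrier G" using A(1) H by blast
  have "Z_independent G A"
    unfolding Z_independent_def
  proof (intro conjI allI impI ballI Ac)
    show "finite A" using B(2) A(2,3) unfolding Z_independent_def by (simp add: finite_image_iff)
    fix c :: "'a \<Rightarrow> int" and a assume c: "finprod G (\<lambda>b. b [^] c b) A = \<one>" and a: "a \<in> A"
    have hA: "h b \<in> carrier G" if "b \<in> A" for b using hom_in_carrier[OF h] Ac that by blast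
    have "finprod G (\<lambda>b. b [^] c (inv_into A h b)) B = finprod G (\<lambda>b. h b [^] c (inv_into A h (h b))) A"
      unfolding A(3) by (rule finprod_reindex[OF _ A(2)]) (use hA in auto)
    also have "\<dots> = finprod G (\<lambda>b. h b [^] c b) A"
      by (rule finprod_cong') (use hA A(2) in auto)
    also have "\<dots> = h (finprod G (\<lambda>b. b [^] c b) A)" by (rule hom_finprod_pow[OF h Ac, symmetric])
    also have "\<dots> = \<one>" using c hom_one[OF h is_group is_group] by simp
    finally have "c (inv_into A h (h a)) = 0"
      using B(2) a A(3) unfolding Z_independent_def by fast
    then show "c a = 0" using a A(2) by simp
  qed
  then show "\<exists>A\<in>{B. B \<subseteq> H \<and> Z_independent G B}. enat (card B) \<le> enat (card A)"
    using A by (intro bexI[of _ A]) (auto simp: card_image)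
qed

text \<open>Gaussian elimination: a vector \<open>b0\<close> that does not vanish at \<open>j\<close> clears this coordinate in the others.\<close>

lemma integer_dependent:
  fixes a :: "'b \<Rightarrow> 'c \<Rightarrow> int"
  assumes "finite C" "finite B" "card C < card B"
  shows "\<exists>c. (\<exists>b\<in>B. c b \<noteq> 0) \<and> (\<forall>j\<in>C. (\<Sum>b\<in>B. c b * a b j) = 0)"
  using assms
proof (induction C arbitrary: B a rule: finite_induct)
  case empty
  then have "B \<noteq> {}" by auto
  then show ?case by (intro exI[of _ "\<lambda>_. 1"]) auto
next
  case (insert j C)
  show ?case
  proof (cases "\<forall>b\<in>B. a b j = 0")
    case True
    have "card C < card B" using insert by simp
    from insert.IH[OF insert.prems(1) this, of a] obtain c
      where "\<exists>b\<in>B. c b \<noteq> 0" "\<forall>j\<in>C. (\<Sum>b\<in>B. c b * a b j) = 0" by blast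
    then show ?thesis using True by (intro exI[of _ c]) simp
  next
    case False
    then obtain b0 where b0: "b0 \<in> B" "a b0 j \<noteq> 0" by blast
    let ?B = "B - {b0}"
    have "card C < card ?B" using insert b0(1) by simp
    from insert.IH[OF _ this, of "\<lambda>b i. a b0 j * a b i - a b j * a b0 i"] insert.prems(1)
    obtain c where c: "\<exists>b\<in>?B. c b \<noteq> 0" "\<forall>i\<in>C. (\<Sum>b\<in>?B. c b * (a b0 j * a b i - a b j * a b0 i)) = 0"
      by auto
    define d where "d b = (if b = b0 then - (\<Sum>b\<in>?B. c b * a b j) else c b * a b0 j)" for b
    have sum: "(\<Sum>b\<in>B. d b * a b i) = - (\<Sum>b\<in>?B. c b * a b j) * a b0 i + (\<Sum>b\<in>?B. c b * a b0 j * a b i)" for i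
    proof -
      have "(\<Sum>b\<in>B. d b * a b i) = d b0 * a b0 i + (\<Sum>b\<in>?B. d b * a b i)"
        by (rule sum.remove[OF insert.prems(1) b0(1)])
      also have "(\<Sum>b\<in>?B. d b * a b i) = (\<Sum>b\<in>?B. c b * a b0 j * a b i)"
        by (rule sum.cong) (auto simp: d_def)
      finally show ?thesis by (simp add: d_def)
    qed
    have "\<exists>b\<in>B. d b \<noteq> 0" using c(1) b0(2) by (auto simp: d_def)
    moreover have "(\<Sum>b\<in>B. d b * a b i) = 0" if "i \<in> insert j C" for i
    proof (cases "i = j")
      case True
      have "(\<Sum>b\<in>?B. c b * a b0 j * a b j) = (\<Sum>b\<in>?B. c b * a b j) * a b0 j"
        unfolding sum_distrib_right by (rule sum.cong) simp_all
      then show ?thesis unfolding sum True by simp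
    next
      case False
      have "(\<Sum>b\<in>?B. c b * (a b0 j * a b i - a b j * a b0 i)) =
        (\<Sum>b\<in>?B. c b * a b0 j * a b i) - (\<Sum>b\<in>?B. c b * a b j) * a b0 i"
        unfolding sum_distrib_right sum_subtractf[symmetric] by (rule sum.cong) (simp_all add: algebra_simps)
      then show ?thesis unfolding sum using c(2) that False by simp
    qed
    ultimately show ?thesis by blast
  qed
qed

lemma (in comm_group) generate_finprod:
  assumes C: "finite C" "C \<subseteq> carrier G" and y: "y \<in> generate G C"
  shows "\<exists>a :: 'a \<Rightarrow> int. y = finprod G (\<lambda>g. g [^] a g) C"
  using y
proof (induction rule: generate.induct)
  case one
  have "\<one> = finprod G (\<lambda>g. g [^] (0 :: int)) C" by simp
  then show ?case by (intro exI[of _ "\<lambda>_. 0"])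
next
  case (incl g)
  have "finprod G (\<lambda>x. x [^] (if g = x then 1 else 0 :: int)) C = finprod G (\<lambda>x. if g = x then x else \<one>) C"
    by (rule finprod_cong') (use C(2) in auto)
  also have "\<dots> = g" using finprod_singleton[OF incl C(1), of "\<lambda>x. x"] C(2) by auto
  finally show ?case by metis
next
  case (inv g)
  have "finprod G (\<lambda>x. x [^] (if g = x then - 1 else 0 :: int)) C = finprod G (\<lambda>x. if g = x then inv x else \<one>) C"
    by (rule finprod_cong') (use C(2) in \<open>auto simp: int_pow_neg\<close>)
  also have "\<dots> = inv g" using finprod_singleton[OF inv C(1), of "\<lambda>x. inv x"] C(2) by auto
  finally show ?case by metis
next
  case (eng y z)
  then obtain a b :: "'a \<Rightarrow> int" where ab: "y = finprod G (\<lambda>g. g [^] a g) C" "z = finprod G (\<lambda>g. g [^] b g) C" by blast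
  have "finprod G (\<lambda>g. g [^] (a g + b g)) C = finprod G (\<lambda>g. g [^] a g \<otimes> g [^] b g) C"
    by (rule finprod_cong') (use C(2) in \<open>auto simp: int_pow_mult\<close>)
  also have "\<dots> = y \<otimes> z" unfolding ab by (rule finprod_multf) (use C(2) in auto)
  finally show ?case by metis
qed

lemma (in comm_group) Z_independent_card_le:
  assumes C: "finite C" "C \<subseteq> carrier G" and B: "B \<subseteq> generate G C" "Z_independent G B"
  shows "card B \<le> card C"
proof (rule ccontr)
  assume "\<not> card B \<le> card C"
  have fB: "finite B" and Bc: "B \<subseteq> carrier G" using B(2) unfolding Z_independent_def by auto
  have "\<forall>b\<in>B. \<exists>a :: 'a \<Rightarrow> int. b = finprod G (\<lambda>g. g [^] a g) C"
    using generate_finprod[OF C] B(1) by blast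
  from bchoice[OF this] obtain a :: "'a \<Rightarrow> 'a \<Rightarrow> int"
    where a: "\<And>b. b \<in> B \<Longrightarrow> b = finprod G (\<lambda>g. g [^] a b g) C" by auto
  obtain c where c: "\<exists>b\<in>B. c b \<noteq> 0" "\<forall>g\<in>C. (\<Sum>b\<in>B. c b * a b g) = 0"
    using integer_dependent[OF C(1) fB, of a] \<open>\<not> card B \<le> card C\<close> by auto
  have gC: "g [^] n \<in> carrier G" if "g \<in> C" for g and n :: int using C(2) that by auto
  have "finprod G (\<lambda>b. b [^] c b) A = finprod G (\<lambda>g. g [^] (\<Sum>b\<in>A. c b * a b g)) C" if "A \<subseteq> B" for A
    using finite_subset[OF that fB] that
  proof (induction A rule: finite_induct)
    case empty
    then show ?case by simp
  next
    case (insert b A)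
    have b: "b \<in> B" "b \<in> carrier G" using insert.prems Bc by auto
    have pow: "(\<lambda>x. x [^] c b) \<in> hom G G" unfolding hom_def by (auto simp: int_pow_distrib)
    have "b [^] c b = (finprod G (\<lambda>g. g [^] a b g) C) [^] c b" using a[OF b(1)] by simp
    also have "\<dots> = finprod G (\<lambda>g. (g [^] a b g) [^] c b) C"
      by (rule hom_finprod[OF comm_group_axioms pow]) (use gC in auto)
    also have "\<dots> = finprod G (\<lambda>g. g [^] (c b * a b g)) C"
      by (rule finprod_cong') (use C(2) gC in \<open>auto simp: int_pow_pow mult.commute\<close>)
    finally have 1: "b [^] c b = finprod G (\<lambda>g. g [^] (c b * a b g)) C" .
    have "finprod G (\<lambda>b. b [^] c b) (insert b A) = b [^] c b \<otimes> finprod G (\<lambda>b. b [^] c b) A"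
      by (rule finprod_insert) (use insert b Bc in auto)
    also have "\<dots> = finprod G (\<lambda>g. g [^] (c b * a b g)) C \<otimes> finprod G (\<lambda>g. g [^] (\<Sum>b\<in>A. c b * a b g)) C"
      using insert unfolding 1 by simp
    also have "\<dots> = finprod G (\<lambda>g. g [^] (c b * a b g) \<otimes> g [^] (\<Sum>b\<in>A. c b * a b g)) C"
      by (rule finprod_multf[symmetric]) (use gC in auto)
    also have "\<dots> = finprod G (\<lambda>g. g [^] (\<Sum>b\<in>insert b A. c b * a b g)) C"
      by (rule finprod_cong') (use C(2) insert gC in \<open>auto simp: int_pow_mult\<close>)
    finally show ?case .
  qed
  from this[OF order_refl] have "finprod G (\<lambda>b. b [^] c b) B = finprod G (\<lambda>g. g [^] (\<Sum>b\<in>B. c b * a b g)) C" .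
  also have "\<dots> = \<one>" by (rule finprod_one_eqI) (simp add: c(2))
  finally show False using B(2) c(1) unfolding Z_independent_def by blast
qed

text \<open>
  An independent set lifted from the image stays independent after adding an element of infinite
  order from the kernel, so such an element would make the rank of the subgroup exceed that of its
  image.
\<close>

lemma (in comm_group) torsion_kernel_if_rank_eq:
  assumes C: "finite C" "C \<subseteq> carrier G" and h: "h \<in> hom G G"
    and rank: "abelian_rank G (h ` generate G C) = abelian_rank G (generate G C)"
    and x: "x \<in> generate G C" "h x = \<one>"
  obtains k :: int where "k \<noteq> 0" "x [^] k = \<one>"
proof (rule ccontr)
  assume neg: "\<not> thesis"
  let ?H = "generate G C"
  have Hc: "?H \<subseteq> carrier G" using generate_incl[OF C(2)] .
  interpret h: group_hom G G h using h by (simp add: group_hom_def group_hom_axioms_def is_group)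
  let ?P = "\<lambda>B. B \<subseteq> ?H \<and> Z_independent G B"
  have bnd: "card B \<le> card C" if "?P B" for B using Z_independent_card_le[OF C] that by blast
  have P0: "?P {}" by (simp add: Z_independent_def)
  obtain B1 where B1: "?P B1" and max: "\<And>B. ?P B \<Longrightarrow> card B \<le> card B1"
    using ex_has_greatest_nat[of ?P "{}" card "Suc (card C)"] P0 bnd by (auto simp: less_Suc_eq_le)
  have rankH: "abelian_rank G ?H = enat (card B1)"
    unfolding abelian_rank_def
    by (intro antisym SUP_least SUP_upper2[of B1]) (use B1 max in auto)
  let ?Q = "\<lambda>B. B \<subseteq> h ` ?H \<and> Z_independent G B"
  have le: "enat (card B) \<le> enat (card B1)" if "?Q B" for B
  proof -
    have "enat (card B) \<le> abelian_rank G (h ` ?H)"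
      unfolding abelian_rank_def by (rule SUP_upper) (use that in simp)
    then show ?thesis using rank rankH by simp
  qed
  have Q0: "?Q {}" by (simp add: Z_independent_def)
  obtain B where B: "?Q B" and maxB: "\<And>A. ?Q A \<Longrightarrow> card A \<le> card B"
    using ex_has_greatest_nat[of ?Q "{}" card "Suc (card B1)"] Q0 le by (auto simp: less_Suc_eq_le)
  have "abelian_rank G (h ` ?H) = enat (card B)"
    unfolding abelian_rank_def
    by (intro antisym SUP_least SUP_upper2[of B]) (use B maxB in auto)
  then have card: "card B = card B1" using rank rankH by simp
  obtain A where A: "A \<subseteq> ?H" "inj_on h A" "B = h ` A" using B unfolding subset_image_inj by blast
  have Ac: "A \<subseteq> carrier G" using A(1) Hc by blast
  have fB: "finite B" and indB: "\<And>c :: 'a \<Rightarrow> int. finprod G (\<lambda>b. b [^] c b) B = \<one> \<Longrightarrow> \<forall>b\<in>B. c b = 0"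
    using B unfolding Z_independent_def by blast+
  have fA: "finite A" using fB A(2,3) by (simp add: finite_image_iff)
  have xc: "x \<in> carrier G" using x(1) Hc by blast
  have hA: "h b \<in> carrier G" if "b \<in> A" for b using Ac that by auto
  have indA: "\<forall>a\<in>A. c a = 0" if c: "finprod G (\<lambda>b. h b [^] (c b :: int)) A = \<one>" for c
  proof
    fix a assume a: "a \<in> A"
    have "finprod G (\<lambda>b. b [^] c (inv_into A h b)) B = finprod G (\<lambda>b. h b [^] c (inv_into A h (h b))) A"
      unfolding A(3) by (rule finprod_reindex[OF _ A(2)]) (use hA in auto)
    also have "\<dots> = finprod G (\<lambda>b. h b [^] c b) A"
      by (rule finprod_cong') (use hA A(2) in auto)
    finally have "c (inv_into A h (h a)) = 0" using indB[of "\<lambda>b. c (inv_into A h b)"] c a A(3) by auto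
    then show "c a = 0" using a A(2) by simp
  qed
  have xA: "x \<notin> A"
  proof
    assume xA: "x \<in> A"
    have "finprod G (\<lambda>b. h b [^] (if b = x then 1 else 0 :: int)) A = \<one>"
      by (rule finprod_one_eqI) (use x(2) in auto)
    from indA[OF this] xA show False by auto
  qed
  have "Z_independent G (insert x A)"
    unfolding Z_independent_def
  proof (intro conjI allI impI)
    show "finite (insert x A)" "insert x A \<subseteq> carrier G" using fA xc Ac by auto
    fix c :: "'a \<Rightarrow> int" assume "finprod G (\<lambda>b. b [^] c b) (insert x A) = \<one>"
    then have c: "x [^] c x \<otimes> finprod G (\<lambda>b. b [^] c b) A = \<one>"
      using finprod_insert[OF fA xA, of "\<lambda>b. b [^] c b"] xc Ac by (auto simp: Pi_iff subset_iff)
    have fc: "finprod G (\<lambda>b. b [^] c b) A \<in> carrier G" by (rule finprod_closed) (use Ac in auto)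
    have "h (x [^] c x \<otimes> finprod G (\<lambda>b. b [^] c b) A) = h (finprod G (\<lambda>b. b [^] c b) A)"
      using xc fc x(2) by (simp add: h.hom_int_pow)
    then have "finprod G (\<lambda>b. h b [^] c b) A = \<one>" unfolding c using hom_finprod_pow[OF h Ac] by simp
    from indA[OF this] have A0: "\<forall>a\<in>A. c a = 0" .
    then have "finprod G (\<lambda>b. b [^] c b) A = \<one>" by (intro finprod_one_eqI) auto
    then have "x [^] c x = \<one>" using c xc by simp
    then have "c x = 0" using neg that by blast
    then show "\<forall>b\<in>insert x A. c b = 0" using A0 by simp
  qed
  then have "card (insert x A) \<le> card B1" using max A(1) x(1) by blast
  moreover have "card B = card A" using A(2,3) by (simp add: card_image)
  ultimately show False using fA xA card by simp
qed

section \<open>Cosyzygies over a self-injective ring\<close>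

lemma hom_factor:
  assumes B: "right_module R B" and D: "right_module R D" and C: "right_module R C"
    and d: "d \<in> right_module_hom R B D" "d ` carrier B = carrier D"
    and f: "f \<in> right_module_hom R B C" and ker: "\<And>x. x \<in> carrier B \<Longrightarrow> d x = \<zero>\<^bsub>D\<^esub> \<Longrightarrow> f x = \<zero>\<^bsub>C\<^esub>"
  obtains f' where "f' \<in> right_module_hom R D C" "\<And>x. x \<in> carrier B \<Longrightarrow> f' (d x) = f x"
proof -
  interpret B: right_module R B by fact
  interpret D: right_module R D by fact
  interpret C: right_module R C by fact
  have eq: "f x = f y" if "x \<in> carrier B" "y \<in> carrier B" "d x = d y" for x y
  proof -
    have "d (x \<oplus>\<^bsub>B\<^esub> \<ominus>\<^bsub>B\<^esub> y) = \<zero>\<^bsub>D\<^esub>"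
      using that right_module_homD(1)[OF d(1)]
      by (simp add: right_module_homD(2)[OF d(1)] right_module_hom_neg[OF B D d(1)] D.M.r_neg)
    then have "f (x \<oplus>\<^bsub>B\<^esub> \<ominus>\<^bsub>B\<^esub> y) = \<zero>\<^bsub>C\<^esub>" by (intro ker) (use that in auto)
    then have "f x \<oplus>\<^bsub>C\<^esub> \<ominus>\<^bsub>C\<^esub> f y = \<zero>\<^bsub>C\<^esub>"
      using that by (simp add: right_module_homD(2)[OF f] right_module_hom_neg[OF B C f])
    then show ?thesis using right_module_homD(1)[OF f] that
      by (metis C.M.a_inv_closed C.M.minus_equality C.M.minus_minus)
  qed
  define s where "s y = inv_into (carrier B) d y" for y
  have s: "s y \<in> carrier B" "d (s y) = y" if "y \<in> carrier D" for y
    using that d(2) unfolding s_def by (simp_all add: inv_into_into f_inv_into_f)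
  have fs: "f (s (d x)) = f x" if "x \<in> carrier B" for x
    using eq[OF s(1) that s(2)] right_module_homD(1)[OF d(1) that] by simp
  show thesis
  proof (rule that[of "\<lambda>y. f (s y)"])
    show "(\<lambda>y. f (s y)) \<in> right_module_hom R D C"
    proof (rule right_module_homI)
      fix x y assume xy: "x \<in> carrier D" "y \<in> carrier D"
      have "d (s x \<oplus>\<^bsub>B\<^esub> s y) = x \<oplus>\<^bsub>D\<^esub> y" using xy s by (simp add: right_module_homD(2)[OF d(1)])
      then have "f (s (x \<oplus>\<^bsub>D\<^esub> y)) = f (s x \<oplus>\<^bsub>B\<^esub> s y)" using fs[of "s x \<oplus>\<^bsub>B\<^esub> s y"] s xy by simp
      then show "f (s (x \<oplus>\<^bsub>D\<^esub> y)) = f (s x) \<oplus>\<^bsub>C\<^esub> f (s y)" using s xy by (simp add: right_module_homD(2)[OF f])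
    next
      fix a x assume ax: "a \<in> carrier R" "x \<in> carrier D"
      have "d (a \<odot>\<^bsub>B\<^esub> s x) = a \<odot>\<^bsub>D\<^esub> x" using ax s by (simp add: right_module_homD(3)[OF d(1)])
      then have "f (s (a \<odot>\<^bsub>D\<^esub> x)) = f (a \<odot>\<^bsub>B\<^esub> s x)" using fs[of "a \<odot>\<^bsub>B\<^esub> s x"] s ax by simp
      then show "f (s (a \<odot>\<^bsub>D\<^esub> x)) = a \<odot>\<^bsub>C\<^esub> f (s x)" using s ax by (simp add: right_module_homD(3)[OF f])
    qed (use s right_module_homD(1)[OF f] in auto)
  qed (rule fs)
qed

context artinian_ring
begin

text \<open>
  The last condition makes the kernel of \<open>j\<close> as small as that of a map to a projective module can
  be; it replaces injectivity, since \<open>M\<close> need not embed in a projective module. Over a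
  self-injective ring the class of the cokernel \<open>C\<close> depends only on \<open>M\<close>.
\<close>

definition cosyzygy :: "('a, 'm) module \<Rightarrow> ('a, 'q) module \<Rightarrow> ('m \<Rightarrow> 'q) \<Rightarrow> ('a, 'c) module \<Rightarrow> ('q \<Rightarrow> 'c) \<Rightarrow> bool" where
  "cosyzygy M Q j C g \<longleftrightarrow> projective_module R Q \<and> finite_length R Q \<and> right_module R C \<and>
    j \<in> right_module_hom R M Q \<and> g \<in> right_module_hom R Q C \<and> g ` carrier Q = carrier C \<and>
    a_kernel Q C g = j ` carrier M \<and>
    (\<forall>Q'\<in>mod_cat R. projective_module R Q' \<longrightarrow>
      (\<forall>h\<in>right_module_hom R M Q'. \<forall>x\<in>carrier M. j x = \<zero>\<^bsub>Q\<^esub> \<longrightarrow> h x = \<zero>\<^bsub>Q'\<^esub>))"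

lemma cosyzygy_universal:
  assumes "cosyzygy M Q j C g" "Q' \<in> mod_cat R" "projective_module R Q'" "h \<in> right_module_hom R M Q'"
    and "x \<in> carrier M" "j x = \<zero>\<^bsub>Q\<^esub>"
  shows "h x = \<zero>\<^bsub>Q'\<^esub>"
  using assms unfolding cosyzygy_def by blast

lemma cosyzygy_kernel:
  assumes c: "cosyzygy M Q j C g" and M: "right_module R M" and P: "projective_module R P" "finite_length R P"
    and h: "h \<in> right_module_hom R M P" and x: "x \<in> carrier M" "j x = \<zero>\<^bsub>Q\<^esub>"
  shows "h x = \<zero>\<^bsub>P\<^esub>"
proof -
  note P' = projective_moduleD[OF P(1)]
  obtain Q' where Q': "Q' \<in> mod_cat R" "module_isomorphic R P Q'" by (rule ex_mod_cat_iso[OF P' P(2)])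
  note r = mod_catD(1)[OF Q'(1)]
  obtain f where f: "f \<in> right_module_hom R P Q'" "inj_on f (carrier P)" using Q'(2) by (rule module_isomorphicE)
  have "f (h x) = \<zero>\<^bsub>Q'\<^esub>"
    by (rule cosyzygy_universal[OF c Q'(1) projective_module_iso[OF P(1) r Q'(2)] right_module_hom_comp[OF h f(1)] x])
  then show ?thesis using f(2) inj_on_hom_iff[OF P' r f(1)] right_module_homD(1)[OF h x(1)] by blast
qed

text \<open>
  Take \<open>j : M \<rightarrow> Q\<close> with kernel of minimal length. Pairing \<open>j\<close> with another map \<open>h\<close> to a projective
  module intersects the kernels, so minimality forces \<open>ker j \<subseteq> ker h\<close>.
\<close>

lemma ex_cosyzygy:
  assumes M: "M \<in> mod_cat R"
  shows "\<exists>Q j C g. cosyzygy M (Q :: ('a, 'a list) module) j C g \<and> C \<in> mod_cat R"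
proof -
  note M' = mod_catD(1)[OF M]
  have fM: "finite_length R M" using M by (simp add: mod_cat_iff)
  let ?P = "\<lambda>(Q, j). Q \<in> mod_cat R \<and> projective_module R Q \<and> j \<in> right_module_hom R M Q"
  let ?l = "\<lambda>(Q :: ('a, 'a list) module, j). mod_length R (M\<lparr>carrier := a_kernel M Q j\<rparr>)"
  obtain Z where Z: "Z \<in> mod_cat R" "zero_module Z" by (rule ex_zero_module)
  have "?P (Z, \<lambda>_. \<zero>\<^bsub>Z\<^esub>)"
    using Z projective_zero_module[OF mod_catD(1)[OF Z(1)] Z(2)] right_module_hom_const_zero[OF mod_catD(1)[OF Z(1)]]
    by simp
  then obtain z where z: "?P z" and min: "\<And>y. ?P y \<Longrightarrow> ?l z \<le> ?l y"
    using ex_has_least_nat[of ?P _ ?l] by blast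
  obtain Q j where zQ: "z = (Q, j)" by (cases z)
  have Q: "Q \<in> mod_cat R" "projective_module R Q" and j: "j \<in> right_module_hom R M Q" using z zQ by simp_all
  note Q' = mod_catD(1)[OF Q(1)]
  have fQ: "finite_length R Q" using Q(1) by (simp add: mod_cat_iff)
  have univ: "h x = \<zero>\<^bsub>P\<^esub>" if P: "P \<in> mod_cat R" "projective_module R P" "h \<in> right_module_hom R M P"
    and x: "x \<in> carrier M" "j x = \<zero>\<^bsub>Q\<^esub>" for P :: "('a, 'a list) module" and h x
  proof -
    note P' = mod_catD(1)[OF P(1)]
    let ?D = "direct_sum Q P"
    note D = right_module_direct_sum[OF Q' P']
    obtain S where S: "S \<in> mod_cat R" "module_isomorphic R ?D S" by (rule ex_direct_sum[OF Q(1) P(1)])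
    note S' = mod_catD(1)[OF S(1)]
    obtain f where f: "f \<in> right_module_hom R ?D S" "inj_on f (carrier ?D)" using S(2) by (rule module_isomorphicE)
    let ?k = "\<lambda>x. f (j x, h x)"
    have k: "?k \<in> right_module_hom R M S" by (rule right_module_hom_comp[OF hom_pair[OF j P(3)] f(1)])
    have "?P (S, ?k)" using S(1) projective_module_iso[OF projective_direct_sum[OF Q(2) P(2)] S' S(2)] k by simp
    from min[OF this] have le: "mod_length R (M\<lparr>carrier := a_kernel M Q j\<rparr>) \<le> mod_length R (M\<lparr>carrier := a_kernel M S ?k\<rparr>)"
      unfolding zQ by simp
    have kk: "a_kernel M S ?k = {x \<in> a_kernel M Q j. h x = \<zero>\<^bsub>P\<^esub>}"
    proof -
      have "f z = \<zero>\<^bsub>S\<^esub> \<longleftrightarrow> z = \<zero>\<^bsub>?D\<^esub>" if "z \<in> carrier ?D" for z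
        using f(2)[unfolded inj_on_hom_iff[OF D S' f(1)]] right_module_hom_zero[OF D S' f(1)] that by blast
      then have "f (j x, h x) = \<zero>\<^bsub>S\<^esub> \<longleftrightarrow> j x = \<zero>\<^bsub>Q\<^esub> \<and> h x = \<zero>\<^bsub>P\<^esub>" if "x \<in> carrier M" for x
        using right_module_homD(1)[OF j that] right_module_homD(1)[OF P(3) that] by simp
      then show ?thesis by (simp add: a_kernel_def' conj_assoc cong: conj_cong)
    qed
    have "a_kernel M S ?k = a_kernel M Q j"
    proof (rule ccontr)
      assume "a_kernel M S ?k \<noteq> a_kernel M Q j"
      then have "a_kernel M S ?k \<subset> a_kernel M Q j" using kk by auto
      from length_submodule_mono[OF M' submodule_a_kernel[OF M' S' k] submodule_a_kernel[OF M' Q' j] this fM] le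
      show False by simp
    qed
    then have "x \<in> {x \<in> a_kernel M Q j. h x = \<zero>\<^bsub>P\<^esub>}" unfolding kk using x by (simp add: a_kernel_iff)
    then show ?thesis by simp
  qed
  have "submodule (j ` carrier M) R Q" by (rule submodule_image[OF M' Q' j submodule_carrier[OF M']])
  then obtain C :: "('a, 'a list) module" and g where C: "right_module R C" "g \<in> right_module_hom R Q C"
    "g ` carrier Q = carrier C" "a_kernel Q C g = j ` carrier M"
    by (rule ex_quotient[OF Q'])
  have "finite_length R C" by (rule length_quotient(1)[OF Q' C(1-3) fQ])
  then have "C \<in> mod_cat R" using C(1) by (simp add: mod_cat_iff)
  moreover have "cosyzygy M Q j C g" unfolding cosyzygy_def using Q(2) fQ C j univ by blast
  ultimately show ?thesis by blast
qed

text \<open>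
  The cokernel \<open>D\<close> of \<open>(j, i) : M \<rightarrow> Q \<oplus> P\<close> contains \<open>P\<close> with quotient \<open>C\<close>. The projective module
  \<open>P\<close> is also injective, so it splits off and \<open>D \<cong> C \<oplus> P\<close>.
\<close>

lemma pushout_class:
  assumes inj: "right_self_injective R"
    and M: "right_module R M" and Q: "projective_module R Q" "finite_length R Q"
    and P: "projective_module R P" "finite_length R P" and C: "right_module R C" and D: "right_module R D"
    and j: "j \<in> right_module_hom R M Q" and i: "i \<in> right_module_hom R M P"
    and ker: "\<And>x. x \<in> carrier M \<Longrightarrow> j x = \<zero>\<^bsub>Q\<^esub> \<Longrightarrow> i x = \<zero>\<^bsub>P\<^esub>"
    and g: "g \<in> right_module_hom R Q C" "g ` carrier Q = carrier C" "a_kernel Q C g = j ` carrier M"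
    and d: "d \<in> right_module_hom R (direct_sum Q P) D" "d ` carrier (direct_sum Q P) = carrier D"
      "a_kernel (direct_sum Q P) D d = (\<lambda>x. (j x, i x)) ` carrier M"
  shows "mclass D = mclass C"
proof -
  interpret K: comm_group "IT_group R" by (rule comm_group_IT_group)
  note Q' = projective_moduleD[OF Q(1)] and P' = projective_moduleD[OF P(1)]
  note S' = right_module_direct_sum[OF Q' P']
  interpret Q: right_module R Q by (rule Q')
  interpret P: right_module R P by (rule P')
  interpret C: right_module R C by (rule C)
  interpret D: right_module R D by (rule D)
  have dz: "d z = \<zero>\<^bsub>D\<^esub> \<longleftrightarrow> (\<exists>x\<in>carrier M. z = (j x, i x))" if "z \<in> carrier (direct_sum Q P)" for z
    using d(3) that by (auto simp: a_kernel_iff set_eq_iff)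
  have gz: "g y = \<zero>\<^bsub>C\<^esub> \<longleftrightarrow> (\<exists>x\<in>carrier M. y = j x)" if "y \<in> carrier Q" for y
    using g(3) that by (auto simp: a_kernel_iff set_eq_iff)
  have gj: "g (j x) = \<zero>\<^bsub>C\<^esub>" if "x \<in> carrier M" for x using gz right_module_homD(1)[OF j that] that by blast
  let ?u = "\<lambda>y. d (\<zero>\<^bsub>Q\<^esub>, y)"
  have u: "?u \<in> right_module_hom R P D" by (rule right_module_hom_comp[OF hom_inr[OF Q'] d(1)])
  have u_inj: "inj_on ?u (carrier P)"
  proof (subst inj_on_hom_iff[OF P' D u], intro ballI impI)
    fix y assume y: "y \<in> carrier P" "d (\<zero>\<^bsub>Q\<^esub>, y) = \<zero>\<^bsub>D\<^esub>"
    then obtain x where "x \<in> carrier M" "\<zero>\<^bsub>Q\<^esub> = j x" "y = i x" using dz[of "(\<zero>\<^bsub>Q\<^esub>, y)"] by auto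
    then show "y = \<zero>\<^bsub>P\<^esub>" using ker by simp
  qed
  have gf: "(\<lambda>z. g (fst z)) \<in> right_module_hom R (direct_sum Q P) C" by (rule right_module_hom_comp[OF hom_fst g(1)])
  obtain e where e: "e \<in> right_module_hom R D C" "\<And>z. z \<in> carrier (direct_sum Q P) \<Longrightarrow> e (d z) = g (fst z)"
    by (rule hom_factor[OF S' D C d(1,2) gf]) (use dz gj in auto)
  have e_surj: "e ` carrier D = carrier C"
  proof
    show "e ` carrier D \<subseteq> carrier C" using right_module_homD(1)[OF e(1)] by blast
    show "carrier C \<subseteq> e ` carrier D"
    proof
      fix c assume "c \<in> carrier C"
      then obtain y where y: "y \<in> carrier Q" "c = g y" using g(2) by blast
      then have "c = e (d (y, \<zero>\<^bsub>P\<^esub>))" using e(2)[of "(y, \<zero>\<^bsub>P\<^esub>)"] by simp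
      then show "c \<in> e ` carrier D" using right_module_homD(1)[OF d(1), of "(y, \<zero>\<^bsub>P\<^esub>)"] y by simp
    qed
  qed
  have e_ker: "a_kernel D C e = ?u ` carrier P"
  proof (intro equalityI subsetI)
    fix w assume "w \<in> a_kernel D C e"
    then have w: "w \<in> carrier D" "e w = \<zero>\<^bsub>C\<^esub>" by (simp_all add: a_kernel_iff)
    then have "w \<in> d ` carrier (direct_sum Q P)" using d(2) by simp
    then obtain y p where yp: "y \<in> carrier Q" "p \<in> carrier P" "w = d (y, p)" by auto
    then have "g y = \<zero>\<^bsub>C\<^esub>" using e(2)[of "(y, p)"] w(2) by simp
    then obtain x where x: "x \<in> carrier M" "y = j x" using gz[OF yp(1)] by blast
    have ix: "i x \<in> carrier P" "j x \<in> carrier Q" using right_module_homD(1)[OF i x(1)] right_module_homD(1)[OF j x(1)] by auto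
    let ?p = "p \<oplus>\<^bsub>P\<^esub> \<ominus>\<^bsub>P\<^esub> i x"
    have "w = d ((j x, i x) \<oplus>\<^bsub>direct_sum Q P\<^esub> (\<zero>\<^bsub>Q\<^esub>, ?p))"
      using yp x ix by (simp add: P.M.a_lcomm P.M.r_neg)
    also have "\<dots> = d (j x, i x) \<oplus>\<^bsub>D\<^esub> d (\<zero>\<^bsub>Q\<^esub>, ?p)"
      by (rule right_module_homD(2)[OF d(1)]) (use ix yp in auto)
    also have "\<dots> = d (\<zero>\<^bsub>Q\<^esub>, ?p)"
      using dz[of "(j x, i x)"] x(1) ix yp right_module_homD(1)[OF u, of ?p] by auto
    finally show "w \<in> ?u ` carrier P" using yp ix by blast
  next
    fix w assume "w \<in> ?u ` carrier P"
    then obtain y where y: "y \<in> carrier P" "w = ?u y" by blast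
    then have "e w = g \<zero>\<^bsub>Q\<^esub>" using e(2)[of "(\<zero>\<^bsub>Q\<^esub>, y)"] by simp
    then show "w \<in> a_kernel D C e"
      using y right_module_homD(1)[OF u y(1)] right_module_hom_zero[OF Q' C g(1)] by (simp add: a_kernel_iff)
  qed
  have fP: "finitely_generated R P" by (rule finite_length_imp_fg[OF P' P(2)])
  obtain r where r: "r \<in> right_module_hom R D P" "\<And>y. y \<in> carrier P \<Longrightarrow> r (?u y) = y"
    using injective_extend[OF injective_of_projective[OF inj P(1) fP] P' D u u_inj right_module_hom_id] by blast
  have iso: "module_isomorphic R D (direct_sum C P)" by (rule split_mono[OF P' D C u e(1) e_surj e_ker r])
  have fC: "finite_length R C" by (rule length_quotient(1)[OF Q' C g(1,2) Q(2)])
  have fD: "finite_length R D" by (rule length_quotient(1)[OF S' D d(1,2) length_direct_sum(1)[OF Q' P' Q(2) P(2)]])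
  show ?thesis
    using mclass_iso[OF D fD right_module_direct_sum[OF C P'] iso] mclass_direct_sum[OF C fC P' P(2)]
      mclass_projective[OF P] mclass_closed[OF C fC] by simp
qed

text \<open>
  Both cokernels have the class of the cokernel of \<open>(j, j') : M \<rightarrow> Q \<oplus> Q'\<close>.
\<close>

lemma cosyzygy_unique:
  fixes Q :: "('a, 'q) module" and Q' :: "('a, 'r) module"
  assumes inj: "right_self_injective R" and M: "right_module R M"
    and c: "cosyzygy M Q j C g" and c': "cosyzygy M Q' j' C' g'"
  shows "mclass C = mclass C'"
proof -
  note d = c[unfolded cosyzygy_def] and d' = c'[unfolded cosyzygy_def]
  have Q: "projective_module R Q" "finite_length R Q" and C: "right_module R C" and j: "j \<in> right_module_hom R M Q"
    and g: "g \<in> right_module_hom R Q C" "g ` carrier Q = carrier C" "a_kernel Q C g = j ` carrier M"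
    using d by blast+
  have P: "projective_module R Q'" "finite_length R Q'" and C': "right_module R C'" and j': "j' \<in> right_module_hom R M Q'"
    and g': "g' \<in> right_module_hom R Q' C'" "g' ` carrier Q' = carrier C'" "a_kernel Q' C' g' = j' ` carrier M"
    using d' by blast+
  let ?S = "direct_sum Q Q'"
  have S: "right_module R ?S" by (rule right_module_direct_sum[OF projective_moduleD[OF Q(1)] projective_moduleD[OF P(1)]])
  have "submodule ((\<lambda>x. (j x, j' x)) ` carrier M) R ?S"
    by (rule submodule_image[OF M S hom_pair[OF j j'] submodule_carrier[OF M]])
  then obtain D :: "('a, 'q \<times> 'r) module" and h where D: "right_module R D" "h \<in> right_module_hom R ?S D"
    "h ` carrier ?S = carrier D" "a_kernel ?S D h = (\<lambda>x. (j x, j' x)) ` carrier M"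
    by (rule ex_quotient[OF S])
  have 1: "mclass D = mclass C"
    by (rule pushout_class[OF inj M Q P C D(1) j j' _ g D(2-4)]) (rule cosyzygy_kernel[OF c M P j'])
  have 2: "mclass D = mclass C'"
  proof (rule pushout_class[OF inj M P Q C' D(1) j' j _ g'])
    show "(\<lambda>z. h (snd z, fst z)) \<in> right_module_hom R (direct_sum Q' Q) D"
      by (rule right_module_hom_comp[OF hom_pair[OF hom_snd hom_fst] D(2)])
    show "(\<lambda>z. h (snd z, fst z)) ` carrier (direct_sum Q' Q) = carrier D"
    proof -
      have "(\<lambda>z. (snd z, fst z)) ` carrier (direct_sum Q' Q) = carrier ?S" by (auto simp: image_iff)
      then show ?thesis using D(3) by (metis image_image)
    qed
    show "a_kernel (direct_sum Q' Q) D (\<lambda>z. h (snd z, fst z)) = (\<lambda>x. (j' x, j x)) ` carrier M"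
    proof -
      have "(a, b) \<in> a_kernel (direct_sum Q' Q) D (\<lambda>z. h (snd z, fst z)) \<longleftrightarrow> (b, a) \<in> a_kernel ?S D h" for a b
        by (auto simp: a_kernel_iff)
      then show ?thesis unfolding D(4) by (auto simp: image_iff)
    qed
  qed (rule cosyzygy_kernel[OF c' M Q j])
  show ?thesis using 1 2 by simp
qed

lemma cosyzygy_iso:
  assumes M: "right_module R M" and f: "f \<in> right_module_hom R M N" "bij_betw f (carrier M) (carrier N)"
    and c: "cosyzygy N Q j C g"
  shows "cosyzygy M Q (\<lambda>x. j (f x)) C g"
proof -
  note fi = right_module_hom_inv[OF f(1) M f(2)]
  let ?k = "inv_into (carrier M) f"
  have j: "j \<in> right_module_hom R N Q" using c unfolding cosyzygy_def by blast
  have 1: "(\<lambda>x. j (f x)) \<in> right_module_hom R M Q" by (rule right_module_hom_comp[OF f(1) j])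
  have 2: "(\<lambda>x. j (f x)) ` carrier M = j ` carrier N"
    using f(2) by (simp add: bij_betw_def flip: image_image)
  have 3: "h x = \<zero>\<^bsub>Q'\<^esub>" if "Q' \<in> mod_cat R" "projective_module R Q'" "h \<in> right_module_hom R M Q'"
    "x \<in> carrier M" "j (f x) = \<zero>\<^bsub>Q\<^esub>" for Q' h x
  proof -
    have "h (?k (f x)) = \<zero>\<^bsub>Q'\<^esub>"
      by (rule cosyzygy_universal[OF c that(1,2) right_module_hom_comp[OF fi that(3)]
            right_module_homD(1)[OF f(1) that(4)] that(5)])
    then show ?thesis using f(2) that(4) by (simp add: bij_betw_inv_into_left)
  qed
  show ?thesis using c 1 2 3 unfolding cosyzygy_def by simp
qed

lemma cosyzygy_direct_sum:
  assumes M: "right_module R M" and M': "right_module R M'"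
    and c: "cosyzygy M Q j C g" and c': "cosyzygy M' Q' j' C' g'"
  shows "cosyzygy (direct_sum M M') (direct_sum Q Q') (map_prod j j') (direct_sum C C') (map_prod g g')"
proof -
  note d = c[unfolded cosyzygy_def] and d' = c'[unfolded cosyzygy_def]
  interpret M: right_module R M by (rule M)
  interpret M': right_module R M' by (rule M')
  have 1: "projective_module R (direct_sum Q Q')" "finite_length R (direct_sum Q Q')" "right_module R (direct_sum C C')"
    using d d' by (auto intro: projective_direct_sum right_module_direct_sum length_direct_sum(1) dest: projective_moduleD)
  have 2: "map_prod j j' \<in> right_module_hom R (direct_sum M M') (direct_sum Q Q')"
    "map_prod g g' \<in> right_module_hom R (direct_sum Q Q') (direct_sum C C')"
    using d d' by (auto intro: hom_map_prod)
  have 3: "map_prod g g' ` carrier (direct_sum Q Q') = carrier (direct_sum C C')"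
    using d d' by (simp add: map_prod_surj_on)
  have "a_kernel (direct_sum Q Q') (direct_sum C C') (map_prod g g') = a_kernel Q C g \<times> a_kernel Q' C' g'"
    by (auto simp: a_kernel_iff)
  also have "\<dots> = map_prod j j' ` carrier (direct_sum M M')" using d d' by (simp add: map_prod_surj_on)
  finally have 4: "a_kernel (direct_sum Q Q') (direct_sum C C') (map_prod g g') = map_prod j j' ` carrier (direct_sum M M')" .
  have 5: "h z = \<zero>\<^bsub>P\<^esub>" if P: "P \<in> mod_cat R" "projective_module R P" "h \<in> right_module_hom R (direct_sum M M') P"
    "z \<in> carrier (direct_sum M M')" "map_prod j j' z = \<zero>\<^bsub>direct_sum Q Q'\<^esub>" for P h z
  proof -
    note P' = mod_catD(1)[OF P(1)]
    interpret P: right_module R P by (rule P')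
    obtain x y where xy: "z = (x, y)" "x \<in> carrier M" "y \<in> carrier M'" using P(4) by auto
    have j0: "j x = \<zero>\<^bsub>Q\<^esub>" "j' y = \<zero>\<^bsub>Q'\<^esub>" using P(5) xy by simp_all
    have "h (x, \<zero>\<^bsub>M'\<^esub>) = \<zero>\<^bsub>P\<^esub>"
      by (rule cosyzygy_universal[OF c P(1,2) right_module_hom_comp[OF hom_inl[OF M'] P(3)] xy(2) j0(1)])
    moreover have "h (\<zero>\<^bsub>M\<^esub>, y) = \<zero>\<^bsub>P\<^esub>"
      by (rule cosyzygy_universal[OF c' P(1,2) right_module_hom_comp[OF hom_inr[OF M] P(3)] xy(3) j0(2)])
    moreover have "h z = h ((x, \<zero>\<^bsub>M'\<^esub>) \<oplus>\<^bsub>direct_sum M M'\<^esub> (\<zero>\<^bsub>M\<^esub>, y))" using xy by simp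
    moreover have "\<dots> = h (x, \<zero>\<^bsub>M'\<^esub>) \<oplus>\<^bsub>P\<^esub> h (\<zero>\<^bsub>M\<^esub>, y)"
      by (rule right_module_homD(2)[OF P(3)]) (use xy in auto)
    ultimately show ?thesis by simp
  qed
  show ?thesis using 1 2 3 4 5 unfolding cosyzygy_def by blast
qed

text \<open>
  A module is a cosyzygy of its syzygy, so the homomorphism induced by cosyzygies is a left
  inverse of \<open>IT_syzygy R\<close>.
\<close>

lemma IT_syzygy_inj:
  assumes inj: "right_self_injective R"
  shows "inj_on (IT_syzygy R) (carrier (IT_group R))"
proof -
  define F where "F M = (SOME C. C \<in> mod_cat R \<and> (\<exists>(Q :: ('a, 'a list) module) j g. cosyzygy M Q j C g))" for M :: "('a, 'a list) module"
  have F: "F M \<in> mod_cat R \<and> (\<exists>(Q :: ('a, 'a list) module) j g. cosyzygy M Q j (F M) g)" if "M \<in> mod_cat R" for M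
    unfolding F_def by (rule someI_ex) (use ex_cosyzygy[OF that] in blast)
  note r = mod_catD(1)
  have uniq: "IT_class R (F M) = mclass C" if M: "M \<in> mod_cat R" and c: "cosyzygy M Q j C g" for M Q j C g
  proof -
    obtain Q' :: "('a, 'a list) module" and j' g' where c': "cosyzygy M Q' j' (F M) g'" using F[OF M] by blast
    show ?thesis using cosyzygy_unique[OF inj r[OF M] c' c] mclass_mod_cat[of "F M"] F[OF M] by simp
  qed
  have fl: "finite_length R M" if "M \<in> mod_cat R" for M using that by (simp add: mod_cat_iff)
  obtain k where k: "k \<in> hom (IT_group R) (IT_group R)" "\<And>M. M \<in> mod_cat R \<Longrightarrow> k (IT_class R M) = IT_class R (F M)"
  proof (rule IT_group_hom_exists[OF comm_group_IT_group, where \<Phi> = "\<lambda>M. IT_class R (F M)"])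
    fix M assume "M \<in> mod_cat R"
    then show "IT_class R (F M) \<in> carrier (IT_group R)" using F by (intro IT_class_closed) blast
  next
    fix A B C assume ABC: "A \<in> mod_cat R" "B \<in> mod_cat R" "C \<in> mod_cat R"
      and iso: "module_isomorphic R A (direct_sum B C)"
    obtain Q :: "('a, 'a list) module" and j g where c: "cosyzygy B Q j (F B) g" using F[OF ABC(2)] by blast
    obtain Q' :: "('a, 'a list) module" and j' g' where c': "cosyzygy C Q' j' (F C) g'" using F[OF ABC(3)] by blast
    obtain f where f: "f \<in> right_module_hom R A (direct_sum B C)" "bij_betw f (carrier A) (carrier (direct_sum B C))"
      using iso unfolding module_isomorphic_def by blast
    have FB: "F B \<in> mod_cat R" "F C \<in> mod_cat R" using F ABC by blast+
    have "IT_class R (F A) = mclass (direct_sum (F B) (F C))"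
      by (rule uniq[OF ABC(1) cosyzygy_iso[OF r[OF ABC(1)] f cosyzygy_direct_sum[OF r[OF ABC(2)] r[OF ABC(3)] c c']]])
    also have "\<dots> = mclass (F B) \<otimes>\<^bsub>IT_group R\<^esub> mclass (F C)"
      using FB by (intro mclass_direct_sum r fl)
    finally show "IT_class R (F A) = IT_class R (F B) \<otimes>\<^bsub>IT_group R\<^esub> IT_class R (F C)"
      using FB by (simp add: mclass_mod_cat)
  next
    fix P assume P: "P \<in> mod_cat R" "projective_module R P"
    obtain Z where Z: "Z \<in> mod_cat R" "zero_module Z" by (rule ex_zero_module)
    have "cosyzygy P P (\<lambda>x. x) Z (\<lambda>_. \<zero>\<^bsub>Z\<^esub>)"
      unfolding cosyzygy_def
    proof (intro conjI ballI impI)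
      interpret P: right_module R P by (rule r[OF P(1)])
      show "(\<lambda>_. \<zero>\<^bsub>Z\<^esub>) ` carrier P = carrier Z"
        using Z(2) P.M.zero_closed unfolding zero_module_def by auto
      show "a_kernel P Z (\<lambda>_. \<zero>\<^bsub>Z\<^esub>) = (\<lambda>x. x) ` carrier P" by (auto simp: a_kernel_iff)
      fix Q' :: "('a, 'a list) module" and h x
      assume "Q' \<in> mod_cat R" "h \<in> right_module_hom R P Q'" "x = \<zero>\<^bsub>P\<^esub>"
      then show "h x = \<zero>\<^bsub>Q'\<^esub>" using right_module_hom_zero[OF r[OF P(1)] r] by simp
    qed (use P Z fl r right_module_hom_id right_module_hom_const_zero[OF r[OF Z(1)]] in auto)
    from uniq[OF P(1) this] show "IT_class R (F P) = \<one>\<^bsub>IT_group R\<^esub>"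
      using mclass_projective[OF projective_zero_module[OF r[OF Z(1)] Z(2)] fl[OF Z(1)]] by simp
  next
    fix h assume "h \<in> hom (IT_group R) (IT_group R)" "\<And>M. M \<in> mod_cat R \<Longrightarrow> h (IT_class R M) = IT_class R (F M)"
    then show thesis by (rule that)
  qed
  have ks: "k (IT_syzygy R (IT_class R M)) = IT_class R M" if M: "M \<in> mod_cat R" for M
  proof -
    obtain P p where P: "P \<in> mod_cat R" "projective_module R P" "p \<in> right_module_hom R P M"
      "p ` carrier P = carrier M" "syzygy R M = P\<lparr>carrier := a_kernel P M p\<rparr>"
      by (rule syzygy_cover[OF M])
    have "cosyzygy (syzygy R M) P (\<lambda>x. x) M p"
      unfolding cosyzygy_def
    proof (intro conjI ballI impI)
      show "(\<lambda>x. x) \<in> right_module_hom R (syzygy R M) P"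
        unfolding P(5) by (rule right_module_homI) (auto simp: a_kernel_iff)
      show "a_kernel P M p = (\<lambda>x. x) ` carrier (syzygy R M)" unfolding P(5) by simp
      fix Q' :: "('a, 'a list) module" and h x
      assume "Q' \<in> mod_cat R" "h \<in> right_module_hom R (syzygy R M) Q'" "x = \<zero>\<^bsub>P\<^esub>"
      then show "h x = \<zero>\<^bsub>Q'\<^esub>"
        using right_module_hom_zero[OF r[OF syzygy_mod_cat[OF M]] r, of Q' h] unfolding P(5) by simp
    qed (use P fl r M in auto)
    from uniq[OF syzygy_mod_cat[OF M] this] show ?thesis
      using k(2)[OF syzygy_mod_cat[OF M]] IT_syzygy_class[OF M] mclass_mod_cat[OF M] by simp
  qed
  have "k (IT_syzygy R x) = x" if "x \<in> carrier (IT_group R)" for x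
    using IT_group_hom_eq[OF group_IT_group hom_compose[OF IT_syzygy_hom k(1)] _ _ that, of "\<lambda>x. x"] ks
    by (auto simp: hom_def Pi_iff)
  then show ?thesis by (rule inj_on_inverseI)
qed

section \<open>Self-injective rings\<close>

lemma IT_span_subset: "IT_span R M \<subseteq> carrier (IT_group R)"
  unfolding IT_span_def
  by (rule group.generate_incl[OF group_IT_group]) (auto simp: direct_summand_def intro: IT_class_closed)

lemma IT_phi_self_injective:
  assumes inj: "right_self_injective R"
  shows "IT_phi R M = 0"
proof -
  interpret K: comm_group "IT_group R" by (rule comm_group_IT_group)
  let ?s = "IT_syzygy R"
  have pow: "?s ^^ i \<in> hom (IT_group R) (IT_group R) \<and> inj_on (?s ^^ i) (carrier (IT_group R))" for i
  proof (induction i)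
    case 0
    then show ?case by (simp add: hom_def)
  next
    case (Suc i)
    have "?s ^^ Suc i = ?s \<circ> (?s ^^ i)" by simp
    moreover have "(?s ^^ i) ` carrier (IT_group R) \<subseteq> carrier (IT_group R)" using Suc by (auto simp: hom_def)
    ultimately show ?case
      using Suc hom_compose[of "?s ^^ i" "IT_group R" "IT_group R" ?s "IT_group R"] IT_syzygy_hom
        comp_inj_on[of "?s ^^ i" "carrier (IT_group R)" ?s] inj_on_subset[OF IT_syzygy_inj[OF inj]] by metis
  qed
  have "abelian_rank (IT_group R) ((?s ^^ i) ` IT_span R M) = abelian_rank (IT_group R) (IT_span R M)" for i
    using K.abelian_rank_inj_image[OF conjunct1[OF pow] conjunct2[OF pow] IT_span_subset] .
  then show ?thesis unfolding IT_phi_def by (intro Least_equality) simp_all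
qed

text \<open>
  The kernel is injective and splits off \<open>Q\<close>, which leaves \<open>M\<close> as a direct summand of \<open>Q\<close>.
\<close>

lemma projective_of_projective_kernel:
  assumes inj: "right_self_injective R" and Q: "projective_module R Q" and M: "right_module R M"
    and q: "q \<in> right_module_hom R Q M" "q ` carrier Q = carrier M"
    and K: "projective_module R (Q\<lparr>carrier := a_kernel Q M q\<rparr>)" "finite_length R (Q\<lparr>carrier := a_kernel Q M q\<rparr>)"
  shows "projective_module R M"
proof -
  let ?K = "Q\<lparr>carrier := a_kernel Q M q\<rparr>"
  note Q' = projective_moduleD[OF Q] and K' = projective_moduleD[OF K(1)]
  have i: "(\<lambda>x. x) \<in> right_module_hom R ?K Q" by (rule right_module_homI) (auto simp: a_kernel_iff)
  have "injective_module R ?K"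
    by (rule injective_of_projective[OF inj K(1) finite_length_imp_fg[OF K' K(2)]])
  from injective_extend[OF this K' Q' i _ right_module_hom_id]
  obtain r where r: "r \<in> right_module_hom R Q ?K" "\<And>x. x \<in> carrier ?K \<Longrightarrow> r x = x" by auto
  have "module_isomorphic R Q (direct_sum M ?K)"
    by (rule split_mono[OF K' Q' M i q(1,2) _ r]) auto
  from projective_module_iso[OF Q right_module_direct_sum[OF M K'] this]
  show ?thesis by (rule projective_retract[OF _ M hom_inl[OF K'] hom_fst]) simp
qed

text \<open>
  Descending along the resolution from its zero end, each image \<open>I i\<close> of a differential is
  projective, because the kernel of \<open>P i \<rightarrow> I i\<close> is \<open>I (i + 1)\<close>.
\<close>

lemma projective_of_finite_resolution:
  assumes inj: "right_self_injective R" and X: "X \<in> mod_cat R"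
    and res: "projective_resolution R X P d" and z: "\<forall>i>m. zero_module (P i)"
  shows "projective_module R X"
proof -
  note rr = res[unfolded projective_resolution_def]
  define T where "T i = (case i of 0 \<Rightarrow> X | Suc k \<Rightarrow> P k)" for i
  have T0: "T 0 = X" and TS: "T (Suc i) = P i" for i by (simp_all add: T_def)
  have P: "P i \<in> mod_cat R" "projective_module R (P i)" for i using conjunct1[OF rr] by simp_all
  note r = mod_catD(1)
  have T: "T i \<in> mod_cat R" for i using X P by (cases i) (simp_all add: T0 TS)
  have d: "d i \<in> right_module_hom R (P i) (T i)" for i using rr by (cases i) (simp_all add: T0 TS)
  have ker: "d (Suc i) ` carrier (P (Suc i)) = a_kernel (P i) (T i) (d i)" for i
    using rr by (cases i) (simp_all add: T0 TS)
  have fl: "finite_length R M" if "M \<in> mod_cat R" for M using that by (simp add: mod_cat_iff)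
  define I where "I i = (T i)\<lparr>carrier := d i ` carrier (P i)\<rparr>" for i
  have I: "I i \<in> mod_cat R" for i
    unfolding I_def by (rule mod_cat_submodule[OF T submodule_image[OF r[OF P(1)] r[OF T] d submodule_carrier[OF r[OF P(1)]]]])
  have step: "projective_module R (I i)" if "projective_module R (I (Suc i))" for i
  proof (rule projective_of_projective_kernel[OF inj P(2)[of i] r[OF I[of i]]])
    show "d i \<in> right_module_hom R (P i) (I i)"
      unfolding I_def using right_module_hom_sub[OF d order_refl order_refl, of i] by simp
    show "d i ` carrier (P i) = carrier (I i)" unfolding I_def by simp
    have "a_kernel (P i) (I i) (d i) = a_kernel (P i) (T i) (d i)" by (simp add: I_def a_kernel_def')
    then have "(P i)\<lparr>carrier := a_kernel (P i) (I i) (d i)\<rparr> = I (Suc i)"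
      unfolding I_def[of "Suc i"] TS ker by simp
    then show "projective_module R ((P i)\<lparr>carrier := a_kernel (P i) (I i) (d i)\<rparr>)"
      "finite_length R ((P i)\<lparr>carrier := a_kernel (P i) (I i) (d i)\<rparr>)"
      using that fl[OF I] by simp_all
  qed
  have base: "projective_module R (I (Suc m))"
  proof (rule projective_zero_module[OF r[OF I]])
    have "carrier (P (Suc m)) = {\<zero>\<^bsub>P (Suc m)\<^esub>}" using z unfolding zero_module_def by simp
    then show "zero_module (I (Suc m))"
      unfolding zero_module_def I_def using right_module_hom_zero[OF r[OF P(1)] r[OF T] d] by simp
  qed
  have "projective_module R (I (Suc m - k))" if "k \<le> Suc m" for k
    using that
  proof (induction k)
    case (Suc k)
    then have "Suc (Suc m - Suc k) = Suc m - k" by simp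
    then show ?case using step[of "Suc m - Suc k"] Suc by simp
  qed (simp add: base)
  from this[of "Suc m"] have "projective_module R (I 0)" by simp
  moreover have "d 0 ` carrier (P 0) = carrier X" using rr by blast
  then have "I 0 = X" unfolding I_def T0 by simp
  ultimately show ?thesis by simp
qed

lemma proj_dim_projective:
  assumes X: "X \<in> mod_cat R" "projective_module R X"
  shows "proj_dim R X = 0"
proof -
  note X' = mod_catD(1)[OF X(1)]
  interpret X: right_module R X by (rule X')
  let ?Z = "X\<lparr>carrier := {\<zero>\<^bsub>X\<^esub>}\<rparr>"
  have Z: "?Z \<in> mod_cat R" by (rule mod_cat_submodule[OF X(1) submodule_zero[OF X']])
  have zZ: "zero_module ?Z" by (simp add: zero_module_def)
  let ?P = "\<lambda>i :: nat. if i = 0 then X else ?Z"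
  let ?d = "\<lambda>(i :: nat) x. if i = 0 then x else \<zero>\<^bsub>X\<^esub>"
  have "projective_resolution R X ?P ?d"
    unfolding projective_resolution_def
    using X Z projective_zero_module[OF mod_catD(1)[OF Z] zZ]
    by (auto simp: a_kernel_def' right_module_hom_id intro!: right_module_homI)
  then have "\<exists>P d. projective_resolution R X P d \<and> (\<forall>i>0. zero_module (P i))"
    using zZ by (intro exI[of _ ?P] exI[of _ ?d]) simp
  then have "proj_dim R X \<le> enat 0" unfolding proj_dim_def by (intro INF_lower) simp
  then show ?thesis by (simp add: zero_enat_def[symmetric])
qed

lemma proj_dim_self_injective:
  assumes inj: "right_self_injective R" and X: "X \<in> mod_cat R" and pd: "proj_dim R X = enat n"
  shows "n = 0"
proof -
  have "{n. \<exists>P d. projective_resolution R X P d \<and> (\<forall>i>n. zero_module (P i))} \<noteq> {}"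
  proof
    assume "{n. \<exists>P d. projective_resolution R X P d \<and> (\<forall>i>n. zero_module (P i))} = {}"
    then have "proj_dim R X = \<infinity>" unfolding proj_dim_def by (simp only: image_empty Inf_empty top_enat_def)
    then show False using pd by simp
  qed
  then obtain m P d where "projective_resolution R X P d" "\<forall>i>m. zero_module (P i)" by blast
  then have "projective_module R X" by (rule projective_of_finite_resolution[OF inj X])
  from proj_dim_projective[OF X this] pd show ?thesis by (simp add: zero_enat_def)
qed

lemma IT_psi_self_injective:
  assumes inj: "right_self_injective R" and M: "M \<in> mod_cat R"
  shows "IT_psi R M = 0"
proof -
  have "{n. \<exists>X. direct_summand R X M \<and> proj_dim R X = enat n} = {0}"
  proof (intro equalityI subsetI)
    fix n assume "n \<in> {n. \<exists>X. direct_summand R X M \<and> proj_dim R X = enat n}"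
    then show "n \<in> {0}" using proj_dim_self_injective[OF inj] by (auto simp: direct_summand_def)
  next
    obtain Z where Z: "Z \<in> mod_cat R" "zero_module Z" by (rule ex_zero_module)
    note r = mod_catD(1)
    have "module_isomorphic R M (direct_sum Z M)"
      by (rule module_isomorphic_trans[OF module_isomorphic_sym[OF right_module_direct_sum[OF r[OF M] r[OF Z(1)]]
              module_isomorphic_direct_sum_zero[OF Z(2)]] module_isomorphic_direct_sum_comm])
    then have "direct_summand R Z M" unfolding direct_summand_def using Z M by blast
    moreover have "proj_dim R Z = enat 0"
      using proj_dim_projective[OF Z(1) projective_zero_module[OF r[OF Z(1)] Z(2)]] by (simp add: zero_enat_def)
    ultimately show "n \<in> {n. \<exists>X. direct_summand R X M \<and> proj_dim R X = enat n}" if "n \<in> {0}" for n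
      using that by blast
  qed
  then show ?thesis unfolding IT_psi_def IT_phi_self_injective[OF inj] by simp
qed

section \<open>Decompositions into indecomposables\<close>

lemma direct_summand_iff_retract:
  assumes M: "M \<in> mod_cat R" and X: "X \<in> mod_cat R"
  shows "direct_summand R X M \<longleftrightarrow>
    (\<exists>i\<in>right_module_hom R X M. \<exists>r\<in>right_module_hom R M X. \<forall>x\<in>carrier X. r (i x) = x)"
proof
  note M' = mod_catD(1)[OF M] and X' = mod_catD(1)[OF X]
  assume "direct_summand R X M"
  then obtain Y where Y: "Y \<in> mod_cat R" "module_isomorphic R M (direct_sum X Y)"
    unfolding direct_summand_def by blast
  note Y' = mod_catD(1)[OF Y(1)]
  interpret Y: right_module R Y by (rule Y')
  obtain f where f: "f \<in> right_module_hom R M (direct_sum X Y)" "bij_betw f (carrier M) (carrier (direct_sum X Y))"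
    using Y(2) unfolding module_isomorphic_def by blast
  let ?k = "inv_into (carrier M) f"
  have k: "?k \<in> right_module_hom R (direct_sum X Y) M" by (rule right_module_hom_inv[OF f(1) M' f(2)])
  have "fst (f (?k (x, \<zero>\<^bsub>Y\<^esub>))) = x" if "x \<in> carrier X" for x
    using bij_betw_inv_into_right[OF f(2), of "(x, \<zero>\<^bsub>Y\<^esub>)"] that by simp
  then show "\<exists>i\<in>right_module_hom R X M. \<exists>r\<in>right_module_hom R M X. \<forall>x\<in>carrier X. r (i x) = x"
    by (intro bexI[OF _ right_module_hom_comp[OF hom_inl[OF Y'] k]] bexI[OF _ right_module_hom_comp[OF f(1) hom_fst]]) simp
next
  note M' = mod_catD(1)[OF M] and X' = mod_catD(1)[OF X]
  assume "\<exists>i\<in>right_module_hom R X M. \<exists>r\<in>right_module_hom R M X. \<forall>x\<in>carrier X. r (i x) = x"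
  then obtain i r where ir: "i \<in> right_module_hom R X M" "r \<in> right_module_hom R M X" "\<And>x. x \<in> carrier X \<Longrightarrow> r (i x) = x"
    by blast
  let ?Y = "M\<lparr>carrier := a_kernel M X r\<rparr>"
  have Y: "?Y \<in> mod_cat R" by (rule mod_cat_submodule[OF M submodule_a_kernel[OF M' X' ir(2)]])
  have "module_isomorphic R M (direct_sum X ?Y)"
    by (rule module_isomorphic_trans[OF split_epi[OF M' X' ir(2,1,3)] module_isomorphic_direct_sum_comm])
  then show "direct_summand R X M" unfolding direct_summand_def using X Y by blast
qed

lemma direct_summand_trans:
  assumes M: "M \<in> mod_cat R" and N: "N \<in> mod_cat R" and X: "direct_summand R X M" and MN: "direct_summand R M N"
  shows "direct_summand R X N"
proof -
  have X': "X \<in> mod_cat R" using X unfolding direct_summand_def by blast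
  obtain i r where ir: "i \<in> right_module_hom R X M" "r \<in> right_module_hom R M X" "\<forall>x\<in>carrier X. r (i x) = x"
    using X direct_summand_iff_retract[OF M X'] by blast
  obtain j s where js: "j \<in> right_module_hom R M N" "s \<in> right_module_hom R N M" "\<forall>x\<in>carrier M. s (j x) = x"
    using MN direct_summand_iff_retract[OF N M] by blast
  have "\<forall>x\<in>carrier X. r (s (j (i x))) = x" using ir js right_module_homD(1)[OF ir(1)] by simp
  then show ?thesis
    unfolding direct_summand_iff_retract[OF N X']
    by (intro bexI[OF _ right_module_hom_comp[OF ir(1) js(1)]] bexI[OF _ right_module_hom_comp[OF js(2) ir(2)]])
qed

lemma direct_summandI:
  assumes A: "A \<in> mod_cat R" and B: "B \<in> mod_cat R" and iso: "module_isomorphic R M (direct_sum A B)"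
    and M: "right_module R M"
  shows "direct_summand R A M" "direct_summand R B M"
  using A B iso module_isomorphic_trans[OF iso module_isomorphic_direct_sum_comm]
  unfolding direct_summand_def by blast+

lemma hom_funpow:
  assumes "u \<in> right_module_hom R X X"
  shows "(u ^^ n) \<in> right_module_hom R X X"
proof (induction n)
  case 0
  show ?case using right_module_hom_id by (simp add: id_def)
next
  case (Suc n)
  show ?case using right_module_hom_comp[OF Suc assms] by (simp add: comp_def)
qed

text \<open>
  Fitting's lemma. The kernels of the powers of \<open>u\<close> stop growing, say at \<open>w = u\<^sup>m\<^sup>+\<^sup>1\<close>. Then \<open>w\<close> is
  injective on its image, hence bijective there by length, and \<open>X\<close> is the direct sum of the kernel
  and the image of \<open>w\<close>, one of which is zero.
\<close>

lemma indecomposable_endo: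
  assumes X: "X \<in> mod_cat R" "indecomposable R X" and u: "u \<in> right_module_hom R X X"
  shows "inj_on u (carrier X) \<or> (\<exists>n. \<forall>x\<in>carrier X. (u ^^ n) x = \<zero>\<^bsub>X\<^esub>)"
proof -
  note X' = mod_catD(1)[OF X(1)]
  have fX: "finite_length R X" using X(1) by (simp add: mod_cat_iff)
  have u0: "(u ^^ n) \<zero>\<^bsub>X\<^esub> = \<zero>\<^bsub>X\<^esub>" for n by (rule right_module_hom_zero[OF X' X' hom_funpow[OF u]])
  let ?K = "\<lambda>n. a_kernel X X (u ^^ n)"
  let ?l = "\<lambda>n. mod_length R (X\<lparr>carrier := ?K n\<rparr>)"
  have sub: "submodule (?K n) R X" for n by (rule submodule_a_kernel[OF X' X' hom_funpow[OF u]])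
  have mono: "?K m \<subseteq> ?K (k + m)" for m k
    by (auto simp: a_kernel_iff funpow_add u0)
  obtain m where m: "\<And>n. ?l n \<le> ?l m"
    using ex_has_greatest_nat[of "\<lambda>_. True" 0 ?l "Suc (mod_length R X)"] length_submodule(2)[OF X' sub fX]
    by (auto simp: less_Suc_eq_le)
  have stab: "?K (k + m) = ?K m" for k
  proof (rule ccontr)
    assume "?K (k + m) \<noteq> ?K m"
    then have "?K m \<subset> ?K (k + m)" using mono by blast
    from length_submodule_mono[OF X' sub sub this fX] m[of "k + m"] show False by simp
  qed
  \<comment> \<open>The exponent is positive so that injectivity of \<open>w\<close> gives that of \<open>u\<close>.\<close>
  define w where "w = u ^^ Suc m"
  have w: "w \<in> right_module_hom R X X" unfolding w_def by (rule hom_funpow[OF u])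
  have ww: "w x = \<zero>\<^bsub>X\<^esub>" if "x \<in> carrier X" "w (w x) = \<zero>\<^bsub>X\<^esub>" for x
  proof -
    have "(u ^^ (Suc m + Suc m)) x = w (w x)" unfolding w_def funpow_add by simp
    then have "x \<in> ?K (Suc m + Suc m)" using that by (simp only: a_kernel_iff)
    then have "x \<in> ?K m" using stab[of "Suc (Suc m)"] by simp
    then have "x \<in> ?K (1 + m)" using mono[of m 1] by blast
    then show ?thesis by (simp add: a_kernel_iff w_def)
  qed
  let ?I = "X\<lparr>carrier := w ` carrier X\<rparr>"
  have subI: "submodule (w ` carrier X) R X" by (rule submodule_image[OF X' X' w submodule_carrier[OF X']])
  have I: "?I \<in> mod_cat R" by (rule mod_cat_submodule[OF X(1) subI])
  note I' = mod_catD(1)[OF I]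
  have fI: "finite_length R ?I" using I by (simp add: mod_cat_iff)
  have Ic: "w ` carrier X \<subseteq> carrier X" using right_module_homD(1)[OF w] by blast
  have wI: "w \<in> right_module_hom R X ?I" using right_module_hom_sub[OF w order_refl order_refl] by simp
  have wII: "w \<in> right_module_hom R ?I ?I" by (rule right_module_hom_sub[OF w Ic]) (use Ic in blast)
  have inj: "inj_on w (carrier ?I)"
    by (subst inj_on_hom_iff[OF I' I' wII]) (use ww in auto)
  have surj: "w ` carrier ?I = carrier ?I" by (rule inj_endo_surj[OF I' fI wII inj])
  have bij: "bij_betw w (carrier ?I) (carrier ?I)" using inj surj by (simp add: bij_betw_def)
  let ?s = "inv_into (carrier ?I) w"
  have s: "?s \<in> right_module_hom R ?I X"
    by (rule right_module_hom_incl[OF right_module_hom_inv[OF wII I' bij] Ic])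
  have ws: "w (?s y) = y" if "y \<in> carrier ?I" for y using bij_betw_inv_into_right[OF bij that] .
  let ?N = "X\<lparr>carrier := a_kernel X ?I w\<rparr>"
  have N: "?N \<in> mod_cat R" by (rule mod_cat_submodule[OF X(1) submodule_a_kernel[OF X' I' wI]])
  have "module_isomorphic R X (direct_sum ?N ?I)" by (rule split_epi[OF X' I' wI s ws])
  then have "zero_module ?N \<or> zero_module ?I" using X(2) N I unfolding indecomposable_def by blast
  then show ?thesis
  proof
    assume "zero_module ?N"
    then have N0: "a_kernel X ?I w = {\<zero>\<^bsub>X\<^esub>}" by (simp add: zero_module_def)
    have "x = \<zero>\<^bsub>X\<^esub>" if "x \<in> carrier X" "u x = \<zero>\<^bsub>X\<^esub>" for x
    proof -
      have "w x = (u ^^ m) (u x)" unfolding w_def by (simp add: funpow_swap1)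
      then have "w x = \<zero>\<^bsub>X\<^esub>" using that(2) u0 by simp
      then have "x \<in> a_kernel X ?I w" using that(1) by (simp add: a_kernel_iff)
      then show ?thesis using N0 by simp
    qed
    then show ?thesis using inj_on_hom_iff[OF X' X' u] by blast
  next
    assume "zero_module ?I"
    then have "\<forall>x\<in>carrier X. (u ^^ Suc m) x = \<zero>\<^bsub>X\<^esub>" unfolding zero_module_def w_def[symmetric] by auto
    then show ?thesis by blast
  qed
qed

lemma direct_summand_of_inj:
  assumes X: "X \<in> mod_cat R" and A: "A \<in> mod_cat R"
    and i: "i \<in> right_module_hom R X A" and r: "r \<in> right_module_hom R A X"
    and inj: "inj_on (\<lambda>x. r (i x)) (carrier X)"
  shows "direct_summand R X A"
proof -
  note X' = mod_catD(1)[OF X]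
  have fX: "finite_length R X" using X by (simp add: mod_cat_iff)
  let ?u = "\<lambda>x. r (i x)"
  have u: "?u \<in> right_module_hom R X X" by (rule right_module_hom_comp[OF i r])
  have bij: "bij_betw ?u (carrier X) (carrier X)"
    using inj inj_endo_surj[OF X' fX u inj] by (simp add: bij_betw_def)
  have k: "inv_into (carrier X) ?u \<in> right_module_hom R X X" by (rule right_module_hom_inv[OF u X' bij])
  have "\<forall>x\<in>carrier X. inv_into (carrier X) ?u (r (i x)) = x"
    using bij_betw_inv_into_left[OF bij] by simp
  then show ?thesis
    unfolding direct_summand_iff_retract[OF A X]
    by (intro bexI[OF _ i] bexI[OF _ right_module_hom_comp[OF r k]])
qed

text \<open>
  The identity of \<open>X\<close> is the sum of the endomorphism \<open>u\<close> that factors through \<open>A\<close> and the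
  endomorphism \<open>v\<close> that factors through \<open>B\<close>. If \<open>u\<close> is nilpotent, then \<open>v\<close> is injective: \<open>v x = 0\<close>
  implies \<open>u x = x\<close>.
\<close>

lemma indecomposable_summand_of_sum:
  assumes X: "X \<in> mod_cat R" "indecomposable R X" and A: "A \<in> mod_cat R" and B: "B \<in> mod_cat R"
    and N: "N \<in> mod_cat R" "module_isomorphic R N (direct_sum A B)" and XN: "direct_summand R X N"
  shows "direct_summand R X A \<or> direct_summand R X B"
proof -
  note X' = mod_catD(1)[OF X(1)] and A' = mod_catD(1)[OF A] and B' = mod_catD(1)[OF B] and N' = mod_catD(1)[OF N(1)]
  interpret X: right_module R X by (rule X')
  interpret A: right_module R A by (rule A')
  interpret B: right_module R B by (rule B')
  let ?D = "direct_sum A B"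
  obtain f where f: "f \<in> right_module_hom R N ?D" "bij_betw f (carrier N) (carrier ?D)"
    using N(2) unfolding module_isomorphic_def by blast
  note k = right_module_hom_inv[OF f(1) N' f(2)]
  obtain i0 r0 where ir0: "i0 \<in> right_module_hom R X N" "r0 \<in> right_module_hom R N X" "\<forall>x\<in>carrier X. r0 (i0 x) = x"
    using XN direct_summand_iff_retract[OF N(1) X(1)] by blast
  define i where "i x = f (i0 x)" for x
  define r where "r z = r0 (inv_into (carrier N) f z)" for z
  have i: "i \<in> right_module_hom R X ?D" unfolding i_def by (rule right_module_hom_comp[OF ir0(1) f(1)])
  have r: "r \<in> right_module_hom R ?D X" unfolding r_def by (rule right_module_hom_comp[OF k ir0(2)])
  have ri: "r (i x) = x" if "x \<in> carrier X" for x
    unfolding r_def i_def using bij_betw_inv_into_left[OF f(2) right_module_homD(1)[OF ir0(1) that]] ir0(3) that by simp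
  have i1: "(\<lambda>x. fst (i x)) \<in> right_module_hom R X A" by (rule right_module_hom_comp[OF i hom_fst])
  have i2: "(\<lambda>x. snd (i x)) \<in> right_module_hom R X B" by (rule right_module_hom_comp[OF i hom_snd])
  have r1: "(\<lambda>a. r (a, \<zero>\<^bsub>B\<^esub>)) \<in> right_module_hom R A X" by (rule right_module_hom_comp[OF hom_inl[OF B'] r])
  have r2: "(\<lambda>b. r (\<zero>\<^bsub>A\<^esub>, b)) \<in> right_module_hom R B X" by (rule right_module_hom_comp[OF hom_inr[OF A'] r])
  let ?u = "\<lambda>x. r (fst (i x), \<zero>\<^bsub>B\<^esub>)" and ?v = "\<lambda>x. r (\<zero>\<^bsub>A\<^esub>, snd (i x))"
  have u: "?u \<in> right_module_hom R X X" by (rule right_module_hom_comp[OF i1 r1])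
  have v: "?v \<in> right_module_hom R X X" by (rule right_module_hom_comp[OF i2 r2])
  have uv: "?u x \<oplus>\<^bsub>X\<^esub> ?v x = x" if x: "x \<in> carrier X" for x
  proof -
    have c: "fst (i x) \<in> carrier A" "snd (i x) \<in> carrier B" using right_module_homD(1)[OF i x] by auto
    have "?u x \<oplus>\<^bsub>X\<^esub> ?v x = r ((fst (i x), \<zero>\<^bsub>B\<^esub>) \<oplus>\<^bsub>?D\<^esub> (\<zero>\<^bsub>A\<^esub>, snd (i x)))"
      by (rule right_module_homD(2)[OF r, symmetric]) (use c in auto)
    also have "\<dots> = r (i x)" using c by simp
    finally show ?thesis using ri[OF x] by simp
  qed
  show ?thesis
  proof (cases "inj_on ?u (carrier X)")
    case True
    then show ?thesis using direct_summand_of_inj[OF X(1) A i1 r1] by blast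
  next
    case False
    then obtain n where n: "\<forall>x\<in>carrier X. (?u ^^ n) x = \<zero>\<^bsub>X\<^esub>" using indecomposable_endo[OF X u] by blast
    have "x = \<zero>\<^bsub>X\<^esub>" if x: "x \<in> carrier X" "?v x = \<zero>\<^bsub>X\<^esub>" for x
    proof -
      have ux: "?u x = x" using uv[OF x(1)] x(2) right_module_homD(1)[OF u x(1)] by simp
      have "(?u ^^ m) x = x" for m
      proof (induction m)
        case (Suc m)
        have "(?u ^^ Suc m) x = ?u ((?u ^^ m) x)" by simp
        also have "\<dots> = x" unfolding Suc by (rule ux)
        finally show ?case .
      qed simp
      then show ?thesis using n x(1) by metis
    qed
    then have "inj_on ?v (carrier X)" by (subst inj_on_hom_iff[OF X' X' v]) blast
    then show ?thesis using direct_summand_of_inj[OF X(1) B i2 r2] by blast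
  qed
qed

lemma mod_cat_decomposition_induct [consumes 1, case_names zero indecomposable sum]:
  assumes M: "M \<in> mod_cat R"
    and zero: "\<And>M. \<lbrakk>M \<in> mod_cat R; zero_module M\<rbrakk> \<Longrightarrow> P M"
    and ind: "\<And>M. \<lbrakk>M \<in> mod_cat R; indecomposable R M\<rbrakk> \<Longrightarrow> P M"
    and sum: "\<And>M A B. \<lbrakk>M \<in> mod_cat R; A \<in> mod_cat R; B \<in> mod_cat R;
      module_isomorphic R M (direct_sum A B); P A; P B\<rbrakk> \<Longrightarrow> P M"
  shows "P M"
  using M
proof (induction "mod_length R M" arbitrary: M rule: less_induct)
  case less
  show ?case
  proof (cases "zero_module M \<or> indecomposable R M")
    case True
    then show ?thesis using zero ind less.prems by blast
  next
    case False
    then obtain A B where AB: "A \<in> mod_cat R" "B \<in> mod_cat R" "module_isomorphic R M (direct_sum A B)"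
      "\<not> zero_module A" "\<not> zero_module B"
      unfolding indecomposable_def by blast
    have f: "right_module R A" "finite_length R A" "right_module R B" "finite_length R B" "right_module R M" "finite_length R M"
      using AB(1,2) less.prems by (simp_all add: mod_cat_iff)
    have "mod_length R M = mod_length R A + mod_length R B"
      using length_iso(2)[OF f(5) right_module_direct_sum[OF f(1,3)] AB(3) f(6)] length_direct_sum(2)[OF f(1,3,2,4)] by simp
    moreover have "mod_length R A \<noteq> 0" "mod_length R B \<noteq> 0"
      using mod_length_zero_iff[OF f(1,2)] mod_length_zero_iff[OF f(3,4)] AB(4,5) by simp_all
    ultimately have "mod_length R A < mod_length R M" "mod_length R B < mod_length R M" by simp_all
    then show ?thesis using sum[OF less.prems AB(1-3)] less.hyps AB(1,2) by blast
  qed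
qed

text \<open>
  This makes \<open>IT_span R N\<close> finitely generated, so that a comparison of ranks is informative.
\<close>

lemma finite_indecomposable_classes:
  assumes "N \<in> mod_cat R"
  shows "finite {IT_class R X | X. direct_summand R X N \<and> indecomposable R X}"
  using assms
proof (induction N rule: mod_cat_decomposition_induct)
  case (zero N)
  have "\<not> indecomposable R X" if X: "direct_summand R X N" for X
  proof -
    have X': "X \<in> mod_cat R" using X unfolding direct_summand_def by blast
    obtain i r where ir: "i \<in> right_module_hom R X N" "r \<in> right_module_hom R N X" "\<forall>x\<in>carrier X. r (i x) = x"
      using X direct_summand_iff_retract[OF zero(1) X'] by blast
    note r = mod_catD(1)
    interpret X: right_module R X by (rule r[OF X'])
    have "x = \<zero>\<^bsub>X\<^esub>" if "x \<in> carrier X" for x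
    proof -
      have "i x = \<zero>\<^bsub>N\<^esub>" using right_module_homD(1)[OF ir(1) that] zero(2) unfolding zero_module_def by simp
      then have "r (i x) = \<zero>\<^bsub>X\<^esub>" using right_module_hom_zero[OF r[OF zero(1)] r[OF X'] ir(2)] by simp
      then show ?thesis using ir(3) that by simp
    qed
    then have "zero_module X" unfolding zero_module_def by auto
    then show ?thesis unfolding indecomposable_def by blast
  qed
  then have "{IT_class R X | X. direct_summand R X N \<and> indecomposable R X} = {}" by blast
  then show ?case by (simp only: finite.emptyI)
next
  case (indecomposable N)
  have "IT_class R X = IT_class R N" if X: "direct_summand R X N" "indecomposable R X" for X
  proof -
    obtain Y where Y: "X \<in> mod_cat R" "Y \<in> mod_cat R" "module_isomorphic R N (direct_sum X Y)"
      using X(1) unfolding direct_summand_def by blast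
    have "zero_module X \<or> zero_module Y" using indecomposable(2) Y unfolding indecomposable_def by blast
    moreover have "\<not> zero_module X" using X(2) unfolding indecomposable_def by blast
    ultimately have "zero_module Y" by blast
    then have "module_isomorphic R N X"
      by (intro module_isomorphic_trans[OF Y(3)] module_isomorphic_direct_sum_zero)
    from IT_class_iso[OF indecomposable(1) Y(1) this] show ?thesis by simp
  qed
  then have "{IT_class R X | X. direct_summand R X N \<and> indecomposable R X} \<subseteq> {IT_class R N}" by blast
  then show ?case by (rule finite_subset) simp
next
  case (sum N A B)
  have "{IT_class R X | X. direct_summand R X N \<and> indecomposable R X} \<subseteq>
    {IT_class R X | X. direct_summand R X A \<and> indecomposable R X} \<union>
    {IT_class R X | X. direct_summand R X B \<and> indecomposable R X}"
  proof
    fix c assume "c \<in> {IT_class R X | X. direct_summand R X N \<and> indecomposable R X}"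
    then obtain X where X: "c = IT_class R X" "direct_summand R X N" "indecomposable R X" by blast
    have "X \<in> mod_cat R" using X(2) unfolding direct_summand_def by blast
    from indecomposable_summand_of_sum[OF this X(3) sum(2,3,1,4) X(2)]
    show "c \<in> {IT_class R X | X. direct_summand R X A \<and> indecomposable R X} \<union>
      {IT_class R X | X. direct_summand R X B \<and> indecomposable R X}" using X by blast
  qed
  then show ?case by (rule finite_subset) (use sum in simp)
qed

lemma IT_span_generators:
  assumes N: "N \<in> mod_cat R"
  obtains C where "finite C" "C \<subseteq> carrier (IT_group R)" "IT_span R N = generate (IT_group R) C"
proof
  let ?C = "{IT_class R X | X. direct_summand R X N \<and> indecomposable R X \<and> \<not> projective_module R X}"
  show "finite ?C" by (rule finite_subset[OF _ finite_indecomposable_classes[OF N]]) blast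
  show "?C \<subseteq> carrier (IT_group R)" by (auto simp: direct_summand_def intro: IT_class_closed)
  show "IT_span R N = generate (IT_group R) ?C" by (rule IT_span_def)
qed

lemma subgroup_IT_span: "subgroup (IT_span R N) (IT_group R)"
  unfolding IT_span_def
  by (rule group.generate_is_subgroup[OF group_IT_group]) (auto simp: direct_summand_def intro: IT_class_closed)

lemma IT_class_in_span:
  assumes N: "N \<in> mod_cat R" and M: "M \<in> mod_cat R" and "direct_summand R M N"
  shows "IT_class R M \<in> IT_span R N"
  using M assms(3)
proof (induction M rule: mod_cat_decomposition_induct)
  case (zero M)
  show ?case
    using IT_class_projective[OF zero(1) projective_zero_module[OF mod_catD(1)[OF zero(1)] zero(2)]]
      subgroup.one_closed[OF subgroup_IT_span] by simp
next
  case (indecomposable M)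
  show ?case
  proof (cases "projective_module R M")
    case True
    then show ?thesis using IT_class_projective[OF indecomposable(1)] subgroup.one_closed[OF subgroup_IT_span] by simp
  next
    case False
    then show ?thesis unfolding IT_span_def using indecomposable by (intro generate.incl) blast
  qed
next
  case (sum M A B)
  have M': "right_module R M" by (rule mod_catD(1)[OF sum(1)])
  have "direct_summand R A N" "direct_summand R B N"
    using direct_summand_trans[OF sum(1) N _ sum(7)] direct_summandI[OF sum(2-4) M'] by blast+
  then show ?case
    using IT_class_direct_sum[OF sum(1-4)] subgroup.m_closed[OF subgroup_IT_span] sum(5,6) by simp
qed

section \<open>Ranks when the Igusa-Todorov function vanishes\<close>

text \<open>
  The ranks do not increase along the powers of the syzygy homomorphism, so they become constant
  and the least exponent in the definition of \<open>IT_phi\<close> does have its defining property.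
\<close>

lemma rank_syzygy_if_phi_zero:
  assumes phi: "IT_phi R N = 0"
  shows "abelian_rank (IT_group R) (IT_syzygy R ` IT_span R N) = abelian_rank (IT_group R) (IT_span R N)"
proof -
  interpret K: comm_group "IT_group R" by (rule comm_group_IT_group)
  let ?s = "IT_syzygy R"
  let ?rk = "\<lambda>i. abelian_rank (IT_group R) ((?s ^^ i) ` IT_span R N)"
  have cl: "(?s ^^ i) ` IT_span R N \<subseteq> carrier (IT_group R)" for i
  proof (induction i)
    case 0
    show ?case using IT_span_subset by simp
  next
    case (Suc i)
    have "(?s ^^ Suc i) ` IT_span R N = ?s ` (?s ^^ i) ` IT_span R N" by (simp add: image_comp)
    then show ?case using Suc IT_syzygy_hom by (auto simp: hom_def)
  qed
  have dec: "?rk (Suc i) \<le> ?rk i" for i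
    using K.abelian_rank_image_le[OF IT_syzygy_hom cl[of i]] by (simp add: image_comp)
  have anti: "?rk j \<le> ?rk i" if "i \<le> j" for i j
    by (rule lift_Suc_antimono_le[of ?rk, OF dec that])
  obtain n where n: "\<And>i. ?rk n \<le> ?rk i"
  proof -
    have "(LEAST z. z \<in> range ?rk) \<in> range ?rk" by (rule LeastI[of "\<lambda>z. z \<in> range ?rk" "?rk 0"]) (rule rangeI)
    then obtain n where n: "(LEAST z. z \<in> range ?rk) = ?rk n" by blast
    have "?rk n \<le> ?rk i" for i unfolding n[symmetric] by (rule Least_le) (rule rangeI)
    then show thesis by (rule that)
  qed
  have "\<forall>i\<ge>n. ?rk n = ?rk i" using n anti by (auto intro: antisym)
  then have "\<forall>i\<ge>IT_phi R N. ?rk (IT_phi R N) = ?rk i" unfolding IT_phi_def by (rule LeastI)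
  from this[rule_format, of "Suc 0"] have "?rk 0 = ?rk (Suc 0)" unfolding phi by simp
  then show ?thesis by simp
qed

section \<open>Trace lengths\<close>

definition annihilated :: "'a set \<Rightarrow> ('a, 'm) module \<Rightarrow> 'm set" where
  "annihilated L M = {x \<in> carrier M. \<forall>r\<in>L. r \<odot>\<^bsub>M\<^esub> x = \<zero>\<^bsub>M\<^esub>}"

text \<open>The sum of the images of all homomorphisms \<open>R/L \<rightarrow> M\<close>.\<close>

definition trace :: "'a set \<Rightarrow> ('a, 'm) module \<Rightarrow> 'm set" where
  "trace L M = generated_submodule R M (annihilated L M)"

definition trace_length :: "'a set \<Rightarrow> ('a, 'm) module \<Rightarrow> nat" where
  "trace_length L M = mod_length R (M\<lparr>carrier := trace L M\<rparr>)"

lemma submodule_trace: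
  assumes "right_module R M"
  shows "submodule (trace L M) R M"
  unfolding trace_def by (rule submodule_generated[OF assms]) (auto simp: annihilated_def)

lemma zero_annihilated:
  assumes "right_module R M" "L \<subseteq> carrier R"
  shows "\<zero>\<^bsub>M\<^esub> \<in> annihilated L M"
proof -
  interpret M: right_module R M by fact
  show ?thesis using assms(2) by (auto simp: annihilated_def)
qed

lemma trace_length_inj:
  assumes M: "right_module R M" "finite_length R M" and N: "right_module R N"
    and f: "f \<in> right_module_hom R M N" "inj_on f (carrier M)" and ann: "annihilated L N = f ` annihilated L M"
  shows "trace_length L N = trace_length L M"
proof -
  have eq: "trace L N = f ` trace L M"
    unfolding trace_def ann by (rule generated_submodule_image[OF M(1) N f(1)]) (auto simp: annihilated_def)
  note sM = submodule_trace[OF M(1), of L] and sN = submodule_trace[OF N, of L]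
  have tM: "trace L M \<subseteq> carrier M" by (rule right_module.right_submoduleE(1)[OF M(1) sM])
  have "module_isomorphic R (M\<lparr>carrier := trace L M\<rparr>) (N\<lparr>carrier := trace L N\<rparr>)"
    unfolding eq using right_module_hom_sub[OF f(1) tM order_refl] inj_on_subset[OF f(2) tM]
    by (intro module_isomorphicI[of f]) simp_all
  from length_iso(2)[OF right_module.right_module_submodule[OF M(1) sM] right_module.right_module_submodule[OF N sN] this
      length_submodule(1)[OF M(1) sM M(2)]]
  show ?thesis unfolding trace_length_def by simp
qed

lemma annihilated_image_iso:
  assumes M: "right_module R M" and N: "right_module R N" and L: "L \<subseteq> carrier R"
    and f: "f \<in> right_module_hom R M N" "inj_on f (carrier M)" "f ` carrier M = carrier N"
  shows "annihilated L N = f ` annihilated L M"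
proof -
  interpret M: right_module R M by fact
  have Lc: "r \<in> carrier R" if "r \<in> L" for r using L that by blast
  have "f x \<in> annihilated L N \<longleftrightarrow> x \<in> annihilated L M" if x: "x \<in> carrier M" for x
  proof -
    have "r \<odot>\<^bsub>N\<^esub> f x = \<zero>\<^bsub>N\<^esub> \<longleftrightarrow> r \<odot>\<^bsub>M\<^esub> x = \<zero>\<^bsub>M\<^esub>" if "r \<in> L" for r
    proof -
      have "r \<odot>\<^bsub>N\<^esub> f x = f (r \<odot>\<^bsub>M\<^esub> x)" using right_module_homD(3)[OF f(1) Lc[OF that] x] by simp
      then show ?thesis
        using f(2)[unfolded inj_on_hom_iff[OF M N f(1)]] right_module_hom_zero[OF M N f(1)] Lc[OF that] x
        by (metis M.smult_closed)
    qed
    then show ?thesis using x right_module_homD(1)[OF f(1) x] by (auto simp: annihilated_def)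
  qed
  moreover have "annihilated L N \<subseteq> f ` carrier M" unfolding f(3) by (auto simp: annihilated_def)
  moreover have "annihilated L M \<subseteq> carrier M" by (auto simp: annihilated_def)
  ultimately show ?thesis by blast
qed

lemma trace_length_iso:
  assumes M: "right_module R M" "finite_length R M" and N: "right_module R N" and L: "L \<subseteq> carrier R"
    and iso: "module_isomorphic R M N"
  shows "trace_length L M = trace_length L N"
proof -
  obtain f where f: "f \<in> right_module_hom R M N" "inj_on f (carrier M)" "f ` carrier M = carrier N"
    using iso by (rule module_isomorphicE)
  show ?thesis using trace_length_inj[OF M N f(1,2) annihilated_image_iso[OF M(1) N L f]] by simp
qed

lemma trace_length_direct_sum:
  assumes M: "right_module R M" "finite_length R M" and N: "right_module R N" "finite_length R N" and L: "L \<subseteq> carrier R"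
  shows "trace_length L (direct_sum M N) = trace_length L M + trace_length L N"
proof -
  interpret M: right_module R M by (rule M(1))
  interpret N: right_module R N by (rule N(1))
  let ?D = "direct_sum M N"
  note D = right_module_direct_sum[OF M(1) N(1)]
  interpret D: right_module R ?D by (rule D)
  note sM = submodule_trace[OF M(1), of L] and sN = submodule_trace[OF N(1), of L]
  note sME = M.right_submoduleE[OF sM] and sNE = N.right_submoduleE[OF sN]
  have sD: "submodule (trace L ?D) R ?D" by (rule submodule_trace[OF D])
  have ann: "annihilated L ?D = annihilated L M \<times> annihilated L N"
    by (auto simp: annihilated_def)
  have "trace L ?D = trace L M \<times> trace L N"
  proof
    have "submodule (trace L M \<times> trace L N) R ?D"
      by (rule D.right_submoduleI) (use sME sNE in auto)
    then show "trace L ?D \<subseteq> trace L M \<times> trace L N"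
      unfolding trace_def[of L ?D] ann
      by (rule generated_submodule_minimal) (auto simp: trace_def intro: subsetD[OF generated_submodule_superset])
    have sup: "annihilated L M \<times> annihilated L N \<subseteq> trace L ?D"
      unfolding trace_def ann by (rule generated_submodule_superset)
    have 1: "(\<lambda>x. (x, \<zero>\<^bsub>N\<^esub>)) ` trace L M \<subseteq> trace L ?D"
    proof -
      have "(\<lambda>x. (x, \<zero>\<^bsub>N\<^esub>)) ` trace L M = generated_submodule R ?D ((\<lambda>x. (x, \<zero>\<^bsub>N\<^esub>)) ` annihilated L M)"
        unfolding trace_def by (rule generated_submodule_image[OF M(1) D hom_inl[OF N(1)], symmetric]) (auto simp: annihilated_def)
      also have "\<dots> \<subseteq> trace L ?D"
        by (rule generated_submodule_minimal[OF sD]) (use sup zero_annihilated[OF N(1) L] in auto)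
      finally show ?thesis .
    qed
    have 2: "(\<lambda>x. (\<zero>\<^bsub>M\<^esub>, x)) ` trace L N \<subseteq> trace L ?D"
    proof -
      have "(\<lambda>x. (\<zero>\<^bsub>M\<^esub>, x)) ` trace L N = generated_submodule R ?D ((\<lambda>x. (\<zero>\<^bsub>M\<^esub>, x)) ` annihilated L N)"
        unfolding trace_def by (rule generated_submodule_image[OF N(1) D hom_inr[OF M(1)], symmetric]) (auto simp: annihilated_def)
      also have "\<dots> \<subseteq> trace L ?D"
        by (rule generated_submodule_minimal[OF sD]) (use sup zero_annihilated[OF M(1) L] in auto)
      finally show ?thesis .
    qed
    show "trace L M \<times> trace L N \<subseteq> trace L ?D"
    proof
      fix z assume z: "z \<in> trace L M \<times> trace L N"
      then have c: "fst z \<in> carrier M" "snd z \<in> carrier N" using sME(1) sNE(1) by auto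
      have "(fst z, \<zero>\<^bsub>N\<^esub>) \<in> trace L ?D" "(\<zero>\<^bsub>M\<^esub>, snd z) \<in> trace L ?D" using 1 2 z by auto
      from D.right_submoduleE(3)[OF sD this] show "z \<in> trace L ?D" using c by simp
    qed
  qed
  then have "?D\<lparr>carrier := trace L ?D\<rparr> = direct_sum (M\<lparr>carrier := trace L M\<rparr>) (N\<lparr>carrier := trace L N\<rparr>)"
    by (simp only: direct_sum_carrier_update)
  then show ?thesis
    unfolding trace_length_def
    using length_direct_sum(2)[OF M.right_module_submodule[OF sM] N.right_module_submodule[OF sN]
        length_submodule(1)[OF M(1) sM M(2)] length_submodule(1)[OF N(1) sN N(2)]] by simp
qed

text \<open>
  How far \<open>trace_length L\<close> is from being additive on the presentation \<open>0 \<rightarrow> ker p \<rightarrow> P \<rightarrow> M \<rightarrow> 0\<close>.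
\<close>

definition trace_defect :: "'a set \<Rightarrow> ('a, 'p) module \<Rightarrow> ('p \<Rightarrow> 'm) \<Rightarrow> ('a, 'm) module \<Rightarrow> int" where
  "trace_defect L P p M =
    int (trace_length L M) + int (trace_length L (P\<lparr>carrier := a_kernel P M p\<rparr>)) - int (trace_length L P)"

text \<open>
  By Schanuel's lemma, and because \<open>trace_length L\<close> is additive on direct sums.
\<close>

lemma trace_defect_eq:
  assumes L: "L \<subseteq> carrier R" and P: "projective_module R P" "finite_length R P" and Q: "projective_module R Q" "finite_length R Q"
    and M: "right_module R M" and p: "p \<in> right_module_hom R P M" "p ` carrier P = carrier M"
    and N: "right_module R N" and q: "q \<in> right_module_hom R Q N" "q ` carrier Q = carrier N"
    and iso: "module_isomorphic R M N"
  shows "trace_defect L P p M = trace_defect L Q q N"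
proof -
  note P' = projective_moduleD[OF P(1)] and Q' = projective_moduleD[OF Q(1)]
  obtain f where f: "f \<in> right_module_hom R M N" "inj_on f (carrier M)" "f ` carrier M = carrier N"
    using iso by (rule module_isomorphicE)
  let ?p = "\<lambda>x. f (p x)"
  have fp: "?p \<in> right_module_hom R P N" by (rule right_module_hom_comp[OF p(1) f(1)])
  have s: "?p ` carrier P = carrier N" using p(2) f(3) by (simp flip: image_image)
  have ker: "a_kernel P N ?p = a_kernel P M p"
    using f(2) inj_on_hom_iff[OF M N f(1)] right_module_hom_zero[OF M N f(1)] right_module_homD(1)[OF p(1)]
    by (auto simp: a_kernel_iff set_eq_iff)
  note sP = submodule_a_kernel[OF P' N fp] and sQ = submodule_a_kernel[OF Q' N q(1)]
  let ?KP = "P\<lparr>carrier := a_kernel P N ?p\<rparr>" and ?KQ = "Q\<lparr>carrier := a_kernel Q N q\<rparr>"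
  have KP: "right_module R ?KP" "finite_length R ?KP"
    by (rule right_module.right_module_submodule[OF P' sP]) (rule length_submodule(1)[OF P' sP P(2)])
  have KQ: "right_module R ?KQ" "finite_length R ?KQ"
    by (rule right_module.right_module_submodule[OF Q' sQ]) (rule length_submodule(1)[OF Q' sQ Q(2)])
  have "module_isomorphic R (direct_sum ?KP Q) (direct_sum ?KQ P)"
    by (rule schanuel[OF P(1) finite_length_imp_fg[OF P' P(2)] Q(1) finite_length_imp_fg[OF Q' Q(2)] N fp s q])
  from trace_length_iso[OF right_module_direct_sum[OF KP(1) Q'] length_direct_sum(1)[OF KP(1) Q' KP(2) Q(2)]
      right_module_direct_sum[OF KQ(1) P'] L this]
  have "trace_length L ?KP + trace_length L Q = trace_length L ?KQ + trace_length L P"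
    using trace_length_direct_sum[OF KP Q' Q(2) L] trace_length_direct_sum[OF KQ P' P(2) L] by simp
  moreover have "trace_length L M = trace_length L N"
    by (rule trace_length_iso[OF M length_quotient(1)[OF P' M p P(2)] N L iso])
  ultimately show ?thesis unfolding trace_defect_def ker by simp
qed

lemma trace_length_zero:
  assumes Z: "right_module R Z" "zero_module Z"
  shows "trace_length L Z = 0"
proof -
  note s = submodule_trace[OF Z(1), of L]
  let ?T = "Z\<lparr>carrier := trace L Z\<rparr>"
  have T: "right_module R ?T" by (rule right_module.right_module_submodule[OF Z(1) s])
  have "zero_module ?T"
    using right_module.right_submoduleE(1,2)[OF Z(1) s] Z(2) by (auto simp: zero_module_def)
  then show ?thesis
    unfolding trace_length_def using mod_length_zero_iff[OF T finite_length_zero[OF T]] by simp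
qed

text \<open>
  Unlike \<open>trace_length L\<close> itself, the defect vanishes on projective modules, so it is defined on
  \<open>IT_group R\<close>.
\<close>

lemma trace_defect_hom:
  assumes L: "L \<subseteq> carrier R"
  obtains \<chi> where "\<chi> \<in> hom (IT_group R) integer_group"
    "\<And>M P p. \<lbrakk>M \<in> mod_cat R; P \<in> mod_cat R; projective_module R P; p \<in> right_module_hom R P M;
      p ` carrier P = carrier M\<rbrakk> \<Longrightarrow> \<chi> (IT_class R M) = trace_defect L P p M"
proof -
  note r = mod_catD(1)
  have fl: "finite_length R M" if "M \<in> mod_cat R" for M using that by (simp add: mod_cat_iff)
  let ?pres = "\<lambda>M P p. P \<in> mod_cat R \<and> projective_module R P \<and> p \<in> right_module_hom R P M \<and> p ` carrier P = carrier M"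
  define \<Phi> where "\<Phi> M = (SOME v. \<exists>P p. ?pres M P p \<and> v = trace_defect L P p M)" for M :: "('a, 'a list) module"
  have ex: "\<exists>P p. ?pres M P p" if "M \<in> mod_cat R" for M using syzygy_cover[OF that] by metis
  have \<Phi>: "\<Phi> M = trace_defect L Q q N" if M: "M \<in> mod_cat R" and N: "right_module R N" "module_isomorphic R M N"
    and Q: "projective_module R Q" "finite_length R Q" "q \<in> right_module_hom R Q N" "q ` carrier Q = carrier N" for M N Q q
  proof -
    have "\<exists>P p. ?pres M P p \<and> \<Phi> M = trace_defect L P p M"
      unfolding \<Phi>_def by (rule someI_ex) (use ex[OF M] in blast)
    then obtain P p where P: "?pres M P p" "\<Phi> M = trace_defect L P p M" by blast
    have P1: "P \<in> mod_cat R" "projective_module R P" "p \<in> right_module_hom R P M" "p ` carrier P = carrier M"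
      using P(1) by simp_all
    show ?thesis unfolding P(2) by (rule trace_defect_eq[OF L P1(2) fl[OF P1(1)] Q(1,2) r[OF M] P1(3,4) N(1) Q(3,4) N(2)])
  qed
  have "comm_group integer_group" by (rule abelian_integer_group)
  then obtain \<chi> where \<chi>: "\<chi> \<in> hom (IT_group R) integer_group" "\<And>M. M \<in> mod_cat R \<Longrightarrow> \<chi> (IT_class R M) = \<Phi> M"
  proof (rule IT_group_hom_exists[where \<Phi> = \<Phi>])
    fix A B C assume ABC: "A \<in> mod_cat R" "B \<in> mod_cat R" "C \<in> mod_cat R"
      and iso: "module_isomorphic R A (direct_sum B C)"
    obtain Q q where Q: "?pres B Q q" using ex[OF ABC(2)] by blast
    obtain T t where T: "?pres C T t" using ex[OF ABC(3)] by blast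
    have Q1: "Q \<in> mod_cat R" "projective_module R Q" "q \<in> right_module_hom R Q B" "q ` carrier Q = carrier B"
      using Q by simp_all
    have T1: "T \<in> mod_cat R" "projective_module R T" "t \<in> right_module_hom R T C" "t ` carrier T = carrier C"
      using T by simp_all
    let ?D = "direct_sum Q T"
    have "a_kernel ?D (direct_sum B C) (map_prod q t) = a_kernel Q B q \<times> a_kernel T C t"
      by (auto simp: a_kernel_iff)
    then have K: "?D\<lparr>carrier := a_kernel ?D (direct_sum B C) (map_prod q t)\<rparr> =
        direct_sum (Q\<lparr>carrier := a_kernel Q B q\<rparr>) (T\<lparr>carrier := a_kernel T C t\<rparr>)"
      by (simp only: direct_sum_carrier_update)
    have k1: "Q\<lparr>carrier := a_kernel Q B q\<rparr> \<in> mod_cat R"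
      by (rule mod_cat_submodule[OF Q1(1) submodule_a_kernel[OF r[OF Q1(1)] r[OF ABC(2)] Q1(3)]])
    have k2: "T\<lparr>carrier := a_kernel T C t\<rparr> \<in> mod_cat R"
      by (rule mod_cat_submodule[OF T1(1) submodule_a_kernel[OF r[OF T1(1)] r[OF ABC(3)] T1(3)]])
    have "\<Phi> A = trace_defect L ?D (map_prod q t) (direct_sum B C)"
      by (rule \<Phi>[OF ABC(1) right_module_direct_sum[OF r[OF ABC(2)] r[OF ABC(3)]] iso projective_direct_sum[OF Q1(2) T1(2)]
            length_direct_sum(1)[OF r[OF Q1(1)] r[OF T1(1)] fl[OF Q1(1)] fl[OF T1(1)]] hom_map_prod[OF Q1(3) T1(3)]])
        (use Q1(4) T1(4) in \<open>simp add: map_prod_surj_on\<close>)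
    also have "\<dots> = trace_defect L Q q B + trace_defect L T t C"
      unfolding trace_defect_def K
      using trace_length_direct_sum[OF r[OF k1] fl[OF k1] r[OF k2] fl[OF k2] L]
        trace_length_direct_sum[OF r[OF Q1(1)] fl[OF Q1(1)] r[OF T1(1)] fl[OF T1(1)] L]
        trace_length_direct_sum[OF r[OF ABC(2)] fl[OF ABC(2)] r[OF ABC(3)] fl[OF ABC(3)] L] by simp
    also have "\<dots> = \<Phi> B + \<Phi> C"
      using \<Phi>[OF ABC(2) r[OF ABC(2)] module_isomorphic_refl Q1(2) fl[OF Q1(1)] Q1(3,4)]
        \<Phi>[OF ABC(3) r[OF ABC(3)] module_isomorphic_refl T1(2) fl[OF T1(1)] T1(3,4)] by simp
    finally show "\<Phi> A = \<Phi> B \<otimes>\<^bsub>integer_group\<^esub> \<Phi> C" by simp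
  next
    fix P assume P: "P \<in> mod_cat R" "projective_module R P"
    let ?Z = "P\<lparr>carrier := a_kernel P P (\<lambda>x. x)\<rparr>"
    have sub: "submodule (a_kernel P P (\<lambda>x. x)) R P"
      by (rule submodule_a_kernel[OF r[OF P(1)] r[OF P(1)] right_module_hom_id])
    note Z = mod_cat_submodule[OF P(1) sub]
    have zZ: "zero_module ?Z"
      using right_module.right_submoduleE(2)[OF r[OF P(1)] sub] by (auto simp: zero_module_def a_kernel_iff)
    have "\<Phi> P = trace_defect L P (\<lambda>x. x) P"
      by (rule \<Phi>[OF P(1) r[OF P(1)] module_isomorphic_refl P(2) fl[OF P(1)] right_module_hom_id]) simp
    also have "\<dots> = 0" unfolding trace_defect_def using trace_length_zero[OF r[OF Z] zZ, of L] by simp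
    finally show "\<Phi> P = \<one>\<^bsub>integer_group\<^esub>" by simp
  next
    fix h assume "h \<in> hom (IT_group R) integer_group" "\<And>M. M \<in> mod_cat R \<Longrightarrow> h (IT_class R M) = \<Phi> M"
    then show thesis by (rule that)
  qed simp
  show thesis
  proof (rule that[OF \<chi>(1)])
    fix M P p assume M: "M \<in> mod_cat R" and P: "P \<in> mod_cat R" "projective_module R P" "p \<in> right_module_hom R P M"
      "p ` carrier P = carrier M"
    show "\<chi> (IT_class R M) = trace_defect L P p M"
      using \<chi>(2)[OF M] \<Phi>[OF M r[OF M] module_isomorphic_refl P(2) fl[OF P(1)] P(3,4)] by simp
  qed
qed

end

section \<open>Injectivity from maximal right ideals\<close>

text \<open>
  Maximality of \<open>L\<close> is expressed as right invertibility modulo \<open>L\<close> of the elements outside \<open>L\<close>, the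
  form in which it is established and used.
\<close>

definition maximal_right_ideal :: "('a, 'b) ring_scheme \<Rightarrow> 'a set \<Rightarrow> bool" where
  "maximal_right_ideal R L \<longleftrightarrow> submodule L R (regular_module R) \<and> \<one>\<^bsub>R\<^esub> \<notin> L \<and>
    (\<forall>a\<in>carrier R - L. \<exists>c\<in>carrier R. \<one>\<^bsub>R\<^esub> \<ominus>\<^bsub>R\<^esub> a \<otimes>\<^bsub>R\<^esub> c \<in> L)"

context artinian_ring
begin

text \<open>
  Baer's criterion with maximal right ideals only. Let \<open>G\<close> be a maximal graph of a partial
  homomorphism \<open>N \<rightarrow> E\<close> extending \<open>f\<close>, and suppose that \<open>n0\<close> is not in its domain. The module
  \<open>n0 R\<close> has finite length, so it has a minimal submodule \<open>V\<close> not contained in the domain. For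
  \<open>n \<in> V\<close> outside the domain, the elements \<open>r\<close> with \<open>n r\<close> in the domain form a maximal right ideal,
  and an extension of \<open>r \<mapsto> G(n r)\<close> to \<open>R\<close> enlarges \<open>G\<close> by \<open>n\<close>.
\<close>

lemma injective_if_extends_from_maximal:
  assumes E: "right_module R E"
    and ext: "\<And>L p. \<lbrakk>maximal_right_ideal R L; p \<in> right_module_hom R ((regular_module R)\<lparr>carrier := L\<rparr>) E\<rbrakk>
      \<Longrightarrow> \<exists>e\<in>carrier E. \<forall>r\<in>L. p r = r \<odot>\<^bsub>E\<^esub> e"
  shows "injective_module R E"
  unfolding injective_module_def
proof (intro conjI E allI impI ballI)
  fix M N :: "('a, 'a list) module" and j f
  assume MN: "right_module R M \<and> right_module R N" and j: "j \<in> right_module_hom R M N"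
    and f: "f \<in> right_module_hom R M E" and inj: "inj_on j (carrier M)"
  have M: "right_module R M" and N: "right_module R N" using MN by simp_all
  interpret E: right_module R E by (rule E)
  interpret M: right_module R M by (rule M)
  interpret N: right_module R N by (rule N)
  note A = right_module_R
  interpret A: right_module R "regular_module R" by (rule A)
  let ?D = "direct_sum N E"
  note D = right_module_direct_sum[OF N E]
  interpret D: right_module R ?D by (rule D)
  let ?Z = "{z. fst z = \<zero>\<^bsub>N\<^esub> \<and> snd z \<noteq> \<zero>\<^bsub>E\<^esub>}"
  let ?G0 = "(\<lambda>x. (j x, f x)) ` carrier M"
  have G0: "submodule ?G0 R ?D" by (rule submodule_image[OF M D hom_pair[OF j f] submodule_carrier[OF M]])
  have "?G0 \<inter> ?Z = {}"
    using inj[unfolded inj_on_hom_iff[OF M N j]] right_module_hom_zero[OF M E f] by auto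
  then obtain G where G: "submodule G R ?D" "?G0 \<subseteq> G" "G \<inter> ?Z = {}"
    and max: "\<And>K. submodule K R ?D \<Longrightarrow> G \<subset> K \<Longrightarrow> K \<inter> ?Z \<noteq> {}"
    by (rule ex_maximal_submodule_avoiding[OF D G0]) (rule that)
  note GE = D.right_submoduleE[OF G(1)]
  have Gc: "x \<in> carrier N" "y \<in> carrier E" if "(x, y) \<in> G" for x y using GE(1) that by auto
  have Gz: "y = \<zero>\<^bsub>E\<^esub>" if "(\<zero>\<^bsub>N\<^esub>, y) \<in> G" for y using G(3) that by auto
  have Gadd: "(x \<oplus>\<^bsub>N\<^esub> x', y \<oplus>\<^bsub>E\<^esub> y') \<in> G" if "(x, y) \<in> G" "(x', y') \<in> G" for x y x' y'
    using GE(3)[OF that] by simp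
  have Gsm: "(a \<odot>\<^bsub>N\<^esub> x, a \<odot>\<^bsub>E\<^esub> y) \<in> G" if "a \<in> carrier R" "(x, y) \<in> G" for a x y
    using GE(4)[OF that] by simp
  have Gneg: "(\<ominus>\<^bsub>N\<^esub> x, \<ominus>\<^bsub>E\<^esub> y) \<in> G" if "(x, y) \<in> G" for x y
    using Gsm[of "\<ominus>\<^bsub>R\<^esub> \<one>\<^bsub>R\<^esub>", OF _ that] Gc[OF that] by (simp add: N.minus_smult E.minus_smult)
  have uniq: "y = y'" if "(x, y) \<in> G" "(x, y') \<in> G" for x y y'
  proof -
    have "(\<zero>\<^bsub>N\<^esub>, y \<oplus>\<^bsub>E\<^esub> (\<ominus>\<^bsub>E\<^esub> y')) \<in> G"
      using Gadd[OF that(1) Gneg[OF that(2)]] Gc(1)[OF that(1)] by (simp add: N.M.r_neg)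
    from Gz[OF this] show ?thesis
      using Gc(2)[OF that(1)] Gc(2)[OF that(2)]
      by (metis E.M.a_inv_closed E.M.minus_equality E.M.minus_minus)
  qed
  have dom: "submodule (fst ` G) R N" by (rule submodule_image[OF D N hom_fst G(1)])
  note domE = N.right_submoduleE[OF dom]
  have total: "n0 \<in> fst ` G" if n0: "n0 \<in> carrier N" for n0
  proof (rule ccontr)
    assume out: "n0 \<notin> fst ` G"
    let ?C = "(\<lambda>r. r \<odot>\<^bsub>N\<^esub> n0) ` carrier R"
    have orbit: "submodule ((\<lambda>r. r \<odot>\<^bsub>N\<^esub> x) ` carrier R) R N" if "x \<in> carrier N" for x
      using submodule_image[OF A N orbit_hom[OF N that] submodule_carrier[OF A]] by simp
    note C = orbit[OF n0]
    let ?N = "N\<lparr>carrier := ?C\<rparr>"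
    have N': "right_module R ?N" by (rule N.right_module_submodule[OF C])
    have "(\<lambda>r. r \<odot>\<^bsub>N\<^esub> n0) \<in> right_module_hom R (regular_module R) ?N"
      using right_module_homD[OF orbit_hom[OF N n0]] by (intro right_module_homI) auto
    then have fC: "finite_length R ?N"
      using length_quotient(1)[OF A N' _ _ right_artinian_finite_length[OF artinian]] by simp
    have sub: "submodule V R ?N \<longleftrightarrow> submodule V R N \<and> V \<subseteq> ?C" for V by (rule submodule_submodule_iff[OF N C])
    let ?P = "\<lambda>V. submodule V R ?N \<and> \<not> V \<subseteq> fst ` G"
    let ?l = "\<lambda>V. mod_length R (?N\<lparr>carrier := V\<rparr>)"
    have "n0 = \<one>\<^bsub>R\<^esub> \<odot>\<^bsub>N\<^esub> n0" using n0 by simp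
    then have "n0 \<in> ?C" by (rule image_eqI) simp
    then have "?P ?C" using out C sub by blast
    then obtain V where V: "?P V" and min: "\<And>W. ?P W \<Longrightarrow> ?l V \<le> ?l W"
      using ex_has_least_nat[of ?P ?C ?l] by blast
    have VN: "submodule V R N" using V sub by simp
    note VE = N.right_submoduleE[OF VN]
    obtain n where n: "n \<in> V" "n \<notin> fst ` G" using V by blast
    have nc: "n \<in> carrier N" using n(1) VE(1) by blast
    let ?L = "{r \<in> carrier R. r \<odot>\<^bsub>N\<^esub> n \<in> fst ` G}"
    have L: "submodule ?L R (regular_module R)" using submodule_vimage[OF A N orbit_hom[OF N nc] dom] by simp
    have max_L: "maximal_right_ideal R ?L"
      unfolding maximal_right_ideal_def
    proof (intro conjI L ballI)
      show "\<one>\<^bsub>R\<^esub> \<notin> ?L" using n(2) nc by simp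
      fix a assume a: "a \<in> carrier R - ?L"
      then have an: "a \<in> carrier R" "a \<odot>\<^bsub>N\<^esub> n \<notin> fst ` G" by auto
      let ?W = "(\<lambda>r. r \<odot>\<^bsub>N\<^esub> (a \<odot>\<^bsub>N\<^esub> n)) ` carrier R"
      have anc: "a \<odot>\<^bsub>N\<^esub> n \<in> carrier N" using an(1) nc by simp
      have W: "submodule ?W R N" by (rule orbit[OF anc])
      have "a \<odot>\<^bsub>N\<^esub> n = \<one>\<^bsub>R\<^esub> \<odot>\<^bsub>N\<^esub> (a \<odot>\<^bsub>N\<^esub> n)" using anc by simp
      then have "a \<odot>\<^bsub>N\<^esub> n \<in> ?W" by (rule image_eqI) simp
      then have W_out: "\<not> ?W \<subseteq> fst ` G" using an(2) by (meson subsetD)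
      have WV: "?W \<subseteq> V" using VE(4) an(1) n(1) by blast
      have "V \<subseteq> ?C" using V sub by simp
      then have PW: "?P ?W" using W_out W WV by (simp only: sub) (meson subset_trans)
      have "?W = V"
      proof (rule ccontr)
        assume "?W \<noteq> V"
        then have "?W \<subset> V" using WV by blast
        from length_submodule_mono[OF N' _ _ this fC] min[OF PW] PW V show False by simp
      qed
      then obtain c where c: "c \<in> carrier R" "n = c \<odot>\<^bsub>N\<^esub> (a \<odot>\<^bsub>N\<^esub> n)" using n(1) by blast
      then have ac: "(a \<otimes>\<^bsub>R\<^esub> c) \<odot>\<^bsub>N\<^esub> n = n" using an(1) nc by (simp add: N.smult_assoc)
      have "(\<one>\<^bsub>R\<^esub> \<ominus>\<^bsub>R\<^esub> a \<otimes>\<^bsub>R\<^esub> c) \<odot>\<^bsub>N\<^esub> n = \<zero>\<^bsub>N\<^esub>"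
        using an(1) c(1) nc by (simp add: a_minus_def N.smult_l_distr N.minus_smult ac N.M.r_neg)
      then show "\<exists>c\<in>carrier R. \<one>\<^bsub>R\<^esub> \<ominus>\<^bsub>R\<^esub> a \<otimes>\<^bsub>R\<^esub> c \<in> ?L"
        using c(1) an(1) domE(2) by (intro bexI[of _ c]) auto
    qed
    define p where "p r = (SOME y. (r \<odot>\<^bsub>N\<^esub> n, y) \<in> G)" for r
    have p: "(r \<odot>\<^bsub>N\<^esub> n, p r) \<in> G" if "r \<in> ?L" for r
      unfolding p_def by (rule someI_ex) (use that in auto)
    have Lc: "r \<in> carrier R" if "r \<in> ?L" for r using that by simp
    note LE = A.right_submoduleE[OF L, simplified regular_simps]
    have "p \<in> right_module_hom R ((regular_module R)\<lparr>carrier := ?L\<rparr>) E"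
    proof (rule right_module_homI)
      show "p \<in> carrier ((regular_module R)\<lparr>carrier := ?L\<rparr>) \<rightarrow> carrier E" using Gc(2)[OF p] by auto
    next
      fix r s assume "r \<in> carrier ((regular_module R)\<lparr>carrier := ?L\<rparr>)" "s \<in> carrier ((regular_module R)\<lparr>carrier := ?L\<rparr>)"
      then have rs: "r \<in> ?L" "s \<in> ?L" by simp_all
      have "((r \<oplus>\<^bsub>R\<^esub> s) \<odot>\<^bsub>N\<^esub> n, p r \<oplus>\<^bsub>E\<^esub> p s) \<in> G"
        using Gadd[OF p[OF rs(1)] p[OF rs(2)]] rs nc by (simp add: N.smult_l_distr)
      then show "p (r \<oplus>\<^bsub>(regular_module R)\<lparr>carrier := ?L\<rparr>\<^esub> s) = p r \<oplus>\<^bsub>E\<^esub> p s"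
        using uniq[OF p[OF LE(3)[OF rs]]] by simp
    next
      fix a r assume a: "a \<in> carrier R" and "r \<in> carrier ((regular_module R)\<lparr>carrier := ?L\<rparr>)"
      then have r: "r \<in> ?L" by simp
      have "((r \<otimes>\<^bsub>R\<^esub> a) \<odot>\<^bsub>N\<^esub> n, a \<odot>\<^bsub>E\<^esub> p r) \<in> G"
        using Gsm[OF a p[OF r]] r a nc by (simp add: N.smult_assoc)
      then show "p (a \<odot>\<^bsub>(regular_module R)\<lparr>carrier := ?L\<rparr>\<^esub> r) = a \<odot>\<^bsub>E\<^esub> p r"
        using uniq[OF p[OF LE(4)[OF a r]]] by simp
    qed
    from ext[OF max_L this] obtain e where e: "e \<in> carrier E" "\<And>r. r \<in> ?L \<Longrightarrow> p r = r \<odot>\<^bsub>E\<^esub> e" by blast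
    let ?G = "{g \<oplus>\<^bsub>?D\<^esub> r \<odot>\<^bsub>?D\<^esub> (n, e) | g r. g \<in> G \<and> r \<in> carrier R}"
    have ne: "(n, e) \<in> carrier ?D" using nc e(1) by simp
    have G': "submodule ?G R ?D"
      by (rule submodule_add_cyclic[OF D G(1) ne submodule_regular_carrier[OF ring_R]])
    have "G \<subseteq> ?G"
    proof
      fix g assume g: "g \<in> G"
      then have "g \<in> carrier ?D" using GE(1) by blast
      then have "g = g \<oplus>\<^bsub>?D\<^esub> \<zero>\<^bsub>R\<^esub> \<odot>\<^bsub>?D\<^esub> (n, e)" using ne by auto
      then show "g \<in> ?G" using g E.R.zero_closed by blast
    qed
    moreover have "(n, e) \<in> ?G"
    proof -
      have "(n, e) = \<zero>\<^bsub>?D\<^esub> \<oplus>\<^bsub>?D\<^esub> \<one>\<^bsub>R\<^esub> \<odot>\<^bsub>?D\<^esub> (n, e)" using nc e(1) by simp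
      then show ?thesis using GE(2) E.R.one_closed by blast
    qed
    moreover have "(n, e) \<notin> G" using n(2) by force
    ultimately have "G \<subset> ?G" by blast
    from max[OF G' this] obtain z where z: "z \<in> ?G" "fst z = \<zero>\<^bsub>N\<^esub>" "snd z \<noteq> \<zero>\<^bsub>E\<^esub>" by blast
    then obtain x y r where xy: "(x, y) \<in> G" "r \<in> carrier R" "z = (x, y) \<oplus>\<^bsub>?D\<^esub> r \<odot>\<^bsub>?D\<^esub> (n, e)" by auto
    note c = Gc[OF xy(1)]
    have "x \<oplus>\<^bsub>N\<^esub> r \<odot>\<^bsub>N\<^esub> n = \<zero>\<^bsub>N\<^esub>" using z(2) xy(3) by simp
    then have "x = \<ominus>\<^bsub>N\<^esub> (r \<odot>\<^bsub>N\<^esub> n)" using N.M.minus_equality c(1) xy(2) nc by force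
    then have x: "x = (\<ominus>\<^bsub>R\<^esub> r) \<odot>\<^bsub>N\<^esub> n" using xy(2) nc by (simp add: N.minus_smult)
    have rL: "\<ominus>\<^bsub>R\<^esub> r \<in> ?L" using xy(1,2) x by force
    have "y = p (\<ominus>\<^bsub>R\<^esub> r)" using uniq[OF _ p[OF rL]] xy(1) x by simp
    then have "y = \<ominus>\<^bsub>E\<^esub> (r \<odot>\<^bsub>E\<^esub> e)" using e(2)[OF rL] xy(2) e(1) by (simp add: E.minus_smult)
    then show False using z(3) xy(2,3) e(1) by (simp add: E.M.l_neg)
  qed
  define h where "h x = (SOME y. (x, y) \<in> G)" for x
  have h: "(x, h x) \<in> G" if "x \<in> carrier N" for x
    unfolding h_def by (rule someI_ex) (use total[OF that] in auto)
  have hh: "h \<in> right_module_hom R N E"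
  proof (rule right_module_homI)
    show "h \<in> carrier N \<rightarrow> carrier E" using Gc(2)[OF h] by auto
  next
    fix x y assume "x \<in> carrier N" "y \<in> carrier N"
    then show "h (x \<oplus>\<^bsub>N\<^esub> y) = h x \<oplus>\<^bsub>E\<^esub> h y" using uniq[OF h Gadd[OF h h]] by simp
  next
    fix a x assume "a \<in> carrier R" "x \<in> carrier N"
    then show "h (a \<odot>\<^bsub>N\<^esub> x) = a \<odot>\<^bsub>E\<^esub> h x" using uniq[OF h Gsm[OF _ h]] by simp
  qed
  have "h (j x) = f x" if "x \<in> carrier M" for x
    using uniq[OF h[OF right_module_homD(1)[OF j that]]] G(2) that by blast
  then show "\<exists>h\<in>right_module_hom R N E. \<forall>x\<in>carrier M. h (j x) = f x" using hh by blast
qed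

section \<open>Self-injectivity from the vanishing of the Igusa-Todorov function\<close>

text \<open>
  If two modules have isomorphic kernels of presentations, the difference of their classes is in
  the kernel of the syzygy homomorphism. It lies in \<open>IT_span R S\<close>, where \<open>S\<close> is the direct sum of
  the two modules, so it is torsion when \<open>IT_phi R S = 0\<close>, and integer-valued homomorphisms vanish
  on it.
\<close>

lemma trace_defect_eq_if_kernels_isomorphic:
  assumes phi: "\<And>N. N \<in> mod_cat R \<Longrightarrow> IT_phi R N = 0" and L: "L \<subseteq> carrier R"
    and M: "right_module R M" and P: "projective_module R P" "finite_length R P"
    and p: "p \<in> right_module_hom R P M" "p ` carrier P = carrier M"
    and N: "right_module R N" and Q: "projective_module R Q" "finite_length R Q"
    and q: "q \<in> right_module_hom R Q N" "q ` carrier Q = carrier N"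
    and ker: "module_isomorphic R (P\<lparr>carrier := a_kernel P M p\<rparr>) (Q\<lparr>carrier := a_kernel Q N q\<rparr>)"
  shows "trace_defect L P p M = trace_defect L Q q N"
proof -
  interpret K: comm_group "IT_group R" by (rule comm_group_IT_group)
  note P' = projective_moduleD[OF P(1)] and Q' = projective_moduleD[OF Q(1)]
  note r = mod_catD(1)
  have fl: "finite_length R M" if "M \<in> mod_cat R" for M using that by (simp add: mod_cat_iff)
  obtain M' where M': "M' \<in> mod_cat R" "module_isomorphic R M M'"
    by (rule ex_mod_cat_iso[OF M length_quotient(1)[OF P' M p P(2)]])
  obtain N' where N': "N' \<in> mod_cat R" "module_isomorphic R N N'"
    by (rule ex_mod_cat_iso[OF N length_quotient(1)[OF Q' N q Q(2)]])
  obtain P1 p1 where P1: "P1 \<in> mod_cat R" "projective_module R P1" "p1 \<in> right_module_hom R P1 M'"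
    "p1 ` carrier P1 = carrier M'" "syzygy R M' = P1\<lparr>carrier := a_kernel P1 M' p1\<rparr>"
    by (rule syzygy_cover[OF M'(1)])
  obtain Q1 q1 where Q1: "Q1 \<in> mod_cat R" "projective_module R Q1" "q1 \<in> right_module_hom R Q1 N'"
    "q1 ` carrier Q1 = carrier N'" "syzygy R N' = Q1\<lparr>carrier := a_kernel Q1 N' q1\<rparr>"
    by (rule syzygy_cover[OF N'(1)])
  have sM: "IT_syzygy R (IT_class R M') = mclass (P\<lparr>carrier := a_kernel P M p\<rparr>)"
    unfolding IT_syzygy_presentation[OF M'(1) P1(2) fl[OF P1(1)] P1(3,4)]
    by (rule mclass_kernel_iso[OF P P1(2) fl[OF P1(1)] M p r[OF M'(1)] P1(3,4) M'(2), symmetric])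
  have sN: "IT_syzygy R (IT_class R N') = mclass (Q\<lparr>carrier := a_kernel Q N q\<rparr>)"
    unfolding IT_syzygy_presentation[OF N'(1) Q1(2) fl[OF Q1(1)] Q1(3,4)]
    by (rule mclass_kernel_iso[OF Q Q1(2) fl[OF Q1(1)] N q r[OF N'(1)] Q1(3,4) N'(2), symmetric])
  note kP = submodule_a_kernel[OF P' M p(1)] and kQ = submodule_a_kernel[OF Q' N q(1)]
  have s_eq: "IT_syzygy R (IT_class R M') = IT_syzygy R (IT_class R N')"
    unfolding sM sN
    by (rule mclass_iso[OF right_module.right_module_submodule[OF P' kP] length_submodule(1)[OF P' kP P(2)]
          right_module.right_module_submodule[OF Q' kQ] ker])
  obtain S where S: "S \<in> mod_cat R" "module_isomorphic R (direct_sum M' N') S" by (rule ex_direct_sum[OF M'(1) N'(1)])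
  have "module_isomorphic R S (direct_sum M' N')"
    by (rule module_isomorphic_sym[OF right_module_direct_sum[OF r[OF M'(1)] r[OF N'(1)]] S(2)])
  note ds = direct_summandI[OF M'(1) N'(1) this r[OF S(1)]]
  let ?x = "IT_class R M' \<otimes>\<^bsub>IT_group R\<^esub> inv\<^bsub>IT_group R\<^esub> IT_class R N'"
  note cM = IT_class_closed[OF M'(1)] and cN = IT_class_closed[OF N'(1)]
  have x: "?x \<in> IT_span R S"
    using IT_class_in_span[OF S(1) M'(1) ds(1)] IT_class_in_span[OF S(1) N'(1) ds(2)]
      subgroup.m_closed[OF subgroup_IT_span] subgroup.m_inv_closed[OF subgroup_IT_span] by blast
  interpret s: group_hom "IT_group R" "IT_group R" "IT_syzygy R"
    using IT_syzygy_hom by (simp add: group_hom_def group_hom_axioms_def group_IT_group)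
  have sx: "IT_syzygy R ?x = \<one>\<^bsub>IT_group R\<^esub>" using cM cN s_eq by simp
  obtain C where C: "finite C" "C \<subseteq> carrier (IT_group R)" "IT_span R S = generate (IT_group R) C"
    by (rule IT_span_generators[OF S(1)])
  obtain k :: int where k: "k \<noteq> 0" "?x [^]\<^bsub>IT_group R\<^esub> k = \<one>\<^bsub>IT_group R\<^esub>"
    by (rule K.torsion_kernel_if_rank_eq[OF C(1,2) IT_syzygy_hom
          rank_syzygy_if_phi_zero[OF phi[OF S(1)], unfolded C(3)] x[unfolded C(3)] sx])
  obtain \<chi> where \<chi>: "\<chi> \<in> hom (IT_group R) integer_group"
    "\<And>M P p. \<lbrakk>M \<in> mod_cat R; P \<in> mod_cat R; projective_module R P; p \<in> right_module_hom R P M;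
      p ` carrier P = carrier M\<rbrakk> \<Longrightarrow> \<chi> (IT_class R M) = trace_defect L P p M"
    by (rule trace_defect_hom[OF L]) blast
  interpret \<chi>: group_hom "IT_group R" integer_group \<chi>
    using \<chi>(1) by (simp add: group_hom_def group_hom_axioms_def group_IT_group)
  have xc: "?x \<in> carrier (IT_group R)" using cM cN by simp
  have "k * \<chi> ?x = 0"
    using \<chi>.hom_int_pow[OF xc, of k] k(2) by (simp add: mult.commute)
  then have "\<chi> ?x = 0" using k(1) by simp
  then have "\<chi> (IT_class R M') = \<chi> (IT_class R N')" using cM cN by simp
  moreover have "\<chi> (IT_class R M') = trace_defect L P p M"
    unfolding \<chi>(2)[OF M'(1) P1(1-4)]
    by (rule trace_defect_eq[OF L P P1(2) fl[OF P1(1)] M p r[OF M'(1)] P1(3,4) M'(2), symmetric])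
  moreover have "\<chi> (IT_class R N') = trace_defect L Q q N"
    unfolding \<chi>(2)[OF N'(1) Q1(1-4)]
    by (rule trace_defect_eq[OF L Q Q1(2) fl[OF Q1(1)] N q r[OF N'(1)] Q1(3,4) N'(2), symmetric])
  ultimately show ?thesis by simp
qed

text \<open>
  Choose \<open>c\<close> with \<open>1 - a c \<in> L\<close>. For \<open>s \<in> L\<close>, maximality gives \<open>c s \<in> L\<close>, and so
  \<open>p s = p (a (c s)) + p ((1 - a c) s) = (p (1 - a c) - b c) s\<close>.
\<close>

lemma extends_from_maximal:
  assumes L: "maximal_right_ideal R L" and p: "p \<in> right_module_hom R ((regular_module R)\<lparr>carrier := L\<rparr>) (regular_module R)"
    and a: "a \<in> carrier R" "a \<notin> L" and b: "b \<in> carrier R"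
    and ab: "\<And>r. r \<in> L \<Longrightarrow> a \<otimes>\<^bsub>R\<^esub> r \<in> L \<and> p (a \<otimes>\<^bsub>R\<^esub> r) = \<ominus>\<^bsub>R\<^esub> (b \<otimes>\<^bsub>R\<^esub> r)"
  shows "\<exists>e\<in>carrier R. \<forall>r\<in>L. p r = e \<otimes>\<^bsub>R\<^esub> r"
proof -
  interpret R: ring R by (rule ring_R)
  interpret A: right_module R "regular_module R" by (rule right_module_R)
  have Ls: "submodule L R (regular_module R)" using L unfolding maximal_right_ideal_def by blast
  note LE = A.right_submoduleE[OF Ls, simplified regular_simps]
  have Lc: "r \<in> carrier R" if "r \<in> L" for r using LE(1) that by blast
  note maxL = L[unfolded maximal_right_ideal_def, THEN conjunct2, THEN conjunct2, rule_format]
  have padd: "p (r \<oplus>\<^bsub>R\<^esub> s) = p r \<oplus>\<^bsub>R\<^esub> p s" if "r \<in> L" "s \<in> L" for r s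
    using right_module_homD(2)[OF p, of r s] that by simp
  have psm: "p (r \<otimes>\<^bsub>R\<^esub> s) = p r \<otimes>\<^bsub>R\<^esub> s" if "r \<in> L" "s \<in> carrier R" for r s
    using right_module_homD(3)[OF p, of s r] that by simp
  have pc: "p r \<in> carrier R" if "r \<in> L" for r using right_module_homD(1)[OF p, of r] that by simp
  obtain c where c: "c \<in> carrier R" "\<one>\<^bsub>R\<^esub> \<ominus>\<^bsub>R\<^esub> a \<otimes>\<^bsub>R\<^esub> c \<in> L" using maxL[of a] a by blast
  let ?l = "\<one>\<^bsub>R\<^esub> \<ominus>\<^bsub>R\<^esub> a \<otimes>\<^bsub>R\<^esub> c"
  have eq: "p s = (p ?l \<ominus>\<^bsub>R\<^esub> b \<otimes>\<^bsub>R\<^esub> c) \<otimes>\<^bsub>R\<^esub> s" if s: "s \<in> L" for s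
  proof -
    note sc = Lc[OF s]
    let ?t = "c \<otimes>\<^bsub>R\<^esub> s"
    have tc: "?t \<in> carrier R" using c(1) sc by simp
    have ls: "?l \<otimes>\<^bsub>R\<^esub> s \<in> L" using LE(4)[OF sc c(2)] .
    have dec: "s = a \<otimes>\<^bsub>R\<^esub> ?t \<oplus>\<^bsub>R\<^esub> ?l \<otimes>\<^bsub>R\<^esub> s"
    proof -
      have "?l \<otimes>\<^bsub>R\<^esub> s = s \<ominus>\<^bsub>R\<^esub> a \<otimes>\<^bsub>R\<^esub> ?t"
        using a(1) c(1) sc by (simp add: a_minus_def R.l_distr R.l_minus R.m_assoc)
      then show ?thesis using a(1) tc sc by (simp add: a_minus_def R.a_lcomm R.r_neg)
    qed
    have neg: "\<ominus>\<^bsub>R\<^esub> r \<in> L" if "r \<in> L" for r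
      using LE(4)[of "\<ominus>\<^bsub>R\<^esub> \<one>\<^bsub>R\<^esub>" r] that Lc[OF that] by (simp add: R.r_minus)
    have atL: "a \<otimes>\<^bsub>R\<^esub> ?t \<in> L"
    proof -
      have "a \<otimes>\<^bsub>R\<^esub> ?t = s \<oplus>\<^bsub>R\<^esub> \<ominus>\<^bsub>R\<^esub> (?l \<otimes>\<^bsub>R\<^esub> s)"
      proof -
        have "s \<oplus>\<^bsub>R\<^esub> \<ominus>\<^bsub>R\<^esub> (?l \<otimes>\<^bsub>R\<^esub> s) = (a \<otimes>\<^bsub>R\<^esub> ?t \<oplus>\<^bsub>R\<^esub> ?l \<otimes>\<^bsub>R\<^esub> s) \<oplus>\<^bsub>R\<^esub> \<ominus>\<^bsub>R\<^esub> (?l \<otimes>\<^bsub>R\<^esub> s)"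
          using dec by simp
        also have "\<dots> = a \<otimes>\<^bsub>R\<^esub> ?t" using a(1) tc Lc[OF ls] by (simp add: R.a_assoc R.r_neg)
        finally show ?thesis by simp
      qed
      then show ?thesis using LE(3)[OF s neg[OF ls]] by simp
    qed
    have tL: "?t \<in> L"
    proof (rule ccontr)
      assume "?t \<notin> L"
      then obtain d where d: "d \<in> carrier R" "\<one>\<^bsub>R\<^esub> \<ominus>\<^bsub>R\<^esub> ?t \<otimes>\<^bsub>R\<^esub> d \<in> L" using maxL[of ?t] tc by blast
      let ?m = "\<one>\<^bsub>R\<^esub> \<ominus>\<^bsub>R\<^esub> ?t \<otimes>\<^bsub>R\<^esub> d"
      have "a \<otimes>\<^bsub>R\<^esub> ?m \<in> L" using ab[OF d(2)] by blast
      moreover have "(a \<otimes>\<^bsub>R\<^esub> ?t) \<otimes>\<^bsub>R\<^esub> d \<in> L" using LE(4)[OF d(1) atL] .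
      ultimately have "a \<otimes>\<^bsub>R\<^esub> ?m \<oplus>\<^bsub>R\<^esub> (a \<otimes>\<^bsub>R\<^esub> ?t) \<otimes>\<^bsub>R\<^esub> d \<in> L" by (rule LE(3))
      moreover have "a \<otimes>\<^bsub>R\<^esub> ?m \<oplus>\<^bsub>R\<^esub> (a \<otimes>\<^bsub>R\<^esub> ?t) \<otimes>\<^bsub>R\<^esub> d = a"
        using a(1) tc d(1) by (simp add: a_minus_def R.r_distr R.r_minus R.m_assoc[of a "?t" d] R.a_assoc R.l_neg)
      ultimately show False using a(2) by simp
    qed
    have "p s = p (a \<otimes>\<^bsub>R\<^esub> ?t \<oplus>\<^bsub>R\<^esub> ?l \<otimes>\<^bsub>R\<^esub> s)" using dec by simp
    also have "\<dots> = p (a \<otimes>\<^bsub>R\<^esub> ?t) \<oplus>\<^bsub>R\<^esub> p ?l \<otimes>\<^bsub>R\<^esub> s" using padd[OF atL ls] psm[OF c(2) sc] by simp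
    also have "\<dots> = \<ominus>\<^bsub>R\<^esub> (b \<otimes>\<^bsub>R\<^esub> ?t) \<oplus>\<^bsub>R\<^esub> p ?l \<otimes>\<^bsub>R\<^esub> s" using ab[OF tL] by simp
    also have "\<dots> = (p ?l \<ominus>\<^bsub>R\<^esub> b \<otimes>\<^bsub>R\<^esub> c) \<otimes>\<^bsub>R\<^esub> s"
      using b c(1) sc pc[OF c(2)] by (simp add: a_minus_def R.l_distr R.l_minus R.m_assoc R.a_comm)
    finally show ?thesis .
  qed
  show ?thesis
    by (rule bexI[of _ "p ?l \<ominus>\<^bsub>R\<^esub> b \<otimes>\<^bsub>R\<^esub> c"]) (use eq b c(1) pc[OF c(2)] in auto)
qed

text \<open>
  Let \<open>p : L \<rightarrow> R\<close> be defined on a maximal right ideal, \<open>M\<close> the quotient of \<open>R \<oplus> R\<close> by the elements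
  \<open>(r, - p r)\<close>, and \<open>S = R/L\<close>. Both have presentations with kernel \<open>L\<close>, so equality of the trace
  defects gives \<open>trace_length L M = trace_length L S + trace_length L R\<close>, where the first summand
  is positive. Hence \<open>M\<close> has an element annihilated by \<open>L\<close> that is not the image of an element of
  \<open>R\<close> annihilated by \<open>L\<close> under the embedding \<open>b \<mapsto> (0, b)\<close>. Writing it as the class of \<open>(a, b)\<close>, one
  gets \<open>a \<notin> L\<close> and \<open>p (a r) = - b r\<close> for \<open>r \<in> L\<close>, which determines an extension of \<open>p\<close>.
\<close>

lemma self_injective_if_phi_zero:
  assumes phi: "\<And>N. N \<in> mod_cat R \<Longrightarrow> IT_phi R N = 0"
  shows "right_self_injective R"
  unfolding right_self_injective_def
proof (rule injective_if_extends_from_maximal[OF right_module_R])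
  fix L p assume L: "maximal_right_ideal R L"
    and p: "p \<in> right_module_hom R ((regular_module R)\<lparr>carrier := L\<rparr>) (regular_module R)"
  let ?A = "regular_module R"
  note A = right_module_R
  interpret R: ring R by (rule ring_R)
  interpret A: right_module R ?A by (rule A)
  have Ls: "submodule L R ?A" using L unfolding maximal_right_ideal_def by blast
  note LE = A.right_submoduleE[OF Ls, simplified regular_simps]
  have Lc: "r \<in> carrier R" if "r \<in> L" for r using LE(1) that by blast
  have fA: "finite_length R ?A" by (rule right_artinian_finite_length[OF artinian])
  have pA: "projective_module R ?A" by (rule projective_regular[OF ring_R])
  have negA: "\<ominus>\<^bsub>?A\<^esub> x = \<ominus>\<^bsub>R\<^esub> x" if "x \<in> carrier R" for x
    using A.M.minus_equality[of "\<ominus>\<^bsub>R\<^esub> x" x] that by (simp add: R.l_neg)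
  let ?L = "?A\<lparr>carrier := L\<rparr>"
  have L': "right_module R ?L" by (rule A.right_module_submodule[OF Ls])
  have incl: "(\<lambda>x. x) \<in> right_module_hom R ?L ?A" by (rule right_module_homI) (use Lc in auto)
  have pc: "p r \<in> carrier R" if "r \<in> L" for r using right_module_homD(1)[OF p, of r] that by simp
  let ?D = "direct_sum ?A ?A"
  note D = right_module_direct_sum[OF A A]
  let ?g = "\<lambda>r. (r, \<ominus>\<^bsub>?A\<^esub> p r)"
  have g: "?g \<in> right_module_hom R ?L ?D" by (rule hom_pair[OF incl right_module_hom_uminus[OF L' A p]])
  have sG: "submodule (?g ` L) R ?D" using submodule_image[OF L' D g submodule_carrier[OF L']] by simp
  obtain M :: "('a, 'a \<times> 'a) module" and q where M: "right_module R M" and q: "q \<in> right_module_hom R ?D M"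
    "q ` carrier ?D = carrier M" "a_kernel ?D M q = ?g ` L"
    by (rule ex_quotient[OF D sG])
  obtain S :: "('a, 'a) module" and s where S: "right_module R S" and s: "s \<in> right_module_hom R ?A S"
    "s ` carrier ?A = carrier S" "a_kernel ?A S s = L"
    by (rule ex_quotient[OF A Ls])
  interpret M: right_module R M by (rule M)
  interpret S: right_module R S by (rule S)
  have fD: "finite_length R ?D" by (rule length_direct_sum(1)[OF A A fA fA])
  have fS: "finite_length R S" by (rule length_quotient(1)[OF A S s(1,2) fA])
  have LR: "L \<subseteq> carrier R" by (rule LE(1))
  have qz: "q z = \<zero>\<^bsub>M\<^esub> \<longleftrightarrow> z \<in> ?g ` L" if "z \<in> carrier ?D" for z
    using q(3) that by (auto simp: a_kernel_iff set_eq_iff)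
  have isoK: "module_isomorphic R ?L (?D\<lparr>carrier := ?g ` L\<rparr>)"
  proof (rule module_isomorphicI[where f = ?g])
    have "\<And>x. x \<in> L \<Longrightarrow> ?g x \<in> carrier ?D" using right_module_homD(1)[OF g] by auto
    then show "?g \<in> right_module_hom R ?L (?D\<lparr>carrier := ?g ` L\<rparr>)"
      using right_module_hom_sub[OF g order_refl, of "?g ` L"] by simp
  qed (auto simp: inj_on_def)
  have isoK': "module_isomorphic R (?D\<lparr>carrier := a_kernel ?D M q\<rparr>) (?A\<lparr>carrier := a_kernel ?A S s\<rparr>)"
    unfolding q(3) s(3) by (rule module_isomorphic_sym[OF L' isoK])
  have "trace_defect L ?D q M = trace_defect L ?A s S"
    by (rule trace_defect_eq_if_kernels_isomorphic[OF phi LR M projective_direct_sum[OF pA pA] fD q(1,2) S pA fA s(1,2) isoK'])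
  moreover have "trace_length L (?D\<lparr>carrier := ?g ` L\<rparr>) = trace_length L ?L"
    by (rule trace_length_iso[OF L' length_submodule(1)[OF A Ls fA]
          right_module.right_module_submodule[OF D sG] LR isoK, symmetric])
  ultimately have count: "trace_length L M = trace_length L S + trace_length L ?A"
    using trace_length_direct_sum[OF A fA A fA LR]
    unfolding trace_defect_def q(3) s(3) by simp
  have "trace_length L S \<noteq> 0"
  proof
    assume *: "trace_length L S = 0"
    note sT = submodule_trace[OF S, of L]
    have "zero_module (S\<lparr>carrier := trace L S\<rparr>)"
      using * mod_length_zero_iff[OF S.right_module_submodule[OF sT] length_submodule(1)[OF S sT fS]]
      unfolding trace_length_def by simp
    then have T0: "trace L S = {\<zero>\<^bsub>S\<^esub>}" by (simp add: zero_module_def)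
    have "s \<one>\<^bsub>R\<^esub> \<in> annihilated L S"
    proof -
      have "r \<odot>\<^bsub>S\<^esub> s \<one>\<^bsub>R\<^esub> = \<zero>\<^bsub>S\<^esub>" if r: "r \<in> L" for r
      proof -
        have "r \<odot>\<^bsub>S\<^esub> s \<one>\<^bsub>R\<^esub> = s r" using right_module_homD(3)[OF s(1) Lc[OF r], of "\<one>\<^bsub>R\<^esub>"] Lc[OF r] by simp
        moreover have "r \<in> a_kernel ?A S s" using s(3) r by simp
        ultimately show ?thesis by (simp add: a_kernel_iff)
      qed
      then show ?thesis using right_module_homD(1)[OF s(1), of "\<one>\<^bsub>R\<^esub>"] by (simp add: annihilated_def)
    qed
    then have "s \<one>\<^bsub>R\<^esub> \<in> trace L S"
      unfolding trace_def using generated_submodule_superset[of "annihilated L S" R S] by blast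
    then have "\<one>\<^bsub>R\<^esub> \<in> a_kernel ?A S s" using T0 by (simp add: a_kernel_iff)
    then show False using s(3) L unfolding maximal_right_ideal_def by simp
  qed
  then have ne: "trace_length L M \<noteq> trace_length L ?A" using count by simp
  let ?i = "\<lambda>b. q (\<zero>\<^bsub>?A\<^esub>, b)"
  have i: "?i \<in> right_module_hom R ?A M" by (rule right_module_hom_comp[OF hom_inr[OF A] q(1)])
  have i_inj: "inj_on ?i (carrier ?A)"
  proof (subst inj_on_hom_iff[OF A M i], intro ballI impI)
    fix b assume b: "b \<in> carrier ?A" "?i b = \<zero>\<^bsub>M\<^esub>"
    then have "(\<zero>\<^bsub>?A\<^esub>, b) \<in> ?g ` L" using qz[of "(\<zero>\<^bsub>?A\<^esub>, b)"] by simp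
    then show "b = \<zero>\<^bsub>?A\<^esub>" using right_module_hom_zero[OF L' A p] negA[OF R.zero_closed] by auto
  qed
  have "annihilated L M \<noteq> ?i ` annihilated L ?A"
    using trace_length_inj[OF A fA M i i_inj, of L] ne by blast
  moreover have "?i ` annihilated L ?A \<subseteq> annihilated L M"
  proof
    fix x assume "x \<in> ?i ` annihilated L ?A"
    then obtain b where b: "b \<in> carrier ?A" "\<forall>r\<in>L. r \<odot>\<^bsub>?A\<^esub> b = \<zero>\<^bsub>?A\<^esub>" "x = ?i b" by (auto simp: annihilated_def)
    have "r \<odot>\<^bsub>M\<^esub> ?i b = \<zero>\<^bsub>M\<^esub>" if r: "r \<in> L" for r
      using right_module_homD(3)[OF i Lc[OF r] b(1)] b(2) r right_module_hom_zero[OF A M i] by simp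
    then show "x \<in> annihilated L M" using b right_module_homD(1)[OF i b(1)] by (simp add: annihilated_def)
  qed
  ultimately obtain x where x: "x \<in> annihilated L M" "x \<notin> ?i ` annihilated L ?A" by blast
  have xc: "x \<in> carrier M" and xL: "\<And>r. r \<in> L \<Longrightarrow> r \<odot>\<^bsub>M\<^esub> x = \<zero>\<^bsub>M\<^esub>" using x(1) by (auto simp: annihilated_def)
  then have "x \<in> q ` carrier ?D" using q(2) by simp
  then obtain a b where ab: "a \<in> carrier R" "b \<in> carrier R" "x = q (a, b)" by auto
  have rel: "a \<otimes>\<^bsub>R\<^esub> r \<in> L \<and> p (a \<otimes>\<^bsub>R\<^esub> r) = \<ominus>\<^bsub>R\<^esub> (b \<otimes>\<^bsub>R\<^esub> r)" if r: "r \<in> L" for r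
  proof -
    have "q (a \<otimes>\<^bsub>R\<^esub> r, b \<otimes>\<^bsub>R\<^esub> r) = \<zero>\<^bsub>M\<^esub>"
      using right_module_homD(3)[OF q(1) Lc[OF r], of "(a, b)"] xL[OF r] ab by simp
    then have "(a \<otimes>\<^bsub>R\<^esub> r, b \<otimes>\<^bsub>R\<^esub> r) \<in> ?g ` L" using qz[of "(a \<otimes>\<^bsub>R\<^esub> r, b \<otimes>\<^bsub>R\<^esub> r)"] ab Lc[OF r] by simp
    then have "a \<otimes>\<^bsub>R\<^esub> r \<in> L" "b \<otimes>\<^bsub>R\<^esub> r = \<ominus>\<^bsub>R\<^esub> p (a \<otimes>\<^bsub>R\<^esub> r)" using negA pc by auto
    then show ?thesis using pc by simp
  qed
  have "a \<notin> L"
  proof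
    assume a: "a \<in> L"
    \<comment> \<open>For \<open>a \<in> L\<close> the class of \<open>(a, b)\<close> is that of \<open>(0, b + p a)\<close>, which is excluded by the choice of \<open>x\<close>.\<close>
    let ?c = "b \<oplus>\<^bsub>R\<^esub> p a"
    have c: "?c \<in> carrier ?A" using ab(2) pc[OF a] by simp
    have ga: "q (a, \<ominus>\<^bsub>?A\<^esub> p a) = \<zero>\<^bsub>M\<^esub>" using qz[of "?g a"] a Lc pc negA by auto
    have "(a, b) = ?g a \<oplus>\<^bsub>?D\<^esub> (\<zero>\<^bsub>?A\<^esub>, ?c)"
      using ab pc[OF a] negA[OF pc[OF a]] by (simp add: R.a_lcomm R.l_neg)
    then have "x = q (?g a) \<oplus>\<^bsub>M\<^esub> q (\<zero>\<^bsub>?A\<^esub>, ?c)"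
      unfolding ab(3) using right_module_homD(2)[OF q(1), of "?g a" "(\<zero>\<^bsub>?A\<^esub>, ?c)"] a Lc pc negA c by simp
    then have xi: "x = ?i ?c" using ga right_module_homD(1)[OF i c] by simp
    have "r \<odot>\<^bsub>?A\<^esub> ?c = \<zero>\<^bsub>?A\<^esub>" if r: "r \<in> L" for r
    proof -
      have "?i (r \<odot>\<^bsub>?A\<^esub> ?c) = \<zero>\<^bsub>M\<^esub>" using right_module_homD(3)[OF i Lc[OF r] c] xL[OF r] xi by simp
      moreover have "r \<odot>\<^bsub>?A\<^esub> ?c \<in> carrier ?A" using Lc[OF r] c by (rule A.smult_closed)
      ultimately show ?thesis using i_inj[unfolded inj_on_hom_iff[OF A M i]] by blast
    qed
    then have "?c \<in> annihilated L ?A" using c by (simp add: annihilated_def)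
    then show False using x(2) xi by blast
  qed
  from extends_from_maximal[OF L p ab(1) this ab(2) rel]
  show "\<exists>e\<in>carrier ?A. \<forall>r\<in>L. p r = r \<odot>\<^bsub>?A\<^esub> e" by simp
qed

end

lemma SUP_enat_eq_0_iff: "(SUP x\<in>A. enat (f x)) = 0 \<longleftrightarrow> (\<forall>x\<in>A. f x = 0)"
proof
  assume *: "(SUP x\<in>A. enat (f x)) = 0"
  show "\<forall>x\<in>A. f x = 0"
  proof
    fix x assume "x \<in> A"
    then have "enat (f x) \<le> (SUP x\<in>A. enat (f x))" by (rule SUP_upper)
    then show "f x = 0" unfolding * by (simp add: zero_enat_def)
  qed
next
  assume "\<forall>x\<in>A. f x = 0"
  then have "(SUP x\<in>A. enat (f x)) \<le> 0" by (intro SUP_least) (simp add: zero_enat_def)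
  then show "(SUP x\<in>A. enat (f x)) = 0" by simp
qed

theorem theorem5:
  fixes R :: "('a, 'b) ring_scheme"
  assumes "right_artinian R"
  shows "(phi_dim R = 0 \<longleftrightarrow> psi_dim R = 0) \<and>
         (psi_dim R = 0 \<longleftrightarrow> right_self_injective R)"
proof -
  interpret artinian_ring R by unfold_locales (rule assms)
  have phi: "phi_dim R = 0 \<longleftrightarrow> (\<forall>M\<in>mod_cat R. IT_phi R M = 0)"
    unfolding phi_dim_def by (rule SUP_enat_eq_0_iff)
  have psi: "psi_dim R = 0 \<longleftrightarrow> (\<forall>M\<in>mod_cat R. IT_psi R M = 0)"
    unfolding psi_dim_def by (rule SUP_enat_eq_0_iff)
  have "phi_dim R = 0" if "psi_dim R = 0" using that unfolding phi psi IT_psi_def by simp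
  moreover have "right_self_injective R" if "phi_dim R = 0"
    using that self_injective_if_phi_zero unfolding phi by blast
  moreover have "psi_dim R = 0" if "right_self_injective R"
    unfolding psi using IT_psi_self_injective[OF that] by blast
  ultimately show ?thesis by blast
qed

end
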